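(* Let $\vec n(d)=(n_1(d),\ldots,n_p(d))$, $d=1,2,\ldots$, be a sequence of multi-indices of positive integers such that, with $n(d)=|\vec n(d)|$, $\lim_{d\to\infty}\vec n(d)/n(d)=(r_1,\ldots,r_p)$. For $i=1,\ldots,p$ let $Q_i$ be a continuous real-valued function on $\Gamma_i$ and let $\tau_i$ be a finite positive Borel measure on $\Gamma_i$ satisfying the weighted Bernstein–Markov (BM) inequality for the weight $\exp(-Q_i)$ on $\Gamma_i$. Then almost surely in the weighted Angelesco ensemble the normalized counting measure of a random point converges to the equilibrium measure; that is, for almost every sequence $(X_{\vec n(d)})_{d\ge1}$ in the product probability space $\prod_{d=1}^\infty(\mathbb R^{n(d)},Prob^Q_{\vec n(d)})$, $$\lim_{d\to\infty}\frac1{n(d)}\delta(X_{\vec n(d)})=\mu_{\Gamma,Q}\quad\text{weak*}.$$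
   Context: Fix $p\ge1$ and pairwise disjoint non-degenerate compact intervals $\Gamma_1,\ldots,\Gamma_p\subset\mathbb R$, with $\Gamma_{j+1}$ to the right of $\Gamma_j$; let $\Gamma=\Gamma_1\cup\cdots\cup\Gamma_p$. Fix reals $r_1,\ldots,r_p>0$ with $\sum_i r_i=1$. Write $Q=(Q_1,\ldots,Q_p)$. For a multi-index $\vec n=(n_1,\ldots,n_p)$ of positive integers put $n=|\vec n|=n_1+\cdots+n_p$. Let $L_n=\{x\in\mathbb R^n: x_1\le\cdots\le x_n\}$ and let $\rho:\mathbb R^n\to L_n$ be the map that sorts coordinates into nondecreasing order. A vector $X\in\Gamma_1^{n_1}\times\cdots\times\Gamma_p^{n_p}\subset\mathbb R^n$ is written $X=(X^{(1)},\ldots,X^{(p)})$ with $X^{(i)}=(x^{(i)}_1,\ldots,x^{(i)}_{n_i})\in\Gamma_i^{n_i}$. For vectors $Y=(y_1,\ldots,y_m)$, $Y'=(y'_1,\ldots,y'_l)$ let $\Delta(Y)=\prod_{j<k}(y_k-y_j)$ and $\Delta(Y,Y')=\prod_{k=1}^m\prod_{j=1}^l(y_k-y'_j)$. Define $$A^Q_{\vec n}(X)=\prod_{i=1}^p\Delta(X^{(i)})^2\prod_{1\le i<j\le p}\Delta(X^{(j)},X^{(i)})\exp\Big(-2n\sum_{i=1}^p\sum_{j=1}^{n_i}Q_i(x^{(i)}_j)\Big).$$ With $d\tau(X)=\prod_{i=1}^p\prod_{k=1}^{n_i}d\tau_i(x^{(i)}_k)$ (a measure on $\Gamma_1^{n_1}\times\cdots\times\Gamma_p^{n_p}$)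 and $Z^Q_{\vec n}=\int_{L_n}A^Q_{\vec n}(X)\,d\tau(X)$ (integral over $L_n\cap(\Gamma_1^{n_1}\times\cdots\times\Gamma_p^{n_p})$), $Prob^Q_{\vec n}$ is the probability measure on $\mathbb R^n$ that is invariant under permutation of coordinates and whose push-forward under $\rho$ is $\frac{A^Q_{\vec n}(X)}{Z^Q_{\vec n}}d\tau(X)$ restricted to $L_n$ (the weighted Angelesco ensemble). A positive Borel measure $\tau$ satisfies the weighted BM inequality for the weight $\exp(-q)$ ($q$ continuous real-valued) on a compact set $K\subset\mathbb C$ if for every $\epsilon>0$ there is $C>0$ such that $\sup_K|P|e^{-mq}\le C(1+\epsilon)^{m}\int_K|P|e^{-mq}d\tau$ for all integers $m\ge 0$ and all (complex) polynomials $P$ of degree $\le m$. For $X=(x_1,\ldots,x_n)\in\mathbb R^n$, $\frac1n\delta(X)=\frac1n\sum_{i=1}^n\delta(x_i)$ is its normalized counting measure, where $\delta(x)$ is the Dirac mass at $x$. $\mathcal M_r(\Gamma)$ is the set of $p$-tuples $\nu=(\nu_1,\ldots,\nu_p)$ of positive Borel measures with $\mathrm{supp}\,\nu_i\subset\Gamma_i$ and $\nu_i(\Gamma_i)=r_i$; it is identified with a subset of the set $\mathcal M(\Gamma)$ of probability measures on $\Gamma$ via $\nu\mapsto\sum_i\nu_i$, with the weak* topology. For $\nu\in\mathcal M_r(\Gamma)$, $$E^Q(\nu)=\sum_{i=1}^p\int_{\Gamma_i}\int_{\Gamma_i}\log\frac1{|x-y|}d\nu_i(x)d\nu_i(y)+\sum_{1\le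 i<j\le p}\int_{\Gamma_i}\int_{\Gamma_j}\log\frac1{|x-y|}d\nu_i(x)d\nu_j(y)+2\sum_{i=1}^p\int_{\Gamma_i}Q_i\,d\nu_i\in(-\infty,+\infty].$$ By a known theorem of Gonchar–Rakhmanov, $E^Q$ has a unique minimizer over $\mathcal M_r(\Gamma)$, denoted $\mu_{\Gamma,Q}$ (the weighted equilibrium measure).
   Formalization: The multi-indices in the sequence are additionally assumed pairwise distinct; with unrestricted repetition the claim fails, e.g. for p=1 and n_1(d)=1 for all d the sampled points are independent and their Dirac masses do not converge. *)

theory Defs
  imports "HOL-Probability.Probability" "HOL-Computational_Algebra.Polynomial"
    "HOL-Combinatorics.Permutations"
begin

section \<open>Borel measures on the line\<close>

definition msupport :: "'a::topological_space measure \<Rightarrow> 'a set" where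
  "msupport M = {x. \<forall>U. open U \<longrightarrow> x \<in> U \<longrightarrow> emeasure M U > 0}"

definition borel_measures_on :: "real set \<Rightarrow> real measure set" where
  "borel_measures_on K = {M. sets M = sets borel \<and> msupport M \<subseteq> K}"

definition sum_measure :: "'i set \<Rightarrow> ('i \<Rightarrow> real measure) \<Rightarrow> real measure" where
  "sum_measure I M = measure_of UNIV (sets borel) (\<lambda>A. \<Sum>i\<in>I. emeasure (M i) A)"

text \<open>Weak* convergence in the dual of \<open>C(K)\<close>, for compact \<open>K\<close>.\<close>

definition weak_star_convergent ::
    "real set \<Rightarrow> (nat \<Rightarrow> real measure) \<Rightarrow> real measure \<Rightarrow> bool" where
  "weak_star_convergent K M N \<longleftrightarrow>
     (\<forall>f::real \<Rightarrow> real. continuous_on K f \<longrightarrow>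
        (\<lambda>d. LINT x:K|M d. f x) \<longlonglongrightarrow> (LINT x:K|N. f x))"

text \<open>The integral over \<open>A\<close> of an extended-real function whose negative part has finite integral;
  the value may be \<open>\<infinity>\<close>.\<close>

definition ereal_set_integral :: "'a measure \<Rightarrow> 'a set \<Rightarrow> ('a \<Rightarrow> ereal) \<Rightarrow> ereal" where
  "ereal_set_integral M A f =
     enn2ereal (\<integral>\<^sup>+x\<in>A. e2ennreal (f x) \<partial>M) - enn2ereal (\<integral>\<^sup>+x\<in>A. e2ennreal (- f x) \<partial>M)"


section \<open>Bernstein--Markov inequality\<close>

definition weighted_BM :: "complex set \<Rightarrow> (complex \<Rightarrow> real) \<Rightarrow> complex measure \<Rightarrow> bool" where
  "weighted_BM K q T \<longleftrightarrow>
     (\<forall>\<epsilon>>0. \<exists>C>0. \<forall>m::nat. \<forall>P::complex poly. degree P \<le> m \<longrightarrow>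
        (SUP z\<in>K. norm (poly P z) * exp (- real m * q z))
          \<le> C * (1 + \<epsilon>) ^ m * (LINT z:K|T. norm (poly P z) * exp (- real m * q z)))"


section \<open>The weighted equilibrium measure\<close>

text \<open>\<open>log (1/\<bar>x - y\<bar>)\<close>; the diagonal needs a separate case because \<open>ln (1 / 0) = 0\<close> here.\<close>

definition log_kernel :: "real \<times> real \<Rightarrow> ereal" where
  "log_kernel = (\<lambda>(x, y). if x = y then \<infinity> else ereal (ln (1 / \<bar>x - y\<bar>)))"

text \<open>Tuples indexed by \<open>1, \<dots>, p\<close> are functions on \<open>{1..p}\<close>. For the measure tuples below
  the value outside \<open>{1..p}\<close> is pinned down by the extensional function space.\<close>

definition measure_tuples ::
    "nat \<Rightarrow> (nat \<Rightarrow> real set) \<Rightarrow> (nat \<Rightarrow> real) \<Rightarrow> (nat \<Rightarrow> real measure) set" where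
  "measure_tuples p \<Gamma> r =
     (\<Pi>\<^sub>E i\<in>{1..p}. {\<nu> \<in> borel_measures_on (\<Gamma> i). emeasure \<nu> (\<Gamma> i) = ennreal (r i)})"

definition weighted_energy ::
    "nat \<Rightarrow> (nat \<Rightarrow> real set) \<Rightarrow> (nat \<Rightarrow> real \<Rightarrow> real) \<Rightarrow> (nat \<Rightarrow> real measure) \<Rightarrow> ereal" where
  "weighted_energy p \<Gamma> Q \<nu> =
     (\<Sum>i=1..p. ereal_set_integral (\<nu> i \<Otimes>\<^sub>M \<nu> i) (\<Gamma> i \<times> \<Gamma> i) log_kernel)
     + (\<Sum>i=1..p. \<Sum>j\<in>{i<..p}. ereal_set_integral (\<nu> i \<Otimes>\<^sub>M \<nu> j) (\<Gamma> i \<times> \<Gamma> j) log_kernel)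
     + ereal (2 * (\<Sum>i=1..p. LINT x:\<Gamma> i|\<nu> i. Q i x))"

definition equilibrium_tuple ::
    "nat \<Rightarrow> (nat \<Rightarrow> real set) \<Rightarrow> (nat \<Rightarrow> real) \<Rightarrow> (nat \<Rightarrow> real \<Rightarrow> real) \<Rightarrow> nat \<Rightarrow> real measure" where
  "equilibrium_tuple p \<Gamma> r Q =
     (THE \<nu>. is_arg_min (weighted_energy p \<Gamma> Q) (\<lambda>\<nu>. \<nu> \<in> measure_tuples p \<Gamma> r) \<nu>)"

definition equilibrium_measure ::
    "nat \<Rightarrow> (nat \<Rightarrow> real set) \<Rightarrow> (nat \<Rightarrow> real) \<Rightarrow> (nat \<Rightarrow> real \<Rightarrow> real) \<Rightarrow> real measure" where
  "equilibrium_measure p \<Gamma> r Q = sum_measure {1..p} (equilibrium_tuple p \<Gamma> r Q)"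


section \<open>The weighted Angelesco ensemble\<close>

text \<open>\<open>\<real>\<^sup>n\<close> is the product space over the index set \<open>{1..n}\<close>.\<close>

abbreviation Rn :: "nat \<Rightarrow> (nat \<Rightarrow> real) measure" where
  "Rn n \<equiv> \<Pi>\<^sub>M k\<in>{1..n}. borel"

definition msize :: "nat \<Rightarrow> (nat \<Rightarrow> nat) \<Rightarrow> nat" where
  "msize p nn = (\<Sum>i=1..p. nn i)"

definition block :: "(nat \<Rightarrow> nat) \<Rightarrow> (nat \<Rightarrow> real) \<Rightarrow> nat \<Rightarrow> nat \<Rightarrow> real" where
  "block nn X i k = X ((\<Sum>l=1..<i. nn l) + k)"

text \<open>The number of the block that contains coordinate \<open>m\<close>.\<close>

definition block_of :: "(nat \<Rightarrow> nat) \<Rightarrow> nat \<Rightarrow> nat" where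
  "block_of nn m = (LEAST i. m \<le> (\<Sum>l=1..i. nn l))"

definition sort_coords :: "nat \<Rightarrow> (nat \<Rightarrow> real) \<Rightarrow> nat \<Rightarrow> real" where
  "sort_coords n X = (\<lambda>k\<in>{1..n}. sort (map X [1..<Suc n]) ! (k - 1))"

definition vandermonde :: "nat \<Rightarrow> (nat \<Rightarrow> real) \<Rightarrow> real" where
  "vandermonde m Y = (\<Prod>k=1..m. \<Prod>j=1..<k. Y k - Y j)"

definition cross_vandermonde :: "nat \<Rightarrow> (nat \<Rightarrow> real) \<Rightarrow> nat \<Rightarrow> (nat \<Rightarrow> real) \<Rightarrow> real" where
  "cross_vandermonde m Y l Y' = (\<Prod>k=1..m. \<Prod>j=1..l. Y k - Y' j)"

definition angelesco_weight ::
    "nat \<Rightarrow> (nat \<Rightarrow> real \<Rightarrow> real) \<Rightarrow> (nat \<Rightarrow> nat) \<Rightarrow> (nat \<Rightarrow> real) \<Rightarrow> real" where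
  "angelesco_weight p Q nn X =
     (\<Prod>i=1..p. (vandermonde (nn i) (block nn X i))\<^sup>2)
     * (\<Prod>i=1..p. \<Prod>j\<in>{i<..p}. cross_vandermonde (nn j) (block nn X j) (nn i) (block nn X i))
     * exp (- 2 * real (msize p nn) * (\<Sum>i=1..p. \<Sum>j=1..nn i. Q i (block nn X i j)))"

definition product_tau ::
    "nat \<Rightarrow> (nat \<Rightarrow> real measure) \<Rightarrow> (nat \<Rightarrow> nat) \<Rightarrow> (nat \<Rightarrow> real) measure" where
  "product_tau p \<tau> nn = (\<Pi>\<^sub>M m\<in>{1..msize p nn}. \<tau> (block_of nn m))"

text \<open>\<open>L\<^sub>n \<inter> (\<Gamma>\<^sub>1\<^bsup>n\<^sub>1\<^esup> \<times> \<dots> \<times> \<Gamma>\<^sub>p\<^bsup>n\<^sub>p\<^esup>)\<close>\<close>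

definition ordered_region ::
    "nat \<Rightarrow> (nat \<Rightarrow> real set) \<Rightarrow> (nat \<Rightarrow> nat) \<Rightarrow> (nat \<Rightarrow> real) set" where
  "ordered_region p \<Gamma> nn =
     {X \<in> \<Pi>\<^sub>E m\<in>{1..msize p nn}. \<Gamma> (block_of nn m). mono_on {1..msize p nn} X}"

definition angelesco_Z ::
    "nat \<Rightarrow> (nat \<Rightarrow> real set) \<Rightarrow> (nat \<Rightarrow> real \<Rightarrow> real) \<Rightarrow> (nat \<Rightarrow> real measure) \<Rightarrow> (nat \<Rightarrow> nat) \<Rightarrow> real" where
  "angelesco_Z p \<Gamma> Q \<tau> nn =
     (LINT X:ordered_region p \<Gamma> nn|product_tau p \<tau> nn. angelesco_weight p Q nn X)"

definition ordered_angelesco ::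
    "nat \<Rightarrow> (nat \<Rightarrow> real set) \<Rightarrow> (nat \<Rightarrow> real \<Rightarrow> real) \<Rightarrow> (nat \<Rightarrow> real measure) \<Rightarrow> (nat \<Rightarrow> nat)
       \<Rightarrow> (nat \<Rightarrow> real) measure" where
  "ordered_angelesco p \<Gamma> Q \<tau> nn =
     density (product_tau p \<tau> nn)
       (\<lambda>X. ennreal (indicator (ordered_region p \<Gamma> nn) X
                       * (angelesco_weight p Q nn X / angelesco_Z p \<Gamma> Q \<tau> nn)))"

definition angelesco_prob ::
    "nat \<Rightarrow> (nat \<Rightarrow> real set) \<Rightarrow> (nat \<Rightarrow> real \<Rightarrow> real) \<Rightarrow> (nat \<Rightarrow> real measure) \<Rightarrow> (nat \<Rightarrow> nat)
       \<Rightarrow> (nat \<Rightarrow> real) measure" where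
  "angelesco_prob p \<Gamma> Q \<tau> nn =
     (let n = msize p nn in
      THE M. sets M = sets (Rn n) \<and> prob_space M
        \<and> (\<forall>\<sigma>. \<sigma> permutes {1..n} \<longrightarrow> distr M (Rn n) (\<lambda>X. \<lambda>k\<in>{1..n}. X (\<sigma> k)) = M)
        \<and> distr M (Rn n) (sort_coords n) = ordered_angelesco p \<Gamma> Q \<tau> nn)"

definition counting_measure :: "nat \<Rightarrow> (nat \<Rightarrow> real) \<Rightarrow> real measure" where
  "counting_measure n X =
     scale_measure (ennreal (1 / real n)) (sum_measure {1..n} (\<lambda>k. return borel (X k)))"

end

theory Submission imports Defs
begin

text \<open>Write \<open>e\<close> for the minimal energy. The weight of a configuration \<open>X\<close> of \<open>n\<close> points is, up to diagonal
  terms, \<open>exp (- n\<^sup>2 * E(X))\<close>, where \<open>E(X)\<close> is the energy of its counting measure. The proof shows that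
  a random configuration has weight at least \<open>exp (- n\<^sup>2 * (e + \<eta>))\<close> outside an event of probability
  \<open>exp (- n\<^sup>2 * \<eta> + o(n\<^sup>2))\<close>. These probabilities are summable, so by Borel--Cantelli almost every
  sequence of configurations is asymptotically of minimal energy, for every \<open>\<eta>\<close> at once. By
  compactness, lower semicontinuity of the energy and uniqueness of the minimizer its counting
  measures can only converge to the equilibrium measure.

  Everything about the energy goes through a regularised logarithmic kernel. After scaling the
  intervals into \<open>[-1, 1]\<close> and substituting \<open>x = cos \<theta>\<close>, the kernel \<open>- ln \<bar>x - y\<bar>\<close> is \<open>ln 2 + (\<Sum>n\<ge>1. 2/n *
  cos (n\<theta>) * cos (n\<phi>))\<close>. Inserting \<open>s ^ n\<close> with \<open>s < 1\<close> gives a series with a closed form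
  (\<open>reg_log_chebyshev_sums\<close>): up to constants it is \<open>- ln D / 2\<close>, where \<open>D\<close> is a smooth positive
  perturbation of \<open>(x - y)\<^sup>2\<close> that decreases to it as \<open>s\<close> tends to 1. These kernels are bounded and
  continuous, so their energies are weakly continuous; they increase with \<open>s\<close>, so the energy, being
  their supremum, is lower semicontinuous; and the series has positive coefficients, so they are
  positive definite on differences of measures of equal mass. The interaction between the intervals
  has strength one half of that within an interval. The matrix \<open>(1 + \<delta>\<^sub>i\<^sub>j) / 2\<close> is the sum of a
  constant and an identity part, hence the full interaction is again a sum of positive definite
  kernels (\<open>Phi_pos_def\<close>). A midpoint argument shows that two minimizers have the same cosine moments
  and therefore coincide (\<open>minimizer_unique\<close>); existence follows from Helly selection, since uniform
  measures have finite energy. \<open>equilibrium_measure_minimizes\<close> transfers this to the equilibrium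
  measure by monotone convergence.

  The normalising constant has to be bounded below by \<open>exp (- n\<^sup>2 * (e + o(1)))\<close>. If the \<open>n\<close> points are
  sampled independently from the normalised components of the equilibrium measure, the expected
  logarithm of the weight is about \<open>- n\<^sup>2 * e\<close>, so some configuration has at least this logarithmic
  weight (\<open>good_configuration\<close>). In each coordinate separately the weight is the modulus of a
  polynomial of degree at most \<open>2 * n\<close> times \<open>exp (- 2 * n * Q)\<close>. Applying the Bernstein--Markov
  inequality to one coordinate after the other bounds the weight at that configuration by the
  integral of the weight, with a loss of \<open>(C * (1 + \<epsilon>) ^ (2 * n)) ^ n\<close> (\<open>BM_full\<close>). A permutation of the
  coordinates within the blocks restricts the integral to ordered configurations at the price of
  another factor \<open>n ^ n\<close> (\<open>full_le_ordered\<close>). With \<open>\<epsilon>\<close> small both losses are negligible compared with \<open>exp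
  (n\<^sup>2 * \<eta>)\<close>, and \<open>large_deviation\<close> follows. Summability over the sequence uses that the multi-indices
  are distinct (\<open>summable_exp_size\<close>).\<close>

section \<open>The regularised logarithmic kernel\<close>

definition reg_dist :: "real \<Rightarrow> real \<Rightarrow> real \<Rightarrow> real" where
  "reg_dist \<eta> x y = (x - y)\<^sup>2 + \<eta>\<^sup>2 + 2 * \<eta> * (1 - x * y)"

text \<open>The amount of regularisation that corresponds to the factor \<open>s ^ n\<close> in the Chebyshev series of the
  logarithmic kernel.\<close>

definition reg_eps :: "real \<Rightarrow> real" where
  "reg_eps s = (1 - s)\<^sup>2 / (2 * s)"

text \<open>The perturbation \<open>2 * \<eta> * (1 - x * y)\<close> in \<open>reg_dist\<close> is chosen for this factorisation: the factors are
  the squared moduli of \<open>1 - s * cis (\<theta> - \<phi>)\<close> and \<open>1 - s * cis (\<theta> + \<phi>)\<close>, whose product at \<open>s = 1\<close> is \<open>4 *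
  (cos \<theta> - cos \<phi>)\<^sup>2\<close>.\<close>

lemma reg_dist_cos:
  assumes "0 < s"
  shows "4 * s\<^sup>2 * reg_dist (reg_eps s) (cos \<theta>) (cos \<phi>)
           = (1 - 2 * s * cos (\<theta> - \<phi>) + s\<^sup>2) * (1 - 2 * s * cos (\<theta> + \<phi>) + s\<^sup>2)"
proof -
  have S: "(sin \<theta>)\<^sup>2 = 1 - (cos \<theta>)\<^sup>2" "(sin \<phi>)\<^sup>2 = 1 - (cos \<phi>)\<^sup>2"
    by (simp_all add: sin_squared_eq)
  define c d S T where "c = cos \<theta>" "d = cos \<phi>" "S = sin \<theta>" "T = sin \<phi>"
  have ST: "S\<^sup>2 = 1 - c\<^sup>2" "T\<^sup>2 = 1 - d\<^sup>2"
    using S by (auto simp: c_d_S_T_def)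
  have "4 * s\<^sup>2 * reg_dist (reg_eps s) c d
          = 4 * s\<^sup>2 * (c - d)\<^sup>2 + (1 - s)^4 + 4 * s * (1-s)\<^sup>2 * (1 - c * d)"
    using assms unfolding reg_dist_def reg_eps_def
    by (simp add: field_simps power2_eq_square power4_eq_xxxx)
  also have "\<dots> = (1 - 2 * s * (c * d) + s\<^sup>2)\<^sup>2 - 4 * s\<^sup>2 * ((1 - c\<^sup>2) * (1 - d\<^sup>2))"
    by (simp add: power2_eq_square power4_eq_xxxx) algebra
  also have "\<dots> = (1 - 2 * s * (c * d + S * T) + s\<^sup>2) * (1 - 2 * s * (c * d - S * T) + s\<^sup>2)"
    unfolding ST[symmetric] by (simp add: power2_eq_square) algebra
  finally show ?thesis
    by (simp add: c_d_S_T_def cos_diff cos_add)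
qed

text \<open>This is the real part of the series of \<open>- Ln (1 - z)\<close> at \<open>z = s * cis \<alpha>\<close>.\<close>

lemma poisson_log_sums:
  assumes "0 < s" "s < 1"
  shows "(\<lambda>n. s ^ n * cos (real n * \<alpha>) / real n) sums (- ln (1 - 2 * s * cos \<alpha> + s\<^sup>2) / 2)"
proof -
  define z where "z = complex_of_real s * cis \<alpha>"
  have nz: "cmod (- z) < 1"
    using assms by (simp add: z_def norm_mult)
  have "(\<lambda>n. - ((- (- z)) ^ n) / of_nat n) sums Ln (1 + (- z))"
    by (rule Ln_series') (use nz in simp)
  then have "(\<lambda>n. Re (- (z ^ n) / of_nat n)) sums Re (Ln (1 - z))"
    using sums_Re by fastforce
  moreover have "(\<lambda>n. Re (- (z ^ n) / of_nat n)) = (\<lambda>n. - (s ^ n * cos (real n * \<alpha>) / real n))"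
  proof -
    have "z ^ n = complex_of_real (s ^ n) * cis (real n * \<alpha>)" for n
      by (simp only: z_def power_mult_distrib Complex.DeMoivre of_real_power)
    then show ?thesis by simp
  qed
  moreover have "1 - z \<noteq> 0"
    using nz by auto
  then have "Re (Ln (1 - z)) = ln (cmod (1 - z))" by simp
  moreover have c2: "(cmod (1 - z))\<^sup>2 = 1 - 2 * s * cos \<alpha> + s\<^sup>2"
  proof -
    have "(cmod (1 - z))\<^sup>2 = (1 - s * cos \<alpha>)\<^sup>2 + (s * sin \<alpha>)\<^sup>2"
      unfolding cmod_power2 by (simp add: z_def)
    also have "\<dots> = (1 - s * cos \<alpha>)\<^sup>2 + s\<^sup>2 * (1 - (cos \<alpha>)\<^sup>2)"
      by (simp add: power_mult_distrib sin_squared_eq)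
    also have "\<dots> = 1 - 2 * s * cos \<alpha> + s\<^sup>2"
      by (simp add: power2_eq_square algebra_simps)
    finally show ?thesis .
  qed
  moreover have "ln (cmod (1 - z)) = ln (1 - 2 * s * cos \<alpha> + s\<^sup>2) / 2"
    using \<open>1 - z \<noteq> 0\<close> ln_realpow[of "cmod (1 - z)" 2] unfolding c2[symmetric] by simp
  ultimately have "(\<lambda>n. - (s ^ n * cos (real n * \<alpha>) / real n)) sums (ln (1 - 2 * s * cos \<alpha> + s\<^sup>2) / 2)"
    by metis
  from sums_minus[OF this] show ?thesis by simp
qed

lemma poisson_denominator_pos:
  fixes s :: real
  assumes "0 < s" "s < 1"
  shows "1 - 2 * s * cos \<alpha> + s\<^sup>2 > 0"
proof -
  have "2 * s * cos \<alpha> \<le> 2 * s"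
    using assms by simp
  moreover have "(1 - s)\<^sup>2 > 0" using assms by simp
  ultimately show ?thesis by (simp add: power2_eq_square algebra_simps)
qed

text \<open>Adding the series for the angles \<open>\<theta> - \<phi>\<close> and \<open>\<theta> + \<phi>\<close> turns the cosine of a difference into the product
  kernel \<open>cos (n * \<theta>) * cos (n * \<phi>)\<close>. All coefficients are positive, which makes the regularised
  kernel positive definite up to an additive constant. The term \<open>n = 0\<close> vanishes because \<open>2 / 0 = 0\<close>.\<close>

lemma reg_log_chebyshev_sums:
  assumes "0 < s" "s < 1"
  shows "(\<lambda>n. 2 / real n * s ^ n * (cos (real n * \<theta>) * cos (real n * \<phi>)))
           sums (- ln (reg_dist (reg_eps s) (cos \<theta>) (cos \<phi>)) / 2 - ln (2 * s))"
proof -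
  note P = poisson_denominator_pos[OF assms]
  have h: "4 * s\<^sup>2 * reg_dist (reg_eps s) (cos \<theta>) (cos \<phi>) > 0"
    unfolding reg_dist_cos[OF assms(1)] using P[of "\<theta> - \<phi>"] P[of "\<theta> + \<phi>"] by simp
  then have h': "reg_dist (reg_eps s) (cos \<theta>) (cos \<phi>) > 0"
    by (simp add: zero_less_mult_iff)
  have "ln ((2 * s)\<^sup>2 * reg_dist (reg_eps s) (cos \<theta>) (cos \<phi>))
      = ln (1 - 2 * s * cos (\<theta> - \<phi>) + s\<^sup>2) + ln (1 - 2 * s * cos (\<theta> + \<phi>) + s\<^sup>2)"
    using reg_dist_cos[OF assms(1), of \<theta> \<phi>] P[of "\<theta> - \<phi>"] P[of "\<theta> + \<phi>"]
    by (simp add: power2_eq_square ln_mult_pos)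
  moreover have "ln ((2 * s)\<^sup>2) = 2 * ln (2 * s)"
    using ln_realpow[of "2 * s" 2] assms by simp
  ultimately have e: "2 * ln (2 * s) + ln (reg_dist (reg_eps s) (cos \<theta>) (cos \<phi>))
      = ln (1 - 2 * s * cos (\<theta> - \<phi>) + s\<^sup>2) + ln (1 - 2 * s * cos (\<theta> + \<phi>) + s\<^sup>2)"
    using h' assms ln_mult_pos[of "(2 * s)\<^sup>2"] by simp
  have "(\<lambda>n. s ^ n * cos (real n * (\<theta> - \<phi>)) / real n + s ^ n * cos (real n * (\<theta> + \<phi>)) / real n)
     sums (- ln (1 - 2 * s * cos (\<theta> - \<phi>) + s\<^sup>2) / 2 + - ln (1 - 2 * s * cos (\<theta> + \<phi>) + s\<^sup>2) / 2)"
    by (intro sums_add poisson_log_sums assms)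
  also have "(\<lambda>n. s ^ n * cos (real n * (\<theta> - \<phi>)) / real n + s ^ n * cos (real n * (\<theta> + \<phi>)) / real n)
      = (\<lambda>n. 2 / real n * s ^ n * (cos (real n * \<theta>) * cos (real n * \<phi>)))"
    by (auto simp: fun_eq_iff cos_add cos_diff algebra_simps add_divide_distrib[symmetric])
  finally have "(\<lambda>n. 2 / real n * s ^ n * (cos (real n * \<theta>) * cos (real n * \<phi>))) sums
      (- ln (1 - 2 * s * cos (\<theta> - \<phi>) + s\<^sup>2) / 2 + - ln (1 - 2 * s * cos (\<theta> + \<phi>) + s\<^sup>2) / 2)" .
  moreover have "- ln (1 - 2 * s * cos (\<theta> - \<phi>) + s\<^sup>2) / 2 + - ln (1 - 2 * s * cos (\<theta> + \<phi>) + s\<^sup>2) / 2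
      = - ln (reg_dist (reg_eps s) (cos \<theta>) (cos \<phi>)) / 2 - ln (2 * s)"
    using e by linarith
  ultimately show ?thesis by simp
qed

lemma reg_dist_pos:
  assumes "\<eta> > 0" "\<bar>x\<bar> \<le> 1" "\<bar>y\<bar> \<le> 1"
  shows "reg_dist \<eta> x y \<ge> \<eta>\<^sup>2" "reg_dist \<eta> x y > 0" "reg_dist \<eta> x y \<ge> (x - y)\<^sup>2"
proof -
  have "x * y \<le> 1"
    using assms(2,3) by (metis abs_le_D1 abs_mult mult_le_one abs_ge_zero)
  then have "2 * \<eta> * (1 - x * y) \<ge> 0" using assms(1) by simp
  then show "reg_dist \<eta> x y \<ge> \<eta>\<^sup>2" "reg_dist \<eta> x y \<ge> (x - y)\<^sup>2" unfolding reg_dist_def by simp_all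
  then show "reg_dist \<eta> x y > 0" using assms(1) by (smt (verit) zero_less_power)
qed

lemma reg_dist_mono:
  assumes "0 \<le> \<eta>" "\<eta> \<le> \<eta>'" "\<bar>x\<bar> \<le> 1" "\<bar>y\<bar> \<le> 1"
  shows "reg_dist \<eta> x y \<le> reg_dist \<eta>' x y"
proof -
  have "x * y \<le> 1"
    using assms(3,4) by (metis abs_le_D1 abs_mult mult_le_one abs_ge_zero)
  then have "2 * \<eta> * (1 - x * y) \<le> 2 * \<eta>' * (1 - x * y)"
    using assms(1,2) by (intro mult_right_mono) auto
  moreover have "\<eta>\<^sup>2 \<le> \<eta>'\<^sup>2" using assms(1,2) by (intro power_mono)
  ultimately show ?thesis unfolding reg_dist_def by simp
qed

text \<open>The bound is \<open>(x - y)\<^sup>2 + \<eta>\<^sup>2 + 2 * \<eta> * (1 - x * y) \<le> 4 + 1 + 4\<close>.\<close>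

lemma reg_dist_le:
  assumes "0 \<le> \<eta>" "\<eta> \<le> 1" "\<bar>x\<bar> \<le> 1" "\<bar>y\<bar> \<le> 1"
  shows "reg_dist \<eta> x y \<le> 9"
proof -
  have "\<bar>x * y\<bar> \<le> 1"
    using assms(3,4) by (metis abs_mult mult_le_one abs_ge_zero)
  moreover have "(x - y)\<^sup>2 \<le> 2\<^sup>2" using assms(3,4) by (intro power2_le_iff_abs_le[THEN iffD2]) auto
  moreover have "\<eta>\<^sup>2 \<le> 1" using assms by (simp add: power_le_one)
  moreover have "2 * \<eta> * (1 - x * y) \<le> 2 * 1 * 2"
    using assms \<open>\<bar>x * y\<bar> \<le> 1\<close> by (intro mult_mono) auto
  ultimately show ?thesis unfolding reg_dist_def by simp
qed

lemma integral_geometric_sums: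
  fixes f :: "nat \<Rightarrow> 'a \<Rightarrow> real"
  assumes "finite_measure M" and s: "0 < s" "s < 1"
    and f: "\<And>n. f n \<in> borel_measurable M" and bd: "\<And>n x. norm (f n x) \<le> c * s ^ n"
  shows "(\<lambda>n. integral\<^sup>L M (f n)) sums (\<integral>x. (\<Sum>n. f n x) \<partial>M)"
proof -
  interpret finite_measure M by fact
  have int: "integrable M (f n)" for n
    by (rule integrable_const_bound[OF AE_I2 f]) (rule bd)
  show ?thesis
  proof (rule sums_integral[OF int])
    have sg: "summable (\<lambda>n. c * s ^ n)" using s by (intro summable_mult summable_geometric) auto
    show "AE x in M. summable (\<lambda>n. norm (f n x))"
      by (rule AE_I2) (rule summable_comparison_test'[OF sg, of 0], use bd in auto)
    show "summable (\<lambda>n. \<integral>x. norm (f n x) \<partial>M)"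
    proof (rule summable_comparison_test'[of "\<lambda>n. measure M (space M) * (c * s ^ n)" 0])
      show "summable (\<lambda>n. measure M (space M) * (c * s ^ n))" using sg by (rule summable_mult)
      fix n
      have "(\<integral>x. norm (f n x) \<partial>M) \<le> (\<integral>x. c * s ^ n \<partial>M)"
        by (intro integral_mono integrable_norm int) (use bd in auto)
      then show "norm (\<integral>x. norm (f n x) \<partial>M) \<le> measure M (space M) * (c * s ^ n)" by simp
    qed
  qed
qed

lemma chebyshev_integral_sums:
  fixes s :: real
  assumes s: "0 < s" "s < 1" and "finite_measure M"
    and u: "u \<in> borel_measurable M" "\<And>x. \<bar>u x\<bar> \<le> 1" 
    and \<theta>: "\<theta> \<in> borel_measurable M"
    and v: "\<bar>v\<bar> \<le> 1"
  shows "(\<lambda>n. 2 / real n * s ^ n * v * (\<integral>x. u x * cos (real n * \<theta> x) \<partial>M) * cos (real n * \<phi>)) sums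
           (\<integral>x. u x * v * (- ln (reg_dist (reg_eps s) (cos (\<theta> x)) (cos \<phi>)) / 2 - ln (2 * s)) \<partial>M)"
proof -
  interpret finite_measure M by fact
  define f where "f n x = u x * v * (2 / real n * s ^ n * (cos (real n * \<theta> x) * cos (real n * \<phi>)))" for n x
  note [measurable] = u(1) \<theta>
  have bd: "norm (f n x) \<le> 2 * s ^ n" for n x
  proof -
    have "norm (f n x) = (\<bar>u x\<bar> * \<bar>v\<bar> * (\<bar>cos (real n * \<theta> x)\<bar> * \<bar>cos (real n * \<phi>)\<bar>)) * (2 / real n * s ^ n)"
      using s by (simp add: f_def abs_mult)
    also have "\<dots> \<le> 1 * (2 / real n * s ^ n)"
      using s u(2) v by (intro mult_right_mono mult_le_one) auto
    also have "\<dots> \<le> 2 * s ^ n"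
      \<comment> \<open>at \<open>n = 0\<close> the left-hand side is 0\<close>
      using s by (cases "n = 0") (auto simp: field_simps)
    finally show ?thesis .
  qed
  have [measurable]: "f n \<in> borel_measurable M" for n
    unfolding f_def by measurable
  have "(\<lambda>n. integral\<^sup>L M (f n)) sums (\<integral>x. (\<Sum>n. f n x) \<partial>M)"
    by (rule integral_geometric_sums[OF assms(3) s _ bd]) measurable
  moreover have "integral\<^sup>L M (f n) = 2 / real n * s ^ n * v * (\<integral>x. u x * cos (real n * \<theta> x) \<partial>M) * cos (real n * \<phi>)" for n
  proof -
    have "integral\<^sup>L M (f n) = (\<integral>x. (2 / real n * s ^ n * v * cos (real n * \<phi>)) * (u x * cos (real n * \<theta> x)) \<partial>M)"
      by (rule Bochner_Integration.integral_cong) (auto simp: f_def)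
    then show ?thesis by simp
  qed
  moreover have "(\<Sum>n. f n x) = u x * v * (- ln (reg_dist (reg_eps s) (cos (\<theta> x)) (cos \<phi>)) / 2 - ln (2 * s))" for x
    using sums_mult[OF reg_log_chebyshev_sums[OF s], of "u x * v" "\<theta> x" \<phi>]
    by (auto simp: f_def sums_iff)
  ultimately show ?thesis by simp
qed

definition cos_coeff :: "real measure \<Rightarrow> (real \<Rightarrow> real) \<Rightarrow> (real \<Rightarrow> real) \<Rightarrow> nat \<Rightarrow> real" where
  "cos_coeff M u \<theta> n = (\<integral>x. u x * cos (real n * \<theta> x) \<partial>M)"

text \<open>The mutual energy of the measures with densities \<open>u\<close> with respect to \<open>M\<close> and \<open>N\<close>, transported to the
  circle by \<open>\<theta>\<close>. The density allows the restriction of a measure to a single interval to be treated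
  together with the whole measure.\<close>

definition reg_energy ::
    "real \<Rightarrow> (real \<Rightarrow> real) \<Rightarrow> (real \<Rightarrow> real) \<Rightarrow> real measure \<Rightarrow> real measure \<Rightarrow> real" where
  "reg_energy s u \<theta> M N =
     (\<integral>x. (\<integral>y. u x * u y * (- ln (reg_dist (reg_eps s) (cos (\<theta> x)) (cos (\<theta> y))) / 2) \<partial>N) \<partial>M)"

lemma reg_energy_sums:
  assumes s: "0 < s" "s < 1" and M: "finite_measure M" "sets M = sets borel"
    and N: "finite_measure N" "sets N = sets borel"
    and u: "u \<in> borel_measurable borel" "\<And>x. \<bar>u x\<bar> \<le> 1" 
    and \<theta>: "\<theta> \<in> borel_measurable borel"
  shows "(\<lambda>n. 2 / real n * s ^ n * (cos_coeff M u \<theta> n * cos_coeff N u \<theta> n)) sums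
           (reg_energy s u \<theta> M N - ln (2 * s) * (cos_coeff M u \<theta> 0 * cos_coeff N u \<theta> 0))"
proof -
  interpret M: finite_measure M by fact
  interpret N: finite_measure N by fact
  note [measurable_cong] = M(2) N(2)
  note [measurable] = u(1) \<theta>
  define k where "k x y = - ln (reg_dist (reg_eps s) (cos (\<theta> x)) (cos (\<theta> y))) / 2" for x y
  define C where "C n = cos_coeff N u \<theta> n" for n
  have sums1: "(\<lambda>n. 2 / real n * s ^ n * u x * C n * cos (real n * \<theta> x)) sums
           (\<integral>y. u y * u x * (k x y - ln (2 * s)) \<partial>N)" for x
  proof -
    have sym: "reg_dist \<eta> y x = reg_dist \<eta> x y" for \<eta> x y :: real
      by (simp add: reg_dist_def power2_commute mult.commute)
    have "(\<lambda>n. 2 / real n * s ^ n * u x * (\<integral>y. u y * cos (real n * \<theta> y) \<partial>N) * cos (real n * \<theta> x)) sums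
        (\<integral>y. u y * u x * (- ln (reg_dist (reg_eps s) (cos (\<theta> y)) (cos (\<theta> x))) / 2 - ln (2 * s)) \<partial>N)"
      by (rule chebyshev_integral_sums[OF s N(1)]) (auto simp: u)
    moreover have "reg_dist (reg_eps s) (cos (\<theta> y)) (cos (\<theta> x)) = reg_dist (reg_eps s) (cos (\<theta> x)) (cos (\<theta> y))" for y
      by (rule sym)
    ultimately show ?thesis unfolding C_def cos_coeff_def k_def by simp
  qed
  define m where "m = measure N (space N)"
  have Cb: "\<bar>C n\<bar> \<le> m" for n
  proof -
    have "\<bar>C n\<bar> \<le> (\<integral>x. \<bar>u x * cos (real n * \<theta> x)\<bar> \<partial>N)"
      unfolding C_def cos_coeff_def by (rule integral_abs_bound)
    also have "\<dots> \<le> (\<integral>x. 1 \<partial>N)"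
    proof (rule integral_mono)
      have b: "\<bar>u x * cos (real n * \<theta> x)\<bar> \<le> 1" for x
        unfolding abs_mult using u(2) by (intro mult_le_one) auto
      show "integrable N (\<lambda>x. \<bar>u x * cos (real n * \<theta> x)\<bar>)"
        by (rule N.integrable_const_bound[where B = 1]) (use b in auto)
      show "\<bar>u x * cos (real n * \<theta> x)\<bar> \<le> 1" for x by (rule b)
    qed simp
    finally show ?thesis by (simp add: m_def)
  qed
  define f where "f n x = 2 / real n * s ^ n * u x * C n * cos (real n * \<theta> x)" for n x
  have bd: "norm (f n x) \<le> 2 * m * s ^ n" for n x
  proof -
    have "norm (f n x) = (\<bar>u x\<bar> * \<bar>cos (real n * \<theta> x)\<bar>) * \<bar>C n\<bar> * (2 / real n * s ^ n)"
      using s by (simp add: f_def abs_mult)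
    also have "\<dots> \<le> 1 * m * (2 / real n * s ^ n)"
      using s u(2) Cb by (intro mult_right_mono mult_mono mult_le_one) (auto simp: m_def)
    also have "2 / real n * s ^ n \<le> 2 * s ^ n"
      using s by (cases "n = 0") (auto simp: field_simps)
    then have "1 * m * (2 / real n * s ^ n) \<le> 2 * m * s ^ n"
      using mult_left_mono[of "2 / real n * s ^ n" "2 * s ^ n" m] by (simp add: m_def)
    finally show ?thesis .
  qed
  have [measurable]: "f n \<in> borel_measurable borel" for n
    unfolding f_def by measurable
  have sf: "(\<Sum>n. f n x) = (\<integral>y. u y * u x * (k x y - ln (2 * s)) \<partial>N)" for x
    using sums1 by (simp add: f_def sums_iff)
  have "(\<lambda>n. integral\<^sup>L M (f n)) sums (\<integral>x. (\<Sum>n. f n x) \<partial>M)"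
    by (rule integral_geometric_sums[OF M(1) s _ bd]) measurable
  moreover have "integral\<^sup>L M (f n) = 2 / real n * s ^ n * (cos_coeff M u \<theta> n * C n)" for n
  proof -
    have "integral\<^sup>L M (f n) = (\<integral>x. (2 / real n * s ^ n * C n) * (u x * cos (real n * \<theta> x)) \<partial>M)"
      by (rule Bochner_Integration.integral_cong) (auto simp: f_def)
    then show ?thesis by (simp add: cos_coeff_def)
  qed
  moreover have "(\<integral>x. (\<Sum>n. f n x) \<partial>M) = reg_energy s u \<theta> M N - ln (2 * s) * (cos_coeff M u \<theta> 0 * C 0)"
  proof -
    have e0: "reg_eps s > 0" using s by (simp add: reg_eps_def)
    \<comment> \<open>crude two-sided bounds on the kernel, for integrability\<close>
    have e1: "\<bar>k x y\<bar> \<le> \<bar>ln ((reg_eps s)\<^sup>2)\<bar> + \<bar>ln (4 + (reg_eps s)\<^sup>2 + 4 * reg_eps s)\<bar>" for x y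
    proof -
      define h where "h = reg_dist (reg_eps s) (cos (\<theta> x)) (cos (\<theta> y))"
      have "(reg_eps s)\<^sup>2 \<le> h" "0 < h"
        unfolding h_def using reg_dist_pos[OF e0, of "cos (\<theta> x)" "cos (\<theta> y)"] by auto
      moreover have "h \<le> 4 + (reg_eps s)\<^sup>2 + 4 * reg_eps s"
      proof -
        have "\<bar>cos (\<theta> x) * cos (\<theta> y)\<bar> \<le> 1"
          unfolding abs_mult by (intro mult_le_one) auto
        moreover have "(cos (\<theta> x) - cos (\<theta> y))\<^sup>2 \<le> 2\<^sup>2"
          using abs_cos_le_one[of "\<theta> x"] abs_cos_le_one[of "\<theta> y"]
          by (intro power2_le_iff_abs_le[THEN iffD2]) linarith+
        moreover have "2 * reg_eps s * (1 - cos (\<theta> x) * cos (\<theta> y)) \<le> 2 * reg_eps s * 2"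
          using e0 \<open>\<bar>cos (\<theta> x) * cos (\<theta> y)\<bar> \<le> 1\<close> by (intro mult_left_mono) auto
        ultimately show ?thesis unfolding h_def reg_dist_def by simp
      qed
      ultimately have "ln ((reg_eps s)\<^sup>2) \<le> ln h" "ln h \<le> ln (4 + (reg_eps s)\<^sup>2 + 4 * reg_eps s)"
        using e0 by (auto intro: ln_mono)
      then show ?thesis unfolding k_def h_def[symmetric] by linarith
    qed
    have [measurable]: "(\<lambda>(x,y). k x y) \<in> borel_measurable (borel \<Otimes>\<^sub>M borel)"
      unfolding k_def reg_dist_def by measurable
    have [measurable]: "k x \<in> borel_measurable borel" for x
      unfolding k_def reg_dist_def by measurable
    define B where "B = \<bar>ln ((reg_eps s)\<^sup>2)\<bar> + \<bar>ln (4 + (reg_eps s)\<^sup>2 + 4 * reg_eps s)\<bar>"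
    have e2: "\<bar>u x * u y * k x y\<bar> \<le> B" for x y
    proof -
      have "\<bar>u x * u y * k x y\<bar> \<le> 1 * B"
        unfolding abs_mult using e1 u(2) by (intro mult_mono mult_le_one) (auto simp: B_def)
      then show ?thesis by simp
    qed
    have i1: "integrable N (\<lambda>y. u x * u y * k x y)" for x
      by (rule N.integrable_const_bound[where B = B]) (use e2 in auto)
    have i3: "integrable M u" "integrable N u"
      by (rule M.integrable_const_bound[where B = 1] N.integrable_const_bound[where B = 1], use u(2) in auto)+
    have i2: "integrable M (\<lambda>x. \<integral>y. u x * u y * k x y \<partial>N)"
    proof (rule M.integrable_const_bound[where B = "m * B"])
      show "AE x in M. norm (\<integral>y. u x * u y * k x y \<partial>N) \<le> m * B"
      proof (rule AE_I2)
        fix x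
        have "norm (\<integral>y. u x * u y * k x y \<partial>N) \<le> (\<integral>y. norm (u x * u y * k x y) \<partial>N)"
          by (rule integral_norm_bound)
        also have "\<dots> \<le> (\<integral>y. B \<partial>N)"
          by (intro integral_mono integrable_norm i1) (use e2 in auto)
        finally show "norm (\<integral>y. u x * u y * k x y \<partial>N) \<le> m * B" by (simp add: m_def)
      qed
    qed measurable
    have "(\<integral>y. u y * u x * (k x y - ln (2 * s)) \<partial>N) = (\<integral>y. u x * u y * k x y \<partial>N) - ln (2 * s) * (u x * C 0)" for x
    proof -
      have "(\<integral>y. u y * u x * (k x y - ln (2 * s)) \<partial>N) = (\<integral>y. u x * u y * k x y - (ln (2 * s) * u x) * u y \<partial>N)"
        by (rule Bochner_Integration.integral_cong) (auto simp: algebra_simps)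
      also have "\<dots> = (\<integral>y. u x * u y * k x y \<partial>N) - (\<integral>y. (ln (2 * s) * u x) * u y \<partial>N)"
        by (intro Bochner_Integration.integral_diff i1 integrable_mult_right i3)
      finally show ?thesis by (simp add: C_def cos_coeff_def)
    qed
    then have "(\<integral>x. (\<Sum>n. f n x) \<partial>M) = (\<integral>x. (\<integral>y. u x * u y * k x y \<partial>N) - ln (2 * s) * C 0 * u x \<partial>M)"
      by (intro Bochner_Integration.integral_cong) (auto simp: sf)
    also have "\<dots> = (\<integral>x. (\<integral>y. u x * u y * k x y \<partial>N) \<partial>M) - (\<integral>x. ln (2 * s) * C 0 * u x \<partial>M)"
      by (intro Bochner_Integration.integral_diff i2 integrable_mult_right i3)
    finally show ?thesis
      by (simp add: reg_energy_def k_def cos_coeff_def)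
  qed
  ultimately show ?thesis by (simp add: C_def)
qed

text \<open>Since the masses agree, the constant \<open>ln (2 * s)\<close> cancels in the energy of the difference, and what
  remains is the sum of the squares \<open>2 / k * s ^ k * (cos_coeff M u \<theta> k - cos_coeff N u \<theta> k)\<^sup>2\<close>, which
  is at least its term \<open>k = n\<close>.\<close>

lemma reg_energy_pos_def:
  assumes s: "0 < s" "s < 1" and M: "finite_measure M" "sets M = sets borel"
    and N: "finite_measure N" "sets N = sets borel"
    and u: "u \<in> borel_measurable borel" "\<And>x. \<bar>u x\<bar> \<le> 1" 
    and \<theta>: "\<theta> \<in> borel_measurable borel"
    and mass: "(\<integral>x. u x \<partial>M) = (\<integral>x. u x \<partial>N)"
  shows "reg_energy s u \<theta> M M + reg_energy s u \<theta> N N - reg_energy s u \<theta> M N - reg_energy s u \<theta> N M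
           \<ge> 2 / real n * s ^ n * (cos_coeff M u \<theta> n - cos_coeff N u \<theta> n)\<^sup>2"
proof -
  have mass0: "cos_coeff M u \<theta> 0 = cos_coeff N u \<theta> 0"
    using mass by (simp add: cos_coeff_def)
  define a b w where "a n = cos_coeff M u \<theta> n" and "b n = cos_coeff N u \<theta> n" and "w n = 2 / real n * s ^ n" for n
  have "(\<lambda>n. w n * (a n * a n) + w n * (b n * b n) - w n * (a n * b n) - w n * (b n * a n)) sums
     ((reg_energy s u \<theta> M M - ln (2 * s) * (a 0 * a 0)) + (reg_energy s u \<theta> N N - ln (2 * s) * (b 0 * b 0))
      - (reg_energy s u \<theta> M N - ln (2 * s) * (a 0 * b 0)) - (reg_energy s u \<theta> N M - ln (2 * s) * (b 0 * a 0)))"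
    unfolding a_def b_def w_def
    by (intro sums_add sums_diff reg_energy_sums assms)
  also have "(\<lambda>n. w n * (a n * a n) + w n * (b n * b n) - w n * (a n * b n) - w n * (b n * a n))
      = (\<lambda>n. w n * (a n - b n)\<^sup>2)"
    by (auto simp: fun_eq_iff power2_eq_square algebra_simps)
  finally have S: "(\<lambda>n. w n * (a n - b n)\<^sup>2) sums (reg_energy s u \<theta> M M + reg_energy s u \<theta> N N
      - reg_energy s u \<theta> M N - reg_energy s u \<theta> N M)"
    using mass0 unfolding a_def b_def by (simp add: algebra_simps)
  have "w n * (a n - b n)\<^sup>2 = (\<Sum>k\<in>{n}. w k * (a k - b k)\<^sup>2)" by simp
  also have "\<dots> \<le> (\<Sum>k. w k * (a k - b k)\<^sup>2)"
    by (rule sum_le_suminf) (use S s in \<open>auto simp: sums_iff w_def\<close>)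
  finally show ?thesis using S by (simp add: sums_iff a_def b_def w_def)
qed

section \<open>Measures determined by their cosine moments\<close>

text \<open>The product formula for cosines reduces \<open>cos \<theta> ^ Suc m * cos (n * \<theta>)\<close> to the same expressions with
  exponent \<open>m\<close>; the frequency \<open>n\<close> has to vary in the induction.\<close>

lemma integral_cong_cos_moments:
  assumes M: "real_distribution M" and N: "real_distribution N" 
    and \<theta>[measurable]: "\<theta> \<in> borel_measurable borel"
    and eq: "\<And>n. n > 0 \<Longrightarrow> (\<integral>x. cos (real n * \<theta> x) \<partial>M) = (\<integral>x. cos (real n * \<theta> x) \<partial>N)"
  shows "(\<integral>x. cos (\<theta> x) ^ m * cos (real n * \<theta> x) \<partial>M) = (\<integral>x. cos (\<theta> x) ^ m * cos (real n * \<theta> x) \<partial>N)"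
proof -
  interpret M: real_distribution M by fact
  interpret N: real_distribution N by fact
  have b: "\<bar>cos (\<theta> x) ^ m * cos (real n * \<theta> x)\<bar> \<le> 1" for m n x
    unfolding abs_mult power_abs by (intro mult_le_one power_le_one) auto
  have iM: "integrable M (\<lambda>x. cos (\<theta> x) ^ m * cos (real n * \<theta> x))" for m n
    by (rule M.integrable_const_bound[where B = 1]) (use b in auto)
  have iN: "integrable N (\<lambda>x. cos (\<theta> x) ^ m * cos (real n * \<theta> x))" for m n
    by (rule N.integrable_const_bound[where B = 1]) (use b in auto)
  show ?thesis
  proof (induction m arbitrary: n)
    case 0
    show ?case using eq[of n] by (cases "n = 0") (auto simp: M.prob_space[simplified] N.prob_space[simplified])
  next
    case (Suc m)
    show ?case
    proof (cases n)
      case 0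
      have "cos (\<theta> x) ^ Suc m * cos (real n * \<theta> x) = cos (\<theta> x) ^ m * cos (real 1 * \<theta> x)" for x
        using 0 by (simp add: mult.commute)
      then have "(\<lambda>x. cos (\<theta> x) ^ Suc m * cos (real n * \<theta> x)) = (\<lambda>x. cos (\<theta> x) ^ m * cos (real 1 * \<theta> x))"
        by (rule ext)
      then show ?thesis using Suc.IH[of 1] by metis
    next
      case (Suc l)
      have *: "cos (\<theta> x) ^ Suc m * cos (real n * \<theta> x)
          = (cos (\<theta> x) ^ m * cos (real (Suc n) * \<theta> x) + cos (\<theta> x) ^ m * cos (real l * \<theta> x)) / 2" for x
      proof -
        have "cos (real (Suc n) * \<theta> x) + cos (real l * \<theta> x) = 2 * (cos (\<theta> x) * cos (real n * \<theta> x))"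
          using cos_add[of "real n * \<theta> x" "\<theta> x"] cos_diff[of "real n * \<theta> x" "\<theta> x"]
          by (simp add: Suc algebra_simps)
        then show ?thesis by (simp add: distrib_left[symmetric])
      qed
      show ?thesis unfolding *
        by (simp add: iM iN Suc.IH del: of_nat_Suc)
    qed
  qed
qed

text \<open>Cosine moments determine power moments, hence integrals of polynomials, and by Weierstrass
  approximation on \<open>{-R..R}\<close> integrals of bounded continuous functions. Applied to \<open>cos (t * x)\<close> and \<open>sin
  (t * x)\<close> this gives equality of the characteristic functions.\<close>

lemma measure_eqI_cos_moments:
  assumes M: "real_distribution M" "AE x in M. \<bar>x\<bar> \<le> R" and N: "real_distribution N" "AE x in N. \<bar>x\<bar> \<le> R"
    and \<theta>[measurable]: "\<theta> \<in> borel_measurable borel" and R: "R > 0"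
    and cs: "\<And>x. \<bar>x\<bar> \<le> R \<Longrightarrow> cos (\<theta> x) = x / R"
    and eq: "\<And>n. n > 0 \<Longrightarrow> (\<integral>x. cos (real n * \<theta> x) \<partial>M) = (\<integral>x. cos (real n * \<theta> x) \<partial>N)"
  shows "M = N"
proof -
  interpret M: real_distribution M by fact
  interpret N: real_distribution N by fact
  have iP: "integrable P (\<lambda>x. x ^ m)" 
    if P: "real_distribution P" "AE x in P. \<bar>x\<bar> \<le> R" for P m
  proof -
    interpret P: real_distribution P by fact
    show ?thesis
      by (rule P.integrable_const_bound[where B = "R ^ m"])
         (use P(2) in \<open>auto elim!: eventually_mono simp: power_abs intro: power_mono\<close>)
  qed
  have mom: "(\<integral>x. x ^ m \<partial>M) = (\<integral>x. x ^ m \<partial>N)" for m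
  proof -
    have *: "(\<integral>x. x ^ m \<partial>P) = R ^ m * (\<integral>x. cos (\<theta> x) ^ m * cos (real 0 * \<theta> x) \<partial>P)"
      if P: "real_distribution P" "AE x in P. \<bar>x\<bar> \<le> R" for P
    proof -
      interpret P: real_distribution P by fact
      have "(\<integral>x. x ^ m \<partial>P) = (\<integral>x. R ^ m * (cos (\<theta> x) ^ m) \<partial>P)"
      proof (rule integral_cong_AE)
        show "AE x in P. x ^ m = R ^ m * (cos (\<theta> x) ^ m)"
          using P(2) by (rule eventually_mono) (use cs R in \<open>auto simp: power_divide\<close>)
      qed auto
      then show ?thesis by simp
    qed
    show ?thesis
      unfolding *[OF M] *[OF N] using integral_cong_cos_moments[OF M(1) N(1) \<theta> eq, of m 0] by simp
  qed
  have poly: "(\<integral>x. g x \<partial>M) = (\<integral>x. g x \<partial>N) \<and> integrable M g \<and> integrable N g" if gp: "real_polynomial_function g" for g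
  proof -
    obtain a n where "g = (\<lambda>x. \<Sum>i\<le>n. a i * x ^ i)"
      using gp unfolding real_polynomial_function_iff_sum by blast
    then show ?thesis using mom iP[OF M] iP[OF N] by simp
  qed
  have cont: "(\<integral>x. f x \<partial>M) = (\<integral>x. f x \<partial>N)" if f: "continuous_on UNIV f" "\<And>x. \<bar>f x\<bar> \<le> 1" for f :: "real \<Rightarrow> real"
  proof -
    have [measurable]: "f \<in> borel_measurable borel" using f(1) by (rule borel_measurable_continuous_onI)
    have iM: "integrable M f" by (rule M.integrable_const_bound[where B = 1]) (use f(2) in auto)
    have iN: "integrable N f" by (rule N.integrable_const_bound[where B = 1]) (use f(2) in auto)
    have "\<bar>(\<integral>x. f x \<partial>M) - (\<integral>x. f x \<partial>N)\<bar> \<le> e" if e: "e > 0" for e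
    proof -
      have "continuous_on {-R..R} f" using f(1) continuous_on_subset by blast
      from Stone_Weierstrass_real_polynomial_function[OF compact_Icc this, of "e / 2"] e
      obtain g where g: "real_polynomial_function g" "\<And>x. x \<in> {-R..R} \<Longrightarrow> \<bar>f x - g x\<bar> < e / 2" by auto
      have *: "\<bar>(\<integral>x. f x \<partial>P) - (\<integral>x. g x \<partial>P)\<bar> \<le> e / 2"
        if P: "real_distribution P" "AE x in P. \<bar>x\<bar> \<le> R" "integrable P f" "integrable P g" for P
      proof -
        interpret P: real_distribution P by fact
        have "\<bar>(\<integral>x. f x \<partial>P) - (\<integral>x. g x \<partial>P)\<bar> = \<bar>\<integral>x. f x - g x \<partial>P\<bar>" using P(3,4) by simp
        also have "\<dots> \<le> (\<integral>x. \<bar>f x - g x\<bar> \<partial>P)" by (rule integral_abs_bound)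
        also have "\<dots> \<le> (\<integral>x. e / 2 \<partial>P)"
        proof (rule integral_mono_AE)
          show "AE x in P. \<bar>f x - g x\<bar> \<le> e / 2"
            using P(2)
          proof (rule eventually_mono)
            fix x assume "\<bar>x\<bar> \<le> R"
            then have "x \<in> {-R..R}" by auto
            then show "\<bar>f x - g x\<bar> \<le> e / 2" using g(2) less_imp_le by blast
          qed
        qed (use P(3,4) in auto)
        finally show ?thesis by (simp add: P.prob_space[simplified])
      qed
      have "integrable M g" "integrable N g" "(\<integral>x. g x \<partial>M) = (\<integral>x. g x \<partial>N)" using poly[OF g(1)] by auto
      with *[OF M iM] *[OF N iN] show ?thesis by linarith
    qed
    then have "\<bar>(\<integral>x. f x \<partial>M) - (\<integral>x. f x \<partial>N)\<bar> \<le> 0" by (rule field_le_epsilon[of _ 0, simplified])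
    then show ?thesis by simp
  qed
  have "char M t = char N t" for t
  proof -
    have "char P t = Complex (\<integral>x. cos (t * x) \<partial>P) (\<integral>x. sin (t * x) \<partial>P)" if "real_distribution P" for P
    proof -
      interpret P: real_distribution P by fact
      have "integrable P (\<lambda>x. iexp (t * x))"
        by (rule P.integrable_const_bound[where B = 1]) auto
      from integral_Re[OF this] integral_Im[OF this]
      show ?thesis unfolding char_def by (simp add: complex_eq_iff Re_exp Im_exp)
    qed
    then show ?thesis using assms(1,3)
      by (simp add: cont continuous_intros)
  qed
  then show ?thesis by (intro Levy_uniqueness assms(1,3)) auto
qed

section \<open>Sums of measures and weak convergence of double integrals\<close>

lemma sum_measure_facts:
  assumes "finite I" "\<And>i. i \<in> I \<Longrightarrow> sets (M i) = sets borel"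
  shows sets_sum_measure: "sets (sum_measure I M) = sets borel"
    and emeasure_sum_measure: "A \<in> sets borel \<Longrightarrow> emeasure (sum_measure I M) A = (\<Sum>i\<in>I. emeasure (M i) A)"
proof -
  show S: "sets (sum_measure I M) = sets borel"
    unfolding sum_measure_def using sets.sigma_sets_eq[of "borel :: real measure"] sets.space_closed[of "borel::real measure"]
    by (subst sets_measure_of) auto
  show "emeasure (sum_measure I M) A = (\<Sum>i\<in>I. emeasure (M i) A)" if A: "A \<in> sets borel"
  proof (rule emeasure_measure_of[OF sum_measure_def])
    show "sets borel \<subseteq> Pow (UNIV::real set)" by simp
    show "A \<in> sets (sum_measure I M)" using A S by simp
    show "positive (sets (sum_measure I M)) (\<lambda>A. \<Sum>i\<in>I. emeasure (M i) A)"
      by (simp add: positive_def)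
    show "countably_additive (sets (sum_measure I M)) (\<lambda>A. \<Sum>i\<in>I. emeasure (M i) A)"
    proof (rule countably_additiveI)
      fix B :: "nat \<Rightarrow> real set" assume B: "range B \<subseteq> sets (sum_measure I M)" "disjoint_family B" "(\<Union>i. B i) \<in> sets (sum_measure I M)"
      have "(\<Sum>n. \<Sum>i\<in>I. emeasure (M i) (B n)) = (\<Sum>i\<in>I. \<Sum>n. emeasure (M i) (B n))"
        by (rule suminf_sum) auto
      also have "\<dots> = (\<Sum>i\<in>I. emeasure (M i) (\<Union>i. B i))"
        by (rule sum.cong[OF refl], rule suminf_emeasure) (use B S assms in auto)
      finally show "(\<Sum>n. \<Sum>i\<in>I. emeasure (M i) (B n)) = (\<Sum>i\<in>I. emeasure (M i) (\<Union>i. B i))" .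
    qed
  qed
qed

lemma nn_integral_sum_measure:
  assumes I: "finite I" "\<And>i. i \<in> I \<Longrightarrow> sets (M i) = sets borel" and f: "f \<in> borel_measurable borel"
  shows "(\<integral>\<^sup>+x. f x \<partial>sum_measure I M) = (\<Sum>i\<in>I. \<integral>\<^sup>+x. f x \<partial>M i)"
proof -
  have S: "sets (sum_measure I M) = sets borel"
    by (rule sets_sum_measure) (use I in auto)
  have E: "emeasure (sum_measure I M) A = (\<Sum>i\<in>I. emeasure (M i) A)" if "A \<in> sets borel" for A
    by (rule emeasure_sum_measure) (use I that in auto)
  have m: "g \<in> borel_measurable (sum_measure I M)" 
    if "g \<in> borel_measurable borel" for g :: "real \<Rightarrow> ennreal"
    using that by (simp add: measurable_cong_sets[OF S refl])
  have m': "g \<in> borel_measurable (M i)" if "i \<in> I" "g \<in> borel_measurable borel" for g :: "real \<Rightarrow> ennreal" and i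
    using that(2) by (simp add: measurable_cong_sets[OF I(2)[OF that(1)] refl])
  from f show ?thesis
  proof (induction rule: borel_measurable_induct)
    case (cong f g) then show ?case by simp
  next
    case (set A)
    then show ?case using E[of A] I(2) S by simp
  next
    case (mult u c)
    then show ?case by (simp add: nn_integral_cmult m m' sum_distrib_left)
  next
    case (add u v)
    then show ?case by (simp add: nn_integral_add m m' sum.distrib)
  next
    case (seq U)
    have Um: "U i \<in> borel_measurable borel" for i by fact
    have inc: "incseq U" by fact
    have IH: "(\<integral>\<^sup>+x. U n x \<partial>sum_measure I M) = (\<Sum>i\<in>I. \<integral>\<^sup>+x. U n x \<partial>M i)" for n by (rule seq.IH)
    have "(\<integral>\<^sup>+x. (SUP i. U i x) \<partial>sum_measure I M) = (SUP i. \<integral>\<^sup>+x. U i x \<partial>sum_measure I M)"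
      by (rule nn_integral_monotone_convergence_SUP[OF inc m[OF Um]])
    also have "\<dots> = (SUP n. \<Sum>i\<in>I. \<integral>\<^sup>+x. U n x \<partial>M i)"
      unfolding IH ..
    also have "\<dots> = (\<Sum>i\<in>I. SUP n. \<integral>\<^sup>+x. U n x \<partial>M i)"
      using inc by (intro ennreal_SUP_sum) (auto simp: incseq_def le_fun_def intro!: nn_integral_mono)
    also have "\<dots> = (\<Sum>i\<in>I. \<integral>\<^sup>+x. (SUP n. U n x) \<partial>M i)"
      by (intro sum.cong refl nn_integral_monotone_convergence_SUP[symmetric] inc m' Um)
    finally show ?case by (simp add: image_comp)
  qed
qed

lemma integral_sum_measure:
  fixes f :: "real \<Rightarrow> real"
  assumes I: "finite I" "\<And>i. i \<in> I \<Longrightarrow> sets (M i) = sets borel" and f: "\<And>i. i \<in> I \<Longrightarrow> integrable (M i) f"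
    and fm: "f \<in> borel_measurable borel"
  shows "integrable (sum_measure I M) f" "(\<integral>x. f x \<partial>sum_measure I M) = (\<Sum>i\<in>I. \<integral>x. f x \<partial>M i)"
proof -
  have [measurable_cong]: "sets (sum_measure I M) = sets borel"
    by (rule sets_sum_measure) (use I in auto)
  note [measurable] = fm
  have *: "(\<integral>\<^sup>+x. ennreal (f x) \<partial>M i) < \<infinity>" "(\<integral>\<^sup>+x. ennreal (- f x) \<partial>M i) < \<infinity>" if "i \<in> I" for i
    using f[OF that] unfolding real_integrable_def by (auto simp: top.not_eq_extremum)
  have N: "(\<integral>\<^sup>+x. ennreal (f x) \<partial>sum_measure I M) = (\<Sum>i\<in>I. \<integral>\<^sup>+x. ennreal (f x) \<partial>M i)"
          "(\<integral>\<^sup>+x. ennreal (- f x) \<partial>sum_measure I M) = (\<Sum>i\<in>I. \<integral>\<^sup>+x. ennreal (- f x) \<partial>M i)"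
    by (rule nn_integral_sum_measure[OF I]; simp)+
  have F: "(\<Sum>i\<in>I. \<integral>\<^sup>+x. ennreal (f x) \<partial>M i) < \<infinity>" "(\<Sum>i\<in>I. \<integral>\<^sup>+x. ennreal (- f x) \<partial>M i) < \<infinity>"
    using * using I(1) by auto
  show i: "integrable (sum_measure I M) f"
    unfolding real_integrable_def N using F by (auto simp: less_top[symmetric])
  show "(\<integral>x. f x \<partial>sum_measure I M) = (\<Sum>i\<in>I. \<integral>x. f x \<partial>M i)"
    unfolding real_lebesgue_integral_def[OF i] N
    using * by (subst (1 2) enn2real_sum) (auto simp: sum_subtractf real_lebesgue_integral_def[OF f])
qed

text \<open>By Skorohod's theorem the measures are laws of random variables that converge pointwise, so the
  double integral over \<open>\<mu> n\<close> is a double integral over one fixed space and dominated convergence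
  applies twice.\<close>

lemma weak_conv_double_integral:
  fixes K :: "real \<Rightarrow> real \<Rightarrow> real"
  assumes cont: "continuous_on UNIV (\<lambda>z. K (fst z) (snd z))" and bd: "\<And>x y. \<bar>K x y\<bar> \<le> B"
    and \<mu>: "\<And>n. real_distribution (\<mu> n)" and \<nu>: "real_distribution \<nu>" and wc: "weak_conv_m \<mu> \<nu>"
  shows "(\<lambda>n. \<integral>x. (\<integral>y. K x y \<partial>\<mu> n) \<partial>\<mu> n) \<longlonglongrightarrow> (\<integral>x. (\<integral>y. K x y \<partial>\<nu>) \<partial>\<nu>)"
proof -
  obtain \<Omega> :: "real measure" and Yn Y where
    ps: "prob_space \<Omega>" and
    Yn [measurable]: "\<And>n. Yn n \<in> borel_measurable \<Omega>" and
    dYn: "\<And>n. distr \<Omega> borel (Yn n) = \<mu> n" and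
    Y [measurable]: "Y \<in> borel_measurable \<Omega>" and
    dY: "distr \<Omega> borel Y = \<nu>" and
    lim: "\<And>x. x \<in> space \<Omega> \<Longrightarrow> (\<lambda>n. Yn n x) \<longlonglongrightarrow> Y x"
    using Skorohod[OF \<mu> \<nu> wc] by force
  interpret prob_space \<Omega> by fact
  have [measurable]: "(\<lambda>z. K (fst z) (snd z)) \<in> borel_measurable (borel \<Otimes>\<^sub>M borel)"
    using borel_measurable_continuous_onI[OF cont] by (simp add: borel_prod)
  have [measurable]: "(\<lambda>(x, y). K x y) \<in> borel_measurable (borel \<Otimes>\<^sub>M borel)"
    by (simp add: case_prod_beta)
  have [measurable]: "K x \<in> borel_measurable borel" for x
  proof -
    have "(\<lambda>y. (\<lambda>z. K (fst z) (snd z)) (x, y)) \<in> borel_measurable borel" by measurable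
    then show ?thesis by simp
  qed
  have eq: "(\<integral>x. (\<integral>y. K x y \<partial>distr \<Omega> borel Z) \<partial>distr \<Omega> borel Z) = (\<integral>s. (\<integral>t. K (Z s) (Z t) \<partial>\<Omega>) \<partial>\<Omega>)"
    if [measurable]: "Z \<in> borel_measurable \<Omega>" for Z
  proof -
    interpret Z: real_distribution "distr \<Omega> borel Z" by (rule real_distribution_distr) simp
    show ?thesis by (subst integral_distr; simp add: integral_distr)
  qed
  have kc: "(\<lambda>n. K (Yn n s) (Yn n t)) \<longlonglongrightarrow> K (Y s) (Y t)" if "s \<in> space \<Omega>" "t \<in> space \<Omega>" for s t
  proof -
    have "isCont (\<lambda>z. K (fst z) (snd z)) (Y s, Y t)"
      using cont by (simp add: continuous_on_eq_continuous_at)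
    from isCont_tendsto_compose[OF this tendsto_Pair[OF lim[OF that(1)] lim[OF that(2)]]]
    show ?thesis by simp
  qed
  have inner: "(\<lambda>n. \<integral>t. K (Yn n s) (Yn n t) \<partial>\<Omega>) \<longlonglongrightarrow> (\<integral>t. K (Y s) (Y t) \<partial>\<Omega>)" if "s \<in> space \<Omega>" for s
  proof (rule integral_dominated_convergence[where w = "\<lambda>_. B"])
    show "AE t in \<Omega>. (\<lambda>n. K (Yn n s) (Yn n t)) \<longlonglongrightarrow> K (Y s) (Y t)"
      by (rule AE_I2) (use kc that in auto)
  qed (use bd in auto)
  have ib: "\<bar>\<integral>t. K (Z s) (Z t) \<partial>\<Omega>\<bar> \<le> B" if [measurable]: "Z \<in> borel_measurable \<Omega>" for Z s
  proof -
    have "\<bar>\<integral>t. K (Z s) (Z t) \<partial>\<Omega>\<bar> \<le> (\<integral>t. \<bar>K (Z s) (Z t)\<bar> \<partial>\<Omega>)" by (rule integral_abs_bound)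
    also have "\<dots> \<le> (\<integral>t. B \<partial>\<Omega>)"
    proof (rule integral_mono)
      show "integrable \<Omega> (\<lambda>t. \<bar>K (Z s) (Z t)\<bar>)"
        by (rule integrable_const_bound[where B = B]) (use bd in auto)
    qed (use bd in auto)
    finally show ?thesis by (simp add: prob_space)
  qed
  have "(\<lambda>n. \<integral>s. (\<integral>t. K (Yn n s) (Yn n t) \<partial>\<Omega>) \<partial>\<Omega>) \<longlonglongrightarrow> (\<integral>s. (\<integral>t. K (Y s) (Y t) \<partial>\<Omega>) \<partial>\<Omega>)"
  proof (rule integral_dominated_convergence[where w = "\<lambda>_. B"])
    show "AE s in \<Omega>. (\<lambda>n. \<integral>t. K (Yn n s) (Yn n t) \<partial>\<Omega>) \<longlonglongrightarrow> (\<integral>t. K (Y s) (Y t) \<partial>\<Omega>)"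
      by (rule AE_I2) (rule inner)
    show "AE s in \<Omega>. norm (\<integral>t. K (Yn n s) (Yn n t) \<partial>\<Omega>) \<le> B" for n
      by (rule AE_I2) (use ib[OF Yn] in auto)
  qed measurable
  then show ?thesis
    unfolding eq[OF Yn, unfolded dYn] eq[OF Y, unfolded dY] .
qed

section \<open>The regularised interaction on a union of intervals\<close>

locale angelesco_intervals =
  fixes p :: nat and a b r :: "nat \<Rightarrow> real" and \<Gamma> :: "nat \<Rightarrow> real set" and Q :: "nat \<Rightarrow> real \<Rightarrow> real"
  assumes p_ge: "p \<ge> 1"
    and intervals: "\<And>i. i \<in> {1..p} \<Longrightarrow> a i < b i \<and> \<Gamma> i = {a i..b i}"
    and gaps: "\<And>i. i \<in> {1..<p} \<Longrightarrow> b i < a (Suc i)"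
    and r_pos: "\<And>i. i \<in> {1..p} \<Longrightarrow> r i > 0"
    and r_sum: "(\<Sum>i=1..p. r i) = 1"
    and Q_cont: "\<And>i. i \<in> {1..p} \<Longrightarrow> continuous_on (\<Gamma> i) (Q i)"
begin

definition G :: "real set" where "G = (\<Union>i\<in>{1..p}. \<Gamma> i)"

lemma Gamma_compact: "i \<in> {1..p} \<Longrightarrow> compact (\<Gamma> i)"
  using intervals by simp

lemma Gamma_borel [measurable]: "i \<in> {1..p} \<Longrightarrow> \<Gamma> i \<in> sets borel"
  using intervals by simp

lemma G_compact: "compact G"
  unfolding G_def using Gamma_compact by (intro compact_UN) auto

lemma G_borel [measurable]: "G \<in> sets borel"
  using G_compact by (simp add: borel_compact)

lemma b_less_a:
  assumes "i \<in> {1..p}" "j \<in> {1..p}" "i < j"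
  shows "b i < a j"
proof -
  have "i < j \<Longrightarrow> j \<le> p \<Longrightarrow> b i < a j"
  proof (induction j)
    case (Suc j)
    have *: "b j < a (Suc j)" if "1 \<le> j" using gaps[of j] Suc.prems that by auto
    show ?case
    proof (cases "i = j")
      case True then show ?thesis using * assms(1) by auto
    next
      case False
      then have "b i < a j" "1 \<le> j" using Suc assms(1) by auto
      moreover have "a j < b j" using intervals[of j] Suc.prems \<open>1 \<le> j\<close> by auto
      ultimately show ?thesis using * by linarith
    qed
  qed simp
  then show ?thesis using assms by auto
qed

lemma Gamma_less:
  assumes "i \<in> {1..p}" "j \<in> {1..p}" "i < j" "x \<in> \<Gamma> i" "y \<in> \<Gamma> j"
  shows "x < y"
  using b_less_a[OF assms(1-3)] assms intervals by fastforce

lemma Gamma_disjoint: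
  assumes "i \<in> {1..p}" "j \<in> {1..p}" "x \<in> \<Gamma> i" "x \<in> \<Gamma> j"
  shows "i = j"
  using Gamma_less assms by (metis less_irrefl linorder_neqE_nat)

text \<open>Functions given separately on the disjoint compact intervals form one continuous function on their
  union, which Tietze's theorem extends to the line. Kernels and external fields become bounded
  continuous functions on the whole line in this way, as weak convergence requires.\<close>

lemma glue_extension:
  assumes "\<And>i. i \<in> {1..p} \<Longrightarrow> continuous_on (\<Gamma> i) (f i)"
  shows "\<exists>g. continuous_on UNIV g \<and> (\<exists>B. \<forall>x. \<bar>g x\<bar> \<le> B) \<and> (\<forall>i\<in>{1..p}. \<forall>x\<in>\<Gamma> i. g x = (f i x::real))"
proof -
  define f0 where "f0 x = f (THE i. i \<in> {1..p} \<and> x \<in> \<Gamma> i) x" for x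
  have f0: "f0 x = f i x" if "i \<in> {1..p}" "x \<in> \<Gamma> i" for i x
  proof -
    have "(THE i. i \<in> {1..p} \<and> x \<in> \<Gamma> i) = i"
    proof (rule the_equality)
      show "j = i" if "j \<in> {1..p} \<and> x \<in> \<Gamma> j" for j
        using Gamma_disjoint[of j i x] that \<open>i \<in> {1..p}\<close> \<open>x \<in> \<Gamma> i\<close> by blast
    qed (use that in blast)
    then show ?thesis by (simp add: f0_def)
  qed
  have c: "continuous_on G f0"
    unfolding G_def
  proof (rule continuous_on_closed_Union)
    show "continuous_on (\<Gamma> i) f0" if "i \<in> {1..p}" for i
      using assms[OF that] by (rule continuous_on_eq) (use f0 that in auto)
  qed (use Gamma_compact compact_imp_closed in auto)
  obtain B where "\<And>x. x \<in> G \<Longrightarrow> norm (f0 x) \<le> B" "B \<ge> 0"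
    using compact_imp_bounded[OF compact_continuous_image[OF c G_compact]] unfolding bounded_pos
    by (meson image_eqI less_imp_le)
  then obtain g where g: "continuous_on UNIV g" "\<And>x. x \<in> G \<Longrightarrow> g x = f0 x" "\<And>x. norm (g x) \<le> B"
    using Tietze[OF c, of UNIV B] G_compact compact_imp_closed by auto
  then show ?thesis
  proof (intro exI[of _ g] conjI ballI)
    show "g x = f i x" if "i \<in> {1..p}" "x \<in> \<Gamma> i" for i x
    proof -
      have "x \<in> G" using that unfolding G_def by blast
      then show ?thesis using g(2) f0[OF that] by simp
    qed
  qed (use g in auto)
qed

definition Q_ext :: "real \<Rightarrow> real" where
  "Q_ext = (SOME g. continuous_on UNIV g \<and> (\<exists>B. \<forall>x. \<bar>g x\<bar> \<le> B) \<and> (\<forall>i\<in>{1..p}. \<forall>x\<in>\<Gamma> i. g x = Q i x))"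

lemma Q_ext_spec: "continuous_on UNIV Q_ext \<and> (\<exists>B. \<forall>x. \<bar>Q_ext x\<bar> \<le> B) \<and> (\<forall>i\<in>{1..p}. \<forall>x\<in>\<Gamma> i. Q_ext x = Q i x)"
  unfolding Q_ext_def by (rule someI_ex[OF glue_extension[OF Q_cont]])

lemmas Q_ext_cont = Q_ext_spec[THEN conjunct1]

lemma Q_ext_eq: "i \<in> {1..p} \<Longrightarrow> x \<in> \<Gamma> i \<Longrightarrow> Q_ext x = Q i x"
  using Q_ext_spec by blast

definition Q_bound :: real where "Q_bound = (SOME B. \<forall>x. \<bar>Q_ext x\<bar> \<le> B)"

lemma abs_Q_ext_le: "\<bar>Q_ext x\<bar> \<le> Q_bound"
proof -
  have "\<forall>x. \<bar>Q_ext x\<bar> \<le> Q_bound" unfolding Q_bound_def by (rule someI_ex) (use Q_ext_spec in blast)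
  then show ?thesis ..
qed

lemma Q_bound_nonneg: "0 \<le> Q_bound" using abs_Q_ext_le[of 0] by linarith

lemma Q_ext_borel [measurable]: "Q_ext \<in> borel_measurable borel"
  using Q_ext_cont by (rule borel_measurable_continuous_onI)

text \<open>A continuous stand-in for the indicator function of \<open>\<Gamma> i\<close>: it agrees with it on all the intervals.\<close>

definition chi :: "nat \<Rightarrow> real \<Rightarrow> real" where
  "chi i = (SOME g. continuous_on UNIV g \<and> (\<forall>x. 0 \<le> g x \<and> g x \<le> 1) \<and>
      (\<forall>j\<in>{1..p}. \<forall>x\<in>\<Gamma> j. g x = (if i = j then 1 else 0)))"

lemma chi_spec: "continuous_on UNIV (chi i) \<and> (\<forall>x. 0 \<le> chi i x \<and> chi i x \<le> 1) \<and>
      (\<forall>j\<in>{1..p}. \<forall>x\<in>\<Gamma> j. chi i x = (if i = j then 1 else 0))"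
proof -
  obtain g where g: "continuous_on UNIV g" "\<forall>j\<in>{1..p}. \<forall>x\<in>\<Gamma> j. g x = (if i = j then 1 else (0::real))"
    using glue_extension[of "\<lambda>j x. if i = j then 1 else 0"] by auto
  have "\<exists>g. continuous_on UNIV g \<and> (\<forall>x. 0 \<le> g x \<and> g x \<le> 1) \<and>
      (\<forall>j\<in>{1..p}. \<forall>x\<in>\<Gamma> j. g x = (if i = j then 1 else (0::real)))"
    by (rule exI[of _ "\<lambda>x. max 0 (min 1 (g x))"]) (use g in \<open>auto intro!: continuous_intros\<close>)
  from someI_ex[OF this] show ?thesis unfolding chi_def .
qed

lemma chi_cont: "continuous_on UNIV (chi i)" 
  and chi_nonneg: "0 \<le> chi i x" and chi_le: "chi i x \<le> 1"
  and chi_eq: "j \<in> {1..p} \<Longrightarrow> x \<in> \<Gamma> j \<Longrightarrow> chi i x = (if i = j then 1 else 0)"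
  using chi_spec by blast+

lemma chi_borel [measurable]: "chi i \<in> borel_measurable borel"
  using chi_cont by (rule borel_measurable_continuous_onI)

definition rad :: real where "rad = (SOME R. R \<ge> 1 \<and> (\<forall>x\<in>G. \<bar>x\<bar> \<le> R))"

lemma rad: "rad \<ge> 1" "x \<in> G \<Longrightarrow> \<bar>x\<bar> \<le> rad"
proof -
  obtain B where "\<forall>x\<in>G. norm x \<le> B" using compact_imp_bounded[OF G_compact] unfolding bounded_iff by blast
  then have "max 1 B \<ge> 1 \<and> (\<forall>x\<in>G. \<bar>x\<bar> \<le> max 1 B)" by (auto simp: le_max_iff_disj)
  then have "rad \<ge> 1 \<and> (\<forall>x\<in>G. \<bar>x\<bar> \<le> rad)" unfolding rad_def by (rule someI)
  then show "rad \<ge> 1" "x \<in> G \<Longrightarrow> \<bar>x\<bar> \<le> rad" by auto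
qed

text \<open>On \<open>G\<close> this is the scaling into \<open>[-1, 1]\<close>; clamping keeps the angle \<open>ang x\<close>, for which \<open>x = rad * cos (ang
  x)\<close> on \<open>G\<close>, meaningful everywhere.\<close>

definition rescaled :: "real \<Rightarrow> real" where "rescaled x = max (-1) (min 1 (x / rad))"
definition ang :: "real \<Rightarrow> real" where "ang x = arccos (rescaled x)"

lemma rescaled_abs: "\<bar>rescaled x\<bar> \<le> 1" by (auto simp: rescaled_def)

lemma cos_ang: "cos (ang x) = rescaled x"
  unfolding ang_def using rescaled_abs[of x] by (simp add: cos_arccos_abs)

lemma rescaled_eq: "x \<in> G \<Longrightarrow> rescaled x = x / rad"
  using rad(1) rad(2)[of x] by (auto simp: rescaled_def field_simps max_def min_def abs_le_iff)

lemma rescaled_cont: "continuous_on UNIV rescaled"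
  unfolding rescaled_def using rad(1) by (intro continuous_intros) auto

lemma ang_borel [measurable]: "ang \<in> borel_measurable borel"
proof -
  have "continuous_on UNIV (\<lambda>x. arccos (rescaled x))"
    by (rule continuous_on_compose2[OF continuous_on_arccos' rescaled_cont]) (use rescaled_abs in \<open>auto simp: abs_le_iff minus_le_iff\<close>)
  then show ?thesis unfolding ang_def by (rule borel_measurable_continuous_onI)
qed

text \<open>Any sequence in \<open>(0, 1)\<close> increasing to 1 would do; this one makes \<open>eta\<close> explicit and starts at \<open>1/2\<close>.\<close>

definition sp :: "nat \<Rightarrow> real" where "sp M = (real M + 1) / (real M + 2)"
definition eta :: "nat \<Rightarrow> real" where "eta M = reg_eps (sp M)"

lemma sp: "0 < sp M" "sp M < 1" by (auto simp: sp_def)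

lemma eta_eq: "eta M = 1 / (2 * (real M + 1) * (real M + 2))"
proof -
  have "1 - sp M = 1 / (real M + 2)" by (simp add: sp_def field_simps)
  moreover have "(1 / y)\<^sup>2 / (2 * (x / y)) = 1 / (2 * x * y)" if "x > 0" "y > 0" for x y :: real
    using that by (simp add: power2_eq_square field_simps)
  from this[of "real M + 1" "real M + 2"]
  have "(1 / (real M + 2))\<^sup>2 / (2 * sp M) = 1 / (2 * (real M + 1) * (real M + 2))" by (simp add: sp_def)
  ultimately show ?thesis unfolding eta_def reg_eps_def by simp
qed

lemma eta_pos: "eta M > 0" by (simp add: eta_eq)
lemma eta_le': "eta M \<le> 1 / (real M + 1)"
  unfolding eta_eq by (rule frac_le) (auto simp: algebra_simps)
lemma eta_le: "eta M \<le> 1" using order_trans[OF eta_le', of M 1] by simp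
lemma eta_antimono: "M \<le> M' \<Longrightarrow> eta M' \<le> eta M"
  unfolding eta_eq by (intro divide_left_mono mult_mono) auto
lemma eta_lim: "eta \<longlonglongrightarrow> 0"
proof (rule real_tendsto_sandwich[OF _ _ tendsto_const])
  show "(\<lambda>n. 1 / (real n + 1)) \<longlonglongrightarrow> 0" using LIMSEQ_inverse_real_of_nat by (simp add: inverse_eq_divide add.commute)
  show "\<forall>\<^sub>F n in sequentially. 0 \<le> eta n" using eta_pos by (auto intro!: always_eventually less_imp_le)
  show "\<forall>\<^sub>F n in sequentially. eta n \<le> 1 / (real n + 1)"
    by (intro always_eventually allI eta_le')
qed

text \<open>The regularised logarithmic kernel in the original coordinates; \<open>- ln rad\<close> undoes the scaling. On \<open>G\<close> it
  increases to \<open>- ln \<bar>x - y\<bar>\<close> as \<open>M\<close> tends to infinity, off the diagonal to a finite limit and on the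
  diagonal to infinity.\<close>

definition ell :: "nat \<Rightarrow> real \<Rightarrow> real \<Rightarrow> real" where
  "ell M x y = - ln rad - ln (reg_dist (eta M) (rescaled x) (rescaled y)) / 2"

lemma reg_pos: "reg_dist (eta M) (rescaled x) (rescaled y) > 0"
  using reg_dist_pos(2)[OF eta_pos rescaled_abs rescaled_abs] .

lemma ell_mono: "M \<le> M' \<Longrightarrow> ell M x y \<le> ell M' x y"
  unfolding ell_def using reg_dist_mono[OF less_imp_le[OF eta_pos] eta_antimono rescaled_abs rescaled_abs, of M M' x y] reg_pos
  by simp

text \<open>The constant 9 is the bound on \<open>reg_dist\<close>, used with \<open>ln t \<le> t\<close>.\<close>

lemma ell_lower: "ell M x y \<ge> - ln rad - 9"
proof -
  have "ln (reg_dist (eta M) (rescaled x) (rescaled y)) \<le> reg_dist (eta M) (rescaled x) (rescaled y)"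
    using ln_le_minus_one[OF reg_pos, of M x y] by linarith
  also have "\<dots> \<le> 9" by (rule reg_dist_le[OF less_imp_le[OF eta_pos] eta_le rescaled_abs rescaled_abs])
  finally show ?thesis unfolding ell_def by simp
qed

lemma ell_upper: "ell M x y \<le> - ln (eta M)"
proof -
  have "(eta M)\<^sup>2 \<le> reg_dist (eta M) (rescaled x) (rescaled y)"
    by (rule reg_dist_pos(1)[OF eta_pos rescaled_abs rescaled_abs])
  then have "2 * ln (eta M) \<le> ln (reg_dist (eta M) (rescaled x) (rescaled y))"
    using ln_realpow[of "eta M" 2] eta_pos[of M] reg_pos[of M x y] by (metis ln_le_cancel_iff of_nat_numeral zero_less_power)
  moreover have "ln rad \<ge> 0" using rad(1) by simp
  ultimately show ?thesis unfolding ell_def by linarith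
qed

lemma ell_le_log: "x \<in> G \<Longrightarrow> y \<in> G \<Longrightarrow> x \<noteq> y \<Longrightarrow> ell M x y \<le> - ln \<bar>x - y\<bar>"
proof -
  assume xy: "x \<in> G" "y \<in> G" "x \<noteq> y"
  have "(\<bar>x - y\<bar> / rad)\<^sup>2 = (rescaled x - rescaled y)\<^sup>2"
    using rad(1) xy by (simp add: rescaled_eq diff_divide_distrib[symmetric] power_divide)
  also have "\<dots> \<le> reg_dist (eta M) (rescaled x) (rescaled y)"
    by (rule reg_dist_pos(3)[OF eta_pos rescaled_abs rescaled_abs])
  finally have "ln ((\<bar>x - y\<bar> / rad)\<^sup>2) \<le> ln (reg_dist (eta M) (rescaled x) (rescaled y))"
    using xy rad(1) reg_pos by (intro ln_mono) auto
  moreover have "ln ((\<bar>x - y\<bar> / rad)\<^sup>2) = 2 * (ln \<bar>x - y\<bar> - ln rad)"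
    using ln_realpow[of "\<bar>x - y\<bar> / rad" 2] xy rad(1) by (simp add: ln_div)
  ultimately show ?thesis unfolding ell_def by (simp add: field_simps)
qed

lemma ell_lim: "x \<in> G \<Longrightarrow> y \<in> G \<Longrightarrow> x \<noteq> y \<Longrightarrow> (\<lambda>M. ell M x y) \<longlonglongrightarrow> - ln \<bar>x - y\<bar>"
proof -
  assume xy: "x \<in> G" "y \<in> G" "x \<noteq> y"
  have e: "(\<bar>x - y\<bar> / rad)\<^sup>2 = (rescaled x - rescaled y)\<^sup>2"
    using rad(1) xy by (simp add: rescaled_eq diff_divide_distrib[symmetric] power_divide)
  have "(\<lambda>M. ell M x y) \<longlonglongrightarrow> - ln rad - ln ((rescaled x - rescaled y)\<^sup>2 + 0\<^sup>2 + 2 * 0 * (1 - rescaled x * rescaled y)) / 2"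
    unfolding ell_def reg_dist_def
  proof (intro tendsto_intros eta_lim)
    have "(rescaled x - rescaled y)\<^sup>2 > 0" using xy rad(1) unfolding e[symmetric] by simp
    then show "(rescaled x - rescaled y)\<^sup>2 + 0\<^sup>2 + 2 * 0 * (1 - rescaled x * rescaled y) \<noteq> 0" by simp
  qed simp
  also have "- ln rad - ln ((rescaled x - rescaled y)\<^sup>2 + 0\<^sup>2 + 2 * 0 * (1 - rescaled x * rescaled y)) / 2 = - ln \<bar>x - y\<bar>"
  proof -
    have "ln ((rescaled x - rescaled y)\<^sup>2) = 2 * (ln \<bar>x - y\<bar> - ln rad)"
      unfolding e[symmetric] using ln_realpow[of "\<bar>x - y\<bar> / rad" 2] xy rad(1) by (simp add: ln_div)
    then show ?thesis by (simp add: field_simps)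
  qed
  finally show ?thesis .
qed

lemma ell_diag_lim: "filterlim (\<lambda>M. ell M x x) at_top sequentially"
proof -
  have b: "- ln rad - ln (5 * eta M) / 2 \<le> ell M x x" for M
  proof -
    have "0 \<le> rescaled x * rescaled x" by simp
    then have "1 - rescaled x * rescaled x \<le> 2" by linarith
    then have "2 * eta M * (1 - rescaled x * rescaled x) \<le> 2 * eta M * 2"
      using eta_pos[of M] by (intro mult_left_mono) auto
    moreover have "(eta M)\<^sup>2 \<le> eta M" using eta_pos[of M] eta_le[of M] by (simp add: power2_eq_square mult_left_le)
    ultimately have "reg_dist (eta M) (rescaled x) (rescaled x) \<le> 5 * eta M" unfolding reg_dist_def by simp
    then have "ln (reg_dist (eta M) (rescaled x) (rescaled x)) \<le> ln (5 * eta M)" using reg_pos by (intro ln_mono)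
    then show ?thesis unfolding ell_def by simp
  qed
  have e0: "filterlim (\<lambda>M. 5 * eta M) (at_right 0) sequentially"
    unfolding filterlim_at
  proof (intro conjI always_eventually allI)
    show "(\<lambda>M. 5 * eta M) \<longlonglongrightarrow> 0" using tendsto_mult_right[OF eta_lim, of 5] by simp
    show "5 * eta M \<in> {0<..}" "5 * eta M \<noteq> 0" for M using eta_pos[of M] by auto
  qed
  have l: "filterlim (\<lambda>M. ln (5 * eta M)) at_bot sequentially"
    using filterlim_compose[OF ln_at_0 e0] .
  show ?thesis
    unfolding filterlim_at_top
  proof
    fix Z
    have "\<forall>\<^sub>F M in sequentially. ln (5 * eta M) \<le> 2 * (- ln rad - Z)"
      using l[unfolded filterlim_at_bot, rule_format] .
    then show "\<forall>\<^sub>F M in sequentially. Z \<le> ell M x x"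
    proof (rule eventually_mono)
      fix M assume "ln (5 * eta M) \<le> 2 * (- ln rad - Z)"
      then show "Z \<le> ell M x x" using b[of M] by (simp add: field_simps)
    qed
  qed
qed

lemma ell_cont: "continuous_on UNIV (\<lambda>z. ell M (fst z) (snd z))"
proof -
  have c1: "continuous_on UNIV (\<lambda>z::real\<times>real. rescaled (fst z))" "continuous_on UNIV (\<lambda>z::real\<times>real. rescaled (snd z))"
    by (rule continuous_on_compose2[OF rescaled_cont continuous_on_fst[OF continuous_on_id]],
        simp, rule continuous_on_compose2[OF rescaled_cont continuous_on_snd[OF continuous_on_id]], simp)
  show ?thesis unfolding ell_def
  proof (intro continuous_intros)
    show "continuous_on UNIV (\<lambda>z. reg_dist (eta M) (rescaled (fst z)) (rescaled (snd z)))"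
      unfolding reg_dist_def by (intro continuous_intros c1)
  qed (use reg_pos in \<open>auto simp: less_imp_neq[symmetric]\<close>)
qed

lemma ell_sym: "ell M x y = ell M y x"
proof -
  have "reg_dist \<eta> u v = reg_dist \<eta> v u" for \<eta> u v
    unfolding reg_dist_def by (simp add: power2_eq_square algebra_simps)
  then show ?thesis unfolding ell_def by simp
qed


text \<open>A continuous function with value 1 on pairs from one interval and \<open>1/2\<close> on pairs from two different
  ones. The energy counts each pair of different intervals once, while a double integral over the
  sum of the measures counts it twice. The form as a sum of products of functions of one variable
  preserves positive definiteness.\<close>

definition coupling :: "real \<Rightarrow> real \<Rightarrow> real" where "coupling x y = (1 + (\<Sum>i=1..p. chi i x * chi i y)) / 2"

lemma coupling_nonneg: "0 \<le> coupling x y" 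
  and coupling_le: "coupling x y \<le> (1 + real p) / 2"
proof -
  have "0 \<le> (\<Sum>i=1..p. chi i x * chi i y)" using chi_nonneg by (intro sum_nonneg) auto
  then show "0 \<le> coupling x y" by (simp add: coupling_def)
  have "(\<Sum>i=1..p. chi i x * chi i y) \<le> (\<Sum>i=1..p. 1)"
    using chi_nonneg chi_le by (intro sum_mono mult_le_one) auto
  then show "coupling x y \<le> (1 + real p) / 2" by (simp add: coupling_def)
qed

lemma coupling_eq: "i \<in> {1..p} \<Longrightarrow> j \<in> {1..p} \<Longrightarrow> x \<in> \<Gamma> i \<Longrightarrow> y \<in> \<Gamma> j \<Longrightarrow> coupling x y = (if i = j then 1 else 1/2)"
proof -
  assume ij: "i \<in> {1..p}" "j \<in> {1..p}" "x \<in> \<Gamma> i" "y \<in> \<Gamma> j"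
  have "(\<Sum>k=1..p. chi k x * chi k y) = (\<Sum>k=1..p. if k = i then (if i = j then 1 else 0) else 0)"
    using ij by (intro sum.cong) (auto simp: chi_eq)
  then show ?thesis using ij by (simp add: coupling_def)
qed

text \<open>The double integral of this kernel over a probability measure is the regularised weighted energy:
  each of the two terms \<open>Q_ext\<close> contributes one of the two external field integrals.\<close>

definition kern :: "nat \<Rightarrow> real \<Rightarrow> real \<Rightarrow> real" where
  "kern M x y = coupling x y * ell M x y + Q_ext x + Q_ext y"

lemma kern_cont: "continuous_on UNIV (\<lambda>z. kern M (fst z) (snd z))"
proof -
  have c1: "continuous_on UNIV (\<lambda>z::real\<times>real. f (fst z))" "continuous_on UNIV (\<lambda>z::real\<times>real. f (snd z))" 
    if "continuous_on UNIV f" for f :: "real \<Rightarrow> real"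
    by (rule continuous_on_compose2[OF that continuous_on_fst[OF continuous_on_id]],
        simp, rule continuous_on_compose2[OF that continuous_on_snd[OF continuous_on_id]], simp)
  show ?thesis unfolding kern_def coupling_def
    by (intro continuous_intros ell_cont c1[OF chi_cont] c1[OF Q_ext_cont]) auto
qed

definition kern_floor :: real where "kern_floor = (1 + real p) / 2 * (ln rad + 9) + 2 * Q_bound"

lemma kern_floor_nonneg: "0 \<le> kern_floor" using rad(1) Q_bound_nonneg by (auto simp: kern_floor_def)

lemma kern_lower: "- kern_floor \<le> kern M x y"
proof -
  have "coupling x y * ell M x y \<ge> coupling x y * (- ln rad - 9)" by (rule mult_left_mono[OF ell_lower coupling_nonneg])
  moreover have "coupling x y * (ln rad + 9) \<le> (1 + real p) / 2 * (ln rad + 9)" 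
    using rad(1) by (intro mult_right_mono coupling_le) auto
  ultimately show ?thesis unfolding kern_def kern_floor_def using abs_Q_ext_le[of x] abs_Q_ext_le[of y] by (simp add: algebra_simps abs_le_iff)
qed

definition kern_bound :: "nat \<Rightarrow> real" where "kern_bound M = kern_floor + (1 + real p) / 2 * \<bar>ln (eta M)\<bar> + 2 * Q_bound"

lemma abs_kern_le: "\<bar>kern M x y\<bar> \<le> kern_bound M"
proof -
  have "coupling x y * ell M x y \<le> coupling x y * \<bar>ln (eta M)\<bar>" 
    using ell_upper[of M x y] by (intro mult_left_mono coupling_nonneg) auto
  also have "\<dots> \<le> (1 + real p) / 2 * \<bar>ln (eta M)\<bar>" by (intro mult_right_mono coupling_le) auto
  finally have "kern M x y \<le> kern_bound M" unfolding kern_def kern_bound_def 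
    using abs_Q_ext_le[of x] abs_Q_ext_le[of y] kern_floor_nonneg by (simp add: abs_le_iff)
  moreover have "0 \<le> (1 + real p) / 2 * \<bar>ln (eta M)\<bar>" by simp
  then have "kern_floor \<le> kern_bound M" unfolding kern_bound_def using Q_bound_nonneg by linarith
  ultimately show ?thesis using kern_lower[of M x y] by linarith
qed

lemma kern_mono: "M \<le> M' \<Longrightarrow> kern M x y \<le> kern M' x y"
  unfolding kern_def using mult_left_mono[OF ell_mono coupling_nonneg, of M M' x y x y] by simp

lemma kern_sym: "kern M x y = kern M y x"
  by (simp add: kern_def coupling_def ell_sym[of M x y] mult.commute)

lemma kern_borel [measurable]: "(\<lambda>(x,y). kern M x y) \<in> borel_measurable (borel \<Otimes>\<^sub>M borel)"
  using borel_measurable_continuous_onI[OF kern_cont] by (simp add: borel_prod case_prod_beta)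

lemma kern_borel1 [measurable]: "kern M x \<in> borel_measurable borel"
  using measurable_Pair2[OF kern_borel, of x M] by simp

end

lemma integral_scale_measure:
  fixes f :: "'a \<Rightarrow> real"
  assumes "0 \<le> c" "f \<in> borel_measurable M"
  shows "(\<integral>x. f x \<partial>scale_measure (ennreal c) M) = c * (\<integral>x. f x \<partial>M)"
    and "integrable M f \<Longrightarrow> integrable (scale_measure (ennreal c) M) f"
proof -
  have e: "scale_measure (ennreal c) M = density M (\<lambda>_. ennreal c)"
    by (rule measure_eqI) (auto simp: emeasure_density_const)
  show "(\<integral>x. f x \<partial>scale_measure (ennreal c) M) = c * (\<integral>x. f x \<partial>M)"
    unfolding e by (subst integral_real_density) (use assms in auto)
  show "integrable (scale_measure (ennreal c) M) f" if "integrable M f"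
    unfolding e by (subst integrable_real_density) (use assms that in auto)
qed

section \<open>Iterated integrals of bounded kernels\<close>

definition bdd_kernel :: "(real \<Rightarrow> real \<Rightarrow> real) \<Rightarrow> bool" where
  "bdd_kernel f \<longleftrightarrow> (\<lambda>(x,y). f x y) \<in> borel_measurable (borel \<Otimes>\<^sub>M borel) \<and> (\<exists>B. \<forall>x y. \<bar>f x y\<bar> \<le> B)"

definition dbl :: "real measure \<Rightarrow> real measure \<Rightarrow> (real \<Rightarrow> real \<Rightarrow> real) \<Rightarrow> real" where
  "dbl M N f = (\<integral>x. (\<integral>y. f x y \<partial>N) \<partial>M)"

locale two_finite_borel =
  fixes M N :: "real measure"
  assumes M: "finite_measure M" "sets M = sets borel" and N: "finite_measure N" "sets N = sets borel"
begin

lemma kernel_integrable: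
  assumes "bdd_kernel f"
  shows "integrable (M \<Otimes>\<^sub>M N) (\<lambda>(x,y). f x y)" 
proof -
  interpret M: finite_measure M by (rule M)
  interpret N: finite_measure N by (rule N)
  interpret P: finite_measure "M \<Otimes>\<^sub>M N" by (rule finite_measure_pair_measure) unfold_locales
  note [measurable_cong] = M(2) N(2)
  obtain B where B: "\<And>x y. \<bar>f x y\<bar> \<le> B" using assms unfolding bdd_kernel_def by blast
  show ?thesis
    by (rule P.integrable_const_bound[where B = B]) (use assms B in \<open>auto simp: bdd_kernel_def\<close>)
qed

lemma kernel_inner:
  assumes "bdd_kernel f"
  shows "integrable N (f x)" "integrable M (\<lambda>x. \<integral>y. f x y \<partial>N)"
proof -
  interpret M: finite_measure M by (rule M)
  interpret N: finite_measure N by (rule N)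
  interpret P: pair_sigma_finite M N by standard
  note [measurable_cong] = M(2) N(2)
  obtain B where B: "\<And>x y. \<bar>f x y\<bar> \<le> B" using assms unfolding bdd_kernel_def by blast
  have "(\<lambda>y. f x y) \<in> borel_measurable borel"
    using assms measurable_Pair2[of "\<lambda>(x,y). f x y"] unfolding bdd_kernel_def by fastforce
  then have [measurable]: "f x \<in> borel_measurable borel" by simp
  show "integrable N (f x)"
    by (rule N.integrable_const_bound[where B = B]) (use B in auto)
  show "integrable M (\<lambda>x. \<integral>y. f x y \<partial>N)"
    using P.integrable_fst'[OF kernel_integrable[OF assms]] by simp
qed

lemma dbl_eq_pair:
  assumes "bdd_kernel f"
  shows "dbl M N f = (\<integral>z. f (fst z) (snd z) \<partial>(M \<Otimes>\<^sub>M N))"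
proof -
  interpret M: finite_measure M by (rule M)
  interpret N: finite_measure N by (rule N)
  interpret P: pair_sigma_finite M N by standard
  show ?thesis unfolding dbl_def using P.integral_fst'[OF kernel_integrable[OF assms]]
    by (simp add: case_prod_beta')
qed

lemma dbl_add: "bdd_kernel f \<Longrightarrow> bdd_kernel g \<Longrightarrow> dbl M N (\<lambda>x y. f x y + g x y) = dbl M N f + dbl M N g"
  unfolding dbl_def by (simp add: kernel_inner)

lemma dbl_cmult: "dbl M N (\<lambda>x y. c * f x y) = c * dbl M N f"
  unfolding dbl_def by simp

lemma dbl_sum: "(\<And>i. i \<in> I \<Longrightarrow> bdd_kernel (f i)) \<Longrightarrow> dbl M N (\<lambda>x y. \<Sum>i\<in>I. f i x y) = (\<Sum>i\<in>I. dbl M N (f i))"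
  unfolding dbl_def by (simp add: kernel_inner)

lemma dbl_mono: "bdd_kernel f \<Longrightarrow> bdd_kernel g \<Longrightarrow> (\<And>x y. f x y \<le> g x y) \<Longrightarrow> dbl M N f \<le> dbl M N g"
  unfolding dbl_def by (intro integral_mono kernel_inner)

lemma dbl_mono_AE:
  assumes "bdd_kernel f" "bdd_kernel g" "AE x in M. x \<in> A" "AE x in N. x \<in> B"
    and "\<And>x y. x \<in> A \<Longrightarrow> y \<in> B \<Longrightarrow> f x y \<le> g x y" 
  shows "dbl M N f \<le> dbl M N g"
  unfolding dbl_def
proof (intro integral_mono_AE kernel_inner assms(1,2))
  show "AE x in M. (\<integral>y. f x y \<partial>N) \<le> (\<integral>y. g x y \<partial>N)"
    using assms(3)
  proof (rule eventually_mono)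
    fix x assume "x \<in> A"
    then show "(\<integral>y. f x y \<partial>N) \<le> (\<integral>y. g x y \<partial>N)"
      using assms by (intro integral_mono_AE kernel_inner) (auto elim!: eventually_mono)
  qed
qed

lemma dbl_cong_AE:
  assumes "bdd_kernel f" "bdd_kernel g" "AE x in M. x \<in> A" "AE x in N. x \<in> B"
    and "\<And>x y. x \<in> A \<Longrightarrow> y \<in> B \<Longrightarrow> f x y = g x y" 
  shows "dbl M N f = dbl M N g"
  by (intro antisym dbl_mono_AE[OF assms(1,2,3,4)] dbl_mono_AE[OF assms(2,1,3,4)]) (use assms(5) in auto)

lemma dbl_const: "dbl M N (\<lambda>x y. c) = measure M (space M) * measure N (space N) * c"
  unfolding dbl_def by simp

end

lemma bdd_kernel_const [simp]: "bdd_kernel (\<lambda>x y. c)"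
  unfolding bdd_kernel_def by auto

lemma bdd_kernel_add [intro]:
  assumes "bdd_kernel f" "bdd_kernel g" shows "bdd_kernel (\<lambda>x y. f x y + g x y)"
proof -
  obtain A B where "\<And>x y. \<bar>f x y\<bar> \<le> A" "\<And>x y. \<bar>g x y\<bar> \<le> B"
    using assms unfolding bdd_kernel_def by blast
  then have "\<bar>f x y + g x y\<bar> \<le> A + B" for x y
    by (meson abs_triangle_ineq add_mono order_trans)
  then show ?thesis using assms unfolding bdd_kernel_def by (auto simp: case_prod_beta)
qed

lemma bdd_kernel_mult [intro]:
  assumes "bdd_kernel f" "bdd_kernel g" shows "bdd_kernel (\<lambda>x y. f x y * g x y)"
proof -
  obtain A B where AB: "\<And>x y. \<bar>f x y\<bar> \<le> A" "\<And>x y. \<bar>g x y\<bar> \<le> B"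
    using assms unfolding bdd_kernel_def by blast
  have "\<bar>f x y * g x y\<bar> \<le> A * B" for x y
    unfolding abs_mult using AB[of x y] by (intro mult_mono) auto
  then show ?thesis using assms unfolding bdd_kernel_def by (auto simp: case_prod_beta)
qed

lemma bdd_kernel_sum [intro]:
  assumes "\<And>i. i \<in> I \<Longrightarrow> bdd_kernel (f i)" shows "bdd_kernel (\<lambda>x y. \<Sum>i\<in>I. f i x y)"
  using assms by (induction I rule: infinite_finite_induct) auto

lemma bdd_kernel_left: "g \<in> borel_measurable borel \<Longrightarrow> (\<And>x. \<bar>g x\<bar> \<le> B) \<Longrightarrow> bdd_kernel (\<lambda>x y. g x)"
  and bdd_kernel_right: "g \<in> borel_measurable borel \<Longrightarrow> (\<And>x. \<bar>g x\<bar> \<le> B) \<Longrightarrow> bdd_kernel (\<lambda>x y. g y)"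
  unfolding bdd_kernel_def by (auto simp: case_prod_beta)

context angelesco_intervals
begin

lemma kern_bdd [simp]: "bdd_kernel (kern M)"
  unfolding bdd_kernel_def using abs_kern_le by auto

lemma ell_bdd [simp]: "bdd_kernel (ell M)"
proof -
  have "(\<lambda>(x,y). ell M x y) \<in> borel_measurable (borel \<Otimes>\<^sub>M borel)"
    using borel_measurable_continuous_onI[OF ell_cont] by (simp add: borel_prod case_prod_beta)
  moreover have "\<bar>ell M x y\<bar> \<le> \<bar>ln (eta M)\<bar> + \<bar>ln rad + 9\<bar>" for x y
    using ell_lower[of M x y] ell_upper[of M x y] by linarith
  ultimately show ?thesis unfolding bdd_kernel_def by blast
qed

lemma ell_borel1 [measurable]: "ell M x \<in> borel_measurable borel"
  using ell_bdd[of M] measurable_Pair2[of "\<lambda>(x,y). ell M x y"] unfolding bdd_kernel_def by fastforce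

lemma chi_abs: "\<bar>chi i x\<bar> \<le> 1" using chi_nonneg chi_le by auto

lemma chi_bdd [simp]: "bdd_kernel (\<lambda>x y. chi i x)" "bdd_kernel (\<lambda>x y. chi i y)"
  using bdd_kernel_left[OF chi_borel chi_abs] bdd_kernel_right[OF chi_borel chi_abs] by auto

lemma Q_ext_bdd [simp]: "bdd_kernel (\<lambda>x y. Q_ext x)" "bdd_kernel (\<lambda>x y. Q_ext y)"
  using bdd_kernel_left[OF Q_ext_borel abs_Q_ext_le] bdd_kernel_right[OF Q_ext_borel abs_Q_ext_le] by auto

section \<open>Compactness, semicontinuity and uniqueness of the minimizer\<close>

text \<open>The regularised energy. The second measure argument is needed for the mixed terms in the midpoint
  argument.\<close>

definition Phi :: "nat \<Rightarrow> real measure \<Rightarrow> real measure \<Rightarrow> real" where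
  "Phi M \<mu> \<nu> = dbl \<mu> \<nu> (kern M)"

text \<open>The measures \<open>sum_measure {1..p} \<nu>\<close> with \<open>\<nu> \<in> measure_tuples p \<Gamma> r\<close>, described without reference to
  their components. The masses on the disjoint intervals add up to 1, so nothing is left outside.\<close>

definition admissible :: "real measure \<Rightarrow> bool" where
  "admissible N \<longleftrightarrow> real_distribution N \<and> (\<forall>i\<in>{1..p}. measure N (\<Gamma> i) = r i)"

lemma real_distribution_two:
  "real_distribution \<mu> \<Longrightarrow> real_distribution \<nu> \<Longrightarrow> two_finite_borel \<mu> \<nu>"
  unfolding two_finite_borel_def real_distribution_def real_distribution_axioms_def
  by (auto simp: prob_space_def)

lemma admissible_AE_G: assumes "admissible N" shows "AE x in N. x \<in> G"
proof -
  interpret N: real_distribution N using assms by (simp add: admissible_def)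
  have "measure N G = (\<Sum>i=1..p. measure N (\<Gamma> i))"
    unfolding G_def
  proof (rule N.finite_measure_finite_Union)
    show "disjoint_family_on \<Gamma> {1..p}"
      unfolding disjoint_family_on_def using Gamma_disjoint by blast
  qed (use Gamma_borel in auto)
  also have "\<dots> = 1" using assms r_sum by (simp add: admissible_def)
  finally have "measure N G = 1" .
  then show ?thesis by (subst (asm) N.prob_eq_1) auto
qed

lemma Phi_weak:
  assumes "\<And>n. real_distribution (\<mu> n)" "real_distribution \<nu>" "weak_conv_m \<mu> \<nu>"
  shows "(\<lambda>n. Phi M (\<mu> n) (\<mu> n)) \<longlonglongrightarrow> Phi M \<nu> \<nu>"
  unfolding Phi_def dbl_def by (rule weak_conv_double_integral[OF kern_cont abs_kern_le assms])

lemma Phi_mono: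
  assumes "real_distribution N" "M \<le> M'" shows "Phi M N N \<le> Phi M' N N"
proof -
  interpret two_finite_borel N N by (rule real_distribution_two[OF assms(1) assms(1)])
  show ?thesis unfolding Phi_def by (rule dbl_mono) (auto intro: kern_mono[OF assms(2)])
qed

lemma Phi_lower:
  assumes "real_distribution N" shows "- kern_floor \<le> Phi M N N"
proof -
  interpret N: real_distribution N by fact
  interpret two_finite_borel N N by (rule real_distribution_two[OF assms(1) assms(1)])
  have "dbl N N (\<lambda>x y. - kern_floor) \<le> Phi M N N" unfolding Phi_def by (rule dbl_mono) (auto intro: kern_lower)
  then show ?thesis by (simp add: dbl_const N.prob_space[simplified])
qed

text \<open>The supremum over the regularisations is a monotone limit; it equals the weighted energy by
  \<open>weighted_energy_eq_energy\<close>.\<close>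

definition energy :: "real measure \<Rightarrow> ereal" where "energy N = (SUP M. ereal (Phi M N N))"

lemma energy_lim:
  assumes "real_distribution N" shows "(\<lambda>M. ereal (Phi M N N)) \<longlonglongrightarrow> energy N"
  unfolding energy_def by (rule LIMSEQ_SUP) (auto simp: incseq_def Phi_mono[OF assms])

lemma Phi_le_energy: "ereal (Phi M N N) \<le> energy N"
  unfolding energy_def by (rule SUP_upper) simp

lemma energy_lower:
  assumes "real_distribution N" shows "ereal (- kern_floor) \<le> energy N"
  using Phi_lower[OF assms, of 0] Phi_le_energy[of 0 N] by (meson ereal_less_eq(3) order_trans)

text \<open>A supremum of weakly continuous functionals is lower semicontinuous. The bound is required only for
  each \<open>M\<close> separately, and only in the limit, because for counting measures it holds up to an error
  that depends on \<open>M\<close>.\<close>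

lemma weak_lsc:
  assumes "\<And>n. real_distribution (\<mu> n)" "real_distribution \<nu>" "weak_conv_m \<mu> \<nu>"
    and "\<And>M. \<exists>w. w \<longlonglongrightarrow> e \<and> (\<forall>\<^sub>F k in sequentially. Phi M (\<mu> k) (\<mu> k) \<le> w k)"
  shows "energy \<nu> \<le> ereal e"
  unfolding energy_def
proof (rule SUP_least)
  fix M
  obtain w where "w \<longlonglongrightarrow> e" "\<forall>\<^sub>F k in sequentially. Phi M (\<mu> k) (\<mu> k) \<le> w k" using assms(4) by blast
  then have "Phi M \<nu> \<nu> \<le> e"
    using Phi_weak[OF assms(1-3), of M] tendsto_le[of sequentially w e] by simp
  then show "ereal (Phi M \<nu> \<nu>) \<le> ereal e" by simp
qed

lemma integral_chi:
  assumes "real_distribution N" "AE x in N. x \<in> G" "i \<in> {1..p}"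
  shows "(\<integral>x. chi i x \<partial>N) = measure N (\<Gamma> i)"
proof -
  interpret N: real_distribution N by fact
  have "(\<integral>x. chi i x \<partial>N) = (\<integral>x. indicator (\<Gamma> i) x \<partial>N)"
  proof (rule integral_cong_AE)
    show "AE x in N. chi i x = indicator (\<Gamma> i) x"
      using assms(2)
    proof (rule eventually_mono)
      fix x assume "x \<in> G"
      then obtain j where j: "j \<in> {1..p}" "x \<in> \<Gamma> j" unfolding G_def by blast
      show "chi i x = indicator (\<Gamma> i) x"
      proof (cases "i = j")
        case True then show ?thesis using chi_eq[OF j, of i] j by simp
      next
        case False
        then have "x \<notin> \<Gamma> i" using Gamma_disjoint[OF j(1) assms(3) j(2)] by blast
        then show ?thesis using chi_eq[OF j, of i] False by simp
      qed
    qed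
  qed (use assms(3) in auto)
  also have "\<dots> = measure N (\<Gamma> i)" using assms(3) by simp
  finally show ?thesis .
qed

text \<open>All measures live on the compact set \<open>G\<close>, so Helly's theorem gives a weakly convergent subsequence.
  The limit lives on \<open>G\<close> because the distance to \<open>G\<close> integrates to zero, and its masses on the intervals
  are limits because they are the integrals of the continuous functions \<open>chi i\<close>.\<close>

lemma weak_compact:
  assumes \<mu>: "\<And>n. real_distribution (\<mu> n)" and G: "\<And>n. AE x in \<mu> n. x \<in> G"
    and lim: "\<And>i. i \<in> {1..p} \<Longrightarrow> (\<lambda>n. measure (\<mu> n) (\<Gamma> i)) \<longlonglongrightarrow> r i"
  shows "\<exists>s \<nu>. strict_mono (s::nat\<Rightarrow>nat) \<and> admissible \<nu> \<and> weak_conv_m (\<mu> \<circ> s) \<nu>"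
proof -
  interpret \<mu>: real_distribution "\<mu> n" for n by (rule \<mu>)
  have "tight \<mu>"
    unfolding tight_def
  proof (intro conjI allI impI \<mu>)
    fix \<epsilon> :: real assume "\<epsilon> > 0"
    have "measure (\<mu> n) {-rad - 1<..rad} = 1" for n
    proof -
      have "AE x in \<mu> n. x \<in> {-rad - 1<..rad}"
        using G[of n] by (rule eventually_mono) (use rad(2) in \<open>force simp: abs_le_iff\<close>)
      then show ?thesis by (subst \<mu>.prob_eq_1) auto
    qed
    then show "\<exists>a b. a < b \<and> (\<forall>n. 1 - \<epsilon> < measure (\<mu> n) {a<..b})"
      using rad(1) \<open>\<epsilon> > 0\<close> by (intro exI[of _ "-rad - 1"] exI[of _ rad]) auto
  qed
  from tight_imp_convergent_subsubsequence[OF this strict_mono_id]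
  obtain s \<nu> where s: "strict_mono (s::nat\<Rightarrow>nat)" and \<nu>: "real_distribution \<nu>" and wc: "weak_conv_m (\<mu> \<circ> s) \<nu>"
    by auto
  interpret \<nu>: real_distribution \<nu> by fact
  have conv: "(\<lambda>n. \<integral>x. f x \<partial>\<mu> (s n)) \<longlonglongrightarrow> (\<integral>x. f x \<partial>\<nu>)"
    if "continuous_on UNIV f" "\<And>x. \<bar>f x\<bar> \<le> B" for f :: "real \<Rightarrow> real" and B
    using weak_conv_imp_integral_bdd_continuous_conv[of "\<mu> \<circ> s" \<nu> f B] \<mu> \<nu> wc that
    by (simp add: continuous_on_eq_continuous_at)
  \<comment> \<open>vanishes exactly on the closed set \<open>G\<close>\<close>
  define f where "f x = min 1 (infdist x G)" for x
  have fc: "continuous_on UNIV f" unfolding f_def by (intro continuous_intros)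
  then have [measurable]: "f \<in> borel_measurable borel" by (rule borel_measurable_continuous_onI)
  have fb: "\<bar>f x\<bar> \<le> 1" "0 \<le> f x" for x by (auto simp: f_def infdist_nonneg)
  have "(\<integral>x. f x \<partial>\<mu> n) = 0" for n
    by (rule integral_eq_zero_AE) (use G[of n] in \<open>auto elim!: eventually_mono simp: f_def\<close>)
  then have f0: "(\<integral>x. f x \<partial>\<nu>) = 0"
    using conv[OF fc fb(1)] by (simp add: LIMSEQ_const_iff)
  have "integrable \<nu> f" by (rule \<nu>.integrable_const_bound[where B = 1]) (use fb in auto)
  then have "AE x in \<nu>. f x = 0"
    using f0 fb(2) by (subst (asm) integral_nonneg_eq_0_iff_AE) auto
  then have \<nu>G: "AE x in \<nu>. x \<in> G"
  proof (rule eventually_mono)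
    fix x assume "f x = 0"
    then have "infdist x G = 0" by (auto simp: f_def min_def split: if_splits)
    moreover have "G \<noteq> {}" using p_ge intervals[of 1] unfolding G_def by fastforce
    ultimately show "x \<in> G" using in_closed_iff_infdist_zero[of G x] G_compact compact_imp_closed by blast
  qed
  have "measure \<nu> (\<Gamma> i) = r i" if i: "i \<in> {1..p}" for i
  proof -
    have "(\<lambda>n. measure (\<mu> (s n)) (\<Gamma> i)) \<longlonglongrightarrow> measure \<nu> (\<Gamma> i)"
      using conv[OF chi_cont chi_abs, of i] 
      unfolding integral_chi[OF \<mu> G i] integral_chi[OF \<nu> \<nu>G i] .
    moreover have "(\<lambda>n. measure (\<mu> (s n)) (\<Gamma> i)) \<longlonglongrightarrow> r i"
      using LIMSEQ_subseq_LIMSEQ[OF lim[OF i] s] by (simp add: o_def)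
    ultimately show ?thesis by (rule LIMSEQ_unique)
  qed
  then show ?thesis using s \<nu> wc unfolding admissible_def by blast
qed

text \<open>Splitting the coupling into the constant part and the parts \<open>chi i x * chi i y\<close> exhibits the
  regularised energy as half the sum of the energies of the whole measure and of its restrictions to
  the intervals, apart from constants and linear terms.\<close>

lemma Phi_decomp:
  assumes "real_distribution \<mu>" "real_distribution \<nu>"
  shows "Phi M \<mu> \<nu> = (reg_energy (sp M) (\<lambda>_. 1) ang \<mu> \<nu> - ln rad
            + (\<Sum>i=1..p. reg_energy (sp M) (chi i) ang \<mu> \<nu> - ln rad * (\<integral>x. chi i x \<partial>\<mu>) * (\<integral>x. chi i x \<partial>\<nu>))) / 2
          + (\<integral>x. Q_ext x \<partial>\<mu>) + (\<integral>x. Q_ext x \<partial>\<nu>)"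
proof -
  interpret \<mu>: real_distribution \<mu> by fact
  interpret \<nu>: real_distribution \<nu> by fact
  interpret two_finite_borel \<mu> \<nu> by (rule real_distribution_two[OF assms])
  define g where "g x y = ell M x y + ln rad" for x y
  have gb: "bdd_kernel g" unfolding g_def by (intro bdd_kernel_add) auto
  define h where "h i x y = chi i x * chi i y * g x y + - ln rad * (chi i x * chi i y)" for i x y
  have cc: "bdd_kernel (\<lambda>x y. chi i x * chi i y)" for i by (intro bdd_kernel_mult) auto
  have cg: "bdd_kernel (\<lambda>x y. chi i x * chi i y * g x y)" for i by (intro bdd_kernel_mult cc gb)
  have cl: "bdd_kernel (\<lambda>x y. - ln rad * (chi i x * chi i y))" for i by (intro bdd_kernel_mult cc) simp
  have hb: "bdd_kernel (h i)" for i unfolding h_def by (intro bdd_kernel_add cg cl)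
  have gl: "bdd_kernel (\<lambda>x y. g x y + - ln rad)" by (intro bdd_kernel_add gb) simp
  have hs: "bdd_kernel (\<lambda>x y. \<Sum>i=1..p. h i x y)" by (intro bdd_kernel_sum hb)
  have gh: "bdd_kernel (\<lambda>x y. (g x y + - ln rad) + (\<Sum>i=1..p. h i x y))" by (intro bdd_kernel_add gl hs)
  have mean_Q: "bdd_kernel (\<lambda>x y. Q_ext x + Q_ext y)" by (intro bdd_kernel_add) auto
  have Kg: "kern M = (\<lambda>x y. (1/2) * ((g x y + - ln rad) + (\<Sum>i=1..p. h i x y)) + (Q_ext x + Q_ext y))"
    unfolding kern_def coupling_def g_def h_def
    by (intro ext) (simp add: algebra_simps sum.distrib sum_distrib_left add_divide_distrib diff_divide_distrib sum_subtractf)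
  have re: "dbl \<mu> \<nu> (\<lambda>x y. u x * u y * g x y) = reg_energy (sp M) u ang \<mu> \<nu>" for u
    unfolding dbl_def reg_energy_def g_def ell_def eta_def cos_ang by simp
  have re1: "dbl \<mu> \<nu> g = reg_energy (sp M) (\<lambda>_. 1) ang \<mu> \<nu>"
    using re[of "\<lambda>_. 1"] by simp
  have "Phi M \<mu> \<nu> = dbl \<mu> \<nu> (\<lambda>x y. (1/2) * ((g x y + - ln rad) + (\<Sum>i=1..p. h i x y))) + dbl \<mu> \<nu> (\<lambda>x y. Q_ext x + Q_ext y)"
    unfolding Phi_def Kg by (rule dbl_add[OF bdd_kernel_mult[OF bdd_kernel_const gh] mean_Q])
  also have "\<dots> = (1/2) * dbl \<mu> \<nu> (\<lambda>x y. (g x y + - ln rad) + (\<Sum>i=1..p. h i x y)) + dbl \<mu> \<nu> (\<lambda>x y. Q_ext x + Q_ext y)"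
    unfolding dbl_cmult ..
  also have "\<dots> = (1/2) * (dbl \<mu> \<nu> (\<lambda>x y. g x y + - ln rad) + dbl \<mu> \<nu> (\<lambda>x y. \<Sum>i=1..p. h i x y)) + dbl \<mu> \<nu> (\<lambda>x y. Q_ext x + Q_ext y)"
    unfolding dbl_add[OF gl hs] ..
  also have "\<dots> = (1/2) * (dbl \<mu> \<nu> g + dbl \<mu> \<nu> (\<lambda>x y. - ln rad) + (\<Sum>i=1..p. dbl \<mu> \<nu> (h i))) + (dbl \<mu> \<nu> (\<lambda>x y. Q_ext x) + dbl \<mu> \<nu> (\<lambda>x y. Q_ext y))"
    unfolding dbl_add[OF gb bdd_kernel_const] dbl_sum[OF hb] dbl_add[OF Q_ext_bdd] ..
  finally have "Phi M \<mu> \<nu> = (1/2) * (dbl \<mu> \<nu> g + dbl \<mu> \<nu> (\<lambda>x y. - ln rad) + (\<Sum>i=1..p. dbl \<mu> \<nu> (h i))) + (dbl \<mu> \<nu> (\<lambda>x y. Q_ext x) + dbl \<mu> \<nu> (\<lambda>x y. Q_ext y))" .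
  moreover have "dbl \<mu> \<nu> (h i) = reg_energy (sp M) (chi i) ang \<mu> \<nu> - ln rad * (\<integral>x. chi i x \<partial>\<mu>) * (\<integral>x. chi i x \<partial>\<nu>)" for i
  proof -
    have "dbl \<mu> \<nu> (h i) = dbl \<mu> \<nu> (\<lambda>x y. chi i x * chi i y * g x y) + dbl \<mu> \<nu> (\<lambda>x y. - ln rad * (chi i x * chi i y))"
      unfolding h_def by (rule dbl_add[OF cg cl])
    moreover have "dbl \<mu> \<nu> (\<lambda>x y. chi i x * chi i y) = (\<integral>x. chi i x \<partial>\<mu>) * (\<integral>x. chi i x \<partial>\<nu>)"
      unfolding dbl_def by simp
    ultimately show ?thesis unfolding dbl_cmult re by simp
  qed
  moreover have "dbl \<mu> \<nu> (\<lambda>x y. Q_ext x) = (\<integral>x. Q_ext x \<partial>\<mu>)" "dbl \<mu> \<nu> (\<lambda>x y. Q_ext y) = (\<integral>x. Q_ext x \<partial>\<nu>)"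
    unfolding dbl_def by (simp_all add: \<mu>.prob_space[simplified] \<nu>.prob_space[simplified])
  moreover have "dbl \<mu> \<nu> (\<lambda>x y. - ln rad) = - ln rad"
    by (simp add: dbl_const \<mu>.prob_space[simplified] \<nu>.prob_space[simplified])
  ultimately show ?thesis unfolding re1 by simp
qed

text \<open>The linear terms and the constants cancel, the latter because admissible measures have equal masses
  on each interval. The part for the whole measure bounds each cosine moment; the parts for the
  single intervals are nonnegative and dropped.\<close>

lemma Phi_pos_def:
  assumes "admissible \<mu>" "admissible \<nu>" "n > 0"
  shows "Phi M \<mu> \<mu> + Phi M \<nu> \<nu> - Phi M \<mu> \<nu> - Phi M \<nu> \<mu>
     \<ge> 1 / real n * sp M ^ n * ((\<integral>x. cos (real n * ang x) \<partial>\<mu>) - (\<integral>x. cos (real n * ang x) \<partial>\<nu>))\<^sup>2"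
proof -
  have rd: "real_distribution \<mu>" "real_distribution \<nu>" using assms by (auto simp: admissible_def)
  interpret two_finite_borel \<mu> \<nu> by (rule real_distribution_two[OF rd])
  interpret \<mu>: real_distribution \<mu> by fact
  interpret \<nu>: real_distribution \<nu> by fact
  have chis: "(\<integral>x. chi i x \<partial>\<mu>) = (\<integral>x. chi i x \<partial>\<nu>)" if "i \<in> {1..p}" for i
    using integral_chi[OF rd(1) admissible_AE_G[OF assms(1)] that] integral_chi[OF rd(2) admissible_AE_G[OF assms(2)] that] that assms
    by (simp add: admissible_def)
  define D where "D u = reg_energy (sp M) u ang \<mu> \<mu> + reg_energy (sp M) u ang \<nu> \<nu>
      - reg_energy (sp M) u ang \<mu> \<nu> - reg_energy (sp M) u ang \<nu> \<mu>" for u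
  have D: "D u \<ge> 2 / real m * sp M ^ m * (cos_coeff \<mu> u ang m - cos_coeff \<nu> u ang m)\<^sup>2"
    if "u \<in> borel_measurable borel" "\<And>x. \<bar>u x\<bar> \<le> 1" "(\<integral>x. u x \<partial>\<mu>) = (\<integral>x. u x \<partial>\<nu>)" for u m
    unfolding D_def by (rule reg_energy_pos_def[OF sp M N that(1,2) ang_borel that(3)])
  have 1: "D (\<lambda>_. 1) \<ge> 2 / real n * sp M ^ n * (cos_coeff \<mu> (\<lambda>_. 1) ang n - cos_coeff \<nu> (\<lambda>_. 1) ang n)\<^sup>2"
    by (rule D) (auto simp: \<mu>.prob_space[simplified] \<nu>.prob_space[simplified])
  have 2: "D (chi i) \<ge> 0" if "i \<in> {1..p}" for i
    using D[of "chi i" 0, OF chi_borel chi_abs chis[OF that]] by simp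
  have "Phi M \<mu> \<mu> + Phi M \<nu> \<nu> - Phi M \<mu> \<nu> - Phi M \<nu> \<mu> = (D (\<lambda>_. 1) + (\<Sum>i=1..p. D (chi i))) / 2"
  proof -
    have s: "(\<Sum>i=1..p. reg_energy (sp M) (chi i) ang \<alpha> \<beta> - ln rad * (\<integral>x. chi i x \<partial>\<alpha>) * (\<integral>x. chi i x \<partial>\<beta>))
       = (\<Sum>i=1..p. reg_energy (sp M) (chi i) ang \<alpha> \<beta>) - (\<Sum>i=1..p. ln rad * (\<integral>x. chi i x \<partial>\<mu>) * (\<integral>x. chi i x \<partial>\<mu>))"
      if "\<alpha> \<in> {\<mu>, \<nu>}" "\<beta> \<in> {\<mu>, \<nu>}" for \<alpha> \<beta>
      unfolding sum_subtractf[symmetric] using that chis by (intro sum.cong) auto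
    have "(\<Sum>i=1..p. D (chi i)) = (\<Sum>i=1..p. reg_energy (sp M) (chi i) ang \<mu> \<mu>) + (\<Sum>i=1..p. reg_energy (sp M) (chi i) ang \<nu> \<nu>)
        - (\<Sum>i=1..p. reg_energy (sp M) (chi i) ang \<mu> \<nu>) - (\<Sum>i=1..p. reg_energy (sp M) (chi i) ang \<nu> \<mu>)"
      unfolding D_def by (simp add: sum.distrib sum_subtractf)
    then show ?thesis
      unfolding Phi_decomp[OF rd(1) rd(1)] Phi_decomp[OF rd(2) rd(2)] Phi_decomp[OF rd(1) rd(2)] Phi_decomp[OF rd(2) rd(1)]
      by (subst (1 2 3 4) s) (auto simp: D_def field_simps)
  qed
  also have "\<dots> \<ge> D (\<lambda>_. 1) / 2" using sum_nonneg[of "{1..p}" "\<lambda>i. D (chi i)"] 2 by simp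
  finally have "D (\<lambda>_. 1) / 2 \<le> Phi M \<mu> \<mu> + Phi M \<nu> \<nu> - Phi M \<mu> \<nu> - Phi M \<nu> \<mu>" .
  then show ?thesis using 1 by (simp add: cos_coeff_def)
qed

definition midpoint_measure :: "real measure \<Rightarrow> real measure \<Rightarrow> real measure" where
  "midpoint_measure \<mu> \<nu> = sum_measure UNIV (\<lambda>c. scale_measure (ennreal (1/2)) (if c then \<mu> else \<nu>))"

lemma midpoint_measure_facts:
  assumes "real_distribution \<mu>" "real_distribution \<nu>"
  shows "real_distribution (midpoint_measure \<mu> \<nu>)" 
    and "A \<in> sets borel \<Longrightarrow> measure (midpoint_measure \<mu> \<nu>) A = (measure \<mu> A + measure \<nu> A) / 2"
    and "\<And>f::real\<Rightarrow>real. f \<in> borel_measurable borel \<Longrightarrow> integrable \<mu> f \<Longrightarrow> integrable \<nu> f \<Longrightarrow> 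
       (\<integral>x. f x \<partial>midpoint_measure \<mu> \<nu>) = ((\<integral>x. f x \<partial>\<mu>) + (\<integral>x. f x \<partial>\<nu>)) / 2"
proof -
  interpret \<mu>: real_distribution \<mu> by fact
  interpret \<nu>: real_distribution \<nu> by fact
  have e: "emeasure (midpoint_measure \<mu> \<nu>) A = ennreal ((measure \<mu> A + measure \<nu> A) / 2)" if "A \<in> sets borel" for A
  proof -
    have "emeasure (midpoint_measure \<mu> \<nu>) A = ennreal (1/2) * ennreal (measure \<mu> A) + ennreal (1/2) * ennreal (measure \<nu> A)"
    proof -
      have "emeasure (midpoint_measure \<mu> \<nu>) A = (\<Sum>c\<in>UNIV. emeasure (scale_measure (ennreal (1/2)) (if c then \<mu> else \<nu>)) A)"
        unfolding midpoint_measure_def by (rule emeasure_sum_measure) (use that in auto)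
      then show ?thesis unfolding UNIV_bool \<mu>.emeasure_eq_measure[symmetric] \<nu>.emeasure_eq_measure[symmetric]
        by (simp add: add.commute)
    qed
    also have "\<dots> = ennreal (1/2 * measure \<mu> A + 1/2 * measure \<nu> A)"
    proof -
      have *: "ennreal (1/2) * ennreal c = ennreal (1/2 * c)" if "0 \<le> c" for c :: real
        by (rule ennreal_mult[symmetric]) (use that in auto)
      show ?thesis unfolding *[OF measure_nonneg] by (rule ennreal_plus[symmetric]) auto
    qed
    finally show ?thesis by (simp add: field_simps)
  qed
  have s: "sets (midpoint_measure \<mu> \<nu>) = sets borel"
    unfolding midpoint_measure_def by (rule sets_sum_measure) auto
  then have sp: "space (midpoint_measure \<mu> \<nu>) = UNIV" using sets_eq_imp_space_eq[OF s] by simp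
  show "measure (midpoint_measure \<mu> \<nu>) A = (measure \<mu> A + measure \<nu> A) / 2" if "A \<in> sets borel"
    using e[OF that] by (simp add: measure_def)
  have "prob_space (midpoint_measure \<mu> \<nu>)"
    by (rule prob_spaceI) (simp add: sp e \<mu>.prob_space[simplified] \<nu>.prob_space[simplified])
  then show "real_distribution (midpoint_measure \<mu> \<nu>)"
    using s by (simp add: real_distribution_def real_distribution_axioms_def)
  show "(\<integral>x. f x \<partial>midpoint_measure \<mu> \<nu>) = ((\<integral>x. f x \<partial>\<mu>) + (\<integral>x. f x \<partial>\<nu>)) / 2"
    if "f \<in> borel_measurable borel" "integrable \<mu> f" "integrable \<nu> f" for f :: "real\<Rightarrow>real"
  proof -
    have "(\<integral>x. f x \<partial>midpoint_measure \<mu> \<nu>) = (\<Sum>c\<in>UNIV. \<integral>x. f x \<partial>scale_measure (ennreal (1/2)) (if c then \<mu> else \<nu>))"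
      unfolding midpoint_measure_def
    proof (rule integral_sum_measure)
      show "integrable (scale_measure (ennreal (1/2)) (if c then \<mu> else \<nu>)) f" for c
        by (rule integral_scale_measure(2)) (use that in auto)
    qed (use that in auto)
    also have "\<dots> = ((\<integral>x. f x \<partial>\<mu>) + (\<integral>x. f x \<partial>\<nu>)) / 2"
      using integral_scale_measure(1)[of "1/2" f \<mu>] integral_scale_measure(1)[of "1/2" f \<nu>] that
      by (simp add: UNIV_bool)
    finally show ?thesis .
  qed
qed

lemma admissible_midpoint: "admissible \<mu> \<Longrightarrow> admissible \<nu> \<Longrightarrow> admissible (midpoint_measure \<mu> \<nu>)"
  unfolding admissible_def by (auto simp: midpoint_measure_facts)

lemma Phi_midpoint:
  assumes "real_distribution \<mu>" "real_distribution \<nu>"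
  shows "Phi M (midpoint_measure \<mu> \<nu>) (midpoint_measure \<mu> \<nu>) = (Phi M \<mu> \<mu> + Phi M \<nu> \<nu> + Phi M \<mu> \<nu> + Phi M \<nu> \<mu>) / 4"
proof -
  interpret mm: two_finite_borel \<mu> \<mu> by (rule real_distribution_two) fact+
  interpret mn: two_finite_borel \<mu> \<nu> by (rule real_distribution_two) fact+
  interpret nm: two_finite_borel \<nu> \<mu> by (rule real_distribution_two) fact+
  interpret nn: two_finite_borel \<nu> \<nu> by (rule real_distribution_two) fact+
  note [measurable_cong] = mm.M(2) nn.M(2)
  interpret \<mu>: real_distribution \<mu> by fact
  interpret \<nu>: real_distribution \<nu> by fact
  have i: "(\<integral>y. kern M x y \<partial>midpoint_measure \<mu> \<nu>) = ((\<integral>y. kern M x y \<partial>\<mu>) + (\<integral>y. kern M x y \<partial>\<nu>)) / 2" for x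
    by (rule midpoint_measure_facts[OF assms]) (auto intro: mm.kernel_inner nn.kernel_inner)
  show ?thesis unfolding Phi_def dbl_def i
  proof -
    have "(\<integral>x. ((\<integral>y. kern M x y \<partial>\<mu>) + (\<integral>y. kern M x y \<partial>\<nu>)) / 2 \<partial>midpoint_measure \<mu> \<nu>)
        = ((\<integral>x. ((\<integral>y. kern M x y \<partial>\<mu>) + (\<integral>y. kern M x y \<partial>\<nu>)) / 2 \<partial>\<mu>) + (\<integral>x. ((\<integral>y. kern M x y \<partial>\<mu>) + (\<integral>y. kern M x y \<partial>\<nu>)) / 2 \<partial>\<nu>)) / 2"
      by (rule midpoint_measure_facts(3)[OF assms])
         (auto simp: mm.kernel_inner nn.kernel_inner mn.kernel_inner nm.kernel_inner)
    also have "\<dots> = ((\<integral>x. \<integral>y. kern M x y \<partial>\<mu> \<partial>\<mu>) + (\<integral>x. \<integral>y. kern M x y \<partial>\<nu> \<partial>\<nu>)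
        + (\<integral>x. \<integral>y. kern M x y \<partial>\<nu> \<partial>\<mu>) + (\<integral>x. \<integral>y. kern M x y \<partial>\<mu> \<partial>\<nu>)) / 4"
      by (simp add: mm.kernel_inner nn.kernel_inner mn.kernel_inner nm.kernel_inner field_simps)
    finally show "(\<integral>x. ((\<integral>y. kern M x y \<partial>\<mu>) + (\<integral>y. kern M x y \<partial>\<nu>)) / 2 \<partial>midpoint_measure \<mu> \<nu>) = ((\<integral>x. \<integral>y. kern M x y \<partial>\<mu> \<partial>\<mu>) + (\<integral>x. \<integral>y. kern M x y \<partial>\<nu> \<partial>\<nu>)
        + (\<integral>x. \<integral>y. kern M x y \<partial>\<nu> \<partial>\<mu>) + (\<integral>x. \<integral>y. kern M x y \<partial>\<mu> \<partial>\<nu>)) / 4" .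
  qed
qed

text \<open>By bilinearity the energy at the midpoint of two minimizers lies below the minimum by a quarter of
  their squared distance in \<open>Phi_pos_def\<close>. This deficit is bounded away from zero uniformly in \<open>M\<close>,
  because \<open>sp M \<ge> 1/2\<close>, unless all cosine moments agree.\<close>

lemma minimizer_unique:
  assumes "admissible \<mu>" "admissible \<nu>" "energy \<mu> \<le> ereal e" "energy \<nu> \<le> ereal e" "\<And>N. admissible N \<Longrightarrow> ereal e \<le> energy N"
  shows "\<mu> = \<nu>"
proof -
  have rd: "real_distribution \<mu>" "real_distribution \<nu>" using assms by (auto simp: admissible_def)
  have cc: "(\<integral>x. cos (real n * ang x) \<partial>\<mu>) = (\<integral>x. cos (real n * ang x) \<partial>\<nu>)" if "n > 0" for n
  proof -
    \<comment> \<open>a quarter of the lower bound in \<open>Phi_pos_def\<close>, with \<open>sp M\<close> replaced by its minimum \<open>1/2\<close>\<close>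
    define c where "c = ((\<integral>x. cos (real n * ang x) \<partial>\<mu>) - (\<integral>x. cos (real n * ang x) \<partial>\<nu>))\<^sup>2 / (4 * real n) * (1/2) ^ n"
    have c0: "c \<ge> 0" by (simp add: c_def)
    have "Phi M (midpoint_measure \<mu> \<nu>) (midpoint_measure \<mu> \<nu>) \<le> e - c" for M
    proof -
      have "ereal (Phi M \<mu> \<mu>) \<le> ereal e" "ereal (Phi M \<nu> \<nu>) \<le> ereal e"
        using Phi_le_energy assms(3,4) order_trans by blast+
      moreover have "sp M ^ n \<ge> (1/2) ^ n"
        by (rule power_mono) (auto simp: sp_def field_simps)
      then have "1 / real n * sp M ^ n * ((\<integral>x. cos (real n * ang x) \<partial>\<mu>) - (\<integral>x. cos (real n * ang x) \<partial>\<nu>))\<^sup>2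
         \<ge> 1 / real n * (1/2) ^ n * ((\<integral>x. cos (real n * ang x) \<partial>\<mu>) - (\<integral>x. cos (real n * ang x) \<partial>\<nu>))\<^sup>2"
        by (intro mult_right_mono mult_left_mono) auto
      then have "1 / real n * sp M ^ n * ((\<integral>x. cos (real n * ang x) \<partial>\<mu>) - (\<integral>x. cos (real n * ang x) \<partial>\<nu>))\<^sup>2 \<ge> 4 * c"
        unfolding c_def by (simp add: field_simps)
      ultimately show ?thesis
        using Phi_pos_def[OF assms(1,2) that, of M] unfolding Phi_midpoint[OF rd] by simp
    qed
    then have "energy (midpoint_measure \<mu> \<nu>) \<le> ereal (e - c)" unfolding energy_def by (intro SUP_least) simp
    then have "ereal e \<le> ereal (e - c)" using assms(5)[OF admissible_midpoint[OF assms(1,2)]] order_trans by blast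
    then have "c = 0" using c0 by simp
    then show ?thesis using that by (simp add: c_def)
  qed
  show ?thesis
  proof (rule measure_eqI_cos_moments[where R = rad])
    show "AE x in \<mu>. \<bar>x\<bar> \<le> rad" using admissible_AE_G[OF assms(1)] by (rule eventually_mono) (rule rad(2))
    show "AE x in \<nu>. \<bar>x\<bar> \<le> rad" using admissible_AE_G[OF assms(2)] by (rule eventually_mono) (rule rad(2))
    show "rad > 0" using rad(1) by simp
    show "cos (ang x) = x / rad" if "\<bar>x\<bar> \<le> rad" for x
      using that rad(1) unfolding cos_ang rescaled_def by (auto simp: max_def min_def field_simps abs_le_iff)
  qed (use rd cc in auto)
qed

end

section \<open>Finite energy and existence of the minimizer\<close>

text \<open>A layer-cake bound: the logarithm counts the dyadic scales above \<open>u\<close>. It turns the logarithmic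
  potential of a measure into a sum of measures of small intervals.\<close>

lemma neg_ln_le_dyadic:
  fixes u :: real
  assumes "u > 1 / 2 ^ K"
  shows "- ln u \<le> (\<Sum>k<K. if u \<le> 1 / 2 ^ k then ln 2 else 0)"
  using assms
proof (induction K)
  case 0
  then show ?case by simp
next
  case (Suc K)
  have u0: "u > 0" using Suc.prems by (rule less_trans[rotated]) simp
  show ?case
  proof (cases "u > 1 / 2 ^ K")
    case True
    then show ?thesis using Suc.IH by simp
  next
    case False
    have "(\<Sum>k<Suc K. if u \<le> 1 / 2 ^ k then ln 2 else 0) = (\<Sum>k<Suc K. ln 2 :: real)"
    proof (rule sum.cong[OF refl])
      fix k assume "k \<in> {..<Suc K}"
      then have "(1::real) / 2 ^ K \<le> 1 / 2 ^ k"
        by (intro divide_left_mono power_increasing) auto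
      then show "(if u \<le> 1 / 2 ^ k then ln 2 else 0) = (ln 2 :: real)" using False by simp
    qed
    moreover have "ln (1 / 2 ^ Suc K) \<le> ln u" using Suc.prems u0 by (intro ln_mono) auto
    then have "- ln u \<le> real (Suc K) * ln 2" by (simp add: ln_div ln_realpow ln_mult algebra_simps)
    ultimately show ?thesis by simp
  qed
qed

text \<open>Addition of extended reals is continuous where it does not combine the two infinities; the bound on
  the sum makes the induction work.\<close>

lemma tendsto_sum_ereal_not_MInf:
  fixes f :: "'i \<Rightarrow> nat \<Rightarrow> ereal"
  assumes "finite I" "\<And>i. i \<in> I \<Longrightarrow> f i \<longlonglongrightarrow> L i" "\<And>i. i \<in> I \<Longrightarrow> L i \<noteq> -\<infinity>"
  shows "(\<lambda>n. \<Sum>i\<in>I. f i n) \<longlonglongrightarrow> (\<Sum>i\<in>I. L i) \<and> (\<Sum>i\<in>I. L i) \<noteq> -\<infinity>"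
  using assms
proof (induction I rule: finite_induct)
  case (insert i I)
  then have "(\<lambda>n. \<Sum>i\<in>I. f i n) \<longlonglongrightarrow> (\<Sum>i\<in>I. L i)" "(\<Sum>i\<in>I. L i) \<noteq> -\<infinity>" "f i \<longlonglongrightarrow> L i" "L i \<noteq> -\<infinity>" by auto
  then show ?case using insert.hyps
    by (auto intro!: tendsto_add_ereal_general)
qed simp

text \<open>Every point outside the support has a null neighbourhood, and by the Lindelof property countably
  many of them cover the complement.\<close>

lemma null_complement_msupport:
  fixes M :: "real measure"
  assumes "sets M = sets borel" "msupport M \<subseteq> K" "closed K"
  shows "emeasure M (- K) = 0"
proof -
  define F where "F = {U. open U \<and> emeasure M U = 0}"
  obtain F' where F': "F' \<subseteq> F" "countable F'" "\<Union>F' = \<Union>F"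
    using Lindelof[of F] unfolding F_def by blast
  have "- K \<subseteq> \<Union>F"
  proof
    fix x assume "x \<in> - K"
    then have "x \<notin> msupport M" using assms(2) by blast
    then show "x \<in> \<Union>F" unfolding msupport_def F_def by (auto simp: zero_less_iff_neq_zero)
  qed
  moreover have "emeasure M (\<Union>F') = 0"
  proof -
    have "\<Union>F' \<in> null_sets M"
    proof (rule null_sets_UN'[of F' "\<lambda>x. x", simplified])
      show "U \<in> null_sets M" if "U \<in> F'" for U
        using that F'(1) assms(1) unfolding F_def by (auto intro!: null_setsI)
    qed (rule F'(2))
    then show ?thesis by auto
  qed
  ultimately show ?thesis using F'(3)
    by (metis assms(1) assms(3) borel_closed borel_comp emeasure_eq_0 sets.Diff F'(1) F'(2) F_def emeasure_mono le_zero_eq mem_Collect_eq open_Union borel_open subsetD)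
qed

context angelesco_intervals
begin

text \<open>The condition in \<open>measure_tuples\<close> on the components, with null complements in place of supports and
  without extensionality.\<close>

definition mass_tuple :: "(nat \<Rightarrow> real measure) \<Rightarrow> bool" where
  "mass_tuple \<nu> \<longleftrightarrow> (\<forall>i\<in>{1..p}. sets (\<nu> i) = sets borel \<and> emeasure (\<nu> i) (- \<Gamma> i) = 0 \<and> emeasure (\<nu> i) (\<Gamma> i) = ennreal (r i))"

lemma mass_tupleD:
  assumes "mass_tuple \<nu>" "i \<in> {1..p}"
  shows "sets (\<nu> i) = sets borel" "space (\<nu> i) = UNIV" "finite_measure (\<nu> i)" "AE x in \<nu> i. x \<in> \<Gamma> i" 
    "measure (\<nu> i) UNIV = r i" "A \<in> sets borel \<Longrightarrow> emeasure (\<nu> i) A = emeasure (\<nu> i) (A \<inter> \<Gamma> i)"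
proof -
  show s: "sets (\<nu> i) = sets borel" using assms unfolding mass_tuple_def by blast
  show sp: "space (\<nu> i) = UNIV" using sets_eq_imp_space_eq[OF s] by simp
  have 0: "emeasure (\<nu> i) (- \<Gamma> i) = 0" "emeasure (\<nu> i) (\<Gamma> i) = ennreal (r i)" using assms unfolding mass_tuple_def by auto
  have [measurable]: "\<Gamma> i \<in> sets borel" using assms(2) by (rule Gamma_borel)
  show ae: "AE x in \<nu> i. x \<in> \<Gamma> i"
    by (rule AE_I[of _ _ "- \<Gamma> i"]) (auto simp: s 0)
  show e: "emeasure (\<nu> i) A = emeasure (\<nu> i) (A \<inter> \<Gamma> i)" if "A \<in> sets borel" for A
    by (rule emeasure_eq_AE) (use ae that s in \<open>auto elim!: eventually_mono\<close>)
  from e[of UNIV] have u: "emeasure (\<nu> i) UNIV = ennreal (r i)" using 0 by simp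
  then show "finite_measure (\<nu> i)" by (intro finite_measureI) (simp add: sp)
  show "measure (\<nu> i) UNIV = r i" using u r_pos[OF assms(2)] by (simp add: measure_def)
qed

lemma mass_tuple_sum:
  assumes "mass_tuple \<nu>"
  defines "N \<equiv> sum_measure {1..p} \<nu>"
  shows "i \<in> {1..p} \<Longrightarrow> A \<in> sets borel \<Longrightarrow> emeasure (\<nu> i) A = emeasure N (A \<inter> \<Gamma> i)" "admissible N" 
    "\<And>f::real\<Rightarrow>real. f \<in> borel_measurable borel \<Longrightarrow> (\<And>i. i \<in> {1..p} \<Longrightarrow> integrable (\<nu> i) f) \<Longrightarrow> (\<integral>x. f x \<partial>N) = (\<Sum>i=1..p. \<integral>x. f x \<partial>\<nu> i)"
proof -
  have sN: "sets N = sets borel" unfolding N_def by (rule sets_sum_measure) (use mass_tupleD[OF assms(1)] in auto)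
  then have spN: "space N = UNIV" using sets_eq_imp_space_eq[OF sN] by simp
  have eN: "emeasure N A = (\<Sum>i=1..p. emeasure (\<nu> i) A)" if "A \<in> sets borel" for A
    unfolding N_def by (rule emeasure_sum_measure) (use mass_tupleD[OF assms(1)] that in auto)
  show eG: "emeasure (\<nu> i) A = emeasure N (A \<inter> \<Gamma> i)" if i: "i \<in> {1..p}" and A: "A \<in> sets borel" for i A
  proof -
    \<comment> \<open>only the component with index \<open>i\<close> charges \<open>\<Gamma> i\<close>\<close>
    have AG: "A \<inter> \<Gamma> i \<in> sets borel" using A Gamma_borel[OF i] by auto
    have "emeasure N (A \<inter> \<Gamma> i) = (\<Sum>j=1..p. if j = i then emeasure (\<nu> i) A else 0)"
      unfolding eN[OF AG]
    proof (rule sum.cong[OF refl])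
      fix j assume j: "j \<in> {1..p}"
      show "emeasure (\<nu> j) (A \<inter> \<Gamma> i) = (if j = i then emeasure (\<nu> i) A else 0)"
      proof (cases "j = i")
        case True then show ?thesis using mass_tupleD(6)[OF assms(1) i A] by simp
      next
        case False
        then have "A \<inter> \<Gamma> i \<inter> \<Gamma> j = {}" using Gamma_disjoint[OF i j] by blast
        then show ?thesis using mass_tupleD(6)[OF assms(1) j AG] False by simp
      qed
    qed
    then show ?thesis using i by simp
  qed
  have mG: "emeasure N (\<Gamma> i) = ennreal (r i)" if "i \<in> {1..p}" for i
    using eG[OF that Gamma_borel[OF that]] assms(1) that unfolding mass_tuple_def by simp
  have UB: "(UNIV :: real set) \<in> sets borel" by simp
  have "emeasure N UNIV = (\<Sum>i=1..p. ennreal (r i))"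
    unfolding eN[OF UB]
  proof (rule sum.cong[OF refl])
    fix i assume i: "i \<in> {1..p}"
    show "emeasure (\<nu> i) UNIV = ennreal (r i)"
      using eG[OF i, of UNIV] mG[OF i] by simp
  qed
  also have "\<dots> = ennreal (\<Sum>i=1..p. r i)" using r_pos by (intro sum_ennreal) (auto intro: less_imp_le)
  finally have "emeasure N UNIV = 1" using r_sum by simp
  then have "prob_space N" by (intro prob_spaceI) (simp add: spN)
  then have "real_distribution N" using sN by (simp add: real_distribution_def real_distribution_axioms_def)
  moreover have "measure N (\<Gamma> i) = r i" if "i \<in> {1..p}" for i
    using mG[OF that] r_pos[OF that] by (simp add: measure_def)
  ultimately show "admissible N" by (simp add: admissible_def)
  show "(\<integral>x. f x \<partial>N) = (\<Sum>i=1..p. \<integral>x. f x \<partial>\<nu> i)"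
    if "f \<in> borel_measurable borel" "\<And>i. i \<in> {1..p} \<Longrightarrow> integrable (\<nu> i) f" for f :: "real \<Rightarrow> real"
    unfolding N_def by (rule integral_sum_measure) (use that mass_tupleD[OF assms(1)] in auto)
qed

lemma mass_tuple_two: "mass_tuple \<nu> \<Longrightarrow> i \<in> {1..p} \<Longrightarrow> j \<in> {1..p} \<Longrightarrow> two_finite_borel (\<nu> i) (\<nu> j)"
  unfolding two_finite_borel_def using mass_tupleD by auto

lemma mass_tuple_Phi:
  assumes "mass_tuple \<nu>"
  shows "Phi M (sum_measure {1..p} \<nu>) (sum_measure {1..p} \<nu>) = (\<Sum>i=1..p. \<Sum>j=1..p. dbl (\<nu> i) (\<nu> j) (kern M))"
proof -
  have kb: "kern M x \<in> borel_measurable borel" for x by simp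
  have ki: "i \<in> {1..p} \<Longrightarrow> integrable (\<nu> i) (kern M x)" for i x
    using two_finite_borel.kernel_inner(1)[OF mass_tuple_two[OF assms]] by auto
  have inner: "(\<integral>y. kern M x y \<partial>sum_measure {1..p} \<nu>) = (\<Sum>j=1..p. \<integral>y. kern M x y \<partial>\<nu> j)" for x
    by (rule mass_tuple_sum(3)[OF assms kb ki])
  have ki2: "i \<in> {1..p} \<Longrightarrow> j \<in> {1..p} \<Longrightarrow> integrable (\<nu> i) (\<lambda>x. \<integral>y. kern M x y \<partial>\<nu> j)" for i j
    using two_finite_borel.kernel_inner(2)[OF mass_tuple_two[OF assms]] by auto
  have m: "(\<lambda>x. \<integral>y. kern M x y \<partial>\<nu> j) \<in> borel_measurable borel" if "j \<in> {1..p}" for j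
    using borel_measurable_integrable[OF ki2[OF that that]] measurable_cong_sets[OF mass_tupleD(1)[OF assms that] refl] by blast
  have "Phi M (sum_measure {1..p} \<nu>) (sum_measure {1..p} \<nu>) = (\<Sum>i=1..p. \<integral>x. (\<Sum>j=1..p. \<integral>y. kern M x y \<partial>\<nu> j) \<partial>\<nu> i)"
    unfolding Phi_def dbl_def inner
  proof (rule mass_tuple_sum(3)[OF assms])
    show "(\<lambda>x. \<Sum>j=1..p. \<integral>y. kern M x y \<partial>\<nu> j) \<in> borel_measurable borel" by (intro borel_measurable_sum m)
    show "integrable (\<nu> i) (\<lambda>x. \<Sum>j=1..p. \<integral>y. kern M x y \<partial>\<nu> j)" if "i \<in> {1..p}" for i
      by (intro Bochner_Integration.integrable_sum ki2 that)
  qed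
  also have "\<dots> = (\<Sum>i=1..p. \<Sum>j=1..p. dbl (\<nu> i) (\<nu> j) (kern M))"
    unfolding dbl_def by (intro sum.cong refl Bochner_Integration.integral_sum ki2)
  finally show ?thesis .
qed

definition uniform_law :: "nat \<Rightarrow> real measure" where
  "uniform_law i = density lborel (\<lambda>x. ennreal (r i / (b i - a i)) * indicator (\<Gamma> i) x)"

lemma mass_tuple_uniform_law: "mass_tuple uniform_law"
  unfolding mass_tuple_def
proof (intro ballI conjI)
  fix i assume i: "i \<in> {1..p}"
  have [measurable]: "\<Gamma> i \<in> sets borel" using i by (rule Gamma_borel)
  have ab: "a i < b i" "\<Gamma> i = {a i..b i}" using intervals[OF i] by auto
  show "sets (uniform_law i) = sets borel" unfolding uniform_law_def by simp
  have e: "emeasure (uniform_law i) A = ennreal (r i / (b i - a i)) * emeasure lborel (\<Gamma> i \<inter> A)" if [measurable]: "A \<in> sets borel" for A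
  proof -
    have "emeasure (uniform_law i) A = (\<integral>\<^sup>+x. ennreal (r i / (b i - a i)) * indicator (\<Gamma> i \<inter> A) x \<partial>lborel)"
      unfolding uniform_law_def by (subst emeasure_density) (auto intro!: nn_integral_cong simp: indicator_def)
    then show ?thesis by (simp add: nn_integral_cmult_indicator)
  qed
  show "emeasure (uniform_law i) (- \<Gamma> i) = 0" by (subst e) auto
  show "emeasure (uniform_law i) (\<Gamma> i) = ennreal (r i)"
    using ab r_pos[OF i] by (subst e) (auto simp: ennreal_mult[symmetric])
qed

text \<open>The density is at most \<open>r j / (b j - a j)\<close>, and by \<open>neg_ln_le_dyadic\<close> the positive part of the
  logarithmic kernel has Lebesgue integral at most \<open>(\<Sum>k. ln 2 * (2 / 2 ^ k)) = 4 * ln 2\<close>.\<close>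

lemma uniform_law_potential:
  assumes j: "j \<in> {1..p}" and x: "x \<in> G"
  shows "(\<integral>\<^sup>+y. ennreal (ell M x y) \<partial>uniform_law j) \<le> ennreal (r j / (b j - a j) * (4 * ln 2))"
proof -
  have [measurable]: "\<Gamma> j \<in> sets borel" using j by (rule Gamma_borel)
  have ab: "a j < b j" using intervals[OF j] by auto
  define s where "s k y = ennreal (ln 2) * indicator {x - 1/2^k..x + 1/2^k} y" for k and y :: real
  have pw: "ennreal (ell M x y) \<le> (\<Sum>k. s k y)" if y: "y \<in> \<Gamma> j" "y \<noteq> x" for y
  proof -
    have "y \<in> G" using y j unfolding G_def by blast
    obtain K where K: "(1/2)^K < \<bar>x - y\<bar>"
      using y real_arch_pow_inv[of "\<bar>x - y\<bar>" "1/2"] by auto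
    have "ell M x y \<le> - ln \<bar>x - y\<bar>" by (rule ell_le_log) (use x \<open>y \<in> G\<close> y in auto)
    also have "\<dots> \<le> (\<Sum>k<K. if \<bar>x - y\<bar> \<le> 1 / 2 ^ k then ln 2 else 0)"
      by (rule neg_ln_le_dyadic) (use K in \<open>simp add: power_one_over\<close>)
    finally have "ennreal (ell M x y) \<le> ennreal (\<Sum>k<K. if \<bar>x - y\<bar> \<le> 1 / 2 ^ k then ln 2 else 0)"
      by (rule ennreal_leI)
    also have "\<dots> = (\<Sum>k<K. ennreal (if \<bar>x - y\<bar> \<le> 1 / 2 ^ k then ln 2 else 0))"
      by (rule sum_ennreal[symmetric]) auto
    also have "\<dots> = (\<Sum>k<K. s k y)"
      by (intro sum.cong refl) (auto simp: s_def indicator_def abs_le_iff)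
    also have "\<dots> \<le> (\<Sum>k. s k y)" by (rule sum_le_suminf) auto
    finally show ?thesis .
  qed
  have ne: "AE y in lborel. y \<noteq> x" by (rule AE_lborel_singleton)
  have "(\<integral>\<^sup>+y. ennreal (ell M x y) \<partial>uniform_law j)
     = (\<integral>\<^sup>+y. ennreal (r j / (b j - a j)) * indicator (\<Gamma> j) y * ennreal (ell M x y) \<partial>lborel)"
    unfolding uniform_law_def by (subst nn_integral_density) auto
  also have "\<dots> \<le> (\<integral>\<^sup>+y. ennreal (r j / (b j - a j)) * (\<Sum>k. s k y) \<partial>lborel)"
  proof (rule nn_integral_mono_AE)
    show "AE y in lborel. ennreal (r j / (b j - a j)) * indicator (\<Gamma> j) y * ennreal (ell M x y) \<le> ennreal (r j / (b j - a j)) * (\<Sum>k. s k y)"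
      using ne
    proof (rule eventually_mono)
      fix y assume "y \<noteq> x"
      then show "ennreal (r j / (b j - a j)) * indicator (\<Gamma> j) y * ennreal (ell M x y) \<le> ennreal (r j / (b j - a j)) * (\<Sum>k. s k y)"
        using pw[of y] by (cases "y \<in> \<Gamma> j") (auto intro: mult_left_mono)
    qed
  qed
  also have "\<dots> = ennreal (r j / (b j - a j)) * (\<integral>\<^sup>+y. (\<Sum>k. s k y) \<partial>lborel)"
    unfolding s_def by (rule nn_integral_cmult) simp
  also have "(\<integral>\<^sup>+y. (\<Sum>k. s k y) \<partial>lborel) = (\<Sum>k. \<integral>\<^sup>+y. s k y \<partial>lborel)"
    unfolding s_def by (rule nn_integral_suminf) simp
  also have "(\<lambda>k. \<integral>\<^sup>+y. s k y \<partial>lborel) = (\<lambda>k. ennreal (2 * ln 2 * (1/2)^k))"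
  proof
    fix k
    have "(\<integral>\<^sup>+y. s k y \<partial>lborel) = ennreal (ln 2) * emeasure lborel {x - 1/2^k..x + 1/2^k}"
      unfolding s_def by (rule nn_integral_cmult_indicator) simp
    also have "\<dots> = ennreal (ln 2) * ennreal (2 / 2^k)" by (subst emeasure_lborel_Icc) auto
    also have "\<dots> = ennreal (2 * ln 2 * (1/2)^k)"
      by (subst ennreal_mult[symmetric]) (auto simp: power_one_over)
    finally show "(\<integral>\<^sup>+y. s k y \<partial>lborel) = ennreal (2 * ln 2 * (1/2)^k)" .
  qed
  also have "(\<Sum>k. ennreal (2 * ln 2 * (1/2)^k)) = ennreal (4 * ln 2)"
  proof (rule suminf_ennreal_eq)
    show "(\<lambda>k. 2 * ln 2 * (1/2)^k) sums (4 * ln (2::real))"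
      using sums_mult[OF geometric_sums[of "1/2::real"], of "2 * ln 2"] by simp
  qed simp
  finally show ?thesis using r_pos[OF j] ab by (simp add: ennreal_mult[symmetric])
qed

text \<open>The bound on the potential is uniform in \<open>M\<close>. The kernel is shifted by \<open>ln rad + 9\<close> to make it
  nonnegative, so that the bounded coupling can be estimated by a constant.\<close>

lemma finite_energy: "\<exists>N. admissible N \<and> energy N < \<infinity>"
proof -
  define N where "N = sum_measure {1..p} uniform_law"
  define c where "c j = r j / (b j - a j) * (4 * ln 2) + (ln rad + 9) * r j" for j
  have cj: "(\<integral>y. ell M x y + (ln rad + 9) \<partial>uniform_law j) \<le> c j" "c j \<ge> 0" if j: "j \<in> {1..p}" and x: "x \<in> G" for M j x
  proof -
    interpret two_finite_borel "uniform_law j" "uniform_law j" by (rule mass_tuple_two[OF mass_tuple_uniform_law j j])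
    note [measurable_cong] = mass_tupleD(1)[OF mass_tuple_uniform_law j]
    have g: "bdd_kernel (\<lambda>x y. ell M x y + (ln rad + 9))" by (intro bdd_kernel_add) auto
    have c0: "0 \<le> r j / (b j - a j) * (4 * ln 2)" "0 \<le> (ln rad + 9) * r j"
      using r_pos[OF j] intervals[OF j] rad(1) by auto
    have l0: "0 \<le> ln rad + 9" using rad(1) by simp
    show "c j \<ge> 0" unfolding c_def using c0 by simp
    have nn0: "0 \<le> ell M x y + (ln rad + 9)" for y using ell_lower[of M x y] by linarith
    have "ennreal (\<integral>y. ell M x y + (ln rad + 9) \<partial>uniform_law j) = (\<integral>\<^sup>+y. ennreal (ell M x y + (ln rad + 9)) \<partial>uniform_law j)"
      by (rule nn_integral_eq_integral[symmetric, OF kernel_inner(1)[OF g]]) (use nn0 in simp)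
    also have "\<dots> \<le> (\<integral>\<^sup>+y. ennreal (ell M x y) + ennreal (ln rad + 9) \<partial>uniform_law j)"
    proof (rule nn_integral_mono)
      fix y
      have "ennreal (ell M x y + (ln rad + 9)) \<le> ennreal (max 0 (ell M x y) + (ln rad + 9))"
        by (rule ennreal_leI) simp
      also have "\<dots> = ennreal (max 0 (ell M x y)) + ennreal (ln rad + 9)"
        using l0 by (intro ennreal_plus) auto
      also have "ennreal (max 0 (ell M x y)) = ennreal (ell M x y)" by (auto simp: max_def ennreal_neg)
      finally show "ennreal (ell M x y + (ln rad + 9)) \<le> ennreal (ell M x y) + ennreal (ln rad + 9)" .
    qed
    also have "\<dots> = (\<integral>\<^sup>+y. ennreal (ell M x y) \<partial>uniform_law j) + ennreal (ln rad + 9) * emeasure (uniform_law j) UNIV"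
      by (subst nn_integral_add) (auto simp: mass_tupleD(2)[OF mass_tuple_uniform_law j])
    also have "\<dots> \<le> ennreal (r j / (b j - a j) * (4 * ln 2)) + ennreal (ln rad + 9) * ennreal (r j)"
      by (intro add_mono uniform_law_potential j x)
         (use mass_tupleD[OF mass_tuple_uniform_law j] finite_measure.emeasure_eq_measure[of "uniform_law j" UNIV] in simp)
    also have "\<dots> = ennreal (c j)"
      unfolding c_def using c0 l0 r_pos[OF j] by (simp add: ennreal_mult[symmetric] ennreal_plus[symmetric] del: ennreal_plus)
    finally show "(\<integral>y. ell M x y + (ln rad + 9) \<partial>uniform_law j) \<le> c j"
      using \<open>c j \<ge> 0\<close> by (simp add: ennreal_le_iff)
  qed
  define C where "C = (\<Sum>i=1..p. \<Sum>j=1..p. r i * ((1 + real p) / 2 * c j + 2 * Q_bound * r j))"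
  have "Phi M N N \<le> C" for M
    unfolding N_def mass_tuple_Phi[OF mass_tuple_uniform_law] C_def
  proof (intro sum_mono)
    fix i j assume i: "i \<in> {1..p}" and j: "j \<in> {1..p}"
    interpret two_finite_borel "uniform_law i" "uniform_law j" by (rule mass_tuple_two[OF mass_tuple_uniform_law i j])
    interpret li: finite_measure "uniform_law i" by (rule M)
    interpret lj: finite_measure "uniform_law j" by (rule N)
    have g: "bdd_kernel (\<lambda>x y. ell M x y + (ln rad + 9))" by (intro bdd_kernel_add) auto
    have "dbl (uniform_law i) (uniform_law j) (kern M) \<le> (\<integral>x. (1 + real p) / 2 * c j + 2 * Q_bound * r j \<partial>uniform_law i)"
      unfolding dbl_def
    proof (rule integral_mono_AE)
      show "AE x in uniform_law i. (\<integral>y. kern M x y \<partial>uniform_law j) \<le> (1 + real p) / 2 * c j + 2 * Q_bound * r j"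
        using mass_tupleD(4)[OF mass_tuple_uniform_law i]
      proof (rule eventually_mono)
        fix x assume "x \<in> \<Gamma> i"
        then have xG: "x \<in> G" using i unfolding G_def by blast
        have "(\<integral>y. kern M x y \<partial>uniform_law j) \<le> (\<integral>y. (1 + real p) / 2 * (ell M x y + (ln rad + 9)) + 2 * Q_bound \<partial>uniform_law j)"
        proof (rule integral_mono)
          show "integrable (uniform_law j) (kern M x)" by (rule kernel_inner) simp
          show "integrable (uniform_law j) (\<lambda>y. (1 + real p) / 2 * (ell M x y + (ln rad + 9)) + 2 * Q_bound)"
            using kernel_inner(1)[OF g, of x] by simp
          fix y
          have l0: "0 \<le> ln rad + 9" using rad(1) by simp
          have "coupling x y * ell M x y \<le> coupling x y * (ell M x y + (ln rad + 9))"
            using l0 by (intro mult_left_mono coupling_nonneg) auto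
          also have "\<dots> \<le> (1 + real p) / 2 * (ell M x y + (ln rad + 9))"
            using ell_lower[of M x y] by (intro mult_right_mono coupling_le) auto
          finally show "kern M x y \<le> (1 + real p) / 2 * (ell M x y + (ln rad + 9)) + 2 * Q_bound"
            unfolding kern_def using abs_Q_ext_le[of x] abs_Q_ext_le[of y] by (simp add: abs_le_iff)
        qed
        also have "\<dots> = (1 + real p) / 2 * (\<integral>y. ell M x y + (ln rad + 9) \<partial>uniform_law j) + 2 * Q_bound * r j"
          using kernel_inner(1)[OF g, of x] mass_tupleD[OF mass_tuple_uniform_law j] by simp
        also have "\<dots> \<le> (1 + real p) / 2 * c j + 2 * Q_bound * r j"
          by (intro add_right_mono mult_left_mono cj j xG) auto
        finally show "(\<integral>y. kern M x y \<partial>uniform_law j) \<le> (1 + real p) / 2 * c j + 2 * Q_bound * r j" .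
      qed
    qed (auto intro: kernel_inner)
    also have "\<dots> = r i * ((1 + real p) / 2 * c j + 2 * Q_bound * r j)"
      using mass_tupleD[OF mass_tuple_uniform_law i] by simp
    finally show "dbl (uniform_law i) (uniform_law j) (kern M) \<le> r i * ((1 + real p) / 2 * c j + 2 * Q_bound * r j)" .
  qed
  then have "energy N \<le> ereal C" unfolding energy_def by (intro SUP_least) simp
  then have "energy N < \<infinity>" by (rule le_less_trans) simp
  then show ?thesis using mass_tuple_sum(2)[OF mass_tuple_uniform_law] N_def by blast
qed

lemma minimizer_exists: "\<exists>N e. admissible N \<and> energy N = ereal e \<and> (\<forall>N'. admissible N' \<longrightarrow> ereal e \<le> energy N')"
proof -
  define E where "E = (INF N\<in>{N. admissible N}. energy N)"
  have Elow: "ereal (- kern_floor) \<le> E" unfolding E_def by (rule INF_greatest) (use energy_lower in \<open>auto simp: admissible_def\<close>)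
  obtain N0 where N0: "admissible N0" "energy N0 < \<infinity>" using finite_energy by blast
  then have "E < \<infinity>" unfolding E_def using INF_lower[of N0 "{N. admissible N}" energy] by (auto intro: le_less_trans)
  then obtain e where e: "E = ereal e" using Elow by (cases E) auto
  have "\<exists>N. admissible N \<and> energy N < ereal (e + 1 / real (Suc k))" for k
  proof -
    have "E < ereal (e + 1 / real (Suc k))" using e by simp
    then show ?thesis unfolding E_def by (auto simp: INF_less_iff)
  qed
  then obtain Nk where Nk: "\<And>k. admissible (Nk k)" "\<And>k. energy (Nk k) < ereal (e + 1 / real (Suc k))" by metis
  have rd: "real_distribution (Nk k)" for k using Nk(1)[of k] by (simp add: admissible_def)
  have "\<exists>s \<nu>. strict_mono (s::nat\<Rightarrow>nat) \<and> admissible \<nu> \<and> weak_conv_m (Nk \<circ> s) \<nu>"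
    by (rule weak_compact[OF rd admissible_AE_G[OF Nk(1)]]) (use Nk(1) in \<open>simp add: admissible_def\<close>)
  then obtain s \<nu> where s: "strict_mono (s::nat\<Rightarrow>nat)" "admissible \<nu>" "weak_conv_m (Nk \<circ> s) \<nu>" by blast
  have "energy \<nu> \<le> ereal e"
  proof (rule weak_lsc[of "Nk \<circ> s"])
    fix M
    have l: "(\<lambda>k. e + 1 / real (Suc (s k))) \<longlonglongrightarrow> e + 0"
      using LIMSEQ_subseq_LIMSEQ[OF LIMSEQ_inverse_real_of_nat s(1)] by (intro tendsto_add) (auto simp: o_def inverse_eq_divide)
    have "Phi M ((Nk \<circ> s) k) ((Nk \<circ> s) k) \<le> e + 1 / real (Suc (s k))" for k
      using le_less_trans[OF Phi_le_energy[of M "Nk (s k)"] Nk(2)[of "s k"]] by simp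
    then show "\<exists>w. w \<longlonglongrightarrow> e \<and> (\<forall>\<^sub>F k in sequentially. Phi M ((Nk \<circ> s) k) ((Nk \<circ> s) k) \<le> w k)"
      using l by (intro exI[of _ "\<lambda>k. e + 1 / real (Suc (s k))"]) auto
  qed (use rd s in \<open>auto simp: admissible_def\<close>)
  moreover have *: "ereal e \<le> energy N'" if "admissible N'" for N' using that unfolding e[symmetric] E_def by (auto intro: INF_lower)
  ultimately show ?thesis using s(2) by (intro exI[of _ \<nu>] exI[of _ e]) (auto intro: antisym)
qed


section \<open>Identification with the weighted energy\<close>

lemma ell_log_kernel_lim:
  assumes "x \<in> G" "y \<in> G"
  shows "(\<lambda>M. ereal (ell M x y)) \<longlonglongrightarrow> log_kernel (x, y)"
proof (cases "x = y")
  case True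
  have "(\<lambda>M. ereal (ell M x x)) \<longlonglongrightarrow> \<infinity>"
    unfolding tendsto_PInfty using ell_diag_lim[of x, unfolded filterlim_at_top_dense] by simp
  then show ?thesis using True by (simp add: log_kernel_def)
next
  case False
  then have "log_kernel (x, y) = ereal (- ln \<bar>x - y\<bar>)"
    by (simp add: log_kernel_def ln_div)
  then show ?thesis using ell_lim[OF assms False] by simp
qed

text \<open>The regularised kernels increase to the logarithmic kernel: the positive parts converge by monotone
  convergence, possibly to infinity, and the negative parts, bounded by \<open>ln rad + 9\<close>, by dominated
  convergence.\<close>

lemma ell_energy_lim:
  assumes c: "mass_tuple \<nu>" and i: "i \<in> {1..p}" and j: "j \<in> {1..p}"
  defines "L \<equiv> ereal_set_integral (\<nu> i \<Otimes>\<^sub>M \<nu> j) (\<Gamma> i \<times> \<Gamma> j) log_kernel"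
  shows "(\<lambda>M. ereal (dbl (\<nu> i) (\<nu> j) (ell M))) \<longlonglongrightarrow> L" "L \<noteq> -\<infinity>"
proof -
  interpret two_finite_borel "\<nu> i" "\<nu> j" by (rule mass_tuple_two[OF c i j])
  interpret M: finite_measure "\<nu> i" by (rule M)
  interpret N: finite_measure "\<nu> j" by (rule N)
  interpret P: finite_measure "\<nu> i \<Otimes>\<^sub>M \<nu> j" by (rule finite_measure_pair_measure) unfold_locales
  note [measurable_cong] = M(2) N(2)
  have [measurable]: "\<Gamma> i \<in> sets borel" "\<Gamma> j \<in> sets borel" using i j by auto
  have [measurable]: "(\<lambda>(x,y). ell M x y) \<in> borel_measurable (borel \<Otimes>\<^sub>M borel)" for M
    using ell_bdd[of M] unfolding bdd_kernel_def by blast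
  have [measurable]: "log_kernel \<in> borel_measurable (borel \<Otimes>\<^sub>M borel)"
    unfolding log_kernel_def by measurable
  define P where "P = \<nu> i \<Otimes>\<^sub>M \<nu> j"
  define S where "S = \<Gamma> i \<times> \<Gamma> j"
  have [measurable]: "S \<in> sets (borel \<Otimes>\<^sub>M borel)" unfolding S_def by (intro pair_measureI) auto
  have [measurable_cong]: "sets P = sets (borel \<Otimes>\<^sub>M borel)"
    unfolding P_def using M(2) N(2) by (rule sets_pair_measure_cong)
  interpret P': finite_measure P unfolding P_def by unfold_locales
  have ae: "AE z in P. z \<in> S"
  proof -
    have "emeasure P ((- \<Gamma> i) \<times> UNIV) = 0" "emeasure P (UNIV \<times> (- \<Gamma> j)) = 0"
      using c i j unfolding P_def mass_tuple_def by (subst N.emeasure_pair_measure_Times; simp)+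
    then have "(- \<Gamma> i) \<times> UNIV \<union> UNIV \<times> (- \<Gamma> j) \<in> null_sets P"
      by (intro null_sets.Un null_setsI) auto
    then show ?thesis
      by (rule AE_I') (auto simp: S_def)
  qed
  define f where "f M z = ell M (fst z) (snd z)" for M and z :: "real \<times> real"
  have fm [measurable]: "f M \<in> borel_measurable (borel \<Otimes>\<^sub>M borel)" for M
    unfolding f_def using \<open>(\<lambda>(x,y). ell M x y) \<in> borel_measurable (borel \<Otimes>\<^sub>M borel)\<close> by (simp add: case_prod_beta')
  have flim: "(\<lambda>M. ereal (f M z)) \<longlonglongrightarrow> log_kernel z" if "z \<in> S" for z
  proof -
    have "fst z \<in> G" "snd z \<in> G" using that i j unfolding S_def G_def by auto
    from ell_log_kernel_lim[OF this] show ?thesis unfolding f_def by simp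
  qed
  have pos: "(\<lambda>M. \<integral>\<^sup>+z. ennreal (f M z) * indicator S z \<partial>P) \<longlonglongrightarrow> (\<integral>\<^sup>+z. e2ennreal (log_kernel z) * indicator S z \<partial>P)"
  proof (rule nn_integral_LIMSEQ)
    show "incseq (\<lambda>M z. ennreal (f M z) * indicator S z)"
      unfolding incseq_def le_fun_def f_def by (intro allI impI mult_right_mono ennreal_leI ell_mono) auto
    show "(\<lambda>z. ennreal (f M z) * indicator S z) \<in> borel_measurable P" for M by measurable
    show "(\<lambda>M. ennreal (f M z) * indicator S z) \<longlonglongrightarrow> e2ennreal (log_kernel z) * indicator S z" for z
    proof (cases "z \<in> S")
      case True
      have "(\<lambda>M. e2ennreal (ereal (f M z))) \<longlonglongrightarrow> e2ennreal (log_kernel z)"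
        by (rule tendsto_compose[OF continuous_at_e2ennreal[of _ UNIV, unfolded continuous_within] flim[OF True]])
      then show ?thesis using True by simp
    qed simp
  qed
  have nb: "ennreal (- f M z) * indicator S z \<le> ennreal (ln rad + 9)" for M z
  proof -
    have "- f M z \<le> ln rad + 9" unfolding f_def using ell_lower[of M "fst z" "snd z"] by linarith
    then show ?thesis by (cases "z \<in> S") (auto intro: ennreal_leI)
  qed
  have neg: "(\<lambda>M. \<integral>\<^sup>+z. ennreal (- f M z) * indicator S z \<partial>P) \<longlonglongrightarrow> (\<integral>\<^sup>+z. e2ennreal (- log_kernel z) * indicator S z \<partial>P)"
  proof (rule nn_integral_dominated_convergence[where w = "\<lambda>_. ennreal (ln rad + 9)"])
    show "AE z in P. ennreal (- f M z) * indicator S z \<le> ennreal (ln rad + 9)" for M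
      by (intro AE_I2 nb)
    show "(\<integral>\<^sup>+z. ennreal (ln rad + 9) \<partial>P) < \<infinity>"
      by (simp add: P'.emeasure_eq_measure ennreal_mult_less_top)
    show "AE z in P. (\<lambda>M. ennreal (- f M z) * indicator S z) \<longlonglongrightarrow> e2ennreal (- log_kernel z) * indicator S z"
    proof (rule AE_I2)
      fix z
      show "(\<lambda>M. ennreal (- f M z) * indicator S z) \<longlonglongrightarrow> e2ennreal (- log_kernel z) * indicator S z"
      proof (cases "z \<in> S")
        case True
        have "(\<lambda>M. - ereal (f M z)) \<longlonglongrightarrow> - log_kernel z" using flim[OF True] by (rule tendsto_uminus_ereal)
        then have "(\<lambda>M. e2ennreal (- ereal (f M z))) \<longlonglongrightarrow> e2ennreal (- log_kernel z)"
          by (rule tendsto_compose[OF continuous_at_e2ennreal[of _ UNIV, unfolded continuous_within]])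
        then show ?thesis using True by simp
      qed simp
    qed
  qed measurable
  define A where "A = (\<integral>\<^sup>+z. e2ennreal (log_kernel z) * indicator S z \<partial>P)"
  define B where "B = (\<integral>\<^sup>+z. e2ennreal (- log_kernel z) * indicator S z \<partial>P)"
  have LAB: "L = enn2ereal A - enn2ereal B"
    unfolding L_def ereal_set_integral_def A_def B_def P_def S_def ..
  have "B \<le> (\<integral>\<^sup>+z. ennreal (ln rad + 9) \<partial>P)"
  proof (rule LIMSEQ_le_const2[OF neg[folded B_def]])
    show "\<exists>N. \<forall>n\<ge>N. (\<integral>\<^sup>+z. ennreal (- f n z) * indicator S z \<partial>P) \<le> (\<integral>\<^sup>+z. ennreal (ln rad + 9) \<partial>P)"
      by (intro exI allI impI nn_integral_mono nb)
  qed
  also have "\<dots> < \<infinity>" by (simp add: P'.emeasure_eq_measure ennreal_mult_less_top)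
  finally have Bfin: "enn2ereal B \<noteq> \<infinity>" by auto
  moreover have "enn2ereal B \<ge> 0" "enn2ereal A \<ge> 0" by simp_all
  ultimately have Babs: "\<bar>- enn2ereal B\<bar> \<noteq> \<infinity>" by auto
  show "L \<noteq> -\<infinity>" unfolding LAB using \<open>enn2ereal A \<ge> 0\<close> Babs by (cases "enn2ereal A"; cases "enn2ereal B") auto
  have "(\<lambda>M. enn2ereal (\<integral>\<^sup>+z. ennreal (f M z) * indicator S z \<partial>P)) \<longlonglongrightarrow> enn2ereal A"
    unfolding A_def by (rule tendsto_compose[OF continuous_at_enn2ereal[of _ UNIV, unfolded continuous_within] pos])
  moreover have "(\<lambda>M. enn2ereal (\<integral>\<^sup>+z. ennreal (- f M z) * indicator S z \<partial>P)) \<longlonglongrightarrow> enn2ereal B"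
    unfolding B_def by (rule tendsto_compose[OF continuous_at_enn2ereal[of _ UNIV, unfolded continuous_within] neg])
  ultimately have "(\<lambda>M. enn2ereal (\<integral>\<^sup>+z. ennreal (f M z) * indicator S z \<partial>P) + - enn2ereal (\<integral>\<^sup>+z. ennreal (- f M z) * indicator S z \<partial>P))
      \<longlonglongrightarrow> enn2ereal A + - enn2ereal B"
    by (intro tendsto_add_ereal_general1[OF Babs] tendsto_uminus_ereal)
  moreover have "enn2ereal (\<integral>\<^sup>+z. ennreal (f M z) * indicator S z \<partial>P) + - enn2ereal (\<integral>\<^sup>+z. ennreal (- f M z) * indicator S z \<partial>P)
      = ereal (dbl (\<nu> i) (\<nu> j) (ell M))" for M
  proof -
    have int: "integrable P (f M)"
      unfolding f_def P_def using kernel_integrable[OF ell_bdd, of M] by (simp add: case_prod_beta')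
    have "(\<integral>\<^sup>+z. ennreal (f M z) * indicator S z \<partial>P) = (\<integral>\<^sup>+z. ennreal (f M z) \<partial>P)"
      "(\<integral>\<^sup>+z. ennreal (- f M z) * indicator S z \<partial>P) = (\<integral>\<^sup>+z. ennreal (- f M z) \<partial>P)"
      by (intro nn_integral_cong_AE, use ae in \<open>auto elim!: eventually_mono\<close>)+
    moreover have "(\<integral>\<^sup>+z. ennreal (f M z) \<partial>P) < \<infinity>" "(\<integral>\<^sup>+z. ennreal (- f M z) \<partial>P) < \<infinity>"
      using int unfolding real_integrable_def by (auto simp: less_top)
    moreover have "dbl (\<nu> i) (\<nu> j) (ell M) = integral\<^sup>L P (f M)"
      unfolding f_def P_def by (rule dbl_eq_pair[OF ell_bdd])
    ultimately show ?thesis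
      unfolding real_lebesgue_integral_def[OF int]
      by (cases "\<integral>\<^sup>+z. ennreal (f M z) \<partial>P" rule: ennreal_cases; cases "\<integral>\<^sup>+z. ennreal (- f M z) \<partial>P" rule: ennreal_cases) auto
  qed
  ultimately show "(\<lambda>M. ereal (dbl (\<nu> i) (\<nu> j) (ell M))) \<longlonglongrightarrow> L"
    unfolding LAB minus_ereal_def by simp
qed

lemma mass_tuple_Q_ext:
  assumes c: "mass_tuple \<nu>" and k: "k \<in> {1..p}"
  shows "(\<integral>x. Q_ext x \<partial>\<nu> k) = (LINT x:\<Gamma> k|\<nu> k. Q k x)"
  unfolding set_lebesgue_integral_def
proof (rule integral_cong_AE)
  note [measurable_cong] = mass_tupleD(1)[OF c k]
  have [measurable]: "\<Gamma> k \<in> sets borel" using k by simp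
  show "Q_ext \<in> borel_measurable (\<nu> k)" by measurable
  have "(\<lambda>x. indicator (\<Gamma> k) x *\<^sub>R Q k x) \<in> borel_measurable borel"
    by (rule borel_measurable_continuous_on_indicator[OF _ Q_cont[OF k]]) (use k in simp)
  then show "(\<lambda>x. indicator (\<Gamma> k) x *\<^sub>R Q k x) \<in> borel_measurable (\<nu> k)" by measurable
  show "AE x in \<nu> k. Q_ext x = indicator (\<Gamma> k) x *\<^sub>R Q k x"
    using mass_tupleD(4)[OF c k] by (rule eventually_mono) (simp add: Q_ext_eq[OF k])
qed

lemma mass_tuple_dbl_kern:
  assumes c: "mass_tuple \<nu>" and i: "i \<in> {1..p}" and j: "j \<in> {1..p}"
  shows "dbl (\<nu> i) (\<nu> j) (kern M) = (if i = j then 1 else 1/2) * dbl (\<nu> i) (\<nu> j) (ell M)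
       + r j * (LINT x:\<Gamma> i|\<nu> i. Q i x) + r i * (LINT x:\<Gamma> j|\<nu> j. Q j x)"
proof -
  interpret two_finite_borel "\<nu> i" "\<nu> j" by (rule mass_tuple_two[OF c i j])
  have q: "(\<integral>x. Q_ext x \<partial>\<nu> k) = (LINT x:\<Gamma> k|\<nu> k. Q k x)" if "k \<in> {1..p}" for k
    by (rule mass_tuple_Q_ext[OF c that])
  have lb: "bdd_kernel (\<lambda>x y. (if i = j then 1 else 1/2) * ell M x y)"
    by (intro bdd_kernel_mult) auto
  have "dbl (\<nu> i) (\<nu> j) (kern M) = dbl (\<nu> i) (\<nu> j) (\<lambda>x y. ((if i = j then 1 else 1/2) * ell M x y + Q_ext x) + Q_ext y)"
    by (rule dbl_cong_AE[OF _ _ mass_tupleD(4)[OF c i] mass_tupleD(4)[OF c j]])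
       (use coupling_eq[OF i j] lb in \<open>auto simp: kern_def intro!: bdd_kernel_add\<close>)
  also have "\<dots> = (if i = j then 1 else 1/2) * dbl (\<nu> i) (\<nu> j) (ell M) + dbl (\<nu> i) (\<nu> j) (\<lambda>x y. Q_ext x) + dbl (\<nu> i) (\<nu> j) (\<lambda>x y. Q_ext y)"
    unfolding dbl_add[OF bdd_kernel_add[OF lb Q_ext_bdd(1)] Q_ext_bdd(2)] dbl_add[OF lb Q_ext_bdd(1)] dbl_cmult ..
  also have "dbl (\<nu> i) (\<nu> j) (\<lambda>x y. Q_ext x) = r j * (LINT x:\<Gamma> i|\<nu> i. Q i x)"
    unfolding dbl_def q[OF i, symmetric] using mass_tupleD[OF c j] by simp
  also have "dbl (\<nu> i) (\<nu> j) (\<lambda>x y. Q_ext y) = r i * (LINT x:\<Gamma> j|\<nu> j. Q j x)"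
    unfolding dbl_def q[OF j, symmetric] using mass_tupleD[OF c i] by simp
  finally show ?thesis .
qed

lemma dbl_ell_sym:
  assumes "two_finite_borel \<mu> \<nu>"
  shows "dbl \<mu> \<nu> (ell M) = dbl \<nu> \<mu> (ell M)"
proof -
  interpret two_finite_borel \<mu> \<nu> by fact
  interpret M: finite_measure \<mu> by (rule M)
  interpret N: finite_measure \<nu> by (rule N)
  interpret P: pair_sigma_finite \<mu> \<nu> by standard
  have "dbl \<mu> \<nu> (ell M) = (\<integral>y. (\<integral>x. ell M x y \<partial>\<mu>) \<partial>\<nu>)"
    unfolding dbl_def by (rule P.Fubini_integral[symmetric]) (use kernel_integrable[OF ell_bdd, of M] in simp)
  then show ?thesis unfolding dbl_def by (simp add: ell_sym[of M _ "_"])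
qed

text \<open>The factor \<open>1/2\<close> compensates for the two orders of an unordered pair.\<close>

lemma sum_offdiag:
  fixes f :: "nat \<Rightarrow> nat \<Rightarrow> real"
  assumes "\<And>i j. i \<in> {1..p} \<Longrightarrow> j \<in> {1..p} \<Longrightarrow> f i j = f j i"
  shows "(\<Sum>i=1..p. \<Sum>j=1..p. (if i = j then 1 else 1/2) * f i j) = (\<Sum>i=1..p. f i i) + (\<Sum>i=1..p. \<Sum>j\<in>{i<..p}. f i j)"
proof -
  have split: "(\<Sum>j=1..p. (if i = j then 1 else 1/2) * f i j) = f i i + (\<Sum>j\<in>{i<..p}. f i j / 2) + (\<Sum>j\<in>{1..<i}. f i j / 2)"
    if i: "i \<in> {1..p}" for i
  proof -
    have "{1..p} = insert i ({i<..p} \<union> {1..<i})" using i by auto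
    then have "(\<Sum>j=1..p. (if i = j then 1 else 1/2) * f i j) = (\<Sum>j\<in>insert i ({i<..p} \<union> {1..<i}). (if i = j then 1 else 1/2) * f i j)"
      by simp
    also have "\<dots> = f i i + (\<Sum>j\<in>{i<..p} \<union> {1..<i}. (if i = j then 1 else 1/2) * f i j)"
      by (subst sum.insert) auto
    also have "(\<Sum>j\<in>{i<..p} \<union> {1..<i}. (if i = j then 1 else 1/2) * f i j) = (\<Sum>j\<in>{i<..p} \<union> {1..<i}. f i j / 2)"
      by (intro sum.cong) auto
    also have "\<dots> = (\<Sum>j\<in>{i<..p}. f i j / 2) + (\<Sum>j\<in>{1..<i}. f i j / 2)"
      by (intro sum.union_disjoint) auto
    finally show ?thesis by simp
  qed
  have "(\<Sum>i=1..p. \<Sum>j\<in>{1..<i}. f i j / 2) = (\<Sum>(i,j)\<in>(SIGMA i:{1..p}. {1..<i}). f i j / 2)"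
    by (rule sum.Sigma) auto
  also have "\<dots> = (\<Sum>(i,j)\<in>(SIGMA i:{1..p}. {i<..p}). f i j / 2)"
    by (rule sum.reindex_bij_witness[of _ "\<lambda>(i,j). (j,i)" "\<lambda>(i,j). (j,i)"]) (use assms in auto)
  also have "\<dots> = (\<Sum>i=1..p. \<Sum>j\<in>{i<..p}. f i j / 2)"
    by (rule sum.Sigma[symmetric]) auto
  finally have *: "(\<Sum>i=1..p. \<Sum>j\<in>{1..<i}. f i j / 2) = (\<Sum>i=1..p. \<Sum>j\<in>{i<..p}. f i j / 2)" .
  have "(\<Sum>i=1..p. \<Sum>j=1..p. (if i = j then 1 else 1/2) * f i j) = (\<Sum>i=1..p. f i i + (\<Sum>j\<in>{i<..p}. f i j / 2) + (\<Sum>j\<in>{1..<i}. f i j / 2))"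
    by (rule sum.cong[OF refl split])
  also have "\<dots> = (\<Sum>i=1..p. f i i) + ((\<Sum>i=1..p. \<Sum>j\<in>{i<..p}. f i j / 2) + (\<Sum>i=1..p. \<Sum>j\<in>{i<..p}. f i j / 2))"
    unfolding sum.distrib * by simp
  also have "(\<Sum>i=1..p. \<Sum>j\<in>{i<..p}. f i j / 2) + (\<Sum>i=1..p. \<Sum>j\<in>{i<..p}. f i j / 2) = (\<Sum>i=1..p. \<Sum>j\<in>{i<..p}. f i j)"
    unfolding sum.distrib[symmetric] by simp
  finally show ?thesis .
qed

lemma weighted_energy_eq_energy:
  assumes c: "mass_tuple \<nu>"
  shows "weighted_energy p \<Gamma> Q \<nu> = energy (sum_measure {1..p} \<nu>)"
proof -
  let ?N = "sum_measure {1..p} \<nu>"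
  let ?I = "\<lambda>i j. ereal_set_integral (\<nu> i \<Otimes>\<^sub>M \<nu> j) (\<Gamma> i \<times> \<Gamma> j) log_kernel"
  let ?q = "\<lambda>i. LINT x:\<Gamma> i|\<nu> i. Q i x"
  have Phi_eq: "Phi M ?N ?N = (\<Sum>i=1..p. dbl (\<nu> i) (\<nu> i) (ell M)) + (\<Sum>i=1..p. \<Sum>j\<in>{i<..p}. dbl (\<nu> i) (\<nu> j) (ell M))
     + 2 * (\<Sum>i=1..p. ?q i)" for M
  proof -
    have "Phi M ?N ?N = (\<Sum>i=1..p. \<Sum>j=1..p. (if i = j then 1 else 1/2) * dbl (\<nu> i) (\<nu> j) (ell M) + r j * ?q i + r i * ?q j)"
      unfolding mass_tuple_Phi[OF c] by (intro sum.cong refl mass_tuple_dbl_kern c)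
    also have "\<dots> = (\<Sum>i=1..p. \<Sum>j=1..p. (if i = j then 1 else 1/2) * dbl (\<nu> i) (\<nu> j) (ell M))
        + (\<Sum>i=1..p. \<Sum>j=1..p. r j * ?q i) + (\<Sum>i=1..p. \<Sum>j=1..p. r i * ?q j)"
      by (simp only: sum.distrib)
    also have "(\<Sum>i=1..p. \<Sum>j=1..p. r j * ?q i) = (\<Sum>i=1..p. ?q i)"
      unfolding sum_distrib_right[symmetric] r_sum by simp
    also have "(\<Sum>i=1..p. \<Sum>j=1..p. r i * ?q j) = (\<Sum>i=1..p. ?q i)"
      unfolding sum_distrib_left[symmetric] sum_distrib_right[symmetric] r_sum by simp
    also have "(\<Sum>i=1..p. \<Sum>j=1..p. (if i = j then 1 else 1/2) * dbl (\<nu> i) (\<nu> j) (ell M)) =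
        (\<Sum>i=1..p. dbl (\<nu> i) (\<nu> i) (ell M)) + (\<Sum>i=1..p. \<Sum>j\<in>{i<..p}. dbl (\<nu> i) (\<nu> j) (ell M))"
      by (rule sum_offdiag) (rule dbl_ell_sym[OF mass_tuple_two[OF c]])
    finally show ?thesis by simp
  qed
  have s1: "(\<lambda>M. \<Sum>i=1..p. ereal (dbl (\<nu> i) (\<nu> i) (ell M))) \<longlonglongrightarrow> (\<Sum>i=1..p. ?I i i) \<and> (\<Sum>i=1..p. ?I i i) \<noteq> -\<infinity>"
    by (rule tendsto_sum_ereal_not_MInf) (use ell_energy_lim[OF c] in auto)
  have s2i: "(\<lambda>M. \<Sum>j\<in>{i<..p}. ereal (dbl (\<nu> i) (\<nu> j) (ell M))) \<longlonglongrightarrow> (\<Sum>j\<in>{i<..p}. ?I i j) \<and> (\<Sum>j\<in>{i<..p}. ?I i j) \<noteq> -\<infinity>"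
    if "i \<in> {1..p}" for i
    by (rule tendsto_sum_ereal_not_MInf) (use ell_energy_lim[OF c] that in auto)
  have s2: "(\<lambda>M. \<Sum>i=1..p. \<Sum>j\<in>{i<..p}. ereal (dbl (\<nu> i) (\<nu> j) (ell M))) \<longlonglongrightarrow> (\<Sum>i=1..p. \<Sum>j\<in>{i<..p}. ?I i j) \<and> (\<Sum>i=1..p. \<Sum>j\<in>{i<..p}. ?I i j) \<noteq> -\<infinity>"
    by (rule tendsto_sum_ereal_not_MInf) (use s2i in auto)
  have "(\<lambda>M. ((\<Sum>i=1..p. ereal (dbl (\<nu> i) (\<nu> i) (ell M))) + (\<Sum>i=1..p. \<Sum>j\<in>{i<..p}. ereal (dbl (\<nu> i) (\<nu> j) (ell M))))
        + ereal (2 * (\<Sum>i=1..p. ?q i)))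
       \<longlonglongrightarrow> ((\<Sum>i=1..p. ?I i i) + (\<Sum>i=1..p. \<Sum>j\<in>{i<..p}. ?I i j)) + ereal (2 * (\<Sum>i=1..p. ?q i))"
    using s1 s2 by (intro tendsto_add_ereal_general tendsto_const) auto
  then have "(\<lambda>M. ereal (Phi M ?N ?N)) \<longlonglongrightarrow> weighted_energy p \<Gamma> Q \<nu>"
    unfolding Phi_eq weighted_energy_def by (simp add: sum_ereal)
  moreover have "real_distribution ?N" using mass_tuple_sum(2)[OF c] by (simp add: admissible_def)
  from energy_lim[OF this] have "(\<lambda>M. ereal (Phi M ?N ?N)) \<longlonglongrightarrow> energy ?N" .
  ultimately show ?thesis by (rule LIMSEQ_unique)
qed

lemma measure_tuples_mass_tuple:
  assumes "\<nu> \<in> measure_tuples p \<Gamma> r"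
  shows "mass_tuple \<nu>"
  unfolding mass_tuple_def
proof (intro ballI conjI)
  fix i assume i: "i \<in> {1..p}"
  have *: "sets (\<nu> i) = sets borel" "msupport (\<nu> i) \<subseteq> \<Gamma> i" "emeasure (\<nu> i) (\<Gamma> i) = ennreal (r i)"
    using PiE_mem[OF assms[unfolded measure_tuples_def] i] unfolding borel_measures_on_def by auto
  then show "sets (\<nu> i) = sets borel" "emeasure (\<nu> i) (\<Gamma> i) = ennreal (r i)" by auto
  show "emeasure (\<nu> i) (- \<Gamma> i) = 0"
    using null_complement_msupport[OF *(1,2)] Gamma_compact[OF i] compact_imp_closed by blast
qed

text \<open>The components are the restrictions to the intervals, which are disjoint and carry the whole mass.\<close>

lemma admissible_tuple:
  assumes "admissible N"
  shows "\<exists>\<nu>\<in>measure_tuples p \<Gamma> r. sum_measure {1..p} \<nu> = N"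
proof -
  interpret N: real_distribution N using assms by (simp add: admissible_def)
  define \<nu> where "\<nu> = (\<lambda>i\<in>{1..p}. density N (\<lambda>x. indicator (\<Gamma> i) x))"
  have s: "sets (\<nu> i) = sets borel" if "i \<in> {1..p}" for i using that by (simp add: \<nu>_def)
  have e: "emeasure (\<nu> i) A = emeasure N (A \<inter> \<Gamma> i)" if i: "i \<in> {1..p}" and A[measurable]: "A \<in> sets borel" for i A
  proof -
    have [measurable]: "\<Gamma> i \<in> sets borel" using i by simp
    have "emeasure (\<nu> i) A = (\<integral>\<^sup>+x. indicator (\<Gamma> i) x * indicator A x \<partial>N)"
      using i unfolding \<nu>_def by (simp add: emeasure_density)
    also have "\<dots> = (\<integral>\<^sup>+x. indicator (A \<inter> \<Gamma> i) x \<partial>N)"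
      by (intro nn_integral_cong) (auto simp: indicator_def)
    finally show ?thesis by simp
  qed
  have "\<nu> \<in> measure_tuples p \<Gamma> r"
    unfolding measure_tuples_def
  proof (rule PiE_I)
    fix i assume i: "i \<in> {1..p}"
    have "msupport (\<nu> i) \<subseteq> \<Gamma> i"
    proof
      fix x assume x: "x \<in> msupport (\<nu> i)"
      show "x \<in> \<Gamma> i"
      proof (rule ccontr)
        assume "x \<notin> \<Gamma> i"
        moreover have "open (- \<Gamma> i)" using Gamma_compact[OF i] compact_imp_closed by blast
        ultimately have "emeasure (\<nu> i) (- \<Gamma> i) > 0" using x unfolding msupport_def by blast
        then show False using i by (subst (asm) e) auto
      qed
    qed
    moreover have "emeasure (\<nu> i) (\<Gamma> i) = ennreal (r i)"
      using assms i by (subst e) (auto simp: N.emeasure_eq_measure admissible_def)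
    ultimately show "\<nu> i \<in> {\<nu> \<in> borel_measures_on (\<Gamma> i). emeasure \<nu> (\<Gamma> i) = ennreal (r i)}"
      using s[OF i] by (simp add: borel_measures_on_def)
  qed (auto simp: \<nu>_def restrict_def)
  moreover have "sum_measure {1..p} \<nu> = N"
  proof (rule measure_eqI)
    show "sets (sum_measure {1..p} \<nu>) = sets N"
      using sets_sum_measure[of "{1..p}" \<nu>] s by simp
    fix A assume "A \<in> sets (sum_measure {1..p} \<nu>)"
    then have A: "A \<in> sets borel" using sets_sum_measure[of "{1..p}" \<nu>] s by simp
    have "emeasure (sum_measure {1..p} \<nu>) A = (\<Sum>i=1..p. emeasure N (A \<inter> \<Gamma> i))"
      using A s by (subst emeasure_sum_measure) (auto simp: e)
    also have "\<dots> = emeasure N (\<Union>i\<in>{1..p}. A \<inter> \<Gamma> i)"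
    proof (rule sum_emeasure)
      show "disjoint_family_on (\<lambda>i. A \<inter> \<Gamma> i) {1..p}"
        unfolding disjoint_family_on_def using Gamma_disjoint by blast
    qed (use A in auto)
    also have "\<dots> = emeasure N A"
      by (rule emeasure_eq_AE) (use admissible_AE_G[OF assms] A in \<open>auto elim!: eventually_mono simp: G_def\<close>)
    finally show "emeasure (sum_measure {1..p} \<nu>) A = emeasure N A" .
  qed
  ultimately show ?thesis by blast
qed

lemma tuple_unique:
  assumes "\<nu> \<in> measure_tuples p \<Gamma> r" "\<nu>' \<in> measure_tuples p \<Gamma> r" "sum_measure {1..p} \<nu> = sum_measure {1..p} \<nu>'"
  shows "\<nu> = \<nu>'"
proof (rule PiE_ext[OF assms(1)[unfolded measure_tuples_def] assms(2)[unfolded measure_tuples_def]])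
  fix i assume i: "i \<in> {1..p}"
  note c = measure_tuples_mass_tuple[OF assms(1)] measure_tuples_mass_tuple[OF assms(2)]
  show "\<nu> i = \<nu>' i"
  proof (rule measure_eqI)
    show "sets (\<nu> i) = sets (\<nu>' i)" using mass_tupleD(1)[OF c(1) i] mass_tupleD(1)[OF c(2) i] by simp
    fix A assume "A \<in> sets (\<nu> i)"
    then have A: "A \<in> sets borel" using mass_tupleD(1)[OF c(1) i] by simp
    show "emeasure (\<nu> i) A = emeasure (\<nu>' i) A"
      unfolding mass_tuple_sum(1)[OF c(1) i A] mass_tuple_sum(1)[OF c(2) i A] assms(3) ..
  qed
qed

text \<open>Tuples and admissible measures correspond one to one with equal energies, so the unique admissible
  minimizer gives the unique minimizing tuple selected by the definition of the equilibrium measure.\<close>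

theorem equilibrium_measure_minimizes:
  obtains e where "admissible (equilibrium_measure p \<Gamma> r Q)" "\<And>N. admissible N \<Longrightarrow> ereal e \<le> energy N" 
    "energy (equilibrium_measure p \<Gamma> r Q) = ereal e"
    "\<And>N. admissible N \<Longrightarrow> energy N \<le> ereal e \<Longrightarrow> N = equilibrium_measure p \<Gamma> r Q"
proof -
  obtain N e where N: "admissible N" "energy N = ereal e" "\<And>N'. admissible N' \<Longrightarrow> ereal e \<le> energy N'"
    using minimizer_exists by blast
  have uniq: "N' = N" if "admissible N'" "energy N' \<le> ereal e" for N'
    by (rule minimizer_unique[OF that(1) N(1) that(2)]) (use N in auto)
  obtain \<nu> where \<nu>: "\<nu> \<in> measure_tuples p \<Gamma> r" "sum_measure {1..p} \<nu> = N" using admissible_tuple[OF N(1)] by blast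
  have we: "weighted_energy p \<Gamma> Q \<mu> = energy (sum_measure {1..p} \<mu>)" "admissible (sum_measure {1..p} \<mu>)" if "\<mu> \<in> measure_tuples p \<Gamma> r" for \<mu>
    using weighted_energy_eq_energy mass_tuple_sum(2) measure_tuples_mass_tuple[OF that] by auto
  have "equilibrium_tuple p \<Gamma> r Q = \<nu>"
    unfolding equilibrium_tuple_def
  proof (rule the_equality)
    show "is_arg_min (weighted_energy p \<Gamma> Q) (\<lambda>\<nu>. \<nu> \<in> measure_tuples p \<Gamma> r) \<nu>"
      unfolding is_arg_min_def using \<nu> we N by (auto simp: not_less)
    fix \<mu> assume "is_arg_min (weighted_energy p \<Gamma> Q) (\<lambda>\<nu>. \<nu> \<in> measure_tuples p \<Gamma> r) \<mu>"
    then have \<mu>: "\<mu> \<in> measure_tuples p \<Gamma> r" "\<not> weighted_energy p \<Gamma> Q \<nu> < weighted_energy p \<Gamma> Q \<mu>"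
      using \<nu>(1) unfolding is_arg_min_def by auto
    then have "energy (sum_measure {1..p} \<mu>) \<le> ereal e" using we[OF \<mu>(1)] we[OF \<nu>(1)] \<nu>(2) N(2) by (simp add: not_less)
    then have "sum_measure {1..p} \<mu> = N" using uniq we[OF \<mu>(1)] by blast
    then show "\<mu> = \<nu>" using tuple_unique[OF \<mu>(1) \<nu>(1)] \<nu>(2) by simp
  qed
  then have "equilibrium_measure p \<Gamma> r Q = N" unfolding equilibrium_measure_def using \<nu>(2) by simp
  then show ?thesis using that N uniq by blast
qed

end

section \<open>The ensemble weight as a product over pairs\<close>

locale multi_index = angelesco_intervals +
  fixes nn :: "nat \<Rightarrow> nat"
  assumes nn_pos: "\<And>i. i \<in> {1..p} \<Longrightarrow> nn i \<ge> 1"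
begin

definition n :: nat where "n = msize p nn"
definition off :: "nat \<Rightarrow> nat" where "off i = (\<Sum>l=1..<i. nn l)"
abbreviation blk :: "nat \<Rightarrow> nat" where "blk \<equiv> block_of nn"

lemma off_Suc: "i \<ge> 1 \<Longrightarrow> off (Suc i) = off i + nn i"
  by (simp add: off_def)

lemma off_mono: "i \<le> j \<Longrightarrow> off i \<le> off j"
  unfolding off_def by (rule sum_mono2) auto

lemma off_1: "off 1 = 0" "off (Suc 0) = 0" by (simp_all add: off_def)

lemma off_upto: "(\<Sum>l=1..i. nn l) = off (Suc i)"
  by (simp add: off_def atLeastLessThanSuc_atLeastAtMost)

lemma off_last: "off (Suc p) = n"
  by (simp add: n_def msize_def off_upto[symmetric])

lemma block_of_eq: "block_of nn m = (LEAST i. m \<le> off (Suc i))"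
  unfolding block_of_def off_upto ..

lemma block_of_off:
  assumes "i \<in> {1..p}" "k \<in> {1..nn i}"
  shows "blk (off i + k) = i"
  unfolding block_of_eq
proof (rule Least_equality)
  show "off i + k \<le> off (Suc i)" using assms off_Suc[of i] by simp
  fix y assume y: "off i + k \<le> off (Suc y)"
  show "i \<le> y"
  proof (rule ccontr)
    assume "\<not> i \<le> y"
    then have "off (Suc y) \<le> off i" by (intro off_mono) simp
    then show False using y assms by simp
  qed
qed

lemma blk_bounds:
  assumes "m \<in> {1..n}"
  shows "blk m \<in> {1..p}" "off (blk m) < m" "m \<le> off (blk m) + nn (blk m)"
proof -
  have pair_exp: "m \<le> off (Suc p)" using assms off_last by simp
  have 1: "m \<le> off (Suc (blk m))" unfolding block_of_eq by (rule LeastI[where P = "\<lambda>i. m \<le> off (Suc i)", OF pair_exp])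
  have 2: "blk m \<le> p" unfolding block_of_eq by (rule Least_le[where P = "\<lambda>i. m \<le> off (Suc i)", OF pair_exp])
  have 3: "blk m \<noteq> 0"
  proof
    assume "blk m = 0"
    then show False using 1 assms off_1 by simp
  qed
  then show "blk m \<in> {1..p}" using 2 by simp
  have "\<not> m \<le> off (Suc (blk m - 1))" unfolding block_of_eq by (rule not_less_Least[where P = "\<lambda>i. m \<le> off (Suc i)"]) (use 3 block_of_eq[of m] in simp)
  then show "off (blk m) < m" using 3 by simp
  show "m \<le> off (blk m) + nn (blk m)" using 1 off_Suc[of "blk m"] 3 by simp
qed

lemma blk_mono: "m \<in> {1..n} \<Longrightarrow> m' \<in> {1..n} \<Longrightarrow> m' \<le> m \<Longrightarrow> blk m' \<le> blk m"
  unfolding block_of_eq[of m']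
proof (rule Least_le)
  assume m: "m \<in> {1..n}" "m' \<in> {1..n}" "m' \<le> m"
  have "m \<le> off (Suc (blk m))" using blk_bounds(3)[OF m(1)] off_Suc[of "blk m"] blk_bounds(1)[OF m(1)] by simp
  then show "m' \<le> off (Suc (blk m))" using m by simp
qed

lemma position_bij: "bij_betw (\<lambda>(i,k). off i + k) (SIGMA i:{1..p}. {1..nn i}) {1..n}"
proof (rule bij_betw_byWitness[where f' = "\<lambda>m. (blk m, m - off (blk m))"])
  show "\<forall>z\<in>(SIGMA i:{1..p}. {1..nn i}). (\<lambda>m. (blk m, m - off (blk m))) ((\<lambda>(i,k). off i + k) z) = z"
    by (auto simp: block_of_off)
  show "\<forall>m\<in>{1..n}. (\<lambda>(i,k). off i + k) (blk m, m - off (blk m)) = m"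
    using blk_bounds(2) by (auto simp: less_imp_le)
  show "(\<lambda>(i,k). off i + k) ` (SIGMA i:{1..p}. {1..nn i}) \<subseteq> {1..n}"
  proof safe
    fix i k assume "i \<in> {1..p}" "k \<in> {1..nn i}"
    then have "off i + k \<le> off (Suc i)" "off (Suc i) \<le> off (Suc p)" using off_Suc[of i] off_mono[of "Suc i" "Suc p"] by auto
    then show "off i + k \<in> {1..n}" using off_last \<open>k \<in> {1..nn i}\<close> by simp
  qed
  show "(\<lambda>m. (blk m, m - off (blk m))) ` {1..n} \<subseteq> (SIGMA i:{1..p}. {1..nn i})"
    using blk_bounds by (fastforce simp: le_diff_conv)
qed

lemma prod_positions: "(\<Prod>m=1..n. F m) = (\<Prod>i=1..p. \<Prod>k=1..nn i. F (off i + k))"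
  for F :: "nat \<Rightarrow> 'a::comm_monoid_mult"
proof -
  have "(\<Prod>m=1..n. F m) = (\<Prod>(i,k)\<in>(SIGMA i:{1..p}. {1..nn i}). F (off i + k))"
    using prod.reindex_bij_betw[OF position_bij, of F] by (simp add: case_prod_beta)
  also have "\<dots> = (\<Prod>i=1..p. \<Prod>k=1..nn i. F (off i + k))"
    by (rule prod.Sigma[symmetric]) auto
  finally show ?thesis .
qed

lemma sum_positions: "(\<Sum>m=1..n. F m) = (\<Sum>i=1..p. \<Sum>k=1..nn i. F (off i + k))"
  for F :: "nat \<Rightarrow> 'a::comm_monoid_add"
proof -
  have "(\<Sum>m=1..n. F m) = (\<Sum>(i,k)\<in>(SIGMA i:{1..p}. {1..nn i}). F (off i + k))"
    using sum.reindex_bij_betw[OF position_bij, of F] by (simp add: case_prod_beta)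
  also have "\<dots> = (\<Sum>i=1..p. \<Sum>k=1..nn i. F (off i + k))"
    by (rule sum.Sigma[symmetric]) auto
  finally show ?thesis .
qed

lemma sum_blk: "(\<Sum>m=1..n. g (blk m)) = (\<Sum>i=1..p. real (nn i) * g i)"
  unfolding sum_positions by (intro sum.cong refl) (simp add: block_of_off)

lemma n_sum: "real n = (\<Sum>i=1..p. real (nn i))"
  by (simp add: n_def msize_def)

lemma n_pos: "n \<ge> 1"
proof -
  have "nn 1 \<le> (\<Sum>i=1..p. nn i)" by (rule member_le_sum) (use p_ge in auto)
  then show ?thesis using nn_pos[of 1] p_ge by (simp add: n_def msize_def)
qed

lemma prod_initial:
  fixes F :: "nat \<Rightarrow> 'a::comm_monoid_mult"
  assumes "1 \<le> i" and k1: "1 \<le> k"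
  shows "(\<Prod>m=1..<off i + k. F m) = (\<Prod>j=1..<i. \<Prod>l=1..nn j. F (off j + l)) * (\<Prod>l=1..<k. F (off i + l))"
proof -
  have a: "(\<Prod>m=1..off i. F m) = (\<Prod>j=1..<i. \<Prod>l=1..nn j. F (off j + l))"
    using assms(1)
  proof (induction i rule: dec_induct)
    case base then show ?case by (simp add: off_1)
  next
    case (step i)
    have "(\<Prod>m=1..off (Suc i). F m) = (\<Prod>m=1..off i. F m) * (\<Prod>m\<in>{off i + 1..off i + nn i}. F m)"
      using off_Suc[of i] step.hyps prod.ub_add_nat[of 1 "off i" F "nn i"] by simp
    also have "(\<Prod>m\<in>{off i + 1..off i + nn i}. F m) = (\<Prod>l=1..nn i. F (off i + l))"
      using prod.shift_bounds_cl_nat_ivl[of F 1 "off i" "nn i"] by (simp add: add.commute)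
    finally show ?case using step by simp
  qed
  have "{1..<off i + k} = {1..<Suc (off i)} \<union> {Suc (off i)..<off i + k}" using k1 by auto
  then have "(\<Prod>m=1..<off i + k. F m) = prod F ({1..<Suc (off i)} \<union> {Suc (off i)..<off i + k})"
    by (simp only:)
  also have "\<dots> = (\<Prod>m=1..<Suc (off i). F m) * (\<Prod>m\<in>{Suc (off i)..<off i + k}. F m)"
    by (rule prod.union_disjoint) auto
  also have "(\<Prod>m=1..<Suc (off i). F m) = (\<Prod>m=1..off i. F m)" by (simp add: atLeastLessThanSuc_atLeastAtMost)
  also have "(\<Prod>m\<in>{Suc (off i)..<off i + k}. F m) = (\<Prod>l=1..<k. F (off i + l))"
    using prod.shift_bounds_nat_ivl[of F 1 "off i" k] by (simp add: add.commute)
  finally show ?thesis using a by simp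
qed

text \<open>The squared Vandermonde factors give the exponent 2 within a block, the mixed ones the exponent 1.\<close>

definition pair_exp :: "nat \<Rightarrow> nat \<Rightarrow> nat" where "pair_exp m m' = (if blk m = blk m' then 2 else 1)"

definition pairs :: "(nat \<times> nat) set" where "pairs = (SIGMA m:{1..n}. {1..<m})"

lemma finite_pairs [simp]: "finite pairs" by (simp add: pairs_def)

lemma pairsD: "(m, m') \<in> pairs \<Longrightarrow> m \<in> {1..n} \<and> m' \<in> {1..n} \<and> m' < m" by (auto simp: pairs_def)

lemma angelesco_weight_pairs:
  "angelesco_weight p Q nn X = (\<Prod>(m,m')\<in>pairs. (X m - X m') ^ pair_exp m m') * exp (- 2 * real n * (\<Sum>m=1..n. Q (blk m) (X m)))"
proof -
  have bk: "block nn X i k = X (off i + k)" for i k by (simp add: block_def off_def)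
  have e: "(\<Sum>i=1..p. \<Sum>j=1..nn i. Q i (block nn X i j)) = (\<Sum>m=1..n. Q (blk m) (X m))"
    unfolding sum_positions bk by (intro sum.cong refl) (simp add: block_of_off)
  have "(\<Prod>(m,m')\<in>pairs. (X m - X m') ^ pair_exp m m') = (\<Prod>m=1..n. \<Prod>m'=1..<m. (X m - X m') ^ pair_exp m m')"
    unfolding pairs_def by (rule prod.Sigma[symmetric]) auto
  also have "\<dots> = (\<Prod>i=1..p. \<Prod>k=1..nn i. \<Prod>m'=1..<off i + k. (X (off i + k) - X m') ^ pair_exp (off i + k) m')"
    unfolding prod_positions ..
  also have "\<dots> = (\<Prod>i=1..p. \<Prod>k=1..nn i. (\<Prod>j=1..<i. \<Prod>l=1..nn j. (X (off i + k) - X (off j + l)))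
      * (\<Prod>l=1..<k. (X (off i + k) - X (off i + l))\<^sup>2))"
  proof (intro prod.cong refl)
    fix i k assume i: "i \<in> {1..p}" and k: "k \<in> {1..nn i}"
    have "(\<Prod>m'=1..<off i + k. (X (off i + k) - X m') ^ pair_exp (off i + k) m')
       = (\<Prod>j=1..<i. \<Prod>l=1..nn j. (X (off i + k) - X (off j + l)) ^ pair_exp (off i + k) (off j + l)) 
         * (\<Prod>l=1..<k. (X (off i + k) - X (off i + l)) ^ pair_exp (off i + k) (off i + l))"
      by (rule prod_initial) (use i k in auto)
    also have "\<dots> = (\<Prod>j=1..<i. \<Prod>l=1..nn j. (X (off i + k) - X (off j + l))) 
         * (\<Prod>l=1..<k. (X (off i + k) - X (off i + l))\<^sup>2)"
      using i k by (intro arg_cong2[of _ _ _ _ "(*)"] prod.cong refl) (auto simp: pair_exp_def block_of_off)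
    finally show "(\<Prod>m'=1..<off i + k. (X (off i + k) - X m') ^ pair_exp (off i + k) m') = \<dots>" .
  qed
  also have "\<dots> = (\<Prod>i=1..p. \<Prod>k=1..nn i. \<Prod>j=1..<i. \<Prod>l=1..nn j. (X (off i + k) - X (off j + l)))
      * (\<Prod>i=1..p. \<Prod>k=1..nn i. \<Prod>l=1..<k. (X (off i + k) - X (off i + l))\<^sup>2)"
    by (simp add: prod.distrib)
  also have "(\<Prod>i=1..p. \<Prod>k=1..nn i. \<Prod>l=1..<k. (X (off i + k) - X (off i + l))\<^sup>2) = (\<Prod>i=1..p. (vandermonde (nn i) (block nn X i))\<^sup>2)"
    unfolding vandermonde_def bk by (simp add: prod_power_distrib)
  also have "(\<Prod>i=1..p. \<Prod>k=1..nn i. \<Prod>j=1..<i. \<Prod>l=1..nn j. (X (off i + k) - X (off j + l)))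
     = (\<Prod>i=1..p. \<Prod>j=1..<i. cross_vandermonde (nn i) (block nn X i) (nn j) (block nn X j))"
    unfolding cross_vandermonde_def bk by (intro prod.cong refl prod.swap)
  also have "\<dots> = (\<Prod>(i,j)\<in>(SIGMA i:{1..p}. {1..<i}). cross_vandermonde (nn i) (block nn X i) (nn j) (block nn X j))"
    by (rule prod.Sigma) auto
  also have "\<dots> = (\<Prod>(i,j)\<in>(SIGMA i:{1..p}. {i<..p}). cross_vandermonde (nn j) (block nn X j) (nn i) (block nn X i))"
    by (rule prod.reindex_bij_witness[of _ "\<lambda>(i,j). (j,i)" "\<lambda>(i,j). (j,i)"]) auto
  also have "\<dots> = (\<Prod>i=1..p. \<Prod>j\<in>{i<..p}. cross_vandermonde (nn j) (block nn X j) (nn i) (block nn X i))"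
    by (rule prod.Sigma[symmetric]) auto
  finally show ?thesis unfolding angelesco_weight_def e by (simp add: n_def mult.commute)
qed

definition region :: "(nat \<Rightarrow> real) set" where "region = (\<Pi>\<^sub>E m\<in>{1..n}. \<Gamma> (blk m))"

lemma regionD: assumes "X \<in> region" "m \<in> {1..n}" shows "X m \<in> \<Gamma> (blk m)" "X m \<in> G"
proof -
  show *: "X m \<in> \<Gamma> (blk m)" using PiE_mem[OF assms[unfolded region_def]] .
  then show "X m \<in> G" using blk_bounds(1)[OF assms(2)] unfolding G_def by blast
qed

text \<open>Different blocks take values in intervals that lie in the order of the blocks, so the factors with
  exponent 1 are positive.\<close>

lemma region_factor:
  assumes "X \<in> region" "(m, m') \<in> pairs"
  shows "(X m - X m') ^ pair_exp m m' = \<bar>X m - X m'\<bar> ^ pair_exp m m'"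
proof (cases "blk m = blk m'")
  case True
  then show ?thesis by (simp add: pair_exp_def)
next
  case False
  have m: "m \<in> {1..n}" "m' \<in> {1..n}" "m' < m" using pairsD[OF assms(2)] by auto
  then have "blk m' < blk m" using blk_mono[of m m'] False by simp
  then have "X m' < X m"
    using Gamma_less[of "blk m'" "blk m" "X m'" "X m"] blk_bounds(1)[OF m(1)] blk_bounds(1)[OF m(2)] regionD[OF assms(1)] m by auto
  then show ?thesis by simp
qed

lemma weight_abs:
  assumes "X \<in> region"
  shows "angelesco_weight p Q nn X = (\<Prod>(m,m')\<in>pairs. \<bar>X m - X m'\<bar> ^ pair_exp m m') * exp (- 2 * real n * (\<Sum>m=1..n. Q_ext (X m)))"
proof -
  have "(\<Prod>(m,m')\<in>pairs. (X m - X m') ^ pair_exp m m') = (\<Prod>(m,m')\<in>pairs. \<bar>X m - X m'\<bar> ^ pair_exp m m')"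
    by (rule prod.cong[OF refl]) (use region_factor[OF assms] in auto)
  moreover have "(\<Sum>m=1..n. Q (blk m) (X m)) = (\<Sum>m=1..n. Q_ext (X m))"
    by (intro sum.cong refl Q_ext_eq[symmetric] blk_bounds(1) regionD assms)
  ultimately show ?thesis unfolding angelesco_weight_pairs by simp
qed

text \<open>Minus the logarithm of the weight, with the regularised kernel in place of the logarithm. It stays
  finite when coordinates coincide.\<close>

definition neg_log_weight :: "nat \<Rightarrow> (nat \<Rightarrow> real) \<Rightarrow> real" where
  "neg_log_weight M X = (\<Sum>(m,m')\<in>pairs. real (pair_exp m m') * ell M (X m) (X m')) + 2 * real n * (\<Sum>m=1..n. Q_ext (X m))"

lemma weight_lower_imp_neg_log_weight:
  assumes X: "X \<in> region" and v: "angelesco_weight p Q nn X \<ge> exp (- v)"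
  shows "neg_log_weight M X \<le> v"
proof -
  have pos: "angelesco_weight p Q nn X > 0" using v by (rule less_le_trans[OF exp_gt_zero])
  then have ne: "(\<Prod>(m,m')\<in>pairs. \<bar>X m - X m'\<bar> ^ pair_exp m m') \<noteq> 0"
    unfolding weight_abs[OF X] by (metis less_irrefl mult_zero_left)
  have d: "X m \<noteq> X m'" if "(m,m') \<in> pairs" for m m'
  proof -
    have "(case (m, m') of (m,m') \<Rightarrow> \<bar>X m - X m'\<bar> ^ pair_exp m m') \<noteq> 0"
      using ne[unfolded prod_zero_iff[OF finite_pairs]] that by blast
    then show ?thesis by (auto simp: pair_exp_def split: if_splits)
  qed
  have "- v \<le> ln (angelesco_weight p Q nn X)" using v pos by (simp add: ln_ge_iff)
  also have "\<dots> = ln (\<Prod>(m,m')\<in>pairs. \<bar>X m - X m'\<bar> ^ pair_exp m m') + - 2 * real n * (\<Sum>m=1..n. Q_ext (X m))"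
    unfolding weight_abs[OF X] using d by (subst ln_mult_pos) (auto intro!: prod_pos)
  also have "ln (\<Prod>(m,m')\<in>pairs. \<bar>X m - X m'\<bar> ^ pair_exp m m') = (\<Sum>(m,m')\<in>pairs. real (pair_exp m m') * ln \<bar>X m - X m'\<bar>)"
    by (subst ln_prod) (use d in \<open>auto intro!: sum.cong simp: ln_realpow\<close>)
  finally have "v \<ge> (\<Sum>(m,m')\<in>pairs. real (pair_exp m m') * - ln \<bar>X m - X m'\<bar>) + 2 * real n * (\<Sum>m=1..n. Q_ext (X m))"
    by (simp add: sum_negf case_prod_beta)
  moreover have "(\<Sum>(m,m')\<in>pairs. real (pair_exp m m') * ell M (X m) (X m')) \<le> (\<Sum>(m,m')\<in>pairs. real (pair_exp m m') * - ln \<bar>X m - X m'\<bar>)"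
  proof (rule sum_mono)
    fix z assume z: "z \<in> pairs"
    obtain m m' where zz: "z = (m, m')" by (cases z)
    have "ell M (X m) (X m') \<le> - ln \<bar>X m - X m'\<bar>"
      by (rule ell_le_log) (use z zz pairsD regionD[OF X] d in auto)
    then show "(case z of (m,m') \<Rightarrow> real (pair_exp m m') * ell M (X m) (X m')) \<le> (case z of (m,m') \<Rightarrow> real (pair_exp m m') * - ln \<bar>X m - X m'\<bar>)"
      unfolding zz prod.case by (rule mult_left_mono) simp
  qed
  ultimately show ?thesis unfolding neg_log_weight_def by linarith
qed

text \<open>A bound uniform in the regularisation excludes coinciding coordinates, because the kernel diverges
  on the diagonal; off the diagonal it converges to the logarithm.\<close>

lemma neg_log_weight_imp_weight_lower:
  assumes X: "X \<in> region" and v: "\<And>M. neg_log_weight M X \<le> v"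
  shows "angelesco_weight p Q nn X \<ge> exp (- v)"
proof -
  have d: "X m \<noteq> X m'" if mm: "(m,m') \<in> pairs" for m m'
  proof
    assume eq: "X m = X m'"
    have "real (pair_exp m m') * (ell M (X m) (X m') + (ln rad + 9)) \<le> (\<Sum>(m,m')\<in>pairs. real (pair_exp m m') * (ell M (X m) (X m') + (ln rad + 9)))" for M
    proof -
      define h where "h z = (case z of (m,m') \<Rightarrow> real (pair_exp m m') * (ell M (X m) (X m') + (ln rad + 9)))" for z
      have "0 \<le> ell M x y + (ln rad + 9)" for x y using ell_lower[of M x y] by linarith
      then have "0 \<le> h z" for z unfolding h_def by (cases z) simp
      then have "h (m, m') \<le> sum h pairs" using member_le_sum[OF mm, of h] by simp
      then show ?thesis unfolding h_def by simp
    qed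
    moreover have "(\<Sum>(m,m')\<in>pairs. real (pair_exp m m') * (ell M (X m) (X m') + (ln rad + 9)))
       = (neg_log_weight M X - 2 * real n * (\<Sum>m=1..n. Q_ext (X m))) + (\<Sum>(m,m')\<in>pairs. real (pair_exp m m')) * (ln rad + 9)" for M
      unfolding neg_log_weight_def by (simp add: case_prod_beta distrib_left sum.distrib sum_distrib_right[symmetric] del: sum_distrib_right)
    moreover define w where "w = v - 2 * real n * (\<Sum>m=1..n. Q_ext (X m)) + (\<Sum>(m,m')\<in>pairs. real (pair_exp m m')) * (ln rad + 9)"
    ultimately have b: "real (pair_exp m m') * (ell M (X m) (X m) + (ln rad + 9)) \<le> w" for M
      using v[of M] eq by (smt (verit))
    have e1: "1 \<le> real (pair_exp m m')" by (simp add: pair_exp_def)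
    have "eventually (\<lambda>M. \<bar>w\<bar> + 1 \<le> ell M (X m) (X m)) sequentially"
      using ell_diag_lim[of "X m", unfolded filterlim_at_top] by blast
    then obtain M where M: "\<bar>w\<bar> + 1 \<le> ell M (X m) (X m)" by (auto simp: eventually_sequentially)
    have "0 \<le> ln rad" using rad(1) by simp
    then have "ell M (X m) (X m) + (ln rad + 9) \<le> real (pair_exp m m') * (ell M (X m) (X m) + (ln rad + 9))"
      using e1 M mult_right_mono[OF e1, of "ell M (X m) (X m) + (ln rad + 9)"] by simp
    then show False using b[of M] M \<open>0 \<le> ln rad\<close> by linarith
  qed
  have "(\<lambda>M. neg_log_weight M X) \<longlonglongrightarrow> (\<Sum>(m,m')\<in>pairs. real (pair_exp m m') * - ln \<bar>X m - X m'\<bar>) + 2 * real n * (\<Sum>m=1..n. Q_ext (X m))"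
    unfolding neg_log_weight_def case_prod_beta
  proof (intro tendsto_add tendsto_sum tendsto_mult tendsto_const)
    fix z assume z: "z \<in> pairs"
    then have zz: "(fst z, snd z) \<in> pairs" by simp
    show "(\<lambda>M. ell M (X (fst z)) (X (snd z))) \<longlonglongrightarrow> - ln \<bar>X (fst z) - X (snd z)\<bar>"
      by (rule ell_lim) (use zz pairsD[OF zz] regionD[OF X] d[OF zz] in auto)
  qed
  then have le: "(\<Sum>(m,m')\<in>pairs. real (pair_exp m m') * - ln \<bar>X m - X m'\<bar>) + 2 * real n * (\<Sum>m=1..n. Q_ext (X m)) \<le> v"
    by (rule LIMSEQ_le_const2) (use v in auto)
  have "ln (\<Prod>(m,m')\<in>pairs. \<bar>X m - X m'\<bar> ^ pair_exp m m') = (\<Sum>(m,m')\<in>pairs. real (pair_exp m m') * ln \<bar>X m - X m'\<bar>)"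
    by (subst ln_prod) (use d in \<open>auto intro!: sum.cong simp: ln_realpow\<close>)
  moreover have pp: "(\<Prod>(m,m')\<in>pairs. \<bar>X m - X m'\<bar> ^ pair_exp m m') > 0"
    using d by (auto intro!: prod_pos)
  ultimately have "(\<Prod>(m,m')\<in>pairs. \<bar>X m - X m'\<bar> ^ pair_exp m m') = exp (\<Sum>(m,m')\<in>pairs. real (pair_exp m m') * ln \<bar>X m - X m'\<bar>)"
    using exp_ln[OF pp] by simp
  then have "angelesco_weight p Q nn X = exp ((\<Sum>(m,m')\<in>pairs. real (pair_exp m m') * ln \<bar>X m - X m'\<bar>) + - 2 * real n * (\<Sum>m=1..n. Q_ext (X m)))"
    unfolding weight_abs[OF X] exp_add by simp
  then show ?thesis using le by (simp add: sum_negf case_prod_beta)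
qed

end

context angelesco_intervals
begin

section \<open>Configurations of nearly minimal energy\<close>

definition coupling_coeff :: "nat \<Rightarrow> nat \<Rightarrow> real" where "coupling_coeff i j = (if i = j then 1 else 1/2)"

text \<open>The mean of the regularised kernel over two independent points from the normalised components;
  \<open>mean_Q\<close> below is the corresponding mean of the external field.\<close>

definition mean_ell :: "(nat \<Rightarrow> real measure) \<Rightarrow> nat \<Rightarrow> nat \<Rightarrow> nat \<Rightarrow> real" where
  "mean_ell \<nu> M i j = dbl (\<nu> i) (\<nu> j) (ell M) / (r i * r j)"

definition mean_Q :: "(nat \<Rightarrow> real measure) \<Rightarrow> nat \<Rightarrow> real" where
  "mean_Q \<nu> i = (\<integral>x. Q_ext x \<partial>\<nu> i) / r i"

lemma abs_mean_Q_le: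
  assumes c: "mass_tuple \<nu>" and i: "i \<in> {1..p}"
  shows "\<bar>mean_Q \<nu> i\<bar> \<le> Q_bound"
proof -
  interpret finite_measure "\<nu> i" by (rule mass_tupleD[OF c i])
  note [measurable_cong] = mass_tupleD(1)[OF c i]
  have "\<bar>\<integral>x. Q_ext x \<partial>\<nu> i\<bar> \<le> (\<integral>x. \<bar>Q_ext x\<bar> \<partial>\<nu> i)" by (rule integral_abs_bound)
  also have "\<dots> \<le> (\<integral>x. Q_bound \<partial>\<nu> i)"
    by (intro integral_mono integrable_const_bound[where B = Q_bound]) (use abs_Q_ext_le Q_bound_nonneg in auto)
  also have "\<dots> = r i * Q_bound" using mass_tupleD[OF c i] by simp
  finally show ?thesis unfolding mean_Q_def using r_pos[OF i] by (simp add: field_simps)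
qed

lemma mean_ell_lower:
  assumes c: "mass_tuple \<nu>" and i: "i \<in> {1..p}" and j: "j \<in> {1..p}"
  shows "- (ln rad + 9) \<le> mean_ell \<nu> M i j"
proof -
  interpret two_finite_borel "\<nu> i" "\<nu> j" by (rule mass_tuple_two[OF c i j])
  have "dbl (\<nu> i) (\<nu> j) (\<lambda>x y. - (ln rad + 9)) \<le> dbl (\<nu> i) (\<nu> j) (ell M)"
    by (rule dbl_mono) (use ell_lower in \<open>auto simp: algebra_simps\<close>)
  then have "r i * r j * - (ln rad + 9) \<le> dbl (\<nu> i) (\<nu> j) (ell M)"
    using mass_tupleD(2,5)[OF c i] mass_tupleD(2,5)[OF c j] by (simp add: dbl_const)
  then show ?thesis unfolding mean_ell_def using r_pos[OF i] r_pos[OF j] by (simp add: pos_le_divide_eq mult.commute)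
qed

lemma Phi_mean_ell:
  assumes c: "mass_tuple \<nu>"
  shows "Phi M (sum_measure {1..p} \<nu>) (sum_measure {1..p} \<nu>)
     = (\<Sum>i=1..p. \<Sum>j=1..p. r i * r j * (coupling_coeff i j * mean_ell \<nu> M i j)) + 2 * (\<Sum>i=1..p. r i * mean_Q \<nu> i)"
proof -
  have "Phi M (sum_measure {1..p} \<nu>) (sum_measure {1..p} \<nu>)
    = (\<Sum>i=1..p. \<Sum>j=1..p. r i * r j * (coupling_coeff i j * mean_ell \<nu> M i j) + r j * (r i * mean_Q \<nu> i) + r i * (r j * mean_Q \<nu> j))"
    unfolding mass_tuple_Phi[OF c]
  proof (intro sum.cong refl)
    fix i j assume ij: "i \<in> {1..p}" "j \<in> {1..p}"
    show "dbl (\<nu> i) (\<nu> j) (kern M) = r i * r j * (coupling_coeff i j * mean_ell \<nu> M i j) + r j * (r i * mean_Q \<nu> i) + r i * (r j * mean_Q \<nu> j)"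
      unfolding mass_tuple_dbl_kern[OF c ij] mass_tuple_Q_ext[OF c ij(1), symmetric] mass_tuple_Q_ext[OF c ij(2), symmetric] mean_ell_def mean_Q_def coupling_coeff_def
      using r_pos[OF ij(1)] r_pos[OF ij(2)] by simp
  qed
  also have "\<dots> = (\<Sum>i=1..p. \<Sum>j=1..p. r i * r j * (coupling_coeff i j * mean_ell \<nu> M i j))
        + (\<Sum>i=1..p. \<Sum>j=1..p. r j * (r i * mean_Q \<nu> i)) + (\<Sum>i=1..p. \<Sum>j=1..p. r i * (r j * mean_Q \<nu> j))"
    by (simp only: sum.distrib)
  also have "(\<Sum>i=1..p. \<Sum>j=1..p. r j * (r i * mean_Q \<nu> i)) = (\<Sum>i=1..p. r i * mean_Q \<nu> i)"
    unfolding sum_distrib_right[symmetric] r_sum by simp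
  also have "(\<Sum>i=1..p. \<Sum>j=1..p. r i * (r j * mean_Q \<nu> j)) = (\<Sum>i=1..p. r i * mean_Q \<nu> i)"
    unfolding sum_distrib_left[symmetric] sum_distrib_right[symmetric] r_sum by simp
  finally show ?thesis by simp
qed

text \<open>All the means are bounded below, and their weighted sum is bounded above by the finite energy, so
  each of them is bounded uniformly in \<open>M\<close>. This controls the error from replacing \<open>r i\<close> by \<open>nn i / n\<close>.\<close>

lemma mean_ell_bounded:
  assumes c: "mass_tuple \<nu>" and e: "energy (sum_measure {1..p} \<nu>) = ereal e"
  shows "\<exists>B\<ge>0. \<forall>M. \<forall>i\<in>{1..p}. \<forall>j\<in>{1..p}. \<bar>mean_ell \<nu> M i j\<bar> \<le> B"
proof -
  define c0 where "c0 = ln rad + 9"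
  have c0: "c0 \<ge> 0" unfolding c0_def using rad(1) by simp
  define T where "T = e + 2 * Q_bound + c0"
  define B where "B = (\<Sum>i=1..p. \<Sum>j=1..p. 2 * \<bar>T\<bar> / (r i * r j)) + c0"
  have "\<bar>mean_ell \<nu> M i j\<bar> \<le> B" if i: "i \<in> {1..p}" and j: "j \<in> {1..p}" for M i j
  proof -
    have rr: "0 < r i" "0 < r j" using r_pos i j by auto
    have cp: "0 \<le> coupling_coeff k l" "coupling_coeff k l \<le> 1" "1/2 \<le> coupling_coeff k l" for k l by (auto simp: coupling_coeff_def)
    \<comment> \<open>nonnegative terms, so each is at most the total\<close>
    define t where "t k l = r k * r l * (coupling_coeff k l * (mean_ell \<nu> M k l + c0))" for k l
    have t0: "0 \<le> t k l" if "k \<in> {1..p}" "l \<in> {1..p}" for k l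
      unfolding t_def using r_pos[OF that(1)] r_pos[OF that(2)] cp[of k l] mean_ell_lower[OF c that, of M] 
      by (intro mult_nonneg_nonneg) (auto simp: c0_def)
    have "t i j \<le> (\<Sum>l=1..p. t i l)" by (rule member_le_sum[OF j]) (use t0 i in auto)
    also have "\<dots> \<le> (\<Sum>k=1..p. \<Sum>l=1..p. t k l)"
      by (rule member_le_sum[OF i]) (use t0 in \<open>auto intro: sum_nonneg\<close>)
    also have "\<dots> = (\<Sum>k=1..p. \<Sum>l=1..p. r k * r l * (coupling_coeff k l * mean_ell \<nu> M k l)) + (\<Sum>k=1..p. \<Sum>l=1..p. r k * r l * (coupling_coeff k l * c0))"
      unfolding t_def by (simp add: distrib_left sum.distrib)
    also have "(\<Sum>k=1..p. \<Sum>l=1..p. r k * r l * (coupling_coeff k l * c0)) \<le> (\<Sum>k=1..p. \<Sum>l=1..p. r k * r l * c0)"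
      using cp c0 r_pos by (intro sum_mono mult_left_mono) (auto simp: mult_left_le_one_le intro: less_imp_le)
    also have "\<dots> = c0"
      unfolding sum_distrib_left[symmetric] sum_distrib_right[symmetric] r_sum by (simp add: r_sum)
    also have "(\<Sum>k=1..p. \<Sum>l=1..p. r k * r l * (coupling_coeff k l * mean_ell \<nu> M k l)) \<le> e + 2 * Q_bound"
    proof -
      have "ereal (Phi M (sum_measure {1..p} \<nu>) (sum_measure {1..p} \<nu>)) \<le> ereal e" unfolding e[symmetric] by (rule Phi_le_energy)
      moreover have "- Q_bound \<le> (\<Sum>i=1..p. r i * mean_Q \<nu> i)"
      proof -
        have "(\<Sum>i=1..p. r i * (- Q_bound)) \<le> (\<Sum>i=1..p. r i * mean_Q \<nu> i)"
          using abs_mean_Q_le[OF c] r_pos by (intro sum_mono mult_left_mono) (auto simp: abs_le_iff less_imp_le minus_le_iff)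
        then show ?thesis unfolding sum_distrib_right[symmetric] r_sum by simp
      qed
      ultimately show ?thesis using Phi_mean_ell[OF c, of M] by simp
    qed
    finally have "t i j \<le> T" unfolding T_def by simp
    moreover have "r i * r j * (1/2 * (mean_ell \<nu> M i j + c0)) \<le> t i j"
      unfolding t_def using rr cp mean_ell_lower[OF c i j, of M] by (intro mult_left_mono mult_right_mono) (auto simp: c0_def)
    ultimately have "r i * r j * (mean_ell \<nu> M i j + c0) \<le> 2 * T" by simp
    then have "mean_ell \<nu> M i j + c0 \<le> 2 * T / (r i * r j)" using rr by (simp add: pos_le_divide_eq mult.commute)
    also have "\<dots> \<le> 2 * \<bar>T\<bar> / (r i * r j)" using rr by (intro divide_right_mono) auto
    also have "\<dots> \<le> (\<Sum>l=1..p. 2 * \<bar>T\<bar> / (r i * r l))"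
      by (rule member_le_sum[OF j]) (use r_pos i in \<open>auto intro!: divide_nonneg_nonneg mult_nonneg_nonneg simp: less_imp_le\<close>)
    also have "\<dots> \<le> (\<Sum>k=1..p. \<Sum>l=1..p. 2 * \<bar>T\<bar> / (r k * r l))"
      by (rule member_le_sum[OF i]) (use r_pos in \<open>auto intro!: sum_nonneg divide_nonneg_nonneg mult_nonneg_nonneg simp: less_imp_le\<close>)
    finally have "mean_ell \<nu> M i j \<le> B" unfolding B_def using c0 by simp
    moreover have "0 \<le> (\<Sum>k=1..p. \<Sum>l=1..p. 2 * \<bar>T\<bar> / (r k * r l))"
      using r_pos by (auto intro!: sum_nonneg divide_nonneg_nonneg mult_nonneg_nonneg simp: less_imp_le)
    then have "- B \<le> mean_ell \<nu> M i j" unfolding B_def using mean_ell_lower[OF c i j, of M] by (simp add: c0_def)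
    ultimately show ?thesis by (simp add: abs_le_iff minus_le_iff)
  qed
  then show ?thesis by (intro exI[of _ "\<bar>B\<bar>"]) (use abs_ge_self[of B] order_trans in \<open>blast intro: abs_ge_zero\<close>)
qed

end

context multi_index
begin

lemma double_sum_pairs:
  fixes g :: "nat \<Rightarrow> nat \<Rightarrow> real"
  assumes "\<And>a b. a \<in> {1..n} \<Longrightarrow> b \<in> {1..n} \<Longrightarrow> g a b = g b a"
  shows "(\<Sum>a=1..n. \<Sum>b=1..n. g a b) = (\<Sum>a=1..n. g a a) + 2 * (\<Sum>(m,m')\<in>pairs. g m m')"
proof -
  have split: "(\<Sum>b=1..n. g a b) = g a a + (\<Sum>b\<in>{1..<a}. g a b) + (\<Sum>b\<in>{a<..n}. g a b)" if a: "a \<in> {1..n}" for a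
  proof -
    have "{1..n} = insert a ({1..<a} \<union> {a<..n})" using a by auto
    then have "(\<Sum>b=1..n. g a b) = (\<Sum>b\<in>insert a ({1..<a} \<union> {a<..n}). g a b)" by (simp only:)
    also have "\<dots> = g a a + (\<Sum>b\<in>{1..<a} \<union> {a<..n}. g a b)" by (rule sum.insert) auto
    also have "(\<Sum>b\<in>{1..<a} \<union> {a<..n}. g a b) = (\<Sum>b\<in>{1..<a}. g a b) + (\<Sum>b\<in>{a<..n}. g a b)"
      by (rule sum.union_disjoint) auto
    finally show ?thesis by simp
  qed
  have 1: "(\<Sum>a=1..n. \<Sum>b\<in>{1..<a}. g a b) = (\<Sum>(m,m')\<in>pairs. g m m')"
    unfolding pairs_def by (rule sum.Sigma) auto
  have "(\<Sum>a=1..n. \<Sum>b\<in>{a<..n}. g a b) = (\<Sum>(a,b)\<in>(SIGMA a:{1..n}. {a<..n}). g a b)"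
    by (rule sum.Sigma) auto
  also have "\<dots> = (\<Sum>(m,m')\<in>pairs. g m m')"
    unfolding pairs_def
    by (rule sum.reindex_bij_witness[of _ "\<lambda>(i,j). (j,i)" "\<lambda>(i,j). (j,i)"]) (use assms in auto)
  finally have 2: "(\<Sum>a=1..n. \<Sum>b\<in>{a<..n}. g a b) = (\<Sum>(m,m')\<in>pairs. g m m')" .
  have "(\<Sum>a=1..n. \<Sum>b=1..n. g a b) = (\<Sum>a=1..n. g a a + (\<Sum>b\<in>{1..<a}. g a b) + (\<Sum>b\<in>{a<..n}. g a b))"
    by (rule sum.cong[OF refl split])
  then show ?thesis unfolding sum.distrib 1 2 by simp
qed

abbreviation emp :: "(nat \<Rightarrow> real) \<Rightarrow> real measure" where "emp X \<equiv> counting_measure n X"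

lemma emp_integral:
  fixes f :: "real \<Rightarrow> real"
  assumes f [measurable]: "f \<in> borel_measurable borel"
  shows "(\<integral>x. f x \<partial>emp X) = (\<Sum>k=1..n. f (X k)) / real n" "integrable (emp X) f"
proof -
  have i: "integrable (return borel y) f" for y
  proof -
    interpret prob_space "return borel y" by (rule prob_space_return) simp
    have "integrable (return borel y) (\<lambda>_. f y)" by simp
    then show ?thesis
      by (subst integrable_cong_AE[where g = "\<lambda>_. f y"]) (auto simp: AE_return)
  qed
  have s: "sets (sum_measure {1..n} (\<lambda>k. return borel (X k))) = sets borel" by (rule sets_sum_measure) auto
  have S: "integrable (sum_measure {1..n} (\<lambda>k. return borel (X k))) f" 
    "(\<integral>x. f x \<partial>sum_measure {1..n} (\<lambda>k. return borel (X k))) = (\<Sum>k=1..n. \<integral>x. f x \<partial>return borel (X k))"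
    by (rule integral_sum_measure; use i in auto)+
  have fm: "f \<in> borel_measurable (sum_measure {1..n} (\<lambda>k. return borel (X k)))"
    using f measurable_cong_sets[OF s refl] by blast
  show "(\<integral>x. f x \<partial>emp X) = (\<Sum>k=1..n. f (X k)) / real n"
  proof -
    have "(\<integral>x. f x \<partial>emp X) = 1 / real n * (\<integral>x. f x \<partial>sum_measure {1..n} (\<lambda>k. return borel (X k)))"
      unfolding counting_measure_def by (rule integral_scale_measure(1)[OF _ fm]) simp
    then show ?thesis unfolding S(2) by (simp add: integral_return)
  qed
  show "integrable (emp X) f"
    unfolding counting_measure_def by (rule integral_scale_measure(2)[OF _ fm S(1)]) simp
qed

lemma emp_measure:
  assumes A: "A \<in> sets borel"
  shows "emeasure (emp X) A = ennreal (real (card {k\<in>{1..n}. X k \<in> A}) / real n)"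
proof -
  have "emeasure (sum_measure {1..n} (\<lambda>k. return borel (X k))) A = (\<Sum>k=1..n. emeasure (return borel (X k)) A)"
    by (rule emeasure_sum_measure) (use A in auto)
  also have "\<dots> = (\<Sum>k=1..n. indicator {k\<in>{1..n}. X k \<in> A} k)"
    using A by (intro sum.cong) (auto simp: indicator_def)
  also have "\<dots> = of_nat (card {k\<in>{1..n}. X k \<in> A})"
    by (simp add: indicator_def sum.If_cases Int_def)
  finally have "emeasure (emp X) A = ennreal (1 / real n) * ennreal (real (card {k\<in>{1..n}. X k \<in> A}))"
    unfolding counting_measure_def by (simp add: ennreal_of_nat_eq_real_of_nat)
  then show ?thesis by (subst (asm) ennreal_mult[symmetric]) auto
qed

lemma emp_real_distribution: "real_distribution (emp X)"
proof -
  have s: "sets (emp X) = sets borel"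
    unfolding counting_measure_def using sets_sum_measure[of "{1..n}" "\<lambda>k. return borel (X k)"] by simp
  then have sp: "space (emp X) = UNIV" using sets_eq_imp_space_eq[OF s] by simp
  have "{k\<in>{1..n}. X k \<in> UNIV} = {1..n}" by auto
  then have "emeasure (emp X) UNIV = 1" using emp_measure[of UNIV X] n_pos by simp
  then have "prob_space (emp X)" by (intro prob_spaceI) (simp add: sp)
  then show ?thesis using s by (simp add: real_distribution_def real_distribution_axioms_def)
qed

lemma emp_region:
  assumes X: "X \<in> region"
  shows "AE x in emp X. x \<in> G" "i \<in> {1..p} \<Longrightarrow> measure (emp X) (\<Gamma> i) = real (nn i) / real n"
proof -
  interpret real_distribution "emp X" by (rule emp_real_distribution)
  have "{k\<in>{1..n}. X k \<in> G} = {1..n}" using regionD[OF X] by auto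
  then have "measure (emp X) G = 1" using emp_measure[of G X] n_pos by (simp add: measure_def)
  then show "AE x in emp X. x \<in> G" by (subst (asm) prob_eq_1) auto
  assume i: "i \<in> {1..p}"
  have "{k\<in>{1..n}. X k \<in> \<Gamma> i} = (\<lambda>k. off i + k) ` {1..nn i}"
  proof safe
    fix k assume k: "k \<in> {1..n}" "X k \<in> \<Gamma> i"
    then have "blk k = i" using Gamma_disjoint[OF blk_bounds(1)[OF k(1)] i regionD(1)[OF X k(1)]] by blast
    then show "k \<in> (\<lambda>k. off i + k) ` {1..nn i}"
      using blk_bounds(2,3)[OF k(1)] by (intro image_eqI[of _ _ "k - off i"]) auto
  next
    fix k assume k: "k \<in> {1..nn i}"
    have "(\<lambda>(i,k). off i + k) (i, k) \<in> {1..n}"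
      using bij_betw_apply[OF position_bij, of "(i,k)"] i k by auto
    then show "off i + k \<in> {1..n}" by simp
    then show "X (off i + k) \<in> \<Gamma> i" using regionD(1)[OF X, of "off i + k"] block_of_off[OF i k] by simp
  qed
  then have "card {k\<in>{1..n}. X k \<in> \<Gamma> i} = nn i" by (simp add: card_image inj_on_def)
  then show "measure (emp X) (\<Gamma> i) = real (nn i) / real n"
    using emp_measure[OF Gamma_borel[OF i], of X] by (simp add: measure_def)
qed

lemma Phi_emp: "Phi M (emp X) (emp X) = (\<Sum>a=1..n. \<Sum>b=1..n. kern M (X a) (X b)) / (real n)\<^sup>2"
proof -
  have m: "(\<lambda>x. \<Sum>k=1..n. kern M x (X k)) \<in> borel_measurable borel"
  proof (rule borel_measurable_sum)
    show "(\<lambda>x. kern M x (X k)) \<in> borel_measurable borel" for k using kern_borel1[of M "X k"] by (simp add: kern_sym[of M _ "X k"])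
  qed
  have "Phi M (emp X) (emp X) = (\<integral>x. (\<Sum>k=1..n. kern M x (X k)) / real n \<partial>emp X)"
    unfolding Phi_def dbl_def by (simp add: emp_integral(1)[OF kern_borel1])
  also have "\<dots> = (\<integral>x. (\<Sum>k=1..n. kern M x (X k)) \<partial>emp X) / real n" by simp
  also have "\<dots> = (\<Sum>a=1..n. \<Sum>b=1..n. kern M (X a) (X b)) / real n / real n" unfolding emp_integral(1)[OF m] ..
  finally show ?thesis by (simp add: power2_eq_square)
qed

text \<open>The double sum over coordinates is twice the sum over pairs plus the diagonal, where the kernel is
  at most \<open>- ln (eta M)\<close>. For fixed \<open>M\<close> the diagonal contributes only \<open>O(1/n)\<close>.\<close>

lemma Phi_emp_le:
  assumes X: "X \<in> region" and v: "angelesco_weight p Q nn X \<ge> exp (- v)"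
  shows "Phi M (emp X) (emp X) \<le> (v + real n * (- ln (eta M))) / (real n)\<^sup>2"
proof -
  have cX: "coupling (X a) (X b) = (if blk a = blk b then 1 else 1/2)" if "a \<in> {1..n}" "b \<in> {1..n}" for a b
    using coupling_eq[OF blk_bounds(1)[OF that(1)] blk_bounds(1)[OF that(2)] regionD(1)[OF X that(1)] regionD(1)[OF X that(2)]] .
  have "(\<Sum>a=1..n. \<Sum>b=1..n. kern M (X a) (X b)) = (\<Sum>a=1..n. \<Sum>b=1..n. coupling (X a) (X b) * ell M (X a) (X b))
     + (\<Sum>a=1..n. \<Sum>b=1..n. Q_ext (X a)) + (\<Sum>a=1..n. \<Sum>b=1..n. Q_ext (X b))"
    unfolding kern_def by (simp only: sum.distrib)
  also have "(\<Sum>a=1..n. \<Sum>b=1..n. Q_ext (X a)) = real n * (\<Sum>m=1..n. Q_ext (X m))" by (simp add: sum_distrib_left)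
  also have "(\<Sum>a=1..n. \<Sum>b=1..n. Q_ext (X b)) = real n * (\<Sum>m=1..n. Q_ext (X m))" by simp
  also have "(\<Sum>a=1..n. \<Sum>b=1..n. coupling (X a) (X b) * ell M (X a) (X b))
    = (\<Sum>a=1..n. coupling (X a) (X a) * ell M (X a) (X a)) + 2 * (\<Sum>(m,m')\<in>pairs. coupling (X m) (X m') * ell M (X m) (X m'))"
    by (rule double_sum_pairs) (simp add: ell_sym[of M "X _" "X _"] coupling_def mult.commute)
  also have "2 * (\<Sum>(m,m')\<in>pairs. coupling (X m) (X m') * ell M (X m) (X m')) = (\<Sum>(m,m')\<in>pairs. real (pair_exp m m') * ell M (X m) (X m'))"
    unfolding sum_distrib_left by (intro sum.cong refl) (auto dest!: pairsD simp: cX pair_exp_def)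
  also have "(\<Sum>a=1..n. coupling (X a) (X a) * ell M (X a) (X a)) \<le> (\<Sum>a=1..n. - ln (eta M))"
    by (intro sum_mono) (use ell_upper cX in auto)
  finally have "(\<Sum>a=1..n. \<Sum>b=1..n. kern M (X a) (X b)) \<le> real n * (- ln (eta M)) + neg_log_weight M X"
    unfolding neg_log_weight_def by simp
  also have "neg_log_weight M X \<le> v" by (rule weight_lower_imp_neg_log_weight[OF X v])
  finally show ?thesis unfolding Phi_emp by (intro divide_right_mono) (auto simp: add.commute)
qed


definition ratio :: "nat \<Rightarrow> real" where "ratio i = real (nn i) / real n"

text \<open>Coordinate \<open>m\<close> follows the normalised component of its block. The law outside \<open>{1..n}\<close> is an arbitrary
  probability measure on the line.\<close>

definition coord_law :: "(nat \<Rightarrow> real measure) \<Rightarrow> nat \<Rightarrow> real measure" where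
  "coord_law \<nu> m = (if m \<in> {1..n} then scale_measure (ennreal (1 / r (blk m))) (\<nu> (blk m)) else return borel 0)"

lemma coord_law_facts:
  assumes c: "mass_tuple \<nu>"
  shows "prob_space (coord_law \<nu> m)" "sets (coord_law \<nu> m) = sets borel"
    and "m \<in> {1..n} \<Longrightarrow> AE x in coord_law \<nu> m. x \<in> \<Gamma> (blk m)"
proof -
  show s: "sets (coord_law \<nu> m) = sets borel" 
    using mass_tupleD(1)[OF c blk_bounds(1)] by (simp add: coord_law_def)
  then have sp: "space (coord_law \<nu> m) = UNIV" using sets_eq_imp_space_eq[OF s] by simp
  show "prob_space (coord_law \<nu> m)"
  proof (cases "m \<in> {1..n}")
    case True
    note b = blk_bounds(1)[OF True]
    interpret finite_measure "\<nu> (blk m)" by (rule mass_tupleD[OF c b])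
    have "emeasure (coord_law \<nu> m) UNIV = ennreal (1 / r (blk m)) * ennreal (r (blk m))"
      using True mass_tupleD[OF c b] by (simp add: coord_law_def emeasure_eq_measure)
    also have "\<dots> = 1" using r_pos[OF b] by (subst ennreal_mult[symmetric]) auto
    finally show ?thesis by (intro prob_spaceI) (simp add: sp)
  next
    case False then have "coord_law \<nu> m = return borel 0" by (auto simp: coord_law_def)
    then show ?thesis by (simp add: prob_space_return)
  qed
  show "AE x in coord_law \<nu> m. x \<in> \<Gamma> (blk m)" if m: "m \<in> {1..n}"
  proof -
    note b = blk_bounds(1)[OF m]
    have "emeasure (coord_law \<nu> m) (- \<Gamma> (blk m)) = 0"
      using c b m unfolding mass_tuple_def coord_law_def by simp
    then show ?thesis by (intro AE_I[of _ _ "- \<Gamma> (blk m)"]) (use Gamma_borel[OF b] in \<open>auto simp: s\<close>)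
  qed
qed

lemma dbl_coord_law:
  assumes c: "mass_tuple \<nu>" and m: "m \<in> {1..n}" "m' \<in> {1..n}"
  shows "dbl (coord_law \<nu> m) (coord_law \<nu> m') (ell M) = mean_ell \<nu> M (blk m) (blk m')"
proof -
  note b = blk_bounds(1)[OF m(1)] blk_bounds(1)[OF m(2)]
  interpret two_finite_borel "\<nu> (blk m)" "\<nu> (blk m')" by (rule mass_tuple_two[OF c b])
  have e: "coord_law \<nu> m = scale_measure (ennreal (1 / r (blk m))) (\<nu> (blk m))" 
    "coord_law \<nu> m' = scale_measure (ennreal (1 / r (blk m'))) (\<nu> (blk m'))"
    using m by (auto simp: coord_law_def)
  have i: "(\<integral>y. ell M x y \<partial>coord_law \<nu> m') = 1 / r (blk m') * (\<integral>y. ell M x y \<partial>\<nu> (blk m'))" for x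
    unfolding e by (rule integral_scale_measure(1)) (use r_pos[OF b(2)] kernel_inner(1)[OF ell_bdd] in auto)
  have "dbl (coord_law \<nu> m) (coord_law \<nu> m') (ell M) = 1 / r (blk m) * (\<integral>x. 1 / r (blk m') * (\<integral>y. ell M x y \<partial>\<nu> (blk m')) \<partial>\<nu> (blk m))"
    unfolding dbl_def i unfolding e
    by (rule integral_scale_measure(1)) (use r_pos[OF b(1)] kernel_inner(2)[OF ell_bdd] in auto)
  then show ?thesis by (simp add: mean_ell_def dbl_def)
qed

lemma Q_ext_coord_law:
  assumes c: "mass_tuple \<nu>" and m: "m \<in> {1..n}"
  shows "(\<integral>x. Q_ext x \<partial>coord_law \<nu> m) = mean_Q \<nu> (blk m)"
proof -
  note b = blk_bounds(1)[OF m]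
  note [measurable_cong] = mass_tupleD(1)[OF c b]
  have "(\<integral>x. Q_ext x \<partial>coord_law \<nu> m) = 1 / r (blk m) * (\<integral>x. Q_ext x \<partial>\<nu> (blk m))"
    using m unfolding coord_law_def by (simp only: if_True, intro integral_scale_measure(1)) (use r_pos[OF b] in auto)
  then show ?thesis by (simp add: mean_Q_def)
qed

text \<open>If the coordinates are sampled independently, the expectation of \<open>neg_log_weight M\<close> is the left-hand
  side of the assumption, at most \<open>V\<close>. One configuration has to work for all \<open>M\<close> simultaneously. Since
  \<open>neg_log_weight M\<close> increases with \<open>M\<close> and is bounded below, monotone convergence bounds the
  expectation of the supremum over \<open>M\<close> by \<open>V\<close>, so the supremum is at most \<open>V\<close> at some configuration.\<close>

lemma weight_average:
  assumes c: "mass_tuple \<nu>" 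
    and V: "\<And>M. (\<Sum>(m,m')\<in>pairs. real (pair_exp m m') * mean_ell \<nu> M (blk m) (blk m')) + 2 * real n * (\<Sum>m=1..n. mean_Q \<nu> (blk m)) \<le> V"
  shows "\<exists>X\<in>region. \<forall>M. neg_log_weight M X \<le> V"
proof -
  define \<beta> where "\<beta> = coord_law \<nu>"
  interpret \<beta>: prob_space "\<beta> m" for m unfolding \<beta>_def by (rule coord_law_facts[OF c])
  interpret P: product_prob_space \<beta> "{1..n}" by unfold_locales
  have [measurable_cong]: "sets (\<beta> m) = sets borel" for m unfolding \<beta>_def by (rule coord_law_facts[OF c])
  have \<beta>sp: "space (\<beta> m) = UNIV" for m using sets_eq_imp_space_eq[of "\<beta> m" borel] coord_law_facts(2)[OF c, of m] by (simp add: \<beta>_def)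
  define P where "P = PiM {1..n} \<beta>"
  interpret PP: prob_space P unfolding P_def by (rule P.prob_space_axioms)
  have [measurable]: "(\<lambda>X. X m) \<in> borel_measurable P" if "m \<in> {1..n}" for m
    unfolding P_def using measurable_component_singleton[OF that, of \<beta>] measurable_cong_sets[OF refl \<open>sets (\<beta> m) = sets borel\<close>] by blast
  have marg1: "distr P borel (\<lambda>X. X m) = \<beta> m" if m: "m \<in> {1..n}" for m
  proof -
    have "distr P borel (\<lambda>X. X m) = distr (PiM {1..n} \<beta>) (\<beta> m) (\<lambda>X. X m)"
      unfolding P_def by (rule distr_cong) (use \<open>sets (\<beta> m) = sets borel\<close> in auto)
    then show ?thesis using P.PiM_component[OF m] by simp
  qed
  \<comment> \<open>pairs of different coordinates are independent\<close>
  have marg2: "distr P (borel \<Otimes>\<^sub>M borel) (\<lambda>X. (X m, X m')) = \<beta> m \<Otimes>\<^sub>M \<beta> m'" if mm: "m \<in> {1..n}" "m' \<in> {1..n}" "m \<noteq> m'" for m m'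
  proof (rule pair_measure_eqI[symmetric])
    show "sigma_finite_measure (\<beta> m)" "sigma_finite_measure (\<beta> m')" by unfold_locales
    show "sets (\<beta> m \<Otimes>\<^sub>M \<beta> m') = sets (distr P (borel \<Otimes>\<^sub>M borel) (\<lambda>X. (X m, X m')))"
      unfolding sets_distr by (rule sets_pair_measure_cong) fact+
    fix A B assume AB: "A \<in> sets (\<beta> m)" "B \<in> sets (\<beta> m')"
    then have AB': "A \<in> sets borel" "B \<in> sets borel" using \<open>\<And>m. sets (\<beta> m) = sets borel\<close> by auto
    define S where "S k = (if k = m then A else B)" for k
    have "emeasure (distr P (borel \<Otimes>\<^sub>M borel) (\<lambda>X. (X m, X m'))) (A \<times> B)
       = emeasure P ((\<lambda>X. (X m, X m')) -` (A \<times> B) \<inter> space P)"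
      by (rule emeasure_distr) (use mm AB' in auto)
    also have "(\<lambda>X. (X m, X m')) -` (A \<times> B) \<inter> space P = {X\<in>space (PiM {1..n} \<beta>). \<forall>k\<in>{m,m'}. X k \<in> S k}"
      using mm(3) by (auto simp: P_def S_def)
    also have "emeasure P \<dots> = (\<Prod>k\<in>{m,m'}. emeasure (\<beta> k) (S k))"
      unfolding P_def by (rule P.emeasure_PiM_Collect) (use mm AB in \<open>auto simp: S_def\<close>)
    also have "\<dots> = emeasure (\<beta> m) A * emeasure (\<beta> m') B" using mm(3) by (simp add: S_def)
    finally show "emeasure (\<beta> m) A * emeasure (\<beta> m') B = emeasure (distr P (borel \<Otimes>\<^sub>M borel) (\<lambda>X. (X m, X m'))) (A \<times> B)" ..
  qed
  have two: "two_finite_borel (\<beta> m) (\<beta> m')" for m m'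
    unfolding two_finite_borel_def using \<beta>.finite_measure_axioms \<open>\<And>m. sets (\<beta> m) = sets borel\<close> by auto
  have [measurable]: "(\<lambda>(x,y). ell M x y) \<in> borel_measurable (borel \<Otimes>\<^sub>M borel)" for M
    using ell_bdd[of M] unfolding bdd_kernel_def by blast
  have Eell: "integrable P (\<lambda>X. ell M (X m) (X m'))" "(\<integral>X. ell M (X m) (X m') \<partial>P) = mean_ell \<nu> M (blk m) (blk m')"
    if mm: "(m, m') \<in> pairs" for M m m'
  proof -
    have m: "m \<in> {1..n}" "m' \<in> {1..n}" "m \<noteq> m'" using pairsD[OF mm] by auto
    have meas: "(\<lambda>X. (X m, X m')) \<in> P \<rightarrow>\<^sub>M borel \<Otimes>\<^sub>M borel" using m by measurable
    have int: "integrable (distr P (borel \<Otimes>\<^sub>M borel) (\<lambda>X. (X m, X m'))) (\<lambda>(x,y). ell M x y)"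
      unfolding marg2[OF m] by (rule two_finite_borel.kernel_integrable[OF two ell_bdd])
    show "integrable P (\<lambda>X. ell M (X m) (X m'))"
      using integrable_distr[OF meas int] by simp
    have "(\<integral>X. ell M (X m) (X m') \<partial>P) = (\<integral>z. (\<lambda>(x,y). ell M x y) z \<partial>distr P (borel \<Otimes>\<^sub>M borel) (\<lambda>X. (X m, X m')))"
      by (subst integral_distr[OF meas]) auto
    also have "\<dots> = dbl (\<beta> m) (\<beta> m') (ell M)"
      unfolding marg2[OF m] two_finite_borel.dbl_eq_pair[OF two ell_bdd] by (simp add: case_prod_beta')
    finally show "(\<integral>X. ell M (X m) (X m') \<partial>P) = mean_ell \<nu> M (blk m) (blk m')"
      unfolding \<beta>_def dbl_coord_law[OF c m(1,2)] .
  qed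
  have Eq: "integrable P (\<lambda>X. Q_ext (X m))" "(\<integral>X. Q_ext (X m) \<partial>P) = mean_Q \<nu> (blk m)" if m: "m \<in> {1..n}" for m
  proof -
    show "integrable P (\<lambda>X. Q_ext (X m))"
      by (rule PP.integrable_const_bound[where B = Q_bound]) (use abs_Q_ext_le m in auto)
    have "(\<integral>X. Q_ext (X m) \<partial>P) = (\<integral>x. Q_ext x \<partial>distr P borel (\<lambda>X. X m))"
      by (subst integral_distr) (use m in auto)
    then show "(\<integral>X. Q_ext (X m) \<partial>P) = mean_Q \<nu> (blk m)"
      unfolding marg1[OF m] \<beta>_def Q_ext_coord_law[OF c m] .
  qed
  have SMi: "integrable P (neg_log_weight M)" "(\<integral>X. neg_log_weight M X \<partial>P) \<le> V" for M
  proof -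
    have i1: "integrable P (\<lambda>X. \<Sum>(m,m')\<in>pairs. real (pair_exp m m') * ell M (X m) (X m'))"
      unfolding case_prod_beta by (intro Bochner_Integration.integrable_sum integrable_mult_right Eell) auto
    have i2: "integrable P (\<lambda>X. 2 * real n * (\<Sum>m=1..n. Q_ext (X m)))"
      by (intro integrable_mult_right Bochner_Integration.integrable_sum Eq)
    show "integrable P (neg_log_weight M)" unfolding neg_log_weight_def[abs_def] by (intro Bochner_Integration.integrable_add i1 i2)
    have "(\<integral>X. neg_log_weight M X \<partial>P) = (\<Sum>(m,m')\<in>pairs. real (pair_exp m m') * mean_ell \<nu> M (blk m) (blk m')) + 2 * real n * (\<Sum>m=1..n. mean_Q \<nu> (blk m))"
    proof -
      have "(\<integral>X. neg_log_weight M X \<partial>P) = (\<integral>X. (\<Sum>(m,m')\<in>pairs. real (pair_exp m m') * ell M (X m) (X m')) \<partial>P) + (\<integral>X. 2 * real n * (\<Sum>m=1..n. Q_ext (X m)) \<partial>P)"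
        unfolding neg_log_weight_def by (rule Bochner_Integration.integral_add[OF i1 i2])
      also have "(\<integral>X. (\<Sum>(m,m')\<in>pairs. real (pair_exp m m') * ell M (X m) (X m')) \<partial>P) = (\<Sum>(m,m')\<in>pairs. real (pair_exp m m') * mean_ell \<nu> M (blk m) (blk m'))"
      proof -
        have "(\<integral>X. (\<Sum>z\<in>pairs. real (pair_exp (fst z) (snd z)) * ell M (X (fst z)) (X (snd z))) \<partial>P)
           = (\<Sum>z\<in>pairs. \<integral>X. real (pair_exp (fst z) (snd z)) * ell M (X (fst z)) (X (snd z)) \<partial>P)"
          by (rule Bochner_Integration.integral_sum) (intro integrable_mult_right Eell, simp)
        also have "\<dots> = (\<Sum>z\<in>pairs. real (pair_exp (fst z) (snd z)) * mean_ell \<nu> M (blk (fst z)) (blk (snd z)))"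
          by (intro sum.cong refl) (simp add: Eell(2))
        finally show ?thesis by (simp add: case_prod_beta)
      qed
      also have "(\<integral>X. 2 * real n * (\<Sum>m=1..n. Q_ext (X m)) \<partial>P) = 2 * real n * (\<Sum>m=1..n. mean_Q \<nu> (blk m))"
        by (simp add: Eq)
      finally show ?thesis .
    qed
    then show "(\<integral>X. neg_log_weight M X \<partial>P) \<le> V" using V by simp
  qed
  \<comment> \<open>a shift that makes all \<open>neg_log_weight M\<close> nonnegative on every configuration\<close>
  define cc where "cc = (\<Sum>(m,m')\<in>pairs. real (pair_exp m m') * (ln rad + 9)) + 2 * real n * (real n * Q_bound)"
  have SMpos: "0 \<le> neg_log_weight M X + cc" for M X
  proof -
    have "0 \<le> (\<Sum>(m,m')\<in>pairs. real (pair_exp m m') * (ell M (X m) (X m') + (ln rad + 9)))"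
    proof (rule sum_nonneg)
      have "0 \<le> ell M x y + (ln rad + 9)" for x y using ell_lower[of M x y] by linarith
      then show "0 \<le> (case z of (m,m') \<Rightarrow> real (pair_exp m m') * (ell M (X m) (X m') + (ln rad + 9)))" for z
        by (cases z) simp
    qed
    moreover have "0 \<le> (\<Sum>m=1..n. Q_ext (X m) + Q_bound)"
    proof (rule sum_nonneg)
      show "0 \<le> Q_ext (X m) + Q_bound" for m using abs_Q_ext_le[of "X m"] by (simp add: abs_le_iff)
    qed
    then have "0 \<le> 2 * real n * (\<Sum>m=1..n. Q_ext (X m) + Q_bound)" by simp
    ultimately show ?thesis
      unfolding neg_log_weight_def cc_def by (simp add: case_prod_beta distrib_left sum.distrib algebra_simps)
  qed
  define f where "f M X = ennreal (neg_log_weight M X + cc)" for M X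
  have fm [measurable]: "f M \<in> borel_measurable P" for M
    unfolding f_def using SMi(1)[of M] by measurable
  have fint: "(\<integral>\<^sup>+X. f M X \<partial>P) \<le> ennreal (V + cc)" for M
  proof -
    have "(\<integral>\<^sup>+X. f M X \<partial>P) = ennreal (\<integral>X. neg_log_weight M X + cc \<partial>P)"
      unfolding f_def by (rule nn_integral_eq_integral) (use SMi SMpos in auto)
    also have "(\<integral>X. neg_log_weight M X + cc \<partial>P) = (\<integral>X. neg_log_weight M X \<partial>P) + cc" using SMi(1)[of M] PP.prob_space by simp
    finally show ?thesis using SMi(2)[of M] by (simp add: ennreal_leI)
  qed
  have finc: "incseq f"
    unfolding incseq_def le_fun_def f_def neg_log_weight_def
    by (intro allI impI ennreal_leI add_right_mono sum_mono) (auto intro!: mult_left_mono ell_mono)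
  have sup: "(\<integral>\<^sup>+X. (SUP M. f M X) \<partial>P) \<le> ennreal (V + cc)"
    unfolding nn_integral_monotone_convergence_SUP[OF finc fm] by (rule SUP_least) (rule fint)
  have aeR: "AE X in P. X \<in> region"
  proof -
    have "AE X in P. \<forall>m\<in>{1..n}. X m \<in> \<Gamma> (blk m)"
    proof (rule AE_finite_allI)
      fix m assume m: "m \<in> {1..n}"
      show "AE X in P. X m \<in> \<Gamma> (blk m)"
        unfolding P_def by (rule AE_PiM_component[OF \<beta>.prob_space_axioms m])
          (rule coord_law_facts(3)[OF c m, folded \<beta>_def])
    qed simp
    moreover have "AE X in P. X \<in> space P" by (rule AE_space)
    ultimately show ?thesis
    proof eventually_elim
      fix X assume X: "\<forall>m\<in>{1..n}. X m \<in> \<Gamma> (blk m)" "X \<in> space P"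
      then show "X \<in> region" unfolding region_def P_def space_PiM by (auto simp: PiE_def)
    qed
  qed
  have "\<exists>X\<in>region. (SUP M. f M X) \<le> ennreal (V + cc)"
  proof (rule ccontr)
    assume "\<not> ?thesis"
    then have gt: "AE X in P. ennreal (V + cc) < (SUP M. f M X)" using aeR by (auto elim!: eventually_mono simp: not_le)
    have "(\<integral>\<^sup>+X. ennreal (V + cc) \<partial>P) < (\<integral>\<^sup>+X. (SUP M. f M X) \<partial>P)"
    proof (rule nn_integral_less)
      show "AE X in P. ennreal (V + cc) \<le> (SUP M. f M X)" using gt by (auto elim!: eventually_mono)
      show "\<not> (AE X in P. (SUP M. f M X) \<le> ennreal (V + cc))"
      proof
        assume "AE X in P. (SUP M. f M X) \<le> ennreal (V + cc)"
        then have "AE X in P. False" using gt by eventually_elim auto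
        then show False by simp
      qed
      show "(\<integral>\<^sup>+X. ennreal (V + cc) \<partial>P) \<noteq> \<infinity>" by (simp add: PP.emeasure_space_1)
    qed measurable
    also have "\<dots> \<le> ennreal (V + cc)" by (rule sup)
    finally show False by (simp add: PP.emeasure_space_1)
  qed
  then obtain X where X: "X \<in> region" "(SUP M. f M X) \<le> ennreal (V + cc)" by blast
  have "neg_log_weight M X \<le> V" for M
  proof -
    have "ennreal (neg_log_weight M X + cc) \<le> ennreal (V + cc)" using X(2) SUP_upper[of M UNIV "\<lambda>M. f M X"] unfolding f_def by (meson UNIV_I order_trans)
    moreover have "0 \<le> V + cc"
    proof -
      have "0 \<le> (\<integral>X. neg_log_weight 0 X + cc \<partial>P)" by (rule Bochner_Integration.integral_nonneg) (rule SMpos)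
      also have "\<dots> = (\<integral>X. neg_log_weight 0 X \<partial>P) + cc" using SMi(1)[of 0] PP.prob_space by simp
      finally show ?thesis using SMi(2)[of 0] by simp
    qed
    ultimately show ?thesis by (simp add: ennreal_le_iff)
  qed
  then show ?thesis using X(1) by blast
qed

text \<open>The first and the third sum compare \<open>nn i / n\<close> with \<open>r i\<close>; the middle term accounts for the diagonal,
  which the sum over pairs omits.\<close>

definition err :: "real \<Rightarrow> real" where
  "err B = (\<Sum>i=1..p. \<Sum>j=1..p. \<bar>ratio i * ratio j - r i * r j\<bar> * B) + B / real n + 2 * (\<Sum>i=1..p. \<bar>ratio i - r i\<bar> * Q_bound)"

lemma good_configuration:
  assumes c: "mass_tuple \<nu>" and e: "energy (sum_measure {1..p} \<nu>) = ereal e"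
    and B: "B \<ge> 0" "\<And>M i j. i \<in> {1..p} \<Longrightarrow> j \<in> {1..p} \<Longrightarrow> \<bar>mean_ell \<nu> M i j\<bar> \<le> B"
  shows "\<exists>X\<in>region. angelesco_weight p Q nn X \<ge> exp (- ((real n)\<^sup>2 * (e + err B)))"
proof -
  have n0: "real n > 0" using n_pos by simp
  have nw: "real (nn i) = real n * ratio i" for i unfolding ratio_def using n0 by simp
  have w0: "0 \<le> ratio i" for i by (simp add: ratio_def)
  have "(\<Sum>(m,m')\<in>pairs. real (pair_exp m m') * mean_ell \<nu> M (blk m) (blk m')) + 2 * real n * (\<Sum>m=1..n. mean_Q \<nu> (blk m)) \<le> (real n)\<^sup>2 * (e + err B)" for M
  proof -
    have sym: "mean_ell \<nu> M i j = mean_ell \<nu> M j i" if "i \<in> {1..p}" "j \<in> {1..p}" for i j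
      unfolding mean_ell_def using dbl_ell_sym[OF mass_tuple_two[OF c that], of M] by (simp add: mult.commute)
    have ds: "(\<Sum>a=1..n. \<Sum>b=1..n. coupling_coeff (blk a) (blk b) * mean_ell \<nu> M (blk a) (blk b)) = (\<Sum>a=1..n. coupling_coeff (blk a) (blk a) * mean_ell \<nu> M (blk a) (blk a))
        + 2 * (\<Sum>(m,m')\<in>pairs. coupling_coeff (blk m) (blk m') * mean_ell \<nu> M (blk m) (blk m'))"
    proof (rule double_sum_pairs)
      fix a b assume "a \<in> {1..n}" "b \<in> {1..n}"
      then show "coupling_coeff (blk a) (blk b) * mean_ell \<nu> M (blk a) (blk b) = coupling_coeff (blk b) (blk a) * mean_ell \<nu> M (blk b) (blk a)"
        using sym[OF blk_bounds(1) blk_bounds(1), of a b] by (simp add: coupling_coeff_def)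
    qed
    have p2: "2 * (\<Sum>(m,m')\<in>pairs. coupling_coeff (blk m) (blk m') * mean_ell \<nu> M (blk m) (blk m')) = (\<Sum>(m,m')\<in>pairs. real (pair_exp m m') * mean_ell \<nu> M (blk m) (blk m'))"
      unfolding sum_distrib_left by (intro sum.cong refl) (auto simp: coupling_coeff_def pair_exp_def)
    have sa: "(\<Sum>a=1..n. \<Sum>b=1..n. coupling_coeff (blk a) (blk b) * mean_ell \<nu> M (blk a) (blk b)) = (\<Sum>i=1..p. \<Sum>j=1..p. real (nn i) * real (nn j) * (coupling_coeff i j * mean_ell \<nu> M i j))"
    proof -
      have "(\<Sum>a=1..n. \<Sum>b=1..n. coupling_coeff (blk a) (blk b) * mean_ell \<nu> M (blk a) (blk b)) = (\<Sum>a=1..n. \<Sum>j=1..p. real (nn j) * (coupling_coeff (blk a) j * mean_ell \<nu> M (blk a) j))"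
      proof (rule sum.cong[OF refl])
        fix a
        show "(\<Sum>b=1..n. coupling_coeff (blk a) (blk b) * mean_ell \<nu> M (blk a) (blk b)) = (\<Sum>j=1..p. real (nn j) * (coupling_coeff (blk a) j * mean_ell \<nu> M (blk a) j))"
          by (rule sum_blk[of "\<lambda>j. coupling_coeff (blk a) j * mean_ell \<nu> M (blk a) j"])
      qed
      also have "\<dots> = (\<Sum>i=1..p. real (nn i) * (\<Sum>j=1..p. real (nn j) * (coupling_coeff i j * mean_ell \<nu> M i j)))"
        by (rule sum_blk[of "\<lambda>i. \<Sum>j=1..p. real (nn j) * (coupling_coeff i j * mean_ell \<nu> M i j)"])
      finally show ?thesis by (simp add: sum_distrib_left mult.assoc)
    qed
    have Phi: "(\<Sum>i=1..p. \<Sum>j=1..p. r i * r j * (coupling_coeff i j * mean_ell \<nu> M i j)) + 2 * (\<Sum>i=1..p. r i * mean_Q \<nu> i) \<le> e"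
    proof -
      have "ereal (Phi M (sum_measure {1..p} \<nu>) (sum_measure {1..p} \<nu>)) \<le> ereal e" unfolding e[symmetric] by (rule Phi_le_energy)
      then show ?thesis using Phi_mean_ell[OF c, of M] by simp
    qed
    have d1: "(\<Sum>i=1..p. \<Sum>j=1..p. ratio i * ratio j * (coupling_coeff i j * mean_ell \<nu> M i j)) 
       \<le> (\<Sum>i=1..p. \<Sum>j=1..p. r i * r j * (coupling_coeff i j * mean_ell \<nu> M i j)) + (\<Sum>i=1..p. \<Sum>j=1..p. \<bar>ratio i * ratio j - r i * r j\<bar> * B)"
      unfolding sum.distrib[symmetric]
    proof (intro sum_mono)
      fix i j assume ij: "i \<in> {1..p}" "j \<in> {1..p}"
      have "\<bar>coupling_coeff i j * mean_ell \<nu> M i j\<bar> \<le> 1 * B"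
        unfolding abs_mult using B(1) B(2)[OF ij, of M] by (intro mult_mono) (auto simp: coupling_coeff_def)
      then have cb: "\<bar>coupling_coeff i j * mean_ell \<nu> M i j\<bar> \<le> B" by simp
      have "(ratio i * ratio j - r i * r j) * (coupling_coeff i j * mean_ell \<nu> M i j) \<le> \<bar>ratio i * ratio j - r i * r j\<bar> * \<bar>coupling_coeff i j * mean_ell \<nu> M i j\<bar>"
        using abs_ge_self[of "(ratio i * ratio j - r i * r j) * (coupling_coeff i j * mean_ell \<nu> M i j)"]
        unfolding abs_mult[of "ratio i * ratio j - r i * r j"] .
      also have "\<dots> \<le> \<bar>ratio i * ratio j - r i * r j\<bar> * B" by (rule mult_left_mono[OF cb]) simp
      finally have "(ratio i * ratio j - r i * r j) * (coupling_coeff i j * mean_ell \<nu> M i j) \<le> \<bar>ratio i * ratio j - r i * r j\<bar> * B" .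
      then show "ratio i * ratio j * (coupling_coeff i j * mean_ell \<nu> M i j) \<le> r i * r j * (coupling_coeff i j * mean_ell \<nu> M i j) + \<bar>ratio i * ratio j - r i * r j\<bar> * B"
        by (simp add: left_diff_distrib)
    qed
    have d2: "(\<Sum>i=1..p. ratio i * mean_Q \<nu> i) \<le> (\<Sum>i=1..p. r i * mean_Q \<nu> i) + (\<Sum>i=1..p. \<bar>ratio i - r i\<bar> * Q_bound)"
      unfolding sum.distrib[symmetric]
    proof (intro sum_mono)
      fix i assume i: "i \<in> {1..p}"
      have "(ratio i - r i) * mean_Q \<nu> i \<le> \<bar>ratio i - r i\<bar> * \<bar>mean_Q \<nu> i\<bar>" unfolding abs_mult[symmetric] by (rule abs_ge_self)
      also have "\<dots> \<le> \<bar>ratio i - r i\<bar> * Q_bound" by (intro mult_left_mono abs_mean_Q_le[OF c i]) simp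
      finally show "ratio i * mean_Q \<nu> i \<le> r i * mean_Q \<nu> i + \<bar>ratio i - r i\<bar> * Q_bound" by (simp add: left_diff_distrib)
    qed
    have d3: "- (\<Sum>a=1..n. coupling_coeff (blk a) (blk a) * mean_ell \<nu> M (blk a) (blk a)) \<le> real n * B"
    proof -
      have "(\<Sum>a=1..n. - (coupling_coeff (blk a) (blk a) * mean_ell \<nu> M (blk a) (blk a))) \<le> (\<Sum>a=1..n. B)"
      proof (rule sum_mono)
        fix a assume "a \<in> {1..n}"
        then show "- (coupling_coeff (blk a) (blk a) * mean_ell \<nu> M (blk a) (blk a)) \<le> B"
          using B(2)[OF blk_bounds(1) blk_bounds(1), of a a M] by (simp add: coupling_coeff_def abs_le_iff)
      qed
      then show ?thesis by (simp add: sum_negf)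
    qed
    have "(\<Sum>(m,m')\<in>pairs. real (pair_exp m m') * mean_ell \<nu> M (blk m) (blk m')) + 2 * real n * (\<Sum>m=1..n. mean_Q \<nu> (blk m))
       \<le> (\<Sum>i=1..p. \<Sum>j=1..p. real (nn i) * real (nn j) * (coupling_coeff i j * mean_ell \<nu> M i j)) + real n * B + 2 * real n * (\<Sum>i=1..p. real (nn i) * mean_Q \<nu> i)"
      using ds p2 sa d3 sum_blk[of "mean_Q \<nu>"] by simp
    also have "\<dots> = (real n)\<^sup>2 * ((\<Sum>i=1..p. \<Sum>j=1..p. ratio i * ratio j * (coupling_coeff i j * mean_ell \<nu> M i j)) + B / real n + 2 * (\<Sum>i=1..p. ratio i * mean_Q \<nu> i))"
      unfolding nw using n0 by (simp add: power2_eq_square sum_distrib_left algebra_simps)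
    also have "\<dots> \<le> (real n)\<^sup>2 * (e + err B)"
      using Phi d1 d2 unfolding err_def by (intro mult_left_mono) auto
    finally show ?thesis .
  qed
  from weight_average[OF c this] obtain X where "X \<in> region" "\<And>M. neg_log_weight M X \<le> (real n)\<^sup>2 * (e + err B)" by blast
  then show ?thesis using neg_log_weight_imp_weight_lower by blast
qed

end

section \<open>Sorting and permuting coordinates\<close>

lemma sorting_permutation:
  "\<exists>\<sigma>. \<sigma> permutes {1..n} \<and> sort_coords n X = (\<lambda>k\<in>{1..n}. X (\<sigma> k))"
proof -
  define xs where "xs = map X [1..<Suc n]"
  have len: "length xs = n" by (simp add: xs_def)
  have "mset (sort xs) = mset xs" by simp
  then obtain q where q: "q permutes {..<length xs}" "permute_list q xs = sort xs"
    by (rule mset_eq_permutation)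
  define \<sigma> where "\<sigma> k = (if k \<in> {1..n} then q (k - 1) + 1 else k)" for k
  have qp: "q k < n" if "k < n" for k using permutes_in_image[OF q(1), of k] that len by simp
  have "bij_betw \<sigma> {1..n} {1..n}"
  proof (rule bij_betwI')
    show "(\<sigma> x = \<sigma> y) = (x = y)" if "x \<in> {1..n}" "y \<in> {1..n}" for x y
      using that permutes_inj[OF q(1)] by (auto simp: \<sigma>_def inj_eq)
    show "\<sigma> x \<in> {1..n}" if "x \<in> {1..n}" for x
    proof -
      have "x - 1 < n" using that by auto
      from qp[OF this] show ?thesis using that by (auto simp: \<sigma>_def)
    qed
    show "\<exists>x\<in>{1..n}. y = \<sigma> x" if y: "y \<in> {1..n}" for y
    proof -
      have "y - 1 < n" using y by auto
      then obtain z where z: "q z = y - 1" "z < n"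
        using permutes_surj[OF q(1)] permutes_in_image[OF q(1)] len by (metis lessThan_iff surjD)
      then show ?thesis using y by (intro bexI[of _ "z + 1"]) (auto simp: \<sigma>_def)
    qed
  qed
  then have "\<sigma> permutes {1..n}" by (rule bij_imp_permutes) (auto simp: \<sigma>_def)
  moreover have "sort_coords n X = (\<lambda>k\<in>{1..n}. X (\<sigma> k))"
    unfolding sort_coords_def
  proof (rule restrict_ext)
    fix k assume k: "k \<in> {1..n}"
    have "sort (map X [1..<Suc n]) ! (k - 1) = xs ! q (k - 1)"
      unfolding xs_def[symmetric] q(2)[symmetric] using k len by (subst permute_list_nth[OF q(1)]) auto
    also have "\<dots> = X (\<sigma> k)"
      using k qp[of "k - 1"] unfolding xs_def by (auto simp: \<sigma>_def simp del: upt_Suc)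
    finally show "sort (map X [1..<Suc n]) ! (k - 1) = X (\<sigma> k)" .
  qed
  ultimately show ?thesis by blast
qed

definition permute_coords :: "nat \<Rightarrow> (nat \<Rightarrow> nat) \<Rightarrow> (nat \<Rightarrow> real) \<Rightarrow> nat \<Rightarrow> real" where
  "permute_coords n \<sigma> X = (\<lambda>k\<in>{1..n}. X (\<sigma> k))"

lemma permute_coords_measurable [measurable]:
  assumes "\<sigma> permutes {1..n}"
  shows "permute_coords n \<sigma> \<in> Rn n \<rightarrow>\<^sub>M Rn n"
  unfolding permute_coords_def[abs_def]
  by (rule measurable_restrict) (use permutes_in_image[OF assms] in \<open>auto intro!: measurable_component_singleton\<close>)

lemma sort_coords_mono: "mono_on {1..n} (sort_coords n X)"
proof (rule mono_onI)
  fix i j assume ij: "i \<in> {1..n}" "j \<in> {1..n}" "i \<le> j"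
  have "sort (map X [1..<Suc n]) ! (i - 1) \<le> sort (map X [1..<Suc n]) ! (j - 1)"
    by (rule sorted_nth_mono) (use ij in auto)
  then show "sort_coords n X i \<le> sort_coords n X j" using ij by (simp add: sort_coords_def del: upt_Suc)
qed

text \<open>Both functions list the same multiset in increasing order.\<close>

lemma mono_rearrangement_unique:
  fixes f g :: "nat \<Rightarrow> 'a::linorder"
  assumes "mono_on {1..n} f" "mono_on {1..n} g" "\<sigma> permutes {1..n}" "\<And>k. k \<in> {1..n} \<Longrightarrow> g k = f (\<sigma> k)" "k \<in> {1..n}"
  shows "g k = f k"
proof -
  have sf: "sorted (map f [1..<Suc n])" "sorted (map g [1..<Suc n])"
    using assms(1,2) unfolding sorted_iff_nth_mono mono_on_def by (auto simp del: upt_Suc)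
  have "mset (map g [1..<Suc n]) = image_mset g (mset_set {1..n})"
    by (simp add: mset_set_upto_eq_mset_upto[symmetric] atLeastLessThanSuc_atLeastAtMost del: upt_Suc)
  also have "\<dots> = image_mset f (image_mset \<sigma> (mset_set {1..n}))"
    using assms(4) by (auto simp: multiset.map_comp intro!: image_mset_cong)
  also have "image_mset \<sigma> (mset_set {1..n}) = mset_set {1..n}"
    using permutes_image[OF assms(3)] permutes_inj_on[OF assms(3), of "{1..n}"] by (subst image_mset_mset_set) auto
  also have "image_mset f (mset_set {1..n}) = mset (map f [1..<Suc n])"
    by (simp add: mset_set_upto_eq_mset_upto[symmetric] atLeastLessThanSuc_atLeastAtMost del: upt_Suc)
  finally have "map g [1..<Suc n] = map f [1..<Suc n]"
    using sf by (metis sorted_sort_id sorted_list_of_multiset_mset)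
  then show ?thesis using assms(5) by (auto simp del: upt_Suc)
qed

section \<open>From the maximum of the weight to its integral\<close>

locale weighted_ensemble = multi_index +
  fixes \<tau> :: "nat \<Rightarrow> real measure"
  assumes tau: "\<And>i. i \<in> {1..p} \<Longrightarrow> \<tau> i \<in> borel_measures_on (\<Gamma> i) \<and> finite_measure (\<tau> i)"
begin

text \<open>A value is needed for every index in order to form products over arbitrary index sets; outside
  \<open>{1..n}\<close> it is any finite measure.\<close>

definition tau_coord :: "nat \<Rightarrow> real measure" where
  "tau_coord m = (if m \<in> {1..n} then \<tau> (blk m) else return borel 0)"

lemma tau_sets: "i \<in> {1..p} \<Longrightarrow> sets (\<tau> i) = sets borel"
  using tau unfolding borel_measures_on_def by auto

lemma tau_coord_sets [measurable_cong]: "sets (tau_coord m) = sets borel"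
  using tau_sets[OF blk_bounds(1)] by (simp add: tau_coord_def)

lemma tau_coord_finite: "finite_measure (tau_coord m)"
  using tau[OF blk_bounds(1), of m] prob_space_return[of 0 "borel::real measure"] by (auto simp: tau_coord_def prob_space_def)

lemma tau_coord_space: "space (tau_coord m) = UNIV"
  using sets_eq_imp_space_eq[OF tau_coord_sets[of m]] by simp

lemma tau_coord_AE: assumes "m \<in> {1..n}" shows "AE x in tau_coord m. x \<in> \<Gamma> (blk m)"
proof -
  note b = blk_bounds(1)[OF assms]
  have "emeasure (tau_coord m) (- \<Gamma> (blk m)) = 0"
    using null_complement_msupport[of "\<tau> (blk m)" "\<Gamma> (blk m)"] tau[OF b] Gamma_compact[OF b] compact_imp_closed assms
    by (auto simp: borel_measures_on_def tau_coord_def)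
  then show ?thesis by (intro AE_I[of _ _ "- \<Gamma> (blk m)"]) (use Gamma_borel[OF b] in \<open>auto simp: tau_coord_sets\<close>)
qed

sublocale TM: product_sigma_finite tau_coord
  using tau_coord_finite unfolding product_sigma_finite_def finite_measure_def by auto

definition tau_prod :: "(nat \<Rightarrow> real) measure" where "tau_prod = PiM {1..n} tau_coord"

lemma tau_prod_eq: "product_tau p \<tau> nn = tau_prod"
  unfolding tau_prod_def product_tau_def n_def[symmetric] by (rule PiM_cong) (auto simp: tau_coord_def)

lemma tau_prod_sets [measurable_cong]: "sets tau_prod = sets (Rn n)"
  unfolding tau_prod_def by (rule sets_PiM_cong) (auto simp: tau_coord_sets)

lemma tau_prod_space: "space tau_prod = space (Rn n)" by (rule sets_eq_imp_space_eq[OF tau_prod_sets])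

lemma tau_prod_AE_region: "AE X in tau_prod. X \<in> region"
proof -
  have "AE X in tau_prod. \<forall>m\<in>{1..n}. X m \<in> \<Gamma> (blk m)"
  proof (rule AE_finite_allI)
    fix m assume m: "m \<in> {1..n}"
    interpret P: finite_product_sigma_finite tau_coord "{1..n}" by standard simp
    have b: "\<Gamma> (blk m) \<in> sets borel" using blk_bounds(1)[OF m] by simp
    define A where "A k = (if k = m then - \<Gamma> (blk m) else UNIV)" for k
    have "emeasure tau_prod (PiE {1..n} A) = (\<Prod>k\<in>{1..n}. emeasure (tau_coord k) (A k))"
      unfolding tau_prod_def by (rule P.measure_times) (use b in \<open>auto simp: A_def tau_coord_sets\<close>)
    also have "\<dots> = 0"
    proof (rule prod_zero)
      have "emeasure (tau_coord m) (- \<Gamma> (blk m)) = 0"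
        using tau_coord_AE[OF m] b by (subst (asm) AE_iff_measurable[OF _ refl]) (auto simp: tau_coord_sets tau_coord_space Compl_eq)
      then show "\<exists>k\<in>{1..n}. emeasure (tau_coord k) (A k) = 0" using m by (intro bexI[of _ m]) (auto simp: A_def)
    qed simp
    finally have "emeasure tau_prod (PiE {1..n} A) = 0" .
    moreover have "PiE {1..n} A \<in> sets tau_prod"
      unfolding tau_prod_def by (rule sets_PiM_I_finite) (use b in \<open>auto simp: A_def tau_coord_sets\<close>)
    ultimately show "AE X in tau_prod. X m \<in> \<Gamma> (blk m)"
      by (intro AE_I[of _ _ "PiE {1..n} A"]) (use m in \<open>auto simp: tau_prod_def space_PiM A_def PiE_iff extensional_def\<close>)
  qed simp
  moreover have "AE X in tau_prod. X \<in> space tau_prod" by (rule AE_space)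
  ultimately show ?thesis
  proof eventually_elim
    fix X assume "\<forall>m\<in>{1..n}. X m \<in> \<Gamma> (blk m)" "X \<in> space tau_prod"
    then show "X \<in> region" unfolding region_def tau_prod_def space_PiM by (auto simp: PiE_def)
  qed
qed

text \<open>On the region it is the ensemble weight. With absolute values the expression is nonnegative
  everywhere and symmetric within the blocks, and each factor becomes the modulus of a polynomial.\<close>

definition abs_weight :: "(nat \<Rightarrow> real) \<Rightarrow> real" where
  "abs_weight X = (\<Prod>(m,m')\<in>pairs. \<bar>X m - X m'\<bar> ^ pair_exp m m') * (\<Prod>m=1..n. exp (- (2 * real n * Q_ext (X m))))"

lemma abs_weight_eq: "X \<in> region \<Longrightarrow> angelesco_weight p Q nn X = abs_weight X"
  unfolding weight_abs abs_weight_def by (simp add: exp_sum[symmetric] sum_negf sum_distrib_left)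

lemma abs_weight_nonneg: "0 \<le> abs_weight X"
  unfolding abs_weight_def by (intro mult_nonneg_nonneg prod_nonneg) auto

lemma abs_weight_cong: "(\<And>m. m \<in> {1..n} \<Longrightarrow> X m = Y m) \<Longrightarrow> abs_weight X = abs_weight Y"
  unfolding abs_weight_def by (intro arg_cong2[of _ _ _ _ "(*)"] prod.cong refl) (auto dest!: pairsD)

lemma abs_weight_measurable:
  assumes "\<And>m. m \<in> {1..n} \<Longrightarrow> (\<lambda>Z. h Z m) \<in> borel_measurable M"
  shows "(\<lambda>Z. abs_weight (h Z)) \<in> borel_measurable M"
proof -
  have "(\<lambda>Z. \<Prod>z\<in>pairs. \<bar>h Z (fst z) - h Z (snd z)\<bar> ^ pair_exp (fst z) (snd z)) \<in> borel_measurable M"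
  proof (rule borel_measurable_prod)
    fix z assume "z \<in> pairs"
    then have "(fst z, snd z) \<in> pairs" by simp
    from pairsD[OF this] have [measurable]: "(\<lambda>Z. h Z (fst z)) \<in> borel_measurable M" "(\<lambda>Z. h Z (snd z)) \<in> borel_measurable M"
      using assms by auto
    show "(\<lambda>Z. \<bar>h Z (fst z) - h Z (snd z)\<bar> ^ pair_exp (fst z) (snd z)) \<in> borel_measurable M" by measurable
  qed
  moreover have "(\<lambda>Z. \<Prod>m=1..n. exp (- (2 * real n * Q_ext (h Z m)))) \<in> borel_measurable M"
  proof (rule borel_measurable_prod)
    fix m assume "m \<in> {1..n}"
    then have [measurable]: "(\<lambda>Z. h Z m) \<in> borel_measurable M" by (rule assms)
    show "(\<lambda>Z. exp (- (2 * real n * Q_ext (h Z m)))) \<in> borel_measurable M" by measurable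
  qed
  ultimately show ?thesis unfolding abs_weight_def case_prod_beta by (rule borel_measurable_times)
qed

lemma abs_weight_bound: "X \<in> region \<Longrightarrow> abs_weight X \<le> ((2 * rad)\<^sup>2) ^ card pairs * exp (2 * real n * Q_bound) ^ n"
  unfolding abs_weight_def
proof (rule mult_mono)
  assume X: "X \<in> region"
  have r2: "1 \<le> 2 * rad" using rad(1) by simp
  have "(\<Prod>(m,m')\<in>pairs. \<bar>X m - X m'\<bar> ^ pair_exp m m') \<le> (\<Prod>z\<in>pairs. (2 * rad)\<^sup>2)"
  proof (rule prod_mono)
    fix z assume z: "z \<in> pairs"
    obtain m m' where zz: "z = (m, m')" by (cases z)
    have m: "m \<in> {1..n}" "m' \<in> {1..n}" using pairsD z zz by auto
    have "\<bar>X m - X m'\<bar> \<le> 2 * rad" using rad(2)[OF regionD(2)[OF X m(1)]] rad(2)[OF regionD(2)[OF X m(2)]] by linarith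
    then have "\<bar>X m - X m'\<bar> ^ pair_exp m m' \<le> (2 * rad) ^ pair_exp m m'" by (intro power_mono) auto
    also have "\<dots> \<le> (2 * rad) ^ 2" by (rule power_increasing[OF _ r2]) (simp add: pair_exp_def)
    finally show "0 \<le> (case z of (m, m') \<Rightarrow> \<bar>X m - X m'\<bar> ^ pair_exp m m') \<and> (case z of (m, m') \<Rightarrow> \<bar>X m - X m'\<bar> ^ pair_exp m m') \<le> (2 * rad)\<^sup>2"
      by (simp add: zz)
  qed
  then show "(\<Prod>(m,m')\<in>pairs. \<bar>X m - X m'\<bar> ^ pair_exp m m') \<le> ((2 * rad)\<^sup>2) ^ card pairs" by simp
  have "(\<Prod>m=1..n. exp (- (2 * real n * Q_ext (X m)))) \<le> (\<Prod>m=1..n. exp (2 * real n * Q_bound))"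
  proof (rule prod_mono)
    fix m
    have "- Q_ext (X m) \<le> Q_bound" using abs_Q_ext_le[of "X m"] by simp
    then have "2 * real n * (- Q_ext (X m)) \<le> 2 * real n * Q_bound" by (intro mult_left_mono) auto
    then show "0 \<le> exp (- (2 * real n * Q_ext (X m))) \<and> exp (- (2 * real n * Q_ext (X m))) \<le> exp (2 * real n * Q_bound)" by simp
  qed
  then show "(\<Prod>m=1..n. exp (- (2 * real n * Q_ext (X m)))) \<le> exp (2 * real n * Q_bound) ^ n" by simp
qed (auto intro!: prod_nonneg)

text \<open>The factors \<open>X m - X m'\<close> that involve coordinate \<open>j\<close> are linear in it and have total degree at most \<open>2 *
  (n - 1)\<close>; all others are constants. The external field enters as \<open>exp (- 2 * n * Q)\<close>, the power of
  the weight that a polynomial of degree \<open>2 * n\<close> requires in the Bernstein--Markov inequality.\<close>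

lemma abs_weight_one_variable:
  assumes j: "j \<in> {1..n}"
  shows "\<exists>P::complex poly. degree P \<le> 2 * n \<and>
     (\<forall>x. abs_weight (X(j := x)) = norm (poly P (complex_of_real x)) * exp (- (2 * real n * Q_ext x)))"
proof -
  \<comment> \<open>the factor of the pair \<open>z\<close> as a polynomial in coordinate \<open>j\<close>\<close>
  define f :: "nat \<times> nat \<Rightarrow> complex poly" where
    "f z = (if fst z = j then [:- complex_of_real (X (snd z)), 1:] ^ pair_exp (fst z) (snd z)
            else if snd z = j then [:- complex_of_real (X (fst z)), 1:] ^ pair_exp (fst z) (snd z)
            else [:complex_of_real (\<bar>X (fst z) - X (snd z)\<bar> ^ pair_exp (fst z) (snd z)):])" for z
  define c where "c = (\<Prod>m\<in>{1..n} - {j}. exp (- (2 * real n * Q_ext (X m))))"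
  define P where "P = smult (complex_of_real c) (\<Prod>z\<in>pairs. f z)"
  have c0: "0 \<le> c" by (simp add: c_def prod_nonneg)
  have ex2: "pair_exp a b \<le> 2" for a b by (simp add: pair_exp_def)
  have dlin: "degree ([:u, 1:] ^ k) \<le> k" for u :: complex and k
    using degree_power_le[of "[:u, 1:]" k] by simp
  have d2: "degree ([:u, 1:] ^ pair_exp a b) \<le> 2" for u :: complex and a b
    by (rule order_trans[OF dlin ex2])
  have deg: "degree (f z) \<le> (if fst z = j then 2 else 0) + (if snd z = j then 2 else 0)" for z
  proof -
    consider "fst z = j" | "fst z \<noteq> j" "snd z = j" | "fst z \<noteq> j" "snd z \<noteq> j" by blast
    then show ?thesis
    proof cases
      case 1
      then have "f z = [:- complex_of_real (X (snd z)), 1:] ^ pair_exp (fst z) (snd z)" by (simp add: f_def)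
      then have "degree (f z) \<le> 2" by (simp only: d2)
      then show ?thesis using 1 by simp
    next
      case 2
      then have "f z = [:- complex_of_real (X (fst z)), 1:] ^ pair_exp (fst z) (snd z)" by (simp add: f_def)
      then have "degree (f z) \<le> 2" by (simp only: d2)
      then show ?thesis using 2 by simp
    next
      case 3 then show ?thesis unfolding f_def by simp
    qed
  qed
  have "degree P \<le> degree (\<Prod>z\<in>pairs. f z)" unfolding P_def by (rule degree_smult_le)
  also have "\<dots> \<le> (\<Sum>z\<in>pairs. degree (f z))" using degree_prod_sum_le[of pairs f] by (simp add: o_def)
  also have "\<dots> \<le> (\<Sum>z\<in>pairs. (if fst z = j then 2 else 0) + (if snd z = j then 2 else 0))" by (intro sum_mono deg)
  also have "\<dots> = (\<Sum>m=1..n. \<Sum>m'=1..<m. (if m = j then 2 else 0) + (if m' = j then 2 else (0::nat)))"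
    unfolding pairs_def by (subst sum.Sigma) (auto simp: case_prod_beta)
  also have "\<dots> \<le> (\<Sum>m=1..n. (if m = j then 2 * (j - 1) else 0) + (if j < m then 2 else 0))"
  proof (rule sum_mono)
    fix m
    have "(\<Sum>m'=1..<m. (if m' = j then 2 else (0::nat))) \<le> (if j < m then 2 else 0)"
      by (subst sum.delta) auto
    then show "(\<Sum>m'=1..<m. (if m = j then 2 else 0) + (if m' = j then 2 else (0::nat))) \<le> (if m = j then 2 * (j - 1) else 0) + (if j < m then 2 else 0)"
      by (auto simp: sum.distrib)
  qed
  also have "\<dots> = 2 * (j - 1) + 2 * (n - j)"
  proof -
    have "{m \<in> {1..n}. j < m} = {j<..n}" using j by auto
    then have "(\<Sum>m=1..n. (if j < m then 2 else (0::nat))) = 2 * (n - j)"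
      by (subst sum.inter_filter[symmetric]) auto
    moreover have "(\<Sum>m=1..n. (if m = j then 2 * (j - 1) else 0)) = 2 * (j - 1)" using j by (subst sum.delta) auto
    ultimately show ?thesis by (simp add: sum.distrib)
  qed
  also have "\<dots> \<le> 2 * n" using j by auto
  finally have "degree P \<le> 2 * n" .
  moreover have "abs_weight (X(j := x)) = norm (poly P (complex_of_real x)) * exp (- (2 * real n * Q_ext x))" for x
  proof -
    let ?Y = "X(j := x)"
    have nf: "norm (poly (f (m, m')) (complex_of_real x)) = \<bar>?Y m - ?Y m'\<bar> ^ pair_exp m m'" if "(m, m') \<in> pairs" for m m'
    proof -
      have ne: "m \<noteq> m'" using pairsD[OF that] by auto
      have nr: "norm (complex_of_real a - complex_of_real b) = \<bar>a - b\<bar>" for a b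
        by (metis norm_of_real of_real_diff)
      show ?thesis using ne
        by (auto simp: f_def norm_power nr abs_minus_commute norm_mult)
    qed
    have "norm (poly P (complex_of_real x)) = c * (\<Prod>z\<in>pairs. norm (poly (f z) (complex_of_real x)))"
      unfolding P_def poly_smult poly_prod norm_mult prod_norm[symmetric] using c0 by simp
    also have "(\<Prod>z\<in>pairs. norm (poly (f z) (complex_of_real x))) = (\<Prod>(m,m')\<in>pairs. \<bar>?Y m - ?Y m'\<bar> ^ pair_exp m m')"
      by (rule prod.cong[OF refl]) (use nf in \<open>auto simp: case_prod_beta\<close>)
    finally have N: "norm (poly P (complex_of_real x)) = c * (\<Prod>(m,m')\<in>pairs. \<bar>?Y m - ?Y m'\<bar> ^ pair_exp m m')" .
    have "(\<Prod>m=1..n. exp (- (2 * real n * Q_ext (?Y m)))) = exp (- (2 * real n * Q_ext x)) * (\<Prod>m\<in>{1..n} - {j}. exp (- (2 * real n * Q_ext (?Y m))))"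
      using j by (subst prod.remove[of _ j]) auto
    also have "(\<Prod>m\<in>{1..n} - {j}. exp (- (2 * real n * Q_ext (?Y m)))) = c"
      unfolding c_def by (rule prod.cong) auto
    finally show ?thesis unfolding abs_weight_def N by simp
  qed
  ultimately show ?thesis by blast
qed

end

lemma mono_region_measurable: "{X \<in> space (Rn n). mono_on {1..n} X} \<in> sets (Rn n)"
proof (cases "n = 0")
  case False
  have "{X \<in> space (Rn n). \<forall>i\<in>{1..n}. \<forall>j\<in>{1..n}. i \<le> j \<longrightarrow> X i \<le> X j} \<in> sets (Rn n)"
  proof (intro sets.sets_Collect_finite_All')
    fix i j assume ij: "i \<in> {1..n}" "j \<in> {1..n}"
    have "(\<lambda>X. X i) \<in> borel_measurable (Rn n)" "(\<lambda>X. X j) \<in> borel_measurable (Rn n)"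
      using ij by (auto intro!: measurable_component_singleton)
    then have "{X \<in> space (Rn n). X i \<le> X j} \<in> sets (Rn n)" by (rule borel_measurable_le)
    then show "{X \<in> space (Rn n). i \<le> j \<longrightarrow> X i \<le> X j} \<in> sets (Rn n)" by (cases "i \<le> j") auto
  qed (use False in auto)
  moreover have "{X \<in> space (Rn n). mono_on {1..n} X} = {X \<in> space (Rn n). \<forall>i\<in>{1..n}. \<forall>j\<in>{1..n}. i \<le> j \<longrightarrow> X i \<le> X j}"
    unfolding mono_on_def by blast
  ultimately show ?thesis by (simp only:)
qed (simp add: mono_on_def)

context angelesco_intervals
begin

text \<open>The Bernstein--Markov inequality as a pointwise estimate on the real line with a nonnegative
  integral, which is convenient for iteration. The constant is common to all intervals.\<close>

definition BM_bound :: "(nat \<Rightarrow> real measure) \<Rightarrow> real \<Rightarrow> real \<Rightarrow> bool" where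
  "BM_bound \<tau> C \<epsilon> \<longleftrightarrow> C > 0 \<and> (\<forall>i\<in>{1..p}. \<forall>m. \<forall>P::complex poly. degree P \<le> m \<longrightarrow> (\<forall>x\<in>\<Gamma> i.
     ennreal (norm (poly P (complex_of_real x)) * exp (- (real m * Q_ext x)))
       \<le> ennreal (C * (1 + \<epsilon>) ^ m) * (\<integral>\<^sup>+y. ennreal (norm (poly P (complex_of_real y)) * exp (- (real m * Q_ext y))) \<partial>\<tau> i)))"

lemma BM_one_interval:
  assumes i: "i \<in> {1..p}" and tau: "\<tau> i \<in> borel_measures_on (\<Gamma> i) \<and> finite_measure (\<tau> i)"
    and BM: "weighted_BM (complex_of_real ` \<Gamma> i) (\<lambda>z. Q i (Re z)) (distr (\<tau> i) borel complex_of_real)"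
    and eps: "\<epsilon> > 0"
  shows "\<exists>C>0. \<forall>m. \<forall>P::complex poly. degree P \<le> m \<longrightarrow> (\<forall>x\<in>\<Gamma> i.
     ennreal (norm (poly P (complex_of_real x)) * exp (- (real m * Q_ext x)))
       \<le> ennreal (C * (1 + \<epsilon>) ^ m) * (\<integral>\<^sup>+y. ennreal (norm (poly P (complex_of_real y)) * exp (- (real m * Q_ext y))) \<partial>\<tau> i))"
proof -
  define K where "K = complex_of_real ` \<Gamma> i"
  obtain C where C: "C > 0" "\<And>m P. degree P \<le> m \<Longrightarrow>
        (SUP z\<in>K. norm (poly P z) * exp (- real m * Q i (Re z)))
          \<le> C * (1 + \<epsilon>) ^ m * (LINT z:K|distr (\<tau> i) borel complex_of_real. norm (poly P z) * exp (- real m * Q i (Re z)))"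
    using BM eps unfolding weighted_BM_def K_def by blast
  interpret finite_measure "\<tau> i" using tau by blast
  have s [measurable_cong]: "sets (\<tau> i) = sets borel" using tau unfolding borel_measures_on_def by blast
  have [measurable]: "\<Gamma> i \<in> sets borel" using i by simp
  have Kc: "compact K" unfolding K_def by (intro compact_continuous_image Gamma_compact[OF i] continuous_intros)
  have Kb: "K \<in> sets borel" using Kc by (simp add: borel_compact)
  have cr: "complex_of_real \<in> \<tau> i \<rightarrow>\<^sub>M borel" by measurable
  have main: "ennreal (norm (poly P (complex_of_real x)) * exp (- (real m * Q_ext x)))
       \<le> ennreal (C * (1 + \<epsilon>) ^ m) * (\<integral>\<^sup>+y. ennreal (norm (poly P (complex_of_real y)) * exp (- (real m * Q_ext y))) \<partial>\<tau> i)"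
    if deg: "degree P \<le> m" and x: "x \<in> \<Gamma> i" for m P x
  proof -
    define g where "g z = norm (poly P z) * exp (- real m * Q i (Re z))" for z
    have gc: "continuous_on K g"
    proof -
      have "continuous_on K (\<lambda>z. Q i (Re z))"
        by (rule continuous_on_compose2[OF Q_cont[OF i]]) (auto simp: K_def intro!: continuous_intros)
      then show ?thesis unfolding g_def by (intro continuous_intros)
    qed
    have bdd: "bdd_above (g ` K)"
      using compact_imp_bounded[OF compact_continuous_image[OF gc Kc]] by (rule bounded_imp_bdd_above)
    obtain B where B: "\<And>z. z \<in> K \<Longrightarrow> norm (g z) \<le> B"
      using compact_imp_bounded[OF compact_continuous_image[OF gc Kc]] unfolding bounded_iff by auto
    define h where "h y = indicator (\<Gamma> i) y * g (complex_of_real y)" for y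
    have ind: "indicator K (complex_of_real y) = (indicator (\<Gamma> i) y :: real)" for y
      unfolding K_def by (auto simp: indicator_def)
    have gm: "(\<lambda>z. indicator K z *\<^sub>R g z) \<in> borel_measurable borel"
      by (rule borel_measurable_continuous_on_indicator[OF Kb gc])
    have hm: "h \<in> borel_measurable (\<tau> i)"
      using measurable_compose[OF cr gm] unfolding ind h_def by simp
    have gn: "0 \<le> g z" for z by (simp add: g_def)
    have hb: "0 \<le> h y \<and> h y \<le> \<bar>B\<bar>" for y
      using B[of "complex_of_real y"] gn[of "complex_of_real y"] by (auto simp: h_def indicator_def K_def)
    have hint: "integrable (\<tau> i) h"
      by (rule integrable_const_bound[where B = "\<bar>B\<bar>"]) (use hb hm in auto)
    have "g (complex_of_real x) \<le> (SUP z\<in>K. g z)"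
      by (rule cSUP_upper[OF _ bdd]) (use x in \<open>simp add: K_def\<close>)
    also have "\<dots> \<le> C * (1 + \<epsilon>) ^ m * (LINT z:K|distr (\<tau> i) borel complex_of_real. g z)"
      using C(2)[OF deg] unfolding g_def .
    also have "(LINT z:K|distr (\<tau> i) borel complex_of_real. g z) = (\<integral>y. h y \<partial>\<tau> i)"
      unfolding set_lebesgue_integral_def by (subst integral_distr[OF cr gm]) (simp add: ind h_def[abs_def])
    finally have 1: "g (complex_of_real x) \<le> C * (1 + \<epsilon>) ^ m * (\<integral>y. h y \<partial>\<tau> i)" .
    have "ennreal (g (complex_of_real x)) \<le> ennreal (C * (1 + \<epsilon>) ^ m) * ennreal (\<integral>y. h y \<partial>\<tau> i)"
      using ennreal_leI[OF 1] C(1) eps hb by (subst (asm) ennreal_mult) auto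
    also have "ennreal (\<integral>y. h y \<partial>\<tau> i) = (\<integral>\<^sup>+y. ennreal (h y) \<partial>\<tau> i)"
      by (rule nn_integral_eq_integral[symmetric, OF hint]) (use hb in auto)
    also have "\<dots> \<le> (\<integral>\<^sup>+y. ennreal (norm (poly P (complex_of_real y)) * exp (- (real m * Q_ext y))) \<partial>\<tau> i)"
      by (intro nn_integral_mono ennreal_leI) (auto simp: h_def g_def indicator_def Q_ext_eq[OF i])
    finally show ?thesis using Q_ext_eq[OF i x] by (simp add: g_def mult_left_mono)
  qed
  then show ?thesis using C(1) by blast
qed

lemma BM_bound_exists:
  assumes tau: "\<And>i. i \<in> {1..p} \<Longrightarrow> \<tau> i \<in> borel_measures_on (\<Gamma> i) \<and> finite_measure (\<tau> i)"
    and BM: "\<And>i. i \<in> {1..p} \<Longrightarrow> weighted_BM (complex_of_real ` \<Gamma> i) (\<lambda>z. Q i (Re z)) (distr (\<tau> i) borel complex_of_real)"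
    and eps: "\<epsilon> > 0"
  shows "\<exists>C. BM_bound \<tau> C \<epsilon>"
proof -
  have "\<forall>i\<in>{1..p}. \<exists>C>0. \<forall>m. \<forall>P::complex poly. degree P \<le> m \<longrightarrow> (\<forall>x\<in>\<Gamma> i.
     ennreal (norm (poly P (complex_of_real x)) * exp (- (real m * Q_ext x)))
       \<le> ennreal (C * (1 + \<epsilon>) ^ m) * (\<integral>\<^sup>+y. ennreal (norm (poly P (complex_of_real y)) * exp (- (real m * Q_ext y))) \<partial>\<tau> i))"
    by (intro ballI BM_one_interval[OF _ tau BM eps])
  from bchoice[OF this] obtain Cf where Cf: "\<And>i. i \<in> {1..p} \<Longrightarrow> Cf i > 0"
    "\<And>i m x P. i \<in> {1..p} \<Longrightarrow> degree P \<le> m \<Longrightarrow> x \<in> \<Gamma> i \<Longrightarrow> 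
     ennreal (norm (poly P (complex_of_real x)) * exp (- (real m * Q_ext x)))
       \<le> ennreal (Cf i * (1 + \<epsilon>) ^ m) * (\<integral>\<^sup>+y. ennreal (norm (poly P (complex_of_real y)) * exp (- (real m * Q_ext y))) \<partial>\<tau> i)"
    by blast
  define C where "C = (\<Sum>i=1..p. Cf i)"
  have le: "Cf i \<le> C" if "i \<in> {1..p}" for i
    unfolding C_def by (rule member_le_sum[OF that]) (use Cf(1) in \<open>auto intro: less_imp_le\<close>)
  have C0: "C > 0" using Cf(1)[of 1] le[of 1] p_ge by simp
  show ?thesis unfolding BM_bound_def
  proof (intro exI[of _ C] conjI C0 ballI allI impI)
    fix i m x and P :: "complex poly" assume a: "i \<in> {1..p}" "degree P \<le> m" "x \<in> \<Gamma> i"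
    have "ennreal (Cf i * (1 + \<epsilon>) ^ m) \<le> ennreal (C * (1 + \<epsilon>) ^ m)"
      using le[OF a(1)] eps by (intro ennreal_leI mult_right_mono) auto
    from order_trans[OF Cf(2)[OF a] mult_right_mono[OF this]]
    show "ennreal (norm (poly P (complex_of_real x)) * exp (- (real m * Q_ext x)))
       \<le> ennreal (C * (1 + \<epsilon>) ^ m) * (\<integral>\<^sup>+y. ennreal (norm (poly P (complex_of_real y)) * exp (- (real m * Q_ext y))) \<partial>\<tau> i)" by simp
  qed
qed

end

context weighted_ensemble
begin

text \<open>By induction on the set of coordinates that are integrated out: in the next coordinate the weight is
  a weighted polynomial, and its value there is bounded by its integral.\<close>

lemma BM_coordinates:
  assumes BM: "BM_bound \<tau> C \<epsilon>" and fin: "finite J" and J: "J \<subseteq> {1..n}" and X: "\<And>m. m \<in> J \<Longrightarrow> X m \<in> \<Gamma> (blk m)"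
  shows "ennreal (abs_weight X) \<le> ennreal (C * (1 + \<epsilon>) ^ (2 * n)) ^ card J
     * (\<integral>\<^sup>+Y. ennreal (abs_weight (\<lambda>k. if k \<in> J then Y k else X k)) \<partial>PiM J tau_coord)"
  using fin J X
proof (induction J rule: finite_induct)
  case empty
  then show ?case by (simp add: PiM_empty nn_integral_count_space_finite)
next
  case (insert j J)
  define D where "D = ennreal (C * (1 + \<epsilon>) ^ (2 * n))"
  define h where "h Y = (\<lambda>k. if k \<in> J then Y k else X k)" for Y
  have j: "j \<in> {1..n}" "X j \<in> \<Gamma> (blk j)" using insert.prems by auto
  have hm: "(\<lambda>Z. ennreal (abs_weight (\<lambda>k. if k \<in> insert j J then Z k else X k))) \<in> borel_measurable (PiM (insert j J) tau_coord)"
  proof (intro measurable_compose[OF abs_weight_measurable measurable_ennreal])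
    fix m
    show "(\<lambda>Z. if m \<in> insert j J then Z m else X m) \<in> borel_measurable (PiM (insert j J) tau_coord)"
    proof (cases "m \<in> insert j J")
      case True
      have "(\<lambda>Z. Z m) \<in> PiM (insert j J) tau_coord \<rightarrow>\<^sub>M tau_coord m" by (rule measurable_component_singleton[OF True])
      then show ?thesis using True by (simp add: measurable_cong_sets[OF refl tau_coord_sets])
    qed simp
  qed
  have step: "ennreal (abs_weight (h Y)) \<le> D * (\<integral>\<^sup>+y. ennreal (abs_weight ((h Y)(j := y))) \<partial>tau_coord j)" for Y
  proof -
    obtain P :: "complex poly" where P: "degree P \<le> 2 * n" 
      "\<And>x. abs_weight ((h Y)(j := x)) = norm (poly P (complex_of_real x)) * exp (- (2 * real n * Q_ext x))"
      using abs_weight_one_variable[OF j(1), of "h Y"] by blast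
    have "h Y = (h Y)(j := X j)" using insert.hyps(2) by (auto simp: h_def)
    then have "abs_weight (h Y) = norm (poly P (complex_of_real (X j))) * exp (- (2 * real n * Q_ext (X j)))" using P(2)[of "X j"] by simp
    moreover have "ennreal (norm (poly P (complex_of_real (X j))) * exp (- (real (2 * n) * Q_ext (X j))))
       \<le> D * (\<integral>\<^sup>+y. ennreal (norm (poly P (complex_of_real y)) * exp (- (real (2 * n) * Q_ext y))) \<partial>\<tau> (blk j))"
      using BM blk_bounds(1)[OF j(1)] P(1) j(2) unfolding BM_bound_def D_def by blast
    ultimately show ?thesis using j(1) by (simp add: P(2) tau_coord_def)
  qed
  have "ennreal (abs_weight X) \<le> D ^ card J * (\<integral>\<^sup>+Y. ennreal (abs_weight (h Y)) \<partial>PiM J tau_coord)"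
    using insert.IH insert.prems unfolding D_def h_def by auto
  also have "\<dots> \<le> D ^ card J * (\<integral>\<^sup>+Y. D * (\<integral>\<^sup>+y. ennreal (abs_weight ((h Y)(j := y))) \<partial>tau_coord j) \<partial>PiM J tau_coord)"
    by (intro mult_left_mono nn_integral_mono step) simp
  also have "(\<integral>\<^sup>+Y. D * (\<integral>\<^sup>+y. ennreal (abs_weight ((h Y)(j := y))) \<partial>tau_coord j) \<partial>PiM J tau_coord)
      = (\<integral>\<^sup>+Y. D * (\<integral>\<^sup>+y. ennreal (abs_weight (\<lambda>k. if k \<in> insert j J then (Y(j := y)) k else X k)) \<partial>tau_coord j) \<partial>PiM J tau_coord)"
    by (intro nn_integral_cong arg_cong[of _ _ "\<lambda>u. D * u"] arg_cong[of _ _ "\<lambda>X. ennreal (abs_weight X)"]) (auto simp: h_def)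
  also have "\<dots> = D * (\<integral>\<^sup>+Y. (\<integral>\<^sup>+y. ennreal (abs_weight (\<lambda>k. if k \<in> insert j J then (Y(j := y)) k else X k)) \<partial>tau_coord j) \<partial>PiM J tau_coord)"
  proof (rule nn_integral_cmult)
    define F where "F Z = ennreal (abs_weight (\<lambda>k. if k \<in> insert j J then Z k else X k))" for Z
    have Fm: "F \<in> borel_measurable (PiM (insert j J) tau_coord)" unfolding F_def by (rule hm)
    have "(\<lambda>(Y, y). Y(j := y)) \<in> PiM J tau_coord \<Otimes>\<^sub>M tau_coord j \<rightarrow>\<^sub>M PiM (insert j J) tau_coord"
      by (rule measurable_add_dim)
    from measurable_compose[OF this Fm]
    have Fm2: "(\<lambda>z. F ((fst z)(j := snd z))) \<in> borel_measurable (PiM J tau_coord \<Otimes>\<^sub>M tau_coord j)"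
      by (simp add: case_prod_beta')
    have sf: "sigma_finite_measure (tau_coord j)" by (rule TM.sigma_finite_measures)
    have "(\<lambda>Y. \<integral>\<^sup>+y. F (Y(j := y)) \<partial>tau_coord j) \<in> borel_measurable (PiM J tau_coord)"
      using sigma_finite_measure.borel_measurable_nn_integral_fst[OF sf Fm2] by simp
    then show "(\<lambda>Y. \<integral>\<^sup>+y. ennreal (abs_weight (\<lambda>k. if k \<in> insert j J then (Y(j := y)) k else X k)) \<partial>tau_coord j) \<in> borel_measurable (PiM J tau_coord)"
      unfolding F_def .
  qed
  also have "(\<integral>\<^sup>+Y. (\<integral>\<^sup>+y. ennreal (abs_weight (\<lambda>k. if k \<in> insert j J then (Y(j := y)) k else X k)) \<partial>tau_coord j) \<partial>PiM J tau_coord)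
     = (\<integral>\<^sup>+Z. ennreal (abs_weight (\<lambda>k. if k \<in> insert j J then Z k else X k)) \<partial>PiM (insert j J) tau_coord)"
    by (rule TM.product_nn_integral_insert[OF insert.hyps hm, symmetric])
  finally show ?case unfolding D_def[symmetric] using insert.hyps by (simp add: ac_simps)
qed

lemma BM_full:
  assumes BM: "BM_bound \<tau> C \<epsilon>" and X: "X \<in> region"
  shows "ennreal (abs_weight X) \<le> ennreal (C * (1 + \<epsilon>) ^ (2 * n)) ^ n * (\<integral>\<^sup>+Y. ennreal (abs_weight Y) \<partial>tau_prod)"
proof -
  have "abs_weight (\<lambda>k. if k \<in> {1..n} then Y k else X k) = abs_weight Y" for Y by (rule abs_weight_cong) simp
  then show ?thesis
    using BM_coordinates[OF BM finite_atLeastAtMost subset_refl regionD(1)[OF X]] unfolding tau_prod_def by simp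
qed

definition block_perms :: "(nat \<Rightarrow> nat) set" where
  "block_perms = {\<sigma>. \<sigma> permutes {1..n} \<and> (\<forall>k\<in>{1..n}. blk (\<sigma> k) = blk k)}"

text \<open>A permutation of the coordinates maps unordered pairs bijectively; reordering the image with \<open>max\<close> and
  \<open>min\<close> gives a bijection of \<open>pairs\<close>. Exponents are preserved because the blocks are.\<close>

lemma abs_weight_block_perm:
  assumes "\<sigma> \<in> block_perms"
  shows "abs_weight (\<lambda>k\<in>{1..n}. X (\<sigma> k)) = abs_weight X"
proof -
  have s: "\<sigma> permutes {1..n}" "\<And>k. k \<in> {1..n} \<Longrightarrow> blk (\<sigma> k) = blk k" using assms unfolding block_perms_def by auto
  have si: "\<sigma> k \<in> {1..n}" if "k \<in> {1..n}" for k using permutes_in_image[OF s(1)] that by blast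
  define g where "g a b = \<bar>X a - X b\<bar> ^ pair_exp a b" for a b
  have gs: "g a b = g b a" for a b by (simp add: g_def pair_exp_def abs_minus_commute)
  define sq where "sq \<rho> z = (max (\<rho> (fst z)) (\<rho> (snd z)), min (\<rho> (fst z)) (\<rho> (snd z)))" for \<rho> :: "nat \<Rightarrow> nat" and z
  have sqP: "sq \<rho> z \<in> pairs" if "\<rho> permutes {1..n}" "z \<in> pairs" for \<rho> z
  proof -
    have z: "fst z \<in> {1..n}" "snd z \<in> {1..n}" "snd z < fst z" using that(2) pairsD[of "fst z" "snd z"] by auto
    have "\<rho> (fst z) \<in> {1..n}" "\<rho> (snd z) \<in> {1..n}" using permutes_in_image[OF that(1)] z by blast+
    moreover have "\<rho> (fst z) \<noteq> \<rho> (snd z)" using injD[OF permutes_inj[OF that(1)], of "fst z" "snd z"] z by auto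
    ultimately show ?thesis unfolding sq_def pairs_def by (simp add: max_def min_def)
  qed
  have sqi: "sq \<rho>' (sq \<rho> z) = z" if "\<rho> permutes {1..n}" "\<And>k. \<rho>' (\<rho> k) = k" "z \<in> pairs" for \<rho> \<rho>' z
  proof -
    have "snd z < fst z" using that(3) pairsD[of "fst z" "snd z"] by auto
    then show ?thesis unfolding sq_def using that(2) by (auto simp: max_def min_def prod_eq_iff)
  qed
  have "(\<Prod>(m,m')\<in>pairs. g (\<sigma> m) (\<sigma> m')) = (\<Prod>(m,m')\<in>pairs. g m m')"
  proof (rule prod.reindex_bij_witness[of _ "sq (inv \<sigma>)" "sq \<sigma>"])
    fix z assume z: "z \<in> pairs"
    show "sq (inv \<sigma>) (sq \<sigma> z) = z" by (rule sqi[OF s(1) _ z]) (simp add: permutes_inverses[OF s(1)])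
    show "sq \<sigma> z \<in> pairs" by (rule sqP[OF s(1) z])
    show "sq \<sigma> (sq (inv \<sigma>) z) = z" by (rule sqi[OF permutes_inv[OF s(1)] _ z]) (simp add: permutes_inverses[OF s(1)])
    show "sq (inv \<sigma>) z \<in> pairs" by (rule sqP[OF permutes_inv[OF s(1)] z])
    show "(case sq \<sigma> z of (m, m') \<Rightarrow> g m m') = (case z of (m, m') \<Rightarrow> g (\<sigma> m) (\<sigma> m'))"
      using gs by (auto simp: sq_def max_def min_def case_prod_beta)
  qed
  moreover have "(\<Prod>(m,m')\<in>pairs. \<bar>(\<lambda>k\<in>{1..n}. X (\<sigma> k)) m - (\<lambda>k\<in>{1..n}. X (\<sigma> k)) m'\<bar> ^ pair_exp m m') = (\<Prod>(m,m')\<in>pairs. g (\<sigma> m) (\<sigma> m'))"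
    by (rule prod.cong[OF refl]) (auto dest!: pairsD simp: g_def pair_exp_def s(2))
  moreover have "(\<Prod>m=1..n. exp (- (2 * real n * Q_ext ((\<lambda>k\<in>{1..n}. X (\<sigma> k)) m)))) = (\<Prod>m=1..n. exp (- (2 * real n * Q_ext (X m))))"
  proof -
    have "(\<Prod>m=1..n. exp (- (2 * real n * Q_ext ((\<lambda>k\<in>{1..n}. X (\<sigma> k)) m)))) = (\<Prod>m=1..n. exp (- (2 * real n * Q_ext (X (\<sigma> m)))))"
      by (rule prod.cong) auto
    also have "\<dots> = (\<Prod>m=1..n. exp (- (2 * real n * Q_ext (X m))))"
      using prod.permute[OF s(1), of "\<lambda>m. exp (- (2 * real n * Q_ext (X m)))"] by (simp add: o_def)
    finally show ?thesis .
  qed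
  ultimately show ?thesis unfolding abs_weight_def by (simp add: g_def case_prod_beta)
qed

lemma tau_prod_block_perm:
  assumes "\<sigma> \<in> block_perms"
  shows "distr tau_prod tau_prod (\<lambda>X. \<lambda>k\<in>{1..n}. X (\<sigma> k)) = tau_prod"
proof -
  have s: "\<sigma> permutes {1..n}" "\<And>k. k \<in> {1..n} \<Longrightarrow> blk (\<sigma> k) = blk k" using assms unfolding block_perms_def by auto
  have si: "\<sigma> k \<in> {1..n}" if "k \<in> {1..n}" for k using permutes_in_image[OF s(1)] that by blast
  have isi: "inv \<sigma> k \<in> {1..n}" if "k \<in> {1..n}" for k using permutes_in_image[OF permutes_inv[OF s(1)]] that by blast
  have tms: "tau_coord (\<sigma> k) = tau_coord k" if "k \<in> {1..n}" for k using that si[OF that] s(2)[OF that] by (simp add: tau_coord_def)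
  have meas: "(\<lambda>X. \<lambda>k\<in>{1..n}. X (\<sigma> k)) \<in> tau_prod \<rightarrow>\<^sub>M tau_prod"
    using permute_coords_measurable[OF s(1), unfolded permute_coords_def[abs_def]] measurable_cong_sets[OF tau_prod_sets tau_prod_sets] by blast
  interpret P: finite_product_sigma_finite tau_coord "{1..n}" by standard simp
  have "distr tau_prod tau_prod (\<lambda>X. \<lambda>k\<in>{1..n}. X (\<sigma> k)) = PiM {1..n} tau_coord"
  proof (rule TM.PiM_eqI)
    show "sets (distr tau_prod tau_prod (\<lambda>X. \<lambda>k\<in>{1..n}. X (\<sigma> k))) = sets (PiM {1..n} tau_coord)" by (simp add: tau_prod_def)
    fix A assume A: "\<And>i. i \<in> {1..n} \<Longrightarrow> A i \<in> sets (tau_coord i)"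
    have pre: "(\<lambda>X. \<lambda>k\<in>{1..n}. X (\<sigma> k)) -` (Pi\<^sub>E {1..n} A) \<inter> space tau_prod = Pi\<^sub>E {1..n} (\<lambda>j. A (inv \<sigma> j))"
    proof (intro set_eqI iffI)
      fix X assume X: "X \<in> (\<lambda>X. \<lambda>k\<in>{1..n}. X (\<sigma> k)) -` (Pi\<^sub>E {1..n} A) \<inter> space tau_prod"
      then have e: "X \<in> extensional {1..n}" unfolding tau_prod_def space_PiM by (auto simp: PiE_def)
      have "X j \<in> A (inv \<sigma> j)" if "j \<in> {1..n}" for j
      proof -
        have "(\<lambda>k\<in>{1..n}. X (\<sigma> k)) (inv \<sigma> j) \<in> A (inv \<sigma> j)" using X isi[OF that] by (auto simp: PiE_iff)
        then show ?thesis using isi[OF that] by (simp add: permutes_inverses[OF s(1)])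
      qed
      then show "X \<in> Pi\<^sub>E {1..n} (\<lambda>j. A (inv \<sigma> j))" using e by (auto simp: PiE_iff)
    next
      fix X assume X: "X \<in> Pi\<^sub>E {1..n} (\<lambda>j. A (inv \<sigma> j))"
      have "X (\<sigma> k) \<in> A k" if "k \<in> {1..n}" for k
        using PiE_mem[OF X si[OF that]] by (simp add: permutes_inverses[OF s(1)])
      then show "X \<in> (\<lambda>X. \<lambda>k\<in>{1..n}. X (\<sigma> k)) -` (Pi\<^sub>E {1..n} A) \<inter> space tau_prod"
        using X by (auto simp: tau_prod_def space_PiM tau_coord_space PiE_iff)
    qed
    have "emeasure (distr tau_prod tau_prod (\<lambda>X. \<lambda>k\<in>{1..n}. X (\<sigma> k))) (Pi\<^sub>E {1..n} A) = emeasure tau_prod (Pi\<^sub>E {1..n} (\<lambda>j. A (inv \<sigma> j)))"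
      unfolding pre[symmetric] by (rule emeasure_distr[OF meas]) (use A in \<open>auto simp: tau_prod_def intro!: sets_PiM_I_finite\<close>)
    also have "\<dots> = (\<Prod>j\<in>{1..n}. emeasure (tau_coord j) (A (inv \<sigma> j)))"
      unfolding tau_prod_def by (rule P.measure_times) (use A isi tau_coord_sets in auto)
    also have "\<dots> = (\<Prod>k\<in>{1..n}. emeasure (tau_coord (\<sigma> k)) (A (inv \<sigma> (\<sigma> k))))"
      using prod.permute[OF s(1), of "\<lambda>j. emeasure (tau_coord j) (A (inv \<sigma> j))"] by (simp add: o_def)
    also have "\<dots> = (\<Prod>i\<in>{1..n}. emeasure (tau_coord i) (A i))"
      by (intro prod.cong refl) (simp add: tms permutes_inverses[OF s(1)])
    finally show "emeasure (distr tau_prod tau_prod (\<lambda>X. \<lambda>k\<in>{1..n}. X (\<sigma> k))) (Pi\<^sub>E {1..n} A) = (\<Prod>i\<in>{1..n}. emeasure (tau_coord i) (A i))" .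
  qed simp
  then show ?thesis by (simp add: tau_prod_def)
qed

abbreviation Ord :: "(nat \<Rightarrow> real) set" where "Ord \<equiv> ordered_region p \<Gamma> nn"

lemma Ord_eq: "Ord = {X \<in> region. mono_on {1..n} X}"
  unfolding ordered_region_def region_def n_def[symmetric] ..

lemma region_sets [measurable]: "region \<in> sets (Rn n)"
  unfolding region_def by (rule sets_PiM_I_finite) (use Gamma_borel[OF blk_bounds(1)] in auto)

lemma Ord_sets [measurable]: "Ord \<in> sets (Rn n)"
proof -
  have "Ord = region \<inter> {X \<in> space (Rn n). mono_on {1..n} X}"
    unfolding Ord_eq using sets.sets_into_space[OF region_sets] by blast
  then show ?thesis using sets.Int[OF region_sets mono_region_measurable] by simp
qed

text \<open>Sorting moves every coordinate within its block: the intervals are ordered like the blocks, so along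
  the sorted configuration the block numbers increase, and an increasing rearrangement of the block
  numbers is unique.\<close>

lemma region_sorting:
  assumes X: "X \<in> region"
  shows "\<exists>\<sigma>\<in>block_perms. (\<lambda>k\<in>{1..n}. X (\<sigma> k)) \<in> Ord"
proof -
  obtain \<sigma> where s: "\<sigma> permutes {1..n}" "sort_coords n X = (\<lambda>k\<in>{1..n}. X (\<sigma> k))" using sorting_permutation by blast
  define Y where "Y = (\<lambda>k\<in>{1..n}. X (\<sigma> k))"
  have mono: "mono_on {1..n} Y" using sort_coords_mono[of n X] unfolding Y_def s(2) .
  have si: "\<sigma> k \<in> {1..n}" if "k \<in> {1..n}" for k using permutes_in_image[OF s(1)] that by blast
  have "blk (\<sigma> k) = blk k" if "k \<in> {1..n}" for k
  proof (rule mono_rearrangement_unique[of n blk "\<lambda>k. blk (\<sigma> k)" \<sigma>])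
    show "mono_on {1..n} blk" by (rule mono_onI) (rule blk_mono)
    \<comment> \<open>a decrease of the block number would be a decrease of the coordinate\<close>
    show "mono_on {1..n} (\<lambda>k. blk (\<sigma> k))"
    proof (rule mono_onI, rule ccontr)
      fix a c assume a: "a \<in> {1..n}" "c \<in> {1..n}" "a \<le> c" and "\<not> blk (\<sigma> a) \<le> blk (\<sigma> c)"
      then have "X (\<sigma> c) < X (\<sigma> a)"
        using Gamma_less[OF blk_bounds(1)[OF si[OF a(2)]] blk_bounds(1)[OF si[OF a(1)]] _ regionD(1)[OF X si[OF a(2)]] regionD(1)[OF X si[OF a(1)]]] by simp
      moreover have "X (\<sigma> a) \<le> X (\<sigma> c)" using mono_onD[OF mono a] a by (simp add: Y_def)
      ultimately show False by simp
    qed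
  qed (use s that in auto)
  then have "\<sigma> \<in> block_perms" using s(1) by (simp add: block_perms_def)
  moreover have "Y \<in> region"
    unfolding region_def Y_def using regionD(1)[OF X si] \<open>\<And>k. k \<in> {1..n} \<Longrightarrow> blk (\<sigma> k) = blk k\<close> by auto
  ultimately show ?thesis using mono unfolding Ord_eq Y_def by blast
qed

lemma abs_weight_meas [measurable]: "abs_weight \<in> borel_measurable (Rn n)"
  using abs_weight_measurable[of "\<lambda>Z. Z" "Rn n"] by (simp add: measurable_component_singleton)

text \<open>The region is covered by the images of the ordered configurations under the at most \<open>n ^ n\<close>
  permutations within the blocks, and these preserve both the weight and the product measure.\<close>

lemma full_le_ordered:
  "(\<integral>\<^sup>+Y. ennreal (abs_weight Y) \<partial>tau_prod) \<le> ennreal (real n ^ n) * (\<integral>\<^sup>+Y. ennreal (abs_weight Y) * indicator Ord Y \<partial>tau_prod)"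
proof -
  have fin: "finite block_perms"
    by (rule finite_subset[OF _ finite_permutations[of "{1..n}"]]) (auto simp: block_perms_def)
  have "card block_perms \<le> card {\<sigma>. \<sigma> permutes {1..n}}"
    by (rule card_mono) (auto simp: block_perms_def finite_permutations)
  also have "\<dots> = fact n" using card_permutations[of "{1..n}" n] by simp
  also have "\<dots> \<le> n ^ n" using fact_le_power[of n, where 'a = nat] by simp
  finally have card: "card block_perms \<le> n ^ n" .
  have "(\<integral>\<^sup>+Y. ennreal (abs_weight Y) \<partial>tau_prod) \<le> (\<integral>\<^sup>+Y. (\<Sum>\<sigma>\<in>block_perms. ennreal (abs_weight (\<lambda>k\<in>{1..n}. Y (\<sigma> k))) * indicator Ord (\<lambda>k\<in>{1..n}. Y (\<sigma> k))) \<partial>tau_prod)"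
  proof (rule nn_integral_mono_AE)
    show "AE Y in tau_prod. ennreal (abs_weight Y) \<le> (\<Sum>\<sigma>\<in>block_perms. ennreal (abs_weight (\<lambda>k\<in>{1..n}. Y (\<sigma> k))) * indicator Ord (\<lambda>k\<in>{1..n}. Y (\<sigma> k)))"
      using tau_prod_AE_region
    proof (rule eventually_mono)
      fix Y assume "Y \<in> region"
      then obtain \<sigma> where s: "\<sigma> \<in> block_perms" "(\<lambda>k\<in>{1..n}. Y (\<sigma> k)) \<in> Ord" using region_sorting by blast
      have "ennreal (abs_weight Y) = ennreal (abs_weight (\<lambda>k\<in>{1..n}. Y (\<sigma> k))) * indicator Ord (\<lambda>k\<in>{1..n}. Y (\<sigma> k))"
        using s abs_weight_block_perm[OF s(1), of Y] by simp
      also have "\<dots> \<le> (\<Sum>\<sigma>\<in>block_perms. ennreal (abs_weight (\<lambda>k\<in>{1..n}. Y (\<sigma> k))) * indicator Ord (\<lambda>k\<in>{1..n}. Y (\<sigma> k)))"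
        by (rule member_le_sum[OF s(1) _ fin, of "\<lambda>\<sigma>. ennreal (abs_weight (\<lambda>k\<in>{1..n}. Y (\<sigma> k))) * indicator Ord (\<lambda>k\<in>{1..n}. Y (\<sigma> k))"]) simp
      finally show "ennreal (abs_weight Y) \<le> (\<Sum>\<sigma>\<in>block_perms. ennreal (abs_weight (\<lambda>k\<in>{1..n}. Y (\<sigma> k))) * indicator Ord (\<lambda>k\<in>{1..n}. Y (\<sigma> k)))" .
    qed
  qed
  also have "\<dots> = (\<Sum>\<sigma>\<in>block_perms. \<integral>\<^sup>+Y. ennreal (abs_weight (\<lambda>k\<in>{1..n}. Y (\<sigma> k))) * indicator Ord (\<lambda>k\<in>{1..n}. Y (\<sigma> k)) \<partial>tau_prod)"
  proof (rule nn_integral_sum)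
    fix \<sigma> assume "\<sigma> \<in> block_perms"
    then have pm: "(\<lambda>X. \<lambda>k\<in>{1..n}. X (\<sigma> k)) \<in> tau_prod \<rightarrow>\<^sub>M Rn n"
      using permute_coords_measurable[of \<sigma> n, unfolded permute_coords_def[abs_def]] measurable_cong_sets[OF tau_prod_sets refl] unfolding block_perms_def by blast
    have "(\<lambda>Y. ennreal (abs_weight Y) * indicator Ord Y) \<in> borel_measurable (Rn n)" by measurable
    from measurable_compose[OF pm this]
    show "(\<lambda>Y. ennreal (abs_weight (\<lambda>k\<in>{1..n}. Y (\<sigma> k))) * indicator Ord (\<lambda>k\<in>{1..n}. Y (\<sigma> k))) \<in> borel_measurable tau_prod" .
  qed
  also have "\<dots> = (\<Sum>\<sigma>\<in>block_perms. \<integral>\<^sup>+Y. ennreal (abs_weight Y) * indicator Ord Y \<partial>tau_prod)"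
  proof (rule sum.cong[OF refl])
    fix \<sigma> assume s: "\<sigma> \<in> block_perms"
    have meas: "(\<lambda>X. \<lambda>k\<in>{1..n}. X (\<sigma> k)) \<in> tau_prod \<rightarrow>\<^sub>M tau_prod"
      using s permute_coords_measurable[of \<sigma> n, unfolded permute_coords_def[abs_def]] measurable_cong_sets[OF tau_prod_sets tau_prod_sets] unfolding block_perms_def by blast
    have "(\<integral>\<^sup>+Y. ennreal (abs_weight Y) * indicator Ord Y \<partial>tau_prod) = (\<integral>\<^sup>+Y. ennreal (abs_weight Y) * indicator Ord Y \<partial>distr tau_prod tau_prod (\<lambda>X. \<lambda>k\<in>{1..n}. X (\<sigma> k)))"
      unfolding tau_prod_block_perm[OF s] ..
    also have "\<dots> = (\<integral>\<^sup>+Y. ennreal (abs_weight (\<lambda>k\<in>{1..n}. Y (\<sigma> k))) * indicator Ord (\<lambda>k\<in>{1..n}. Y (\<sigma> k)) \<partial>tau_prod)"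
      by (rule nn_integral_distr[OF meas]) measurable
    finally show "(\<integral>\<^sup>+Y. ennreal (abs_weight (\<lambda>k\<in>{1..n}. Y (\<sigma> k))) * indicator Ord (\<lambda>k\<in>{1..n}. Y (\<sigma> k)) \<partial>tau_prod) = (\<integral>\<^sup>+Y. ennreal (abs_weight Y) * indicator Ord Y \<partial>tau_prod)" ..
  qed
  also have "\<dots> = of_nat (card block_perms) * (\<integral>\<^sup>+Y. ennreal (abs_weight Y) * indicator Ord Y \<partial>tau_prod)" by simp
  also have "\<dots> \<le> ennreal (real n ^ n) * (\<integral>\<^sup>+Y. ennreal (abs_weight Y) * indicator Ord Y \<partial>tau_prod)"
    using card by (intro mult_right_mono) (auto simp: ennreal_of_nat_eq_real_of_nat simp flip: of_nat_power intro!: ennreal_leI)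
  finally show ?thesis .
qed

end

section \<open>Symmetric laws with a prescribed law of the sorted coordinates\<close>

lemma permute_coords_compose:
  assumes "\<sigma> permutes {1..n}" "\<rho> permutes {1..n}"
  shows "permute_coords n \<rho> (permute_coords n \<sigma> X) = permute_coords n (\<sigma> \<circ> \<rho>) X"
  unfolding permute_coords_def by (rule restrict_ext) (use permutes_in_image[OF assms(2)] in auto)

lemma sort_coords_permutation:
  "\<exists>\<rho>. \<rho> permutes {1..n} \<and> sort_coords n X = permute_coords n \<rho> X"
  using sorting_permutation unfolding permute_coords_def .

lemma sorted_permutation_unique:
  assumes s: "\<sigma> permutes {1..n}" and m: "mono_on {1..n} (permute_coords n \<sigma> X)"
  shows "permute_coords n \<sigma> X = sort_coords n X"
proof -
  obtain \<rho> where r: "\<rho> permutes {1..n}" "sort_coords n X = permute_coords n \<rho> X" using sort_coords_permutation by blast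
  have "permute_coords n \<sigma> X k = sort_coords n X k" if k: "k \<in> {1..n}" for k
  proof (rule mono_rearrangement_unique[OF sort_coords_mono m])
    show "(inv \<rho> \<circ> \<sigma>) permutes {1..n}" by (intro permutes_compose s permutes_inv r(1))
    fix j assume j: "j \<in> {1..n}"
    have "inv \<rho> (\<sigma> j) \<in> {1..n}" using j permutes_in_image[OF s] permutes_in_image[OF permutes_inv[OF r(1)]] by blast
    then show "permute_coords n \<sigma> X j = sort_coords n X ((inv \<rho> \<circ> \<sigma>) j)"
      using j unfolding r(2) by (simp add: permute_coords_def permutes_inverses[OF r(1)])
  qed (rule k)
  then show ?thesis unfolding permute_coords_def sort_coords_def by (auto simp: fun_eq_iff restrict_def)
qed

lemma sort_coords_permute:
  assumes s: "\<sigma> permutes {1..n}"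
  shows "sort_coords n (permute_coords n \<sigma> X) = sort_coords n X"
proof -
  obtain \<rho> where r: "\<rho> permutes {1..n}" "sort_coords n (permute_coords n \<sigma> X) = permute_coords n \<rho> (permute_coords n \<sigma> X)"
    using sort_coords_permutation by blast
  have e: "sort_coords n (permute_coords n \<sigma> X) = permute_coords n (\<sigma> \<circ> \<rho>) X"
    unfolding r(2) by (rule permute_coords_compose[OF s r(1)])
  show ?thesis unfolding e
    by (rule sorted_permutation_unique) (use permutes_compose[OF r(1) s] sort_coords_mono[of n "permute_coords n \<sigma> X"] e in auto)
qed

lemma sort_coords_sorted:
  assumes "mono_on {1..n} X" "X \<in> extensional {1..n}"
  shows "sort_coords n X = X"
proof -
  have "permute_coords n id X = X" using assms(2) by (auto simp: permute_coords_def extensional_def fun_eq_iff)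
  then show ?thesis using sorted_permutation_unique[OF permutes_id, of n X] assms(1) by simp
qed

text \<open>On the set where a given permutation sorts the coordinates, sorting is that permutation; there are
  finitely many of these sets.\<close>

lemma sort_coords_measurable [measurable]: "sort_coords n \<in> Rn n \<rightarrow>\<^sub>M Rn n"
proof (rule measurableI)
  show "sort_coords n X \<in> space (Rn n)" for X
    by (auto simp: space_PiM sort_coords_def)
  fix A assume A: "A \<in> sets (Rn n)"
  define D where "D = {X \<in> space (Rn n). mono_on {1..n} X}"
  have "sort_coords n -` A \<inter> space (Rn n) = (\<Union>\<sigma>\<in>{\<sigma>. \<sigma> permutes {1..n}}. permute_coords n \<sigma> -` (D \<inter> A) \<inter> space (Rn n))"
  proof (intro set_eqI iffI)
    fix X assume X: "X \<in> sort_coords n -` A \<inter> space (Rn n)"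
    obtain \<rho> where r: "\<rho> permutes {1..n}" "sort_coords n X = permute_coords n \<rho> X" using sort_coords_permutation by blast
    have "sort_coords n X \<in> D" unfolding D_def using sort_coords_mono by (auto simp: space_PiM sort_coords_def)
    then show "X \<in> (\<Union>\<sigma>\<in>{\<sigma>. \<sigma> permutes {1..n}}. permute_coords n \<sigma> -` (D \<inter> A) \<inter> space (Rn n))"
      using X r by auto
  next
    fix X assume "X \<in> (\<Union>\<sigma>\<in>{\<sigma>. \<sigma> permutes {1..n}}. permute_coords n \<sigma> -` (D \<inter> A) \<inter> space (Rn n))"
    then obtain \<sigma> where s: "\<sigma> permutes {1..n}" "permute_coords n \<sigma> X \<in> D" "permute_coords n \<sigma> X \<in> A" "X \<in> space (Rn n)" by auto
    then show "X \<in> sort_coords n -` A \<inter> space (Rn n)" using sorted_permutation_unique[OF s(1)] by (auto simp: D_def)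
  qed
  also have "\<dots> \<in> sets (Rn n)"
  proof (rule sets.finite_UN)
    fix \<sigma> assume "\<sigma> \<in> {\<sigma>. \<sigma> permutes {1..n}}"
    then show "permute_coords n \<sigma> -` (D \<inter> A) \<inter> space (Rn n) \<in> sets (Rn n)"
      using measurable_sets[OF permute_coords_measurable, of \<sigma> n "D \<inter> A"] A mono_region_measurable[of n] unfolding D_def by auto
  qed (simp add: finite_permutations)
  finally show "sort_coords n -` A \<inter> space (Rn n) \<in> sets (Rn n)" .
qed

text \<open>The sum of an indicator function over all permutations is invariant under sorting, so its integral
  depends only on the sorted law. For a symmetric law this integral is the number of permutations
  times the probability of the event.\<close>

lemma symmetric_law_unique:
  assumes M: "sets M = sets (Rn n)" and N: "sets N = sets (Rn n)"
    and Mi: "\<And>\<sigma>. \<sigma> permutes {1..n} \<Longrightarrow> distr M (Rn n) (permute_coords n \<sigma>) = M"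
    and Ni: "\<And>\<sigma>. \<sigma> permutes {1..n} \<Longrightarrow> distr N (Rn n) (permute_coords n \<sigma>) = N"
    and eq: "distr M (Rn n) (sort_coords n) = distr N (Rn n) (sort_coords n)"
  shows "M = N"
proof (rule measure_eqI)
  show "sets M = sets N" using M N by simp
  fix A assume "A \<in> sets M"
  then have A [measurable]: "A \<in> sets (Rn n)" using M by simp
  define S where "S = {\<sigma>. \<sigma> permutes {1..n}}"
  have fS: "finite S" and cS: "card S > 0" 
    unfolding S_def using finite_permutations[of "{1..n}"] card_permutations[of "{1..n}" n] by simp_all
  define h where "h X = (\<Sum>\<sigma>\<in>S. indicator A (permute_coords n \<sigma> X) :: ennreal)" for X
  have hm: "h \<in> borel_measurable (Rn n)"
    unfolding h_def
  proof (rule borel_measurable_sum)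
    fix \<sigma> assume "\<sigma> \<in> S"
    then have "permute_coords n \<sigma> \<in> Rn n \<rightarrow>\<^sub>M Rn n" unfolding S_def by (intro permute_coords_measurable) simp
    from measurable_compose[OF this borel_measurable_indicator[OF A]]
    show "(\<lambda>X. indicator A (permute_coords n \<sigma> X) :: ennreal) \<in> borel_measurable (Rn n)" .
  qed
  have hs: "h (sort_coords n X) = h X" for X
  proof -
    obtain \<rho> where r: "\<rho> permutes {1..n}" "sort_coords n X = permute_coords n \<rho> X" using sort_coords_permutation by blast
    have "h (sort_coords n X) = (\<Sum>\<sigma>\<in>S. indicator A (permute_coords n (\<rho> \<circ> \<sigma>) X))"
      unfolding h_def r(2) by (intro sum.cong refl) (simp add: S_def permute_coords_compose[OF r(1)])
    also have "\<dots> = h X"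
      unfolding h_def S_def by (rule setum_permutations_compose_left[OF r(1), symmetric])
    finally show ?thesis .
  qed
  have key: "of_nat (card S) * emeasure P A = (\<integral>\<^sup>+X. h X \<partial>distr P (Rn n) (sort_coords n))"
    if P: "sets P = sets (Rn n)" and Pi: "\<And>\<sigma>. \<sigma> permutes {1..n} \<Longrightarrow> distr P (Rn n) (permute_coords n \<sigma>) = P" for P
  proof -
    have [measurable_cong]: "sets P = sets (Rn n)" by (rule P)
    have sm: "sort_coords n \<in> P \<rightarrow>\<^sub>M Rn n" by measurable
    have "(\<integral>\<^sup>+X. h X \<partial>distr P (Rn n) (sort_coords n)) = (\<integral>\<^sup>+X. h (sort_coords n X) \<partial>P)"
      by (rule nn_integral_distr[OF sm]) (simp only: measurable_distr_eq1 hm)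
    also have "\<dots> = (\<integral>\<^sup>+X. h X \<partial>P)" by (simp only: hs)
    also have "\<dots> = (\<Sum>\<sigma>\<in>S. \<integral>\<^sup>+X. indicator A (permute_coords n \<sigma> X) \<partial>P)"
      unfolding h_def
    proof (rule nn_integral_sum)
      fix \<sigma> assume "\<sigma> \<in> S"
      then have "permute_coords n \<sigma> \<in> P \<rightarrow>\<^sub>M Rn n"
        unfolding S_def using permute_coords_measurable[of \<sigma> n] measurable_cong_sets[OF P refl] by blast
      from measurable_compose[OF this borel_measurable_indicator[OF A]]
      show "(\<lambda>X. indicator A (permute_coords n \<sigma> X) :: ennreal) \<in> borel_measurable P" .
    qed
    also have "\<dots> = (\<Sum>\<sigma>\<in>S. emeasure P A)"
    proof (rule sum.cong[OF refl])
      fix \<sigma> assume s: "\<sigma> \<in> S"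
      then have pm: "permute_coords n \<sigma> \<in> P \<rightarrow>\<^sub>M Rn n"
        unfolding S_def using permute_coords_measurable[of \<sigma> n] measurable_cong_sets[OF P refl] by blast
      have "(\<integral>\<^sup>+X. indicator A (permute_coords n \<sigma> X) \<partial>P) = (\<integral>\<^sup>+X. indicator A X \<partial>distr P (Rn n) (permute_coords n \<sigma>))"
        by (rule nn_integral_distr[OF pm, symmetric]) (simp only: measurable_distr_eq1 borel_measurable_indicator[OF A])
      also have "distr P (Rn n) (permute_coords n \<sigma>) = P" using Pi s unfolding S_def by simp
      finally show "(\<integral>\<^sup>+X. indicator A (permute_coords n \<sigma> X) \<partial>P) = emeasure P A" by simp
    qed
    finally show ?thesis by simp
  qed
  have "of_nat (card S) * emeasure M A = of_nat (card S) * emeasure N A"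
  proof -
    have "of_nat (card S) * emeasure M A = (\<integral>\<^sup>+X. h X \<partial>distr M (Rn n) (sort_coords n))" by (rule key[OF M Mi])
    also have "\<dots> = (\<integral>\<^sup>+X. h X \<partial>distr N (Rn n) (sort_coords n))" by (simp only: eq)
    also have "\<dots> = of_nat (card S) * emeasure N A" by (rule key[OF N Ni, symmetric])
    finally show ?thesis .
  qed
  then show "emeasure M A = emeasure N A"
    using cS by (auto simp: ennreal_mult_cancel_left)
qed

text \<open>The law is the sorted one with the coordinates permuted uniformly at random. Composition with a
  fixed permutation only rearranges the average, and sorting undoes each permutation.\<close>

lemma symmetric_law_exists:
  assumes "prob_space O'" and O_sets: "sets O' = sets (Rn n)" and mono: "AE X in O'. mono_on {1..n} X"
  shows "\<exists>M. sets M = sets (Rn n) \<and> prob_space M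
        \<and> (\<forall>\<sigma>. \<sigma> permutes {1..n} \<longrightarrow> distr M (Rn n) (permute_coords n \<sigma>) = M)
        \<and> distr M (Rn n) (sort_coords n) = O'"
proof -
  interpret O: prob_space O' by fact
  note [measurable_cong] = O_sets
  define S where "S = {\<sigma>. \<sigma> permutes {1..n}}"
  have fS: "finite S" and cS: "card S > 0" and nS: "S \<noteq> {}"
    unfolding S_def using finite_permutations[of "{1..n}"] card_permutations[of "{1..n}" n] permutes_id[of "{1..n}"] by (simp, simp, blast)
  have pm: "permute_coords n \<sigma> \<in> O' \<rightarrow>\<^sub>M Rn n" if "\<sigma> \<in> S" for \<sigma>
    using that permute_coords_measurable[of \<sigma> n] measurable_cong_sets[OF O_sets refl] unfolding S_def by blast
  define f where "f \<sigma> = (if \<sigma> \<in> S then distr O' (Rn n) (permute_coords n \<sigma>) else O')" for \<sigma>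
  define M where "M = measure_pmf (pmf_of_set S) \<bind> f"
  have fP: "f \<sigma> \<in> space (subprob_algebra (Rn n))" for \<sigma>
    using O.prob_space_distr[OF pm, of \<sigma>] O.prob_space_axioms O_sets
    by (auto simp: f_def space_subprob_algebra intro: prob_space_imp_subprob_space)
  have fm: "f \<in> measurable (measure_pmf (pmf_of_set S)) (subprob_algebra (Rn n))"
    using fP by (simp add: measurable_def)
  have sM: "sets M = sets (Rn n)"
    unfolding M_def by (rule sets_bind[OF _ _]) (use fP in \<open>auto simp: space_subprob_algebra\<close>)
  have spM: "space M = space (Rn n)" by (rule sets_eq_imp_space_eq[OF sM])
  have eM: "emeasure M A = (\<Sum>\<sigma>\<in>S. emeasure O' (permute_coords n \<sigma> -` A \<inter> space O')) / of_nat (card S)"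
    if A: "A \<in> sets (Rn n)" for A
  proof -
    have "emeasure M A = (\<integral>\<^sup>+\<sigma>. emeasure (f \<sigma>) A \<partial>measure_pmf (pmf_of_set S))"
      unfolding M_def by (rule emeasure_bind[OF _ fm A]) simp
    also have "\<dots> = (\<Sum>\<sigma>\<in>S. emeasure (f \<sigma>) A) / of_nat (card S)"
      by (subst nn_integral_pmf_of_set[OF nS fS]) (simp add: ennreal_of_nat_eq_real_of_nat)
    also have "(\<Sum>\<sigma>\<in>S. emeasure (f \<sigma>) A) = (\<Sum>\<sigma>\<in>S. emeasure O' (permute_coords n \<sigma> -` A \<inter> space O'))"
    proof (rule sum.cong[OF refl])
      fix \<sigma> assume s: "\<sigma> \<in> S"
      then have "f \<sigma> = distr O' (Rn n) (permute_coords n \<sigma>)" unfolding f_def by (simp only: if_True)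
      then show "emeasure (f \<sigma>) A = emeasure O' (permute_coords n \<sigma> -` A \<inter> space O')"
        using emeasure_distr[OF pm[OF s] A] by (simp only:)
    qed
    finally show ?thesis .
  qed
  have avg: "(\<Sum>\<sigma>\<in>S. c) / of_nat (card S) = c" for c :: ennreal
    using cS by (simp add: ennreal_mult_divide_eq mult.commute)
  have "emeasure M (space M) = 1"
  proof -
    have "emeasure M (space M) = (\<Sum>\<sigma>\<in>S. emeasure O' (permute_coords n \<sigma> -` space (Rn n) \<inter> space O')) / of_nat (card S)"
      unfolding spM by (rule eM) simp
    also have "(\<Sum>\<sigma>\<in>S. emeasure O' (permute_coords n \<sigma> -` space (Rn n) \<inter> space O')) = (\<Sum>\<sigma>\<in>S. 1)"
    proof (rule sum.cong[OF refl])
      fix \<sigma> assume "\<sigma> \<in> S"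
      then have "permute_coords n \<sigma> -` space (Rn n) \<inter> space O' = space O'" using measurable_space[OF pm] by auto
      then show "emeasure O' (permute_coords n \<sigma> -` space (Rn n) \<inter> space O') = 1" by (simp add: O.emeasure_space_1)
    qed
    finally show ?thesis unfolding avg .
  qed
  then have pM: "prob_space M" by (rule prob_spaceI)
  have mM: "g \<in> M \<rightarrow>\<^sub>M Rn n" if "g \<in> Rn n \<rightarrow>\<^sub>M Rn n" for g
    using that measurable_cong_sets[OF sM refl] by blast
  have spO: "space O' = space (Rn n)" by (rule sets_eq_imp_space_eq[OF O_sets])
  have inv: "distr M (Rn n) (permute_coords n \<rho>) = M" if r: "\<rho> permutes {1..n}" for \<rho>
  proof (rule measure_eqI)
    show "sets (distr M (Rn n) (permute_coords n \<rho>)) = sets M" using sM by simp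
    fix A assume "A \<in> sets (distr M (Rn n) (permute_coords n \<rho>))"
    then have A: "A \<in> sets (Rn n)" by simp
    have pA: "permute_coords n \<rho> -` A \<inter> space (Rn n) \<in> sets (Rn n)" by (rule measurable_sets[OF permute_coords_measurable[OF r] A])
    have "emeasure (distr M (Rn n) (permute_coords n \<rho>)) A = emeasure M (permute_coords n \<rho> -` A \<inter> space (Rn n))"
      using emeasure_distr[OF mM[OF permute_coords_measurable[OF r]] A] spM by simp
    also have "\<dots> = (\<Sum>\<sigma>\<in>S. emeasure O' (permute_coords n \<sigma> -` (permute_coords n \<rho> -` A \<inter> space (Rn n)) \<inter> space O')) / of_nat (card S)"
      by (rule eM[OF pA])
    also have "(\<Sum>\<sigma>\<in>S. emeasure O' (permute_coords n \<sigma> -` (permute_coords n \<rho> -` A \<inter> space (Rn n)) \<inter> space O'))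
        = (\<Sum>\<sigma>\<in>S. emeasure O' (permute_coords n (\<sigma> \<circ> \<rho>) -` A \<inter> space O'))"
    proof (rule sum.cong[OF refl])
      fix \<sigma> assume s: "\<sigma> \<in> S"
      have "permute_coords n \<sigma> -` (permute_coords n \<rho> -` A \<inter> space (Rn n)) \<inter> space O' = permute_coords n (\<sigma> \<circ> \<rho>) -` A \<inter> space O'"
        using measurable_space[OF pm[OF s]] s r unfolding S_def by (auto simp: permute_coords_compose)
      then show "emeasure O' (permute_coords n \<sigma> -` (permute_coords n \<rho> -` A \<inter> space (Rn n)) \<inter> space O') = emeasure O' (permute_coords n (\<sigma> \<circ> \<rho>) -` A \<inter> space O')" by simp
    qed
    also have "\<dots> = (\<Sum>\<sigma>\<in>S. emeasure O' (permute_coords n \<sigma> -` A \<inter> space O'))"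
      unfolding S_def using sum_permutations_compose_right[OF r, of "\<lambda>\<sigma>. emeasure O' (permute_coords n \<sigma> -` A \<inter> space O')"] by simp
    finally show "emeasure (distr M (Rn n) (permute_coords n \<rho>)) A = emeasure M A" unfolding eM[OF A] .
  qed
  have srt: "distr M (Rn n) (sort_coords n) = O'"
  proof (rule measure_eqI)
    show "sets (distr M (Rn n) (sort_coords n)) = sets O'" using O_sets by simp
    fix A assume "A \<in> sets (distr M (Rn n) (sort_coords n))"
    then have A [measurable]: "A \<in> sets (Rn n)" by simp
    have pA: "sort_coords n -` A \<inter> space (Rn n) \<in> sets (Rn n)" by (rule measurable_sets[OF sort_coords_measurable A])
    have "emeasure (distr M (Rn n) (sort_coords n)) A = emeasure M (sort_coords n -` A \<inter> space (Rn n))"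
      using emeasure_distr[OF mM[OF sort_coords_measurable] A] spM by simp
    also have "\<dots> = (\<Sum>\<sigma>\<in>S. emeasure O' (permute_coords n \<sigma> -` (sort_coords n -` A \<inter> space (Rn n)) \<inter> space O')) / of_nat (card S)"
      by (rule eM[OF pA])
    also have "(\<Sum>\<sigma>\<in>S. emeasure O' (permute_coords n \<sigma> -` (sort_coords n -` A \<inter> space (Rn n)) \<inter> space O')) = (\<Sum>\<sigma>\<in>S. emeasure O' A)"
    proof (rule sum.cong[OF refl])
      fix \<sigma> assume s: "\<sigma> \<in> S"
      have e: "permute_coords n \<sigma> -` (sort_coords n -` A \<inter> space (Rn n)) \<inter> space O' = sort_coords n -` A \<inter> space O'"
        using measurable_space[OF pm[OF s]] s unfolding S_def by (auto simp: sort_coords_permute)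
      show "emeasure O' (permute_coords n \<sigma> -` (sort_coords n -` A \<inter> space (Rn n)) \<inter> space O') = emeasure O' A"
        unfolding e
      proof (rule emeasure_eq_AE)
        have "AE X in O'. X \<in> space O'" by (rule AE_space)
        with mono show "AE X in O'. (X \<in> sort_coords n -` A \<inter> space O') = (X \<in> A)"
        proof eventually_elim
          fix X assume "mono_on {1..n} X" "X \<in> space O'"
          then have "sort_coords n X = X" by (intro sort_coords_sorted) (auto simp: spO space_PiM PiE_def)
          then show "(X \<in> sort_coords n -` A \<inter> space O') = (X \<in> A)" using \<open>X \<in> space O'\<close> by auto
        qed
        show "A \<in> sets O'" using A O_sets by simp
        show "sort_coords n -` A \<inter> space O' \<in> sets O'" using pA O_sets spO by simp
      qed
    qed
    finally show "emeasure (distr M (Rn n) (sort_coords n)) A = emeasure O' A" unfolding avg .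
  qed
  show ?thesis using sM pM inv srt by blast
qed

context weighted_ensemble
begin

section \<open>Configurations of small weight are improbable\<close>

definition Z :: real where "Z = angelesco_Z p \<Gamma> Q \<tau> nn"

lemma tau_prod_finite: "finite_measure tau_prod" 
  and tau_prod_mass: "0 \<le> T \<Longrightarrow> (\<And>i. i \<in> {1..p} \<Longrightarrow> measure (\<tau> i) (space (\<tau> i)) \<le> T) \<Longrightarrow> emeasure tau_prod (space tau_prod) \<le> ennreal (T ^ n)"
proof -
  interpret P: finite_product_sigma_finite tau_coord "{1..n}" by standard simp
  have sp: "space tau_prod = Pi\<^sub>E {1..n} (\<lambda>m. space (tau_coord m))" unfolding tau_prod_def space_PiM ..
  have e: "emeasure tau_prod (space tau_prod) = (\<Prod>m\<in>{1..n}. emeasure (tau_coord m) (space (tau_coord m)))"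
    unfolding sp unfolding tau_prod_def by (rule P.measure_times) simp
  have "emeasure tau_prod (space tau_prod) \<noteq> \<infinity>"
    unfolding e using finite_measure.emeasure_finite[OF tau_coord_finite] by (simp add: ennreal_prod_eq_top)
  then show "finite_measure tau_prod" by (rule finite_measureI)
  assume T: "0 \<le> T" "\<And>i. i \<in> {1..p} \<Longrightarrow> measure (\<tau> i) (space (\<tau> i)) \<le> T"
  have "(\<Prod>m\<in>{1..n}. emeasure (tau_coord m) (space (tau_coord m))) \<le> (\<Prod>m\<in>{1..n}. ennreal T)"
  proof (rule prod_mono_ennreal)
    fix m assume m: "m \<in> {1..n}"
    have "emeasure (tau_coord m) (space (tau_coord m)) = ennreal (measure (\<tau> (blk m)) (space (\<tau> (blk m))))"
      using finite_measure.emeasure_eq_measure[OF tau_coord_finite, of m] m by (simp add: tau_coord_def)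
    then show "emeasure (tau_coord m) (space (tau_coord m)) \<le> ennreal T"
      using T(2)[OF blk_bounds(1)[OF m]] by (simp add: ennreal_leI)
  qed
  then show "emeasure tau_prod (space tau_prod) \<le> ennreal (T ^ n)" unfolding e using T(1) by (simp add: ennreal_power)
qed

lemma weight_Ord: "indicator Ord X * angelesco_weight p Q nn X = indicator Ord X * abs_weight X"
  using abs_weight_eq[of X] by (cases "X \<in> Ord") (auto simp: Ord_eq)

lemma Z_eq: "ennreal Z = (\<integral>\<^sup>+X. ennreal (abs_weight X) * indicator Ord X \<partial>tau_prod)" and Z_nonneg: "0 \<le> Z"
proof -
  interpret tau_prod: finite_measure tau_prod by (rule tau_prod_finite)
  have int: "integrable tau_prod (\<lambda>X. indicator Ord X * abs_weight X)"
  proof (rule tau_prod.integrable_const_bound)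
    show "AE X in tau_prod. norm (indicator Ord X * abs_weight X) \<le> ((2 * rad)\<^sup>2) ^ card pairs * exp (2 * real n * Q_bound) ^ n"
      using abs_weight_bound abs_weight_nonneg by (intro AE_I2) (auto simp: indicator_def Ord_eq abs_of_nonneg)
    show "(\<lambda>X. indicator Ord X * abs_weight X) \<in> borel_measurable tau_prod" by measurable
  qed
  have Zi: "Z = (\<integral>X. indicator Ord X * abs_weight X \<partial>tau_prod)"
    unfolding Z_def angelesco_Z_def tau_prod_eq set_lebesgue_integral_def by (simp add: weight_Ord)
  show "0 \<le> Z" unfolding Zi by (rule Bochner_Integration.integral_nonneg) (simp add: abs_weight_nonneg)
  have "ennreal Z = (\<integral>\<^sup>+X. ennreal (indicator Ord X * abs_weight X) \<partial>tau_prod)"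
    unfolding Zi by (rule nn_integral_eq_integral[symmetric, OF int]) (simp add: abs_weight_nonneg)
  also have "\<dots> = (\<integral>\<^sup>+X. ennreal (abs_weight X) * indicator Ord X \<partial>tau_prod)"
    by (intro nn_integral_cong) (auto simp: indicator_def)
  finally show "ennreal Z = (\<integral>\<^sup>+X. ennreal (abs_weight X) * indicator Ord X \<partial>tau_prod)" .
qed

text \<open>This bounds the partition function from below by the weight of any single configuration.\<close>

lemma abs_weight_le_Z:
  assumes BM: "BM_bound \<tau> C \<epsilon>" "\<epsilon> > 0" and X: "X \<in> region"
  shows "abs_weight X \<le> (C * (1 + \<epsilon>) ^ (2 * n)) ^ n * real n ^ n * Z"
proof -
  have C: "C > 0" using BM unfolding BM_bound_def by blast
  have "ennreal (abs_weight X) \<le> ennreal (C * (1 + \<epsilon>) ^ (2 * n)) ^ n * (\<integral>\<^sup>+Y. ennreal (abs_weight Y) \<partial>tau_prod)"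
    by (rule BM_full[OF BM(1) X])
  also have "\<dots> \<le> ennreal (C * (1 + \<epsilon>) ^ (2 * n)) ^ n * (ennreal (real n ^ n) * ennreal Z)"
    unfolding Z_eq by (intro mult_left_mono full_le_ordered) simp
  also have "\<dots> = ennreal ((C * (1 + \<epsilon>) ^ (2 * n)) ^ n * real n ^ n * Z)"
  proof -
    have D0: "0 \<le> C * (1 + \<epsilon>) ^ (2 * n)" using C BM(2) by simp
    have "ennreal ((C * (1 + \<epsilon>) ^ (2 * n)) ^ n * real n ^ n * Z) = ennreal ((C * (1 + \<epsilon>) ^ (2 * n)) ^ n) * (ennreal (real n ^ n) * ennreal Z)"
      using D0 Z_nonneg by (simp only: mult.assoc ennreal_mult zero_le_power mult_nonneg_nonneg of_nat_0_le_iff)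
    then show ?thesis unfolding ennreal_power[OF D0] ..
  qed
  finally show ?thesis using C BM(2) Z_nonneg by (simp add: ennreal_le_iff)
qed

abbreviation OA where "OA \<equiv> ordered_angelesco p \<Gamma> Q \<tau> nn"
abbreviation AP where "AP \<equiv> angelesco_prob p \<Gamma> Q \<tau> nn"

lemma OA_density: "OA = density tau_prod (\<lambda>X. ennreal (indicator Ord X * abs_weight X / Z))"
proof -
  have "indicator Ord X * (angelesco_weight p Q nn X / Z) = indicator Ord X * abs_weight X / Z" for X
    using weight_Ord[of X] by (simp only: times_divide_eq_right)
  then show ?thesis unfolding ordered_angelesco_def tau_prod_eq Z_def[symmetric] by (simp only:)
qed

lemma OA_sets [measurable_cong]: "sets OA = sets (Rn n)"
  unfolding OA_density by (simp add: tau_prod_sets)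

lemma OA_emeasure:
  assumes A: "A \<in> sets (Rn n)"
  shows "emeasure OA A = (\<integral>\<^sup>+X. ennreal (indicator Ord X * abs_weight X / Z) * indicator A X \<partial>tau_prod)"
  unfolding OA_density by (rule emeasure_density) (use A tau_prod_sets in measurable)

lemma OA_prob:
  assumes "Z > 0" shows "prob_space OA" "AE X in OA. X \<in> Ord"
proof -
  have "emeasure OA (space OA) = (\<integral>\<^sup>+X. ennreal (indicator Ord X * abs_weight X / Z) * indicator (space (Rn n)) X \<partial>tau_prod)"
    unfolding sets_eq_imp_space_eq[OF OA_sets] by (rule OA_emeasure) simp
  also have "\<dots> = (\<integral>\<^sup>+X. ennreal (1 / Z) * (ennreal (abs_weight X) * indicator Ord X) \<partial>tau_prod)"
  proof (rule nn_integral_cong)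
    fix X assume "X \<in> space tau_prod"
    then have "X \<in> space (Rn n)" using tau_prod_space by simp
    then show "ennreal (indicator Ord X * abs_weight X / Z) * indicator (space (Rn n)) X = ennreal (1 / Z) * (ennreal (abs_weight X) * indicator Ord X)"
      using assms abs_weight_nonneg[of X] by (auto simp: indicator_def ennreal_mult[symmetric])
  qed
  also have "\<dots> = ennreal (1 / Z) * ennreal Z" unfolding Z_eq by (rule nn_integral_cmult) measurable
  also have "\<dots> = 1" using assms by (simp add: ennreal_mult[symmetric])
  finally show "prob_space OA" by (rule prob_spaceI)
  show "AE X in OA. X \<in> Ord"
    unfolding OA_density by (subst AE_density) (auto intro!: AE_I2 simp: indicator_def split: if_splits)
qed

text \<open>Existence and uniqueness of the symmetric law justify the definite description in the definition of
  the ensemble.\<close>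

lemma AP_facts:
  assumes "Z > 0"
  shows "sets AP = sets (Rn n)" "prob_space AP" "distr AP (Rn n) (sort_coords n) = OA"
proof -
  define good where "good M \<longleftrightarrow> sets M = sets (Rn n) \<and> prob_space M
        \<and> (\<forall>\<sigma>. \<sigma> permutes {1..n} \<longrightarrow> distr M (Rn n) (\<lambda>X. \<lambda>k\<in>{1..n}. X (\<sigma> k)) = M)
        \<and> distr M (Rn n) (sort_coords n) = OA" for M
  have AP: "AP = (THE M. good M)"
    unfolding angelesco_prob_def good_def n_def Let_def ..
  have pc: "(\<lambda>X. \<lambda>k\<in>{1..n}. X (\<sigma> k)) = permute_coords n \<sigma>" for \<sigma> by (simp add: permute_coords_def fun_eq_iff)
  have "AE X in OA. mono_on {1..n} X" using OA_prob(2)[OF assms] by (auto elim!: eventually_mono simp: Ord_eq)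
  from symmetric_law_exists[OF OA_prob(1)[OF assms] OA_sets this]
  obtain M where M: "good M" unfolding good_def pc by blast
  have "good AP" unfolding AP
  proof (rule theI[of good, OF M])
    fix M' assume M': "good M'"
    show "M' = M" by (rule symmetric_law_unique[of _ n]) (use M M' in \<open>simp_all only: good_def pc\<close>)
  qed
  then show "sets AP = sets (Rn n)" "prob_space AP" "distr AP (Rn n) (sort_coords n) = OA" unfolding good_def by auto
qed

definition bad :: "real \<Rightarrow> (nat \<Rightarrow> real) set" where
  "bad t = {X \<in> space (Rn n). \<not> (sort_coords n X \<in> Ord \<and> t \<le> abs_weight (sort_coords n X))}"

lemma bad_sets: "bad t \<in> sets (Rn n)"
proof -
  have "{Y \<in> space (Rn n). \<not> (Y \<in> Ord \<and> t \<le> abs_weight Y)} \<in> sets (Rn n)" by measurable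
  from measurable_sets[OF sort_coords_measurable this]
  have "sort_coords n -` {Y \<in> space (Rn n). \<not> (Y \<in> Ord \<and> t \<le> abs_weight Y)} \<inter> space (Rn n) \<in> sets (Rn n)" .
  also have "sort_coords n -` {Y \<in> space (Rn n). \<not> (Y \<in> Ord \<and> t \<le> abs_weight Y)} \<inter> space (Rn n) = bad t"
    unfolding bad_def using measurable_space[OF sort_coords_measurable[of n]] by auto
  finally show ?thesis .
qed

text \<open>Where the weight is below \<open>t\<close>, the density is at most \<open>t / Z\<close> with respect to the product measure, whose
  mass is at most \<open>T ^ n\<close>.\<close>

lemma bad_prob:
  assumes Z: "Z > 0" and t: "t \<ge> 0" and T: "0 \<le> T" "\<And>i. i \<in> {1..p} \<Longrightarrow> measure (\<tau> i) (space (\<tau> i)) \<le> T"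
  shows "measure AP (bad t) \<le> t / Z * T ^ n"
proof -
  interpret AP: prob_space AP by (rule AP_facts[OF Z])
  define D where "D = {Y \<in> space (Rn n). \<not> (Y \<in> Ord \<and> t \<le> abs_weight Y)}"
  have D: "D \<in> sets (Rn n)" unfolding D_def by measurable
  have sm: "sort_coords n \<in> AP \<rightarrow>\<^sub>M Rn n" using sort_coords_measurable measurable_cong_sets[OF AP_facts(1)[OF Z] refl] by blast
  have spAP: "space AP = space (Rn n)" by (rule sets_eq_imp_space_eq[OF AP_facts(1)[OF Z]])
  have "emeasure AP (bad t) = emeasure (distr AP (Rn n) (sort_coords n)) D"
  proof -
    have "bad t = sort_coords n -` D \<inter> space AP"
      unfolding bad_def D_def spAP using measurable_space[OF sort_coords_measurable[of n]] by auto
    then show ?thesis using emeasure_distr[OF sm D] by simp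
  qed
  also have "\<dots> = emeasure OA D" unfolding AP_facts(3)[OF Z] ..
  also have "\<dots> = (\<integral>\<^sup>+X. ennreal (indicator Ord X * abs_weight X / Z) * indicator D X \<partial>tau_prod)" by (rule OA_emeasure[OF D])
  also have "\<dots> \<le> (\<integral>\<^sup>+X. ennreal (t / Z) \<partial>tau_prod)"
  proof (rule nn_integral_mono)
    fix X
    show "ennreal (indicator Ord X * abs_weight X / Z) * indicator D X \<le> ennreal (t / Z)"
    proof (cases "X \<in> Ord \<and> X \<in> D")
      case True
      then have "abs_weight X \<le> t" unfolding D_def by auto
      then show ?thesis using True Z by (auto intro!: ennreal_leI divide_right_mono)
    qed (auto simp: indicator_def)
  qed
  also have "\<dots> = ennreal (t / Z) * emeasure tau_prod (space tau_prod)" by simp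
  also have "\<dots> \<le> ennreal (t / Z) * ennreal (T ^ n)" by (intro mult_left_mono tau_prod_mass T) auto
  also have "\<dots> = ennreal (t / Z * T ^ n)" using Z t T(1) by (simp add: ennreal_mult[symmetric])
  finally show ?thesis using Z t T(1) by (simp add: AP.emeasure_eq_measure ennreal_le_iff)
qed


text \<open>The partition function is bounded below through \<open>abs_weight_le_Z\<close> at a configuration of weight at
  least \<open>exp (- n\<^sup>2 * (e + err B))\<close>. The losses are \<open>exp (n\<^sup>2 * err B)\<close>, the factor \<open>(1 + \<epsilon>) ^ (2 * n *
  n)\<close> from the Bernstein--Markov inequality, and factors of size \<open>exp (O(n * ln n))\<close>.\<close>

lemma large_deviation:
  assumes c: "mass_tuple \<nu>" and e: "energy (sum_measure {1..p} \<nu>) = ereal e"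
    and B: "B \<ge> 0" "\<And>M i j. i \<in> {1..p} \<Longrightarrow> j \<in> {1..p} \<Longrightarrow> \<bar>mean_ell \<nu> M i j\<bar> \<le> B"
    and BM: "BM_bound \<tau> C \<epsilon>" "\<epsilon> > 0"
    and T: "0 \<le> T" "\<And>i. i \<in> {1..p} \<Longrightarrow> measure (\<tau> i) (space (\<tau> i)) \<le> T"
  shows "Z > 0" 
    "measure AP (bad (exp (- ((real n)\<^sup>2 * (e + \<eta>))))) \<le> exp (- ((real n)\<^sup>2 * (\<eta> - err B - 2 * ln (1 + \<epsilon>)))) * (C * T * real n) ^ n"
proof -
  have C: "C > 0" using BM unfolding BM_bound_def by blast
  obtain X where X: "X \<in> region" "angelesco_weight p Q nn X \<ge> exp (- ((real n)\<^sup>2 * (e + err B)))"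
    using good_configuration[OF c e B] by blast
  define D where "D = (C * (1 + \<epsilon>) ^ (2 * n)) ^ n * real n ^ n"
  have D0: "D > 0" unfolding D_def using C BM(2) n_pos by simp
  have low: "exp (- ((real n)\<^sup>2 * (e + err B))) \<le> D * Z"
    using X(2) abs_weight_le_Z[OF BM X(1)] unfolding abs_weight_eq[OF X(1)] D_def by simp
  have "0 < D * Z" by (rule less_le_trans[OF exp_gt_zero low])
  then show Z0: "Z > 0" using D0 by (simp add: zero_less_mult_iff)
  define t where "t = exp (- ((real n)\<^sup>2 * (e + \<eta>)))"
  have "measure AP (bad t) \<le> t / Z * T ^ n" by (rule bad_prob[OF Z0 _ T]) (simp add: t_def)
  also have "t / Z \<le> t * (D * exp ((real n)\<^sup>2 * (e + err B)))"
  proof -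
    have "1 \<le> D * exp ((real n)\<^sup>2 * (e + err B)) * Z"
    proof -
      have "1 = exp (- ((real n)\<^sup>2 * (e + err B))) * exp ((real n)\<^sup>2 * (e + err B))" by (simp add: exp_minus)
      also have "\<dots> \<le> (D * Z) * exp ((real n)\<^sup>2 * (e + err B))" by (rule mult_right_mono[OF low]) simp
      finally show ?thesis by (simp add: ac_simps)
    qed
    then have "1 / Z \<le> D * exp ((real n)\<^sup>2 * (e + err B))" using Z0 by (simp add: pos_divide_le_eq)
    from mult_left_mono[OF this, of t] show ?thesis by (simp add: t_def)
  qed
  then have "t / Z * T ^ n \<le> t * (D * exp ((real n)\<^sup>2 * (e + err B))) * T ^ n" using T(1) by (intro mult_right_mono) auto
  also have "\<dots> = exp (- ((real n)\<^sup>2 * (\<eta> - err B - 2 * ln (1 + \<epsilon>)))) * (C * T * real n) ^ n"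
  proof -
    have "((1 + \<epsilon>) ^ (2 * n)) ^ n = exp ((real n)\<^sup>2 * (2 * ln (1 + \<epsilon>)))"
    proof -
      have "((1 + \<epsilon>) ^ (2 * n)) ^ n = (exp (ln (1 + \<epsilon>))) ^ (2 * n * n)" using BM(2) by (simp add: power_mult)
      also have "\<dots> = exp (real (2 * n * n) * ln (1 + \<epsilon>))" by (rule exp_of_nat_mult[symmetric])
      finally show ?thesis by (simp add: power2_eq_square algebra_simps)
    qed
    then have Deq: "D = exp ((real n)\<^sup>2 * (2 * ln (1 + \<epsilon>))) * (C ^ n * real n ^ n)"
      unfolding D_def power_mult_distrib by simp
    have "t * (exp ((real n)\<^sup>2 * (2 * ln (1 + \<epsilon>))) * exp ((real n)\<^sup>2 * (e + err B))) = exp (- ((real n)\<^sup>2 * (\<eta> - err B - 2 * ln (1 + \<epsilon>))))"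
      unfolding t_def exp_add[symmetric] by (simp add: algebra_simps)
    then show ?thesis unfolding Deq power_mult_distrib by (simp add: ac_simps)
  qed
  finally show "measure AP (bad (exp (- ((real n)\<^sup>2 * (e + \<eta>))))) \<le> exp (- ((real n)\<^sup>2 * (\<eta> - err B - 2 * ln (1 + \<epsilon>)))) * (C * T * real n) ^ n"
    unfolding t_def .
qed

lemma counting_measure_sort: "emp (sort_coords n X) = emp X"
proof (rule measure_eqI)
  have s: "sets (emp Y) = sets borel" for Y using emp_real_distribution[of Y] by (simp add: real_distribution_def real_distribution_axioms_def)
  show "sets (emp (sort_coords n X)) = sets (emp X)" by (simp add: s)
  fix A assume "A \<in> sets (emp (sort_coords n X))"
  then have A: "A \<in> sets borel" by (simp add: s)
  obtain \<rho> where r: "\<rho> permutes {1..n}" "sort_coords n X = permute_coords n \<rho> X" using sort_coords_permutation by blast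
  have "bij_betw \<rho> {k\<in>{1..n}. permute_coords n \<rho> X k \<in> A} {k\<in>{1..n}. X k \<in> A}"
  proof (rule bij_betwI[where g = "inv \<rho>"])
    show "\<rho> \<in> {k\<in>{1..n}. permute_coords n \<rho> X k \<in> A} \<rightarrow> {k\<in>{1..n}. X k \<in> A}"
      using permutes_in_image[OF r(1)] by (auto simp: permute_coords_def)
    show "inv \<rho> \<in> {k\<in>{1..n}. X k \<in> A} \<rightarrow> {k\<in>{1..n}. permute_coords n \<rho> X k \<in> A}"
      using permutes_in_image[OF permutes_inv[OF r(1)]] by (auto simp: permute_coords_def permutes_inverses[OF r(1)])
  qed (auto simp: permutes_inverses[OF r(1)])
  then show "emeasure (emp (sort_coords n X)) A = emeasure (emp X) A"
    unfolding emp_measure[OF A] r(2) by (simp add: bij_betw_same_card)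
qed

end

section \<open>Almost sure convergence along a sequence of multi-indices\<close>

locale ensemble_sequence = angelesco_intervals +
  fixes \<tau> :: "nat \<Rightarrow> real measure" and nn :: "nat \<Rightarrow> nat \<Rightarrow> nat"
  assumes tau: "\<And>i. i \<in> {1..p} \<Longrightarrow> \<tau> i \<in> borel_measures_on (\<Gamma> i) \<and> finite_measure (\<tau> i)"
    and BM: "\<And>i. i \<in> {1..p} \<Longrightarrow> weighted_BM (complex_of_real ` \<Gamma> i) (\<lambda>z. Q i (Re z)) (distr (\<tau> i) borel complex_of_real)"
    and nn_pos: "\<And>d i. i \<in> {1..p} \<Longrightarrow> nn d i \<ge> 1"
    and nn_inj: "inj_on (\<lambda>d. restrict (nn d) {1..p}) {1..}"
    and nn_lim: "\<And>i. i \<in> {1..p} \<Longrightarrow> (\<lambda>d. real (nn d i) / real (msize p (nn d))) \<longlonglongrightarrow> r i"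
begin

sublocale WE: weighted_ensemble p a b r \<Gamma> Q "nn d" \<tau> for d
  by unfold_locales (use nn_pos tau in auto)

text \<open>Since the multi-indices are distinct, the sum is bounded by the sum of \<open>exp (- c * (k 1 + \<dots> + k p))\<close>
  over all multi-indices \<open>k\<close>, a product of geometric series.\<close>

lemma summable_exp_size:
  assumes "c > 0"
  shows "summable (\<lambda>d. exp (- c * real (WE.n d)))"
proof -
  define q where "q = exp (- c)"
  have q: "0 < q" "q < 1" using assms by (auto simp: q_def)
  have eq: "exp (- c * real (WE.n d)) = (\<Prod>i\<in>{1..p}. q ^ (restrict (nn d) {1..p} i))" for d
  proof -
    have "exp (- c * real (WE.n d)) = exp (\<Sum>i=1..p. real (nn d i) * (- c))"
      unfolding WE.n_sum sum_distrib_right[symmetric] by (simp only: mult.commute)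
    also have "\<dots> = (\<Prod>i\<in>{1..p}. exp (real (nn d i) * (- c)))" by (rule exp_sum) simp
    also have "\<dots> = (\<Prod>i\<in>{1..p}. q ^ nn d i)" unfolding q_def by (intro prod.cong refl) (simp only: q_def exp_of_nat_mult restrict_apply if_True)
    finally show ?thesis by simp
  qed
  have "summable (\<lambda>d. exp (- c * real (WE.n (Suc d))))"
  proof (rule summableI_nonneg_bounded)
    fix D
    define K where "K = (\<Sum>d\<in>{1..D}. \<Sum>i=1..p. nn d i)"
    let ?g = "\<lambda>d. restrict (nn d) {1..p}"
    have inj: "inj_on ?g {1..D}" by (rule inj_on_subset[OF nn_inj]) auto
    \<comment> \<open>a box large enough to contain the first \<open>D\<close> multi-indices\<close>
    have sub: "?g ` {1..D} \<subseteq> ({1..p} \<rightarrow>\<^sub>E {..K})"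
    proof
      fix h assume "h \<in> ?g ` {1..D}"
      then obtain d where d: "d \<in> {1..D}" "h = ?g d" by blast
      have "nn d i \<le> K" if i: "i \<in> {1..p}" for i
      proof -
        have "nn d i \<le> (\<Sum>i=1..p. nn d i)" by (rule member_le_sum[OF i]) auto
        also have "\<dots> \<le> K" unfolding K_def by (rule member_le_sum[OF d(1), of "\<lambda>d. \<Sum>i=1..p. nn d i"]) auto
        finally show ?thesis .
      qed
      then show "h \<in> {1..p} \<rightarrow>\<^sub>E {..K}" unfolding d(2) by auto
    qed
    have "(\<Sum>d<D. exp (- c * real (WE.n (Suc d)))) = (\<Sum>d\<in>{1..D}. exp (- c * real (WE.n d)))"
      by (rule sum.reindex_bij_witness[of _ "\<lambda>d. d - 1" Suc]) auto
    also have "\<dots> = (\<Sum>h\<in>?g ` {1..D}. \<Prod>i\<in>{1..p}. q ^ h i)"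
      unfolding eq by (rule sum.reindex[OF inj, symmetric, unfolded o_def])
    also have "\<dots> \<le> (\<Sum>h\<in>{1..p} \<rightarrow>\<^sub>E {..K}. \<Prod>i\<in>{1..p}. q ^ h i)"
      by (rule sum_mono2[OF _ sub]) (use q in \<open>auto intro!: finite_PiE prod_nonneg\<close>)
    also have "\<dots> = (\<Prod>i\<in>{1..p}. \<Sum>k\<le>K. q ^ k)"
      by (rule prod_sum_PiE[symmetric]) auto
    also have "\<dots> \<le> (\<Prod>i\<in>{1..p}. 1 / (1 - q))"
    proof (rule prod_mono)
      fix i
      have "(\<Sum>k\<le>K. q ^ k) \<le> (\<Sum>k. q ^ k)" by (rule sum_le_suminf) (use q in \<open>auto intro!: summable_geometric\<close>)
      also have "\<dots> = 1 / (1 - q)" using q by (intro suminf_geometric) auto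
      finally show "0 \<le> (\<Sum>k\<le>K. q ^ k) \<and> (\<Sum>k\<le>K. q ^ k) \<le> 1 / (1 - q)" using q by (auto intro!: sum_nonneg)
    qed
    finally show "(\<Sum>d<D. exp (- c * real (WE.n (Suc d)))) \<le> (\<Prod>i\<in>{1..p}. 1 / (1 - q))" .
  qed simp
  then show ?thesis by (subst (asm) summable_Suc_iff)
qed

lemma size_at_top: "filterlim (\<lambda>d. real (WE.n d)) at_top sequentially"
proof -
  have "(\<lambda>d. exp (- 1 * real (WE.n d))) \<longlonglongrightarrow> 0" by (rule summable_LIMSEQ_zero[OF summable_exp_size]) simp
  then have l: "(\<lambda>d. exp (- real (WE.n d))) \<longlonglongrightarrow> 0" by simp
  show ?thesis unfolding filterlim_at_top
  proof
    fix Y :: real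
    have "\<forall>\<^sub>F d in sequentially. exp (- real (WE.n d)) < exp (- Y)"
      using l by (rule order_tendstoD) simp
    then show "\<forall>\<^sub>F d in sequentially. Y \<le> real (WE.n d)" by (rule eventually_mono) simp
  qed
qed

lemma inverse_size_lim: "(\<lambda>d. c / real (WE.n d)) \<longlonglongrightarrow> 0"
  by (rule tendsto_divide_0[OF tendsto_const filterlim_at_top_imp_at_infinity[OF size_at_top]])

lemma ratio_lim: "i \<in> {1..p} \<Longrightarrow> (\<lambda>d. WE.ratio d i) \<longlonglongrightarrow> r i"
  using nn_lim[of i] unfolding WE.ratio_def WE.n_def .

lemma err_lim: "(\<lambda>d. WE.err d B) \<longlonglongrightarrow> 0"
proof -
  have "(\<lambda>d. (\<Sum>i=1..p. \<Sum>j=1..p. \<bar>WE.ratio d i * WE.ratio d j - r i * r j\<bar> * B) + B / real (WE.n d) + 2 * (\<Sum>i=1..p. \<bar>WE.ratio d i - r i\<bar> * Q_bound))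
     \<longlonglongrightarrow> (\<Sum>i=1..p. \<Sum>j=1..p. \<bar>r i * r j - r i * r j\<bar> * B) + 0 + 2 * (\<Sum>i=1..p. \<bar>r i - r i\<bar> * Q_bound)"
    by (intro tendsto_intros inverse_size_lim ratio_lim) auto
  then show ?thesis unfolding WE.err_def by simp
qed

text \<open>With \<open>\<epsilon>\<close> chosen such that \<open>2 * ln (1 + \<epsilon>) = \<eta> / 4\<close>, and both the error term and \<open>ln (C * T * n) / n\<close>
  eventually below \<open>\<eta> / 8\<close>, half of the exponent \<open>n\<^sup>2 * \<eta>\<close> survives.\<close>

lemma bad_summable:
  assumes c: "mass_tuple \<nu>" and e: "energy (sum_measure {1..p} \<nu>) = ereal e" and \<eta>: "\<eta> > 0"
  shows "summable (\<lambda>d. measure (WE.AP d) (WE.bad d (exp (- ((real (WE.n d))\<^sup>2 * (e + \<eta>))))))"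
proof -
  obtain B where B: "B \<ge> 0" "\<And>M i j. i \<in> {1..p} \<Longrightarrow> j \<in> {1..p} \<Longrightarrow> \<bar>mean_ell \<nu> M i j\<bar> \<le> B"
    using mean_ell_bounded[OF c e] by blast
  define \<epsilon> where "\<epsilon> = exp (\<eta> / 8) - 1"
  have \<epsilon>: "\<epsilon> > 0" "2 * ln (1 + \<epsilon>) = \<eta> / 4" using \<eta> by (auto simp: \<epsilon>_def)
  obtain C where C: "BM_bound \<tau> C \<epsilon>" using BM_bound_exists[OF tau BM \<epsilon>(1)] by blast
  have C0: "C > 0" using C unfolding BM_bound_def by blast
  \<comment> \<open>the summand 1 ensures \<open>C * T > 0\<close>\<close>
  define T where "T = (\<Sum>i=1..p. measure (\<tau> i) (space (\<tau> i))) + 1"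
  have T1: "T \<ge> 1" unfolding T_def by (simp add: sum_nonneg)
  have T: "0 \<le> T" "\<And>i. i \<in> {1..p} \<Longrightarrow> measure (\<tau> i) (space (\<tau> i)) \<le> T"
  proof -
    show "0 \<le> T" using T1 by simp
    fix i assume "i \<in> {1..p}"
    then have "measure (\<tau> i) (space (\<tau> i)) \<le> (\<Sum>i=1..p. measure (\<tau> i) (space (\<tau> i)))"
      by (rule member_le_sum) auto
    then show "measure (\<tau> i) (space (\<tau> i)) \<le> T" by (simp add: T_def)
  qed
  note LD = WE.large_deviation[OF c e B C \<epsilon>(1) T]
  have "\<forall>\<^sub>F d in sequentially. WE.err d B < \<eta> / 8"
    using err_lim[of B] by (rule order_tendstoD) (use \<eta> in simp)
  moreover have "\<forall>\<^sub>F d in sequentially. ln (C * T * real (WE.n d)) / real (WE.n d) < \<eta> / 8"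
  proof -
    have "((\<lambda>x::real. ln (C * T * x) / x) \<longlongrightarrow> 0) at_top"
    proof -
      have CT: "0 < C * T" using C0 T1 by simp
      have "((\<lambda>x::real. ln (C * T) / x + ln x / x) \<longlongrightarrow> 0 + 0) at_top"
        by (intro tendsto_add tendsto_divide_0[OF tendsto_const filterlim_at_top_imp_at_infinity[OF filterlim_ident]] ln_x_over_x_tendsto_0)
      moreover have "\<forall>\<^sub>F x in at_top. ln (C * T) / x + ln x / x = ln (C * T * x) / x"
        using eventually_gt_at_top[of 0]
      proof eventually_elim
        case (elim x)
        then show ?case using CT ln_mult_pos[of "C * T" x] by (simp add: add_divide_distrib)
      qed
      ultimately show ?thesis using Lim_transform_eventually by fastforce
    qed
    from filterlim_compose[OF this size_at_top]
    have "(\<lambda>d. ln (C * T * real (WE.n d)) / real (WE.n d)) \<longlonglongrightarrow> 0" .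
    then show ?thesis by (rule order_tendstoD) (use \<eta> in simp)
  qed
  ultimately have ev: "\<forall>\<^sub>F d in sequentially. norm (measure (WE.AP d) (WE.bad d (exp (- ((real (WE.n d))\<^sup>2 * (e + \<eta>)))))) \<le> exp (- (\<eta> / 2) * real (WE.n d))"
  proof eventually_elim
    case (elim d)
    define N where "N = real (WE.n d)"
    have N1: "N \<ge> 1" using WE.n_pos[of d] by (simp add: N_def)
    have CTN: "0 < C * T * N" using C0 T1 N1 by simp
    have "ln (C * T * N) \<le> \<eta> / 8 * N" using elim(2) N1 unfolding N_def[symmetric] by (simp add: pos_divide_less_eq)
    then have "C * T * N \<le> exp (\<eta> / 8 * N)"
      using CTN by (metis exp_le_cancel_iff exp_ln)
    then have "(C * T * N) ^ WE.n d \<le> exp (\<eta> / 8 * N) ^ WE.n d"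
      using CTN by (intro power_mono) auto
    also have "\<dots> = exp (N\<^sup>2 * (\<eta> / 8))" unfolding exp_of_nat_mult[symmetric] N_def[symmetric] by (simp add: power2_eq_square algebra_simps)
    finally have pw: "(C * T * N) ^ WE.n d \<le> exp (N\<^sup>2 * (\<eta> / 8))" .
    have "measure (WE.AP d) (WE.bad d (exp (- (N\<^sup>2 * (e + \<eta>))))) \<le> exp (- (N\<^sup>2 * (\<eta> - WE.err d B - 2 * ln (1 + \<epsilon>)))) * (C * T * N) ^ WE.n d"
      unfolding N_def by (rule LD)
    also have "\<dots> \<le> exp (- (N\<^sup>2 * (\<eta> - WE.err d B - 2 * ln (1 + \<epsilon>)))) * exp (N\<^sup>2 * (\<eta> / 8))"
      by (rule mult_left_mono[OF pw]) simp
    also have "\<dots> = exp (- (N\<^sup>2 * (\<eta> - WE.err d B - \<eta> / 4 - \<eta> / 8)))"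
      unfolding exp_add[symmetric] \<epsilon>(2) by (simp add: algebra_simps)
    also have "\<dots> \<le> exp (- (\<eta> / 2) * N)"
    proof -
      have "N * (\<eta> / 2) \<le> N\<^sup>2 * (\<eta> - WE.err d B - \<eta> / 4 - \<eta> / 8)"
        using N1 elim(1) \<eta> by (intro mult_mono) (auto simp: power2_eq_square)
      then show ?thesis by (simp add: mult.commute)
    qed
    finally show ?case by (simp add: N_def)
  qed
  show ?thesis
    by (rule summable_comparison_test_ev[OF ev summable_exp_size]) (use \<eta> in simp)
qed

definition near_optimal :: "real \<Rightarrow> real \<Rightarrow> nat \<Rightarrow> (nat \<Rightarrow> real) \<Rightarrow> bool" where
  "near_optimal e \<eta> d X \<longleftrightarrow> sort_coords (WE.n d) X \<in> WE.Ord d \<and> 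
     exp (- ((real (WE.n d))\<^sup>2 * (e + \<eta>))) \<le> WE.abs_weight d (sort_coords (WE.n d) X)"

lemma AE_near_optimal:
  assumes c: "mass_tuple \<nu>" and e: "energy (sum_measure {1..p} \<nu>) = ereal e" and \<eta>: "\<eta> > 0"
  shows "AE X in (\<Pi>\<^sub>M d\<in>{1..}. WE.AP d). \<forall>\<^sub>F d in sequentially. near_optimal e \<eta> d (X d)"
proof -
  define P where "P = (\<Pi>\<^sub>M d\<in>{1::nat..}. WE.AP d)"
  define S where "S d = WE.bad d (exp (- ((real (WE.n d))\<^sup>2 * (e + \<eta>))))" for d
  have Z0: "WE.Z d > 0" for d
  proof -
    obtain B where B: "B \<ge> 0" "\<And>M i j. i \<in> {1..p} \<Longrightarrow> j \<in> {1..p} \<Longrightarrow> \<bar>mean_ell \<nu> M i j\<bar> \<le> B"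
      using mean_ell_bounded[OF c e] by blast
    obtain C where C: "BM_bound \<tau> C 1" using BM_bound_exists[OF tau BM, of 1] by auto
    define T where "T = (\<Sum>i=1..p. measure (\<tau> i) (space (\<tau> i)))"
    have "measure (\<tau> i) (space (\<tau> i)) \<le> T" if "i \<in> {1..p}" for i
      unfolding T_def by (rule member_le_sum[OF that]) auto
    moreover have "0 \<le> T" unfolding T_def by (simp add: sum_nonneg)
    ultimately show ?thesis using WE.large_deviation(1)[OF c e B C, of T] by simp
  qed
  have pr: "prob_space (WE.AP d)" for d by (rule WE.AP_facts[OF Z0])
  have se: "sets (WE.AP d) = sets (Rn (WE.n d))" for d by (rule WE.AP_facts[OF Z0])
  have spe: "space (WE.AP d) = space (Rn (WE.n d))" for d by (rule sets_eq_imp_space_eq[OF se])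
  have Ss: "S d \<in> sets (WE.AP d)" for d unfolding S_def se by (rule WE.bad_sets)
  interpret P: prob_space P unfolding P_def by (rule prob_space_PiM) (rule pr)
  \<comment> \<open>the product space has no component with index 0\<close>
  define E where "E d = (if d \<ge> 1 then {X \<in> space P. X d \<in> S d} else {})" for d
  have proj: "(\<lambda>X. X d) \<in> P \<rightarrow>\<^sub>M WE.AP d" if "d \<ge> 1" for d
    unfolding P_def by (rule measurable_component_singleton) (use that in simp)
  have Eeq: "E d = (\<lambda>X. X d) -` S d \<inter> space P" if "d \<ge> 1" for d unfolding E_def using that by auto
  have Es: "E d \<in> sets P" for d
    using measurable_sets[OF proj Ss, of d] by (cases "d \<ge> 1") (auto simp: Eeq, simp add: E_def)
  have Em: "measure P (E d) \<le> measure (WE.AP d) (S d)" for d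
  proof (cases "d \<ge> 1")
    case True
    have "measure (WE.AP d) (S d) = measure (distr P (WE.AP d) (\<lambda>X. X d)) (S d)"
      unfolding P_def by (subst distr_PiM_component) (use True pr in auto)
    also have "\<dots> = measure P (E d)" unfolding Eeq[OF True] by (rule measure_distr[OF proj[OF True] Ss])
    finally show ?thesis by simp
  qed (simp add: E_def)
  have "summable (\<lambda>d. measure (WE.AP d) (S d))" unfolding S_def by (rule bad_summable[OF c e \<eta>])
  then have "summable (\<lambda>d. measure P (E d))"
    by (rule summable_comparison_test'[where N = 0]) (use Em in simp)
  then have "AE X in P. \<forall>\<^sub>F d in sequentially. X \<in> space P - E d"
    by (intro borel_cantelli_AE1 Es) (auto simp: P.emeasure_eq_measure)
  then show ?thesis unfolding P_def[symmetric]
  proof (rule eventually_mono)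
    fix X assume X: "\<forall>\<^sub>F d in sequentially. X \<in> space P - E d"
    show "\<forall>\<^sub>F d in sequentially. near_optimal e \<eta> d (X d)"
      using X eventually_ge_at_top[of 1]
    proof eventually_elim
      case (elim d)
      then have "X d \<notin> S d" unfolding E_def by auto
      moreover have "X d \<in> space (WE.AP d)" using measurable_space[OF proj[OF elim(2)], of X] elim(1) by simp
      ultimately show ?case unfolding near_optimal_def S_def WE.bad_def spe by auto
    qed
  qed
qed

text \<open>If the counting measures did not converge, a subsequence would stay away from \<open>\<omega>\<close> in the integral of
  some test function. By compactness a further subsequence has an admissible weak limit; its energy
  is at most \<open>e\<close> by semicontinuity, so it is \<open>\<omega>\<close>, a contradiction.\<close>

lemma near_optimal_weak_limit:
  assumes eq: "admissible \<omega>" "\<And>N. admissible N \<Longrightarrow> energy N \<le> ereal e \<Longrightarrow> N = \<omega>"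
    and opt: "\<And>k. \<forall>\<^sub>F d in sequentially. near_optimal e (1 / real (Suc k)) d (X d)"
  shows "weak_star_convergent G (\<lambda>d. counting_measure (WE.n d) (X d)) \<omega>"
  unfolding weak_star_convergent_def
proof (intro allI impI)
  fix f :: "real \<Rightarrow> real" assume f: "continuous_on G f"
  define S where "S d = sort_coords (WE.n d) (X d)" for d
  obtain F where F: "continuous_on UNIV F" "\<exists>B. \<forall>x. \<bar>F x\<bar> \<le> B" "\<And>i x. i \<in> {1..p} \<Longrightarrow> x \<in> \<Gamma> i \<Longrightarrow> F x = f x"
    using glue_extension[of "\<lambda>_. f"] continuous_on_subset[OF f] unfolding G_def by blast
  obtain BF where BF: "\<And>x. \<bar>F x\<bar> \<le> BF" using F(2) by blast
  have Fm [measurable]: "F \<in> borel_measurable borel" using F(1) by (rule borel_measurable_continuous_onI)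
  have fi: "(LINT x:G|N. f x) = (\<integral>x. F x \<partial>N)" if N: "real_distribution N" "AE x in N. x \<in> G" for N
  proof -
    interpret N: real_distribution N by fact
    have "(\<lambda>x. indicator G x *\<^sub>R f x) \<in> borel_measurable borel" by (rule borel_measurable_continuous_on_indicator[OF G_borel f])
    then have m: "(\<lambda>x. indicator G x *\<^sub>R f x) \<in> borel_measurable N" by measurable
    show ?thesis unfolding set_lebesgue_integral_def
    proof (rule integral_cong_AE[OF m])
      show "AE x in N. indicator G x *\<^sub>R f x = F x"
        using N(2) by (rule eventually_mono) (use F(3) in \<open>auto simp: G_def\<close>)
    qed measurable
  qed
  \<comment> \<open>the finitely many configurations outside the region are replaced by the limit\<close>
  define \<mu> where "\<mu> d = (if S d \<in> WE.region d then counting_measure (WE.n d) (S d) else \<omega>)" for d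
  have evR: "\<forall>\<^sub>F d in sequentially. S d \<in> WE.region d"
    using opt[of 0] by (rule eventually_mono) (auto simp: near_optimal_def S_def WE.Ord_eq)
  have \<mu>rd: "real_distribution (\<mu> d)" for d
    using WE.emp_real_distribution eq(1) unfolding \<mu>_def by (auto simp: admissible_def)
  have \<mu>G: "AE x in \<mu> d. x \<in> G" for d
    using WE.emp_region(1)[of "S d" d] admissible_AE_G[OF eq(1)] unfolding \<mu>_def by auto
  have \<mu>lim: "(\<lambda>d. measure (\<mu> d) (\<Gamma> i)) \<longlonglongrightarrow> r i" if i: "i \<in> {1..p}" for i
  proof (rule Lim_transform_eventually[OF ratio_lim[OF i]])
    show "\<forall>\<^sub>F d in sequentially. WE.ratio d i = measure (\<mu> d) (\<Gamma> i)"
      using evR by (rule eventually_mono) (simp add: \<mu>_def WE.emp_region(2)[OF _ i] WE.ratio_def)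
  qed
  have \<mu>Phi: "\<forall>\<^sub>F d in sequentially. Phi M (\<mu> d) (\<mu> d) \<le> e + 2 / real (Suc k)" for M k
  proof -
    have "\<forall>\<^sub>F d in sequentially. (- ln (eta M)) / real (WE.n d) < 1 / real (Suc k)"
      using inverse_size_lim[of "- ln (eta M)"] by (rule order_tendstoD) simp
    with opt[of k] show ?thesis
    proof eventually_elim
      case (elim d)
      define N where "N = real (WE.n d)"
      have N1: "N > 0" using WE.n_pos[of d] by (simp add: N_def)
      have R: "S d \<in> WE.region d" using elim(1) by (auto simp: near_optimal_def S_def WE.Ord_eq)
      have w: "angelesco_weight p Q (nn d) (S d) \<ge> exp (- (N\<^sup>2 * (e + 1 / real (Suc k))))"
        unfolding WE.abs_weight_eq[OF R] using elim(1) by (simp add: near_optimal_def S_def N_def)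
      have "Phi M (\<mu> d) (\<mu> d) \<le> (N\<^sup>2 * (e + 1 / real (Suc k)) + N * (- ln (eta M))) / N\<^sup>2"
        using WE.Phi_emp_le[OF R w] R by (simp add: \<mu>_def N_def)
      also have "\<dots> = (e + 1 / real (Suc k)) + (- ln (eta M)) / N"
      proof -
        have "(N\<^sup>2 * u + N * v) / N\<^sup>2 = u + v / N" for u v :: real
          using N1 by (simp add: field_simps power2_eq_square)
        then show ?thesis .
      qed
      also have "\<dots> \<le> e + 1 / real (Suc k) + 1 / real (Suc k)" using elim(2) by (simp add: N_def)
      finally show ?case by simp
    qed
  qed
  have "(\<lambda>d. \<integral>x. F x \<partial>\<mu> d) \<longlonglongrightarrow> (\<integral>x. F x \<partial>\<omega>)"
  proof (rule ccontr)
    assume "\<not> (\<lambda>d. \<integral>x. F x \<partial>\<mu> d) \<longlonglongrightarrow> (\<integral>x. F x \<partial>\<omega>)"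
    then obtain \<delta> where \<delta>: "\<delta> > 0" "\<And>N. \<exists>d\<ge>N. \<not> dist (\<integral>x. F x \<partial>\<mu> d) (\<integral>x. F x \<partial>\<omega>) < \<delta>"
      unfolding lim_sequentially by blast
    define D where "D = {d. \<not> dist (\<integral>x. F x \<partial>\<mu> d) (\<integral>x. F x \<partial>\<omega>) < \<delta>}"
    have "infinite D" unfolding infinite_nat_iff_unbounded_le D_def using \<delta>(2) by auto
    then obtain s :: "nat \<Rightarrow> nat" where s: "strict_mono s" "\<And>k. s k \<in> D" using infinite_enumerate by blast
    have "(\<lambda>d. measure (\<mu> (s d)) (\<Gamma> i)) \<longlonglongrightarrow> r i" if i: "i \<in> {1..p}" for i
      using LIMSEQ_subseq_LIMSEQ[OF \<mu>lim[OF i] s(1)] by (simp add: o_def)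
    from weak_compact[OF \<mu>rd \<mu>G this]
    obtain s' \<nu> where s': "strict_mono (s' :: nat \<Rightarrow> nat)" "admissible \<nu>" "weak_conv_m ((\<lambda>d. \<mu> (s d)) \<circ> s') \<nu>" by blast
    have "strict_mono (s \<circ> s')" using s(1) s'(1) by (rule strict_mono_o)
    have rd': "real_distribution (((\<lambda>d. \<mu> (s d)) \<circ> s') k)" for k by (simp add: \<mu>rd)
    have \<nu>rd: "real_distribution \<nu>" using s'(2) by (simp add: admissible_def)
    have "energy \<nu> \<le> ereal (e + 2 / real (Suc k))" for k
    proof (rule weak_lsc[OF rd' \<nu>rd s'(3)])
      fix M
      have "\<forall>\<^sub>F j in sequentially. Phi M (\<mu> ((s \<circ> s') j)) (\<mu> ((s \<circ> s') j)) \<le> e + 2 / real (Suc k)"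
        by (rule eventually_subseq[OF \<open>strict_mono (s \<circ> s')\<close> \<mu>Phi])
      then show "\<exists>w. w \<longlonglongrightarrow> e + 2 / real (Suc k) \<and> (\<forall>\<^sub>F j in sequentially. Phi M (((\<lambda>d. \<mu> (s d)) \<circ> s') j) (((\<lambda>d. \<mu> (s d)) \<circ> s') j) \<le> w j)"
        by (intro exI[of _ "\<lambda>_. e + 2 / real (Suc k)"]) simp
    qed
    note le = this
    have "(\<lambda>k. ereal (e + 2 / real (Suc k))) \<longlonglongrightarrow> ereal (e + 0)"
    proof -
      have "(\<lambda>k. 2 * inverse (real (Suc k))) \<longlonglongrightarrow> 2 * 0" by (intro tendsto_mult tendsto_const LIMSEQ_inverse_real_of_nat)
      then have "(\<lambda>k. 2 / real (Suc k)) \<longlonglongrightarrow> 0" by (simp add: divide_inverse)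
      then show ?thesis by (intro tendsto_intros)
    qed
    from LIMSEQ_le_const[OF this, of "energy \<nu>"] have "energy \<nu> \<le> ereal e" using le by (simp del: of_nat_Suc)
    then have \<nu>: "\<nu> = \<omega>" using eq(2) s'(2) by blast
    have "(\<lambda>k. \<integral>x. F x \<partial>((\<lambda>d. \<mu> (s d)) \<circ> s') k) \<longlonglongrightarrow> (\<integral>x. F x \<partial>\<nu>)"
      by (rule weak_conv_imp_integral_bdd_continuous_conv[OF rd' \<nu>rd s'(3), of F BF])
         (use F(1) BF in \<open>auto simp: continuous_on_eq_continuous_at\<close>)
    then have "\<exists>k. dist (\<integral>x. F x \<partial>\<mu> (s (s' k))) (\<integral>x. F x \<partial>\<omega>) < \<delta>"
      unfolding \<nu> lim_sequentially using \<delta>(1) by auto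
    then show False using s(2) unfolding D_def by blast
  qed
  moreover have "\<forall>\<^sub>F d in sequentially. (\<integral>x. F x \<partial>\<mu> d) = (LINT x:G|counting_measure (WE.n d) (X d). f x)"
    using evR
  proof (rule eventually_mono)
    fix d assume R: "S d \<in> WE.region d"
    then have "\<mu> d = counting_measure (WE.n d) (X d)" unfolding \<mu>_def S_def by (simp add: WE.counting_measure_sort)
    then show "(\<integral>x. F x \<partial>\<mu> d) = (LINT x:G|counting_measure (WE.n d) (X d). f x)"
      using fi[OF \<mu>rd[of d] \<mu>G[of d]] by simp
  qed
  ultimately have "(\<lambda>d. LINT x:G|counting_measure (WE.n d) (X d). f x) \<longlonglongrightarrow> (\<integral>x. F x \<partial>\<omega>)"
    by (rule Lim_transform_eventually)
  then show "(\<lambda>d. LINT x:G|counting_measure (WE.n d) (X d). f x) \<longlonglongrightarrow> (LINT x:G|\<omega>. f x)"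
    using fi[of \<omega>] admissible_AE_G[OF eq(1)] eq(1) by (simp add: admissible_def)
qed

theorem almost_sure_convergence:
  "AE X in (\<Pi>\<^sub>M d\<in>{1..}. angelesco_prob p \<Gamma> Q \<tau> (nn d)).
     weak_star_convergent G (\<lambda>d. counting_measure (msize p (nn d)) (X d)) (equilibrium_measure p \<Gamma> r Q)"
proof -
  obtain e where e: "admissible (equilibrium_measure p \<Gamma> r Q)" "energy (equilibrium_measure p \<Gamma> r Q) = ereal e"
    "\<And>N. admissible N \<Longrightarrow> energy N \<le> ereal e \<Longrightarrow> N = equilibrium_measure p \<Gamma> r Q"
    using equilibrium_measure_minimizes by metis
  obtain \<nu> where \<nu>: "\<nu> \<in> measure_tuples p \<Gamma> r" "sum_measure {1..p} \<nu> = equilibrium_measure p \<Gamma> r Q"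
    using admissible_tuple[OF e(1)] by blast
  have c: "mass_tuple \<nu>" by (rule measure_tuples_mass_tuple[OF \<nu>(1)])
  have energy: "energy (sum_measure {1..p} \<nu>) = ereal e" unfolding \<nu>(2) by (rule e(2))
  have "AE X in (\<Pi>\<^sub>M d\<in>{1..}. WE.AP d). \<forall>k. \<forall>\<^sub>F d in sequentially. near_optimal e (1 / real (Suc k)) d (X d)"
    unfolding AE_all_countable by (intro allI AE_near_optimal[OF c energy]) simp
  then show ?thesis
  proof (rule eventually_mono)
    fix X assume "\<forall>k. \<forall>\<^sub>F d in sequentially. near_optimal e (1 / real (Suc k)) d (X d)"
    then show "weak_star_convergent G (\<lambda>d. counting_measure (msize p (nn d)) (X d)) (equilibrium_measure p \<Gamma> r Q)"
      using near_optimal_weak_limit[where e = e and X = X, OF e(1,3)] unfolding WE.n_def by blast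
  qed
qed

end

theorem theorem5p6:
  fixes p :: nat
    and a b r :: "nat \<Rightarrow> real"
    and \<Gamma> :: "nat \<Rightarrow> real set"
    and Q :: "nat \<Rightarrow> real \<Rightarrow> real"
    and \<tau> :: "nat \<Rightarrow> real measure"
    and nn :: "nat \<Rightarrow> nat \<Rightarrow> nat"
  assumes "p \<ge> 1"
    and "\<And>i. i \<in> {1..p} \<Longrightarrow> a i < b i \<and> \<Gamma> i = {a i..b i}"
    and "\<And>i. i \<in> {1..<p} \<Longrightarrow> b i < a (Suc i)"
    and "\<And>i. i \<in> {1..p} \<Longrightarrow> r i > 0"
    and "(\<Sum>i=1..p. r i) = 1"
    and "\<And>i. i \<in> {1..p} \<Longrightarrow> continuous_on (\<Gamma> i) (Q i)"
    and "\<And>i. i \<in> {1..p} \<Longrightarrow> \<tau> i \<in> borel_measures_on (\<Gamma> i) \<and> finite_measure (\<tau> i)"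
    and "\<And>i. i \<in> {1..p} \<Longrightarrow>
           weighted_BM (complex_of_real ` \<Gamma> i) (\<lambda>z. Q i (Re z)) (distr (\<tau> i) borel complex_of_real)"
    and "\<And>d i. d \<ge> 1 \<Longrightarrow> i \<in> {1..p} \<Longrightarrow> nn d i \<ge> 1"
    and "inj_on (\<lambda>d. restrict (nn d) {1..p}) {1..}"
    and "\<And>i. i \<in> {1..p} \<Longrightarrow> (\<lambda>d. real (nn d i) / real (msize p (nn d))) \<longlonglongrightarrow> r i"
  shows "AE X in (\<Pi>\<^sub>M d\<in>{1..}. angelesco_prob p \<Gamma> Q \<tau> (nn d)).
           weak_star_convergent (\<Union>i\<in>{1..p}. \<Gamma> i)
             (\<lambda>d. counting_measure (msize p (nn d)) (X d))
             (equilibrium_measure p \<Gamma> r Q)"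
proof -
  \<comment> \<open>the sequence starts at 1, whereas the locale asks for positive multi-indices at every index\<close>
  define nn' where "nn' d = (if d = 0 then (\<lambda>_. 1) else nn d)" for d
  have nn': "nn' d = nn d" if "d \<ge> 1" for d using that by (simp add: nn'_def)
  interpret AI: angelesco_intervals p a b r \<Gamma> Q by unfold_locales (use assms in auto)
  interpret ES: ensemble_sequence p a b r \<Gamma> Q \<tau> nn'
  proof
    show "\<tau> i \<in> borel_measures_on (\<Gamma> i) \<and> finite_measure (\<tau> i)" if "i \<in> {1..p}" for i by (rule assms(7)[OF that])
    show "weighted_BM (complex_of_real ` \<Gamma> i) (\<lambda>z. Q i (Re z)) (distr (\<tau> i) borel complex_of_real)" if "i \<in> {1..p}" for i
      by (rule assms(8)[OF that])
    show "nn' d i \<ge> 1" if "i \<in> {1..p}" for d i using assms(9)[of d i] that by (simp add: nn'_def)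
    show "inj_on (\<lambda>d. restrict (nn' d) {1..p}) {1..}" using assms(10) unfolding inj_on_def by (simp add: nn')
    show "(\<lambda>d. real (nn' d i) / real (msize p (nn' d))) \<longlonglongrightarrow> r i" if "i \<in> {1..p}" for i
    proof (rule Lim_transform_eventually[OF assms(11)[OF that]])
      show "\<forall>\<^sub>F d in sequentially. real (nn d i) / real (msize p (nn d)) = real (nn' d i) / real (msize p (nn' d))"
        using eventually_ge_at_top[of 1] by (rule eventually_mono) (simp add: nn')
    qed
  qed
  have PiM: "(\<Pi>\<^sub>M d\<in>{1..}. angelesco_prob p \<Gamma> Q \<tau> (nn' d)) = (\<Pi>\<^sub>M d\<in>{1..}. angelesco_prob p \<Gamma> Q \<tau> (nn d))"
    by (rule PiM_cong) (auto simp: nn')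
  have shift: "weak_star_convergent K (\<lambda>d. counting_measure (msize p (nn d)) (X d)) N"
    if "weak_star_convergent K (\<lambda>d. counting_measure (msize p (nn' d)) (X d)) N" for K N X
    unfolding weak_star_convergent_def
  proof (intro allI impI)
    fix f :: "real \<Rightarrow> real" assume "continuous_on K f"
    then have "(\<lambda>d. LINT x:K|counting_measure (msize p (nn' d)) (X d). f x) \<longlonglongrightarrow> (LINT x:K|N. f x)"
      using that unfolding weak_star_convergent_def by blast
    then show "(\<lambda>d. LINT x:K|counting_measure (msize p (nn d)) (X d). f x) \<longlonglongrightarrow> (LINT x:K|N. f x)"
      by (rule Lim_transform_eventually) (use eventually_ge_at_top[of 1] in \<open>rule eventually_mono, simp add: nn'\<close>)
  qed
  show ?thesis
    using ES.almost_sure_convergence unfolding PiM AI.G_def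
    by (rule eventually_mono) (rule shift)
qed

end
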